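(* Let $n,d\in\mathbb{N}$, $n,d\ge1$, $a\in\mathcal{M}^\#_{n,d}$ and $s\in\mathcal{S}^\#_{n,d}$. Then there exists a constant $\kappa>0$ such that for all $\varepsilon>0$ $$\Big\|\big(-\operatorname{div}a(\tfrac{\cdot}{\varepsilon})\operatorname{grad}+s(\tfrac{\cdot}{\varepsilon})\big)^{-1}-\big(-\operatorname{div}a^{\mathrm{hom}}(0)\operatorname{grad}+\mathrm{m}(s)\big)^{-1}\Big\|\le\kappa\,\varepsilon$$ in the operator norm on $L([L^2(\mathbb{R}^d)]^n)$, where the constant matrix $\mathrm{m}(s)\in\mathcal{S}^\#_{n,d}$ is $\mathrm{m}(s)=\int_Y s(y)\,dy$ and the constant tensor $a^{\mathrm{hom}}(0)\in\mathcal{M}^\#_{n,d}$ is given by $$a^{\mathrm{hom}}(0)X=\int_Y a(y)\big(\nabla N_{0X}(y)+X\big)\,dy\qquad(X\in\mathbb{C}^{n\times d}),$$ with $N_{0X}\in[H^1_\#(Y)\perp1]^n$ the unique solution of $\langle a(\nabla N_{0X}+X),\nabla\phi\rangle_{[L^2(Y)]^{n\times d}}=0$ for all $\phi\in[H^1_\#(Y)\perp1]^n$.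
   Context: $Y:=(0,1)^d$. $\mathcal{M}^\#_{n,d}$ is the set of $a\in L^\infty(\mathbb{R}^d;L(\mathbb{C}^{n\times d}))$ with $a(\cdot+k)=a(\cdot)$ for all $k\in\mathbb{Z}^d$ such that for some $\nu>0$, $\operatorname{Re}a(x)\ge\nu1_{\mathbb{C}^{n\times d}}$ for a.e. $x$. $\mathcal{S}^\#_{n,d}$ is the set of $s\in L^\infty(\mathbb{R}^d;L(\mathbb{C}^n))$ with $s(\cdot+k)=s(\cdot)$ for all $k\in\mathbb{Z}^d$ such that for some $\nu>0$, $\operatorname{Re}s(x)\ge\nu1_{\mathbb{C}^n}$ for a.e. $x$. No selfadjointness is assumed; $\operatorname{Re}T=\frac12(T+T^* )$. $\operatorname{grad}:[H^1(\mathbb{R}^d)]^n\subseteq[L^2(\mathbb{R}^d)]^n\to[L^2(\mathbb{R}^d)]^{n\times d}$, $(\phi_i)_i\mapsto(\partial_j\phi_i)_{ij}$, and $\operatorname{div}:=-\operatorname{grad}^*$; compositions have their natural domains. $H^1_\#(Y)$ is the closure in $H^1(Y)$ of the smooth $\mathbb{Z}^d$-periodic functions; $H^1_\#(Y)\perp1$ is the subspace of functions with zero mean; $\nabla\phi=(\partial_j\phi_i)_{ij}$. *)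

theory Defs
  imports "HOL-Analysis.Analysis"
begin

text \<open>
  \<open>\<complex>\<^sup>n\<close> is \<^typ>\<open>complex^'n\<close>, and \<open>\<complex>\<^bsup>n\<times>d\<^esup>\<close> is \<^typ>\<open>complex^('n::finite \<times> 'd::finite)\<close>, that is, the
  \<open>(i,j)\<close>-entry of \<open>X\<close> is \<open>X $ (i,j)\<close> and the norm is the Frobenius norm. Linear operators on
  \<open>\<complex>\<^sup>n\<close> and on \<open>\<complex>\<^bsup>n\<times>d\<^esup>\<close> are identified with their matrices in the standard basis.
\<close>

section \<open>Coefficients\<close>

definition cinner :: "complex^'i \<Rightarrow> complex^'i \<Rightarrow> complex" where
  "cinner x y = (\<Sum>i\<in>UNIV. x $ i * cnj (y $ i))"

definition conj_transpose :: "complex^'i^'i \<Rightarrow> complex^'i^'i" where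
  "conj_transpose A = (\<chi> i j. cnj (A $ j $ i))"

definition re_part :: "complex^'i^'i \<Rightarrow> complex^'i^'i" where
  "re_part A = (1/2) *\<^sub>R (A + conj_transpose A)"

definition pos_semidef :: "complex^'i^'i \<Rightarrow> bool" where
  "pos_semidef A \<longleftrightarrow> (\<forall>\<xi>. cinner (A *v \<xi>) \<xi> \<in> \<real>\<^sub>\<ge>\<^sub>0)"

definition int_lattice :: "(real^'d) set" where
  "int_lattice = {k. \<forall>i. k $ i \<in> \<int>}"

text \<open>
  Elements of \<open>L\<^sup>\<infinity>\<close> are given by representatives, so periodicity is required almost everywhere.
  Essential boundedness refers to the Frobenius norm, which is equivalent to the operator norm.
\<close>

definition ell_coeffs :: "(real^'d \<Rightarrow> complex^'i^'i) set" where
  "ell_coeffs = {b \<in> borel_measurable lebesgue.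
     (\<exists>C. AE x in lebesgue. norm (b x) \<le> C) \<and>
     (\<forall>k\<in>int_lattice. AE x in lebesgue. b (x + k) = b x) \<and>
     (\<exists>\<nu>>0. AE x in lebesgue. pos_semidef (re_part (b x) - mat (complex_of_real \<nu>)))}"

definition M_per :: "(real^'d \<Rightarrow> complex^('n::finite \<times> 'd::finite)^('n \<times> 'd)) set" where
  "M_per = ell_coeffs"

definition S_per :: "(real^'d \<Rightarrow> complex^'n^'n) set" where
  "S_per = ell_coeffs"


section \<open>Sobolev spaces\<close>

definition square_integrable :: "'a measure \<Rightarrow> ('a \<Rightarrow> 'b::{real_normed_vector}) set" where
  "square_integrable M = {f \<in> borel_measurable M. integrable M (\<lambda>x. (norm (f x))\<^sup>2)}"

definition pderiv_cl :: "'d \<Rightarrow> (real^'d \<Rightarrow> complex) \<Rightarrow> real^'d \<Rightarrow> complex" where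
  "pderiv_cl j f x = frechet_derivative f (at x) (axis j 1)"

definition smooth_fun :: "(real^'d \<Rightarrow> complex) \<Rightarrow> bool" where
  "smooth_fun f \<longleftrightarrow> (\<forall>js. (foldr pderiv_cl js f) differentiable_on UNIV)"

definition test_fun :: "(real^'d) set \<Rightarrow> (real^'d \<Rightarrow> complex) set" where
  "test_fun \<Omega> = {\<psi>. smooth_fun \<psi> \<and> compact (closure {x. \<psi> x \<noteq> 0}) \<and> closure {x. \<psi> x \<noteq> 0} \<subseteq> \<Omega>}"

definition has_weak_pderiv ::
    "(real^'d) set \<Rightarrow> 'd \<Rightarrow> (real^'d \<Rightarrow> complex) \<Rightarrow> (real^'d \<Rightarrow> complex) \<Rightarrow> bool" where
  "has_weak_pderiv \<Omega> j u g \<longleftrightarrow>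
     (\<forall>\<psi>\<in>test_fun \<Omega>. (LINT x|lebesgue_on \<Omega>. u x * pderiv_cl j \<psi> x)
                   = - (LINT x|lebesgue_on \<Omega>. g x * \<psi> x))"

definition H1 :: "(real^'d) set \<Rightarrow> (real^'d \<Rightarrow> complex) set" where
  "H1 \<Omega> = {u \<in> square_integrable (lebesgue_on \<Omega>).
     \<forall>j. \<exists>g\<in>square_integrable (lebesgue_on \<Omega>). has_weak_pderiv \<Omega> j u g}"

text \<open>A representative; for \<open>u \<in> H1 \<Omega>\<close> and open \<open>\<Omega>\<close> it is unique up to null subsets of \<open>\<Omega>\<close>.\<close>

definition weak_pderiv :: "(real^'d) set \<Rightarrow> 'd \<Rightarrow> (real^'d \<Rightarrow> complex) \<Rightarrow> real^'d \<Rightarrow> complex" where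
  "weak_pderiv \<Omega> j u = (SOME g. g \<in> square_integrable (lebesgue_on \<Omega>) \<and> has_weak_pderiv \<Omega> j u g)"

definition H1_norm :: "(real^'d) set \<Rightarrow> (real^'d \<Rightarrow> complex) \<Rightarrow> real" where
  "H1_norm \<Omega> u = sqrt ((LINT x|lebesgue_on \<Omega>. (cmod (u x))\<^sup>2)
     + (\<Sum>j\<in>UNIV. LINT x|lebesgue_on \<Omega>. (cmod (weak_pderiv \<Omega> j u x))\<^sup>2))"

definition H1_vec :: "(real^'d) set \<Rightarrow> (real^'d \<Rightarrow> complex^'n) set" where
  "H1_vec \<Omega> = {u. \<forall>i. (\<lambda>x. u x $ i) \<in> H1 \<Omega>}"

definition nabla :: "(real^'d) set \<Rightarrow> (real^'d \<Rightarrow> complex^'n) \<Rightarrow> real^'d \<Rightarrow> complex^('n::finite \<times> 'd::finite)" where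
  "nabla \<Omega> u x = (\<chi> p. case p of (i, j) \<Rightarrow> weak_pderiv \<Omega> j (\<lambda>y. u y $ i) x)"


section \<open>The cell problem\<close>

definition Ycell :: "(real^'d) set" where
  "Ycell = {y. \<forall>i. 0 < y $ i \<and> y $ i < 1}"

definition smooth_periodic :: "(real^'d \<Rightarrow> complex) set" where
  "smooth_periodic = {\<phi>. smooth_fun \<phi> \<and> (\<forall>k\<in>int_lattice. \<forall>x. \<phi> (x + k) = \<phi> x)}"

text \<open>Functions on the cell are total functions, of which only the values on \<^const>\<open>Ycell\<close> matter.\<close>

definition H1_per :: "(real^'d \<Rightarrow> complex) set" where
  "H1_per = {u \<in> H1 Ycell. \<forall>e>0. \<exists>\<phi>\<in>smooth_periodic. H1_norm Ycell (\<lambda>x. u x - \<phi> x) < e}"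

definition H1_per_perp1 :: "(real^'d \<Rightarrow> complex) set" where
  "H1_per_perp1 = {u \<in> H1_per. (LINT y|lebesgue_on Ycell. u y) = 0}"

definition H1_per_perp1_vec :: "(real^'d \<Rightarrow> complex^'n) set" where
  "H1_per_perp1_vec = {u. \<forall>i. (\<lambda>x. u x $ i) \<in> H1_per_perp1}"

definition is_corrector :: "(real^'d \<Rightarrow> complex^('n::finite \<times> 'd::finite)^('n \<times> 'd)) \<Rightarrow>
    complex^('n::finite \<times> 'd::finite) \<Rightarrow> (real^'d \<Rightarrow> complex^'n) \<Rightarrow> bool" where
  "is_corrector a X N \<longleftrightarrow> N \<in> H1_per_perp1_vec \<and>
     (\<forall>\<phi>\<in>H1_per_perp1_vec.
        (LINT y|lebesgue_on Ycell. cinner (a y *v (nabla Ycell N y + X)) (nabla Ycell \<phi> y)) = 0)"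

definition a_hom :: "(real^'d \<Rightarrow> complex^('n::finite \<times> 'd::finite)^('n \<times> 'd)) \<Rightarrow> complex^('n::finite \<times> 'd::finite)^('n \<times> 'd)" where
  "a_hom a = (THE A. \<forall>X N. is_corrector a X N \<longrightarrow>
     A *v X = (LINT y|lebesgue_on Ycell. a y *v (nabla Ycell N y + X)))"

definition cell_mean :: "(real^'d \<Rightarrow> complex^'n^'n) \<Rightarrow> complex^'n^'n" where
  "cell_mean s = (LINT y|lebesgue_on Ycell. s y)"


section \<open>The space \<open>[L\<^sup>2(\<real>\<^sup>d)]\<^sup>i\<close>\<close>

definition L2_eq :: "(real^'d \<Rightarrow> complex^'i) \<Rightarrow> (real^'d \<Rightarrow> complex^'i) \<Rightarrow> bool" where
  "L2_eq f g \<longleftrightarrow> f \<in> square_integrable lebesgue \<and> g \<in> square_integrable lebesgue \<and>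
     (AE x in lebesgue. f x = g x)"

lemma square_integrable_0: "(\<lambda>x. 0) \<in> square_integrable M"
  by (simp add: square_integrable_def)

lemma square_integrable_add:
  fixes f g :: "'a \<Rightarrow> 'b::euclidean_space"
  assumes "f \<in> square_integrable M" "g \<in> square_integrable M"
  shows "(\<lambda>x. f x + g x) \<in> square_integrable M"
proof -
  have [measurable]: "f \<in> borel_measurable M" "g \<in> borel_measurable M"
    using assms by (auto simp: square_integrable_def)
  have "integrable M (\<lambda>x. 2 * (norm (f x))\<^sup>2 + 2 * (norm (g x))\<^sup>2)"
    using assms by (auto simp: square_integrable_def)
  moreover have "(norm (f x + g x))\<^sup>2 \<le> 2 * (norm (f x))\<^sup>2 + 2 * (norm (g x))\<^sup>2" for x
  proof -
    have "(norm (f x + g x))\<^sup>2 \<le> (norm (f x) + norm (g x))\<^sup>2"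
      by (intro power_mono norm_triangle_ineq norm_ge_zero)
    also have "\<dots> \<le> 2 * (norm (f x))\<^sup>2 + 2 * (norm (g x))\<^sup>2"
      using sum_squares_bound[of "norm (f x)" "norm (g x)"] by (simp add: power2_sum)
    finally show ?thesis .
  qed
  ultimately have "integrable M (\<lambda>x. (norm (f x + g x))\<^sup>2)"
    by (elim Bochner_Integration.integrable_bound) (auto intro!: AE_I2)
  then show ?thesis by (simp add: square_integrable_def)
qed

lemma square_integrable_scaleR:
  fixes f :: "'a \<Rightarrow> 'b::euclidean_space"
  assumes "f \<in> square_integrable M"
  shows "(\<lambda>x. c *\<^sub>R f x) \<in> square_integrable M"
  using assms by (auto simp: square_integrable_def power_mult_distrib)

lemma square_integrable_diff:
  fixes f g :: "'a \<Rightarrow> 'b::euclidean_space"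
  assumes "f \<in> square_integrable M" "g \<in> square_integrable M"
  shows "(\<lambda>x. f x - g x) \<in> square_integrable M"
  using square_integrable_add[OF assms(1) square_integrable_scaleR[OF assms(2), of "-1"]] by simp

lemma square_integrable_inner:
  fixes f g :: "'a \<Rightarrow> 'b::euclidean_space"
  assumes "f \<in> square_integrable M" "g \<in> square_integrable M"
  shows "integrable M (\<lambda>x. f x \<bullet> g x)"
proof -
  have [measurable]: "f \<in> borel_measurable M" "g \<in> borel_measurable M"
    using assms by (auto simp: square_integrable_def)
  have "integrable M (\<lambda>x. (norm (f x))\<^sup>2 + (norm (g x))\<^sup>2)"
    using assms by (auto simp: square_integrable_def)
  moreover have "norm (f x \<bullet> g x) \<le> norm ((norm (f x))\<^sup>2 + (norm (g x))\<^sup>2)" for x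
  proof -
    have "\<bar>f x \<bullet> g x\<bar> \<le> norm (f x) * norm (g x)" by (rule Cauchy_Schwarz_ineq2)
    also have "\<dots> \<le> (norm (f x))\<^sup>2 + (norm (g x))\<^sup>2"
      using sum_squares_bound[of "norm (f x)" "norm (g x)"]
        mult_nonneg_nonneg[OF norm_ge_zero[of "f x"] norm_ge_zero[of "g x"]] by linarith
    finally show ?thesis by simp
  qed
  ultimately show ?thesis
    by (elim Bochner_Integration.integrable_bound) (auto intro!: AE_I2)
qed

quotient_type (overloaded) ('d, 'i) L2 =
  "real^'d::finite \<Rightarrow> complex^'i::finite" / partial: L2_eq
proof (rule part_equivpI)
  show "\<exists>f :: real^'d \<Rightarrow> complex^'i. L2_eq f f"
    by (rule exI[of _ "\<lambda>x. 0"]) (simp add: L2_eq_def square_integrable_0)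
  show "symp (L2_eq :: (real^'d \<Rightarrow> complex^'i) \<Rightarrow> _)"
    by (rule sympI) (auto simp: L2_eq_def)
  show "transp (L2_eq :: (real^'d \<Rightarrow> complex^'i) \<Rightarrow> _)"
    by (rule transpI) (auto simp: L2_eq_def)
qed

instantiation L2 :: (finite, finite) real_inner
begin

lift_definition zero_L2 :: "('a, 'b) L2" is "\<lambda>x. 0"
  by (simp add: L2_eq_def square_integrable_0)

lift_definition plus_L2 :: "('a, 'b) L2 \<Rightarrow> ('a, 'b) L2 \<Rightarrow> ('a, 'b) L2" is "\<lambda>f g x. f x + g x"
  by (auto simp: L2_eq_def intro: square_integrable_add)

lift_definition scaleR_L2 :: "real \<Rightarrow> ('a, 'b) L2 \<Rightarrow> ('a, 'b) L2" is "\<lambda>c f x. c *\<^sub>R f x"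
  by (auto simp: L2_eq_def intro: square_integrable_scaleR)

lift_definition uminus_L2 :: "('a, 'b) L2 \<Rightarrow> ('a, 'b) L2" is "\<lambda>f x. - f x"
  by (auto simp: L2_eq_def square_integrable_def)

lift_definition minus_L2 :: "('a, 'b) L2 \<Rightarrow> ('a, 'b) L2 \<Rightarrow> ('a, 'b) L2" is "\<lambda>f g x. f x - g x"
  by (auto simp: L2_eq_def intro: square_integrable_diff)

lift_definition inner_L2 :: "('a, 'b) L2 \<Rightarrow> ('a, 'b) L2 \<Rightarrow> real" is "\<lambda>f g. LINT x|lebesgue. f x \<bullet> g x"
  by (auto simp: L2_eq_def square_integrable_def intro!: integral_cong_AE)

definition norm_L2 :: "('a, 'b) L2 \<Rightarrow> real" where
  "norm_L2 f = sqrt (f \<bullet> f)"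

definition dist_L2 :: "('a, 'b) L2 \<Rightarrow> ('a, 'b) L2 \<Rightarrow> real" where
  "dist_L2 f g = norm (f - g)"

definition sgn_L2 :: "('a, 'b) L2 \<Rightarrow> ('a, 'b) L2" where
  "sgn_L2 f = scaleR (inverse (norm f)) f"

definition uniformity_L2 :: "(('a, 'b) L2 \<times> ('a, 'b) L2) filter" where
  "uniformity_L2 = (INF e\<in>{0<..}. principal {(x, y). dist x y < e})"

definition open_L2 :: "('a, 'b) L2 set \<Rightarrow> bool" where
  "open_L2 U \<longleftrightarrow> (\<forall>x\<in>U. \<forall>\<^sub>F (x', y) in uniformity. x' = x \<longrightarrow> y \<in> U)"

instance
proof
  fix f g h :: "('a, 'b) L2" and r s :: real
  show "f + g + h = f + (g + h)"
    by transfer (auto simp: L2_eq_def add.assoc intro!: square_integrable_add)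
  show "f + g = g + f"
    by transfer (auto simp: L2_eq_def add.commute intro!: square_integrable_add)
  show "0 + f = f"
    by transfer (auto simp: L2_eq_def)
  show "- f + f = 0"
    by transfer (auto simp: L2_eq_def square_integrable_0)
  show "f - g = f + - g"
    by transfer (auto simp: L2_eq_def intro!: square_integrable_diff)
  show "r *\<^sub>R (f + g) = r *\<^sub>R f + r *\<^sub>R g"
    by transfer (auto simp: L2_eq_def scaleR_add_right
        intro!: square_integrable_add square_integrable_scaleR)
  show "(r + s) *\<^sub>R f = r *\<^sub>R f + s *\<^sub>R f"
    by transfer (auto simp: L2_eq_def scaleR_add_left
        intro!: square_integrable_add square_integrable_scaleR)
  show "r *\<^sub>R s *\<^sub>R f = (r * s) *\<^sub>R f"
    by transfer (auto simp: L2_eq_def intro!: square_integrable_scaleR)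
  show "1 *\<^sub>R f = f"
    by transfer (auto simp: L2_eq_def)
  show "dist f g = norm (f - g)" by (rule dist_L2_def)
  show "sgn f = scaleR (inverse (norm f)) f" by (rule sgn_L2_def)
  show "uniformity = (INF e\<in>{0<..}. principal {(x, y::('a, 'b) L2). dist x y < e})"
    by (rule uniformity_L2_def)
  show "open U \<longleftrightarrow> (\<forall>x\<in>U. \<forall>\<^sub>F (x', y) in uniformity. x' = x \<longrightarrow> y \<in> U)"
    for U :: "('a, 'b) L2 set" by (rule open_L2_def)
  show "f \<bullet> g = g \<bullet> f"
    by transfer (simp add: inner_commute)
  show "(f + g) \<bullet> h = f \<bullet> h + g \<bullet> h"
    by transfer (auto simp: L2_eq_def inner_add_left
        intro!: Bochner_Integration.integral_add square_integrable_inner)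
  show "(r *\<^sub>R f) \<bullet> g = r * (f \<bullet> g)"
    by transfer simp
  show "0 \<le> f \<bullet> f"
    by transfer (auto intro!: Bochner_Integration.integral_nonneg)
  show "f \<bullet> f = 0 \<longleftrightarrow> f = 0"
  proof transfer
    fix f :: "real^'a \<Rightarrow> complex^'b"
    assume "L2_eq f f"
    then have sq: "f \<in> square_integrable lebesgue" by (simp add: L2_eq_def)
    have "(LINT x|lebesgue. f x \<bullet> f x) = 0 \<longleftrightarrow> (AE x in lebesgue. f x \<bullet> f x = 0)"
      using square_integrable_inner[OF sq sq]
      by (intro integral_nonneg_eq_0_iff_AE) auto
    then show "(LINT x|lebesgue. f x \<bullet> f x) = 0 \<longleftrightarrow> L2_eq f (\<lambda>x. 0)"
      using sq by (simp add: L2_eq_def square_integrable_0)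
  qed
  show "norm f = sqrt (f \<bullet> f)" by (rule norm_L2_def)
qed

end

text \<open>The complex inner product, whose real part is \<^const>\<open>inner\<close>.\<close>

lift_definition L2_cinner :: "('d::finite, 'i::finite) L2 \<Rightarrow> ('d, 'i) L2 \<Rightarrow> complex"
  is "\<lambda>f g. LINT x|lebesgue. cinner (f x) (g x)"
proof -
  fix f f' g g' :: "real^'d \<Rightarrow> complex^'i"
  assume "L2_eq f f'" "L2_eq g g'"
  then have [measurable]: "f \<in> borel_measurable lebesgue" "f' \<in> borel_measurable lebesgue"
      "g \<in> borel_measurable lebesgue" "g' \<in> borel_measurable lebesgue"
    and ae: "AE x in lebesgue. f x = f' x" "AE x in lebesgue. g x = g' x"
    by (auto simp: L2_eq_def square_integrable_def)
  have cont: "continuous_on UNIV (\<lambda>p. cinner (fst p) (snd p :: complex^'i))"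
    unfolding cinner_def by (intro continuous_intros)
  have "(\<lambda>x. cinner (F x) (G x)) \<in> borel_measurable lebesgue"
    if "F \<in> borel_measurable lebesgue" "G \<in> borel_measurable lebesgue"
    for F G :: "real^'d \<Rightarrow> complex^'i"
    using borel_measurable_continuous_Pair[OF that cont] by simp
  then show "(LINT x|lebesgue. cinner (f x) (g x)) = (LINT x|lebesgue. cinner (f' x) (g' x))"
    using ae by (intro integral_cong_AE) auto
qed


section \<open>Unbounded operators\<close>

text \<open>
  Operators are represented by their graphs. In \<open>A O B\<close> the operator \<open>A\<close> is applied first,
  and relational composition yields the natural domain.
\<close>

definition op_neg :: "('a \<times> 'b::real_vector) set \<Rightarrow> ('a \<times> 'b) set" where
  "op_neg A = {(u, - f) |u f. (u, f) \<in> A}"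

definition op_add :: "('a \<times> 'b::real_vector) set \<Rightarrow> ('a \<times> 'b) set \<Rightarrow> ('a \<times> 'b) set" where
  "op_add A B = {(u, f + g) |u f g. (u, f) \<in> A \<and> (u, g) \<in> B}"

definition op_adjoint :: "(('d, 'i) L2 \<times> ('d, 'j) L2) set \<Rightarrow>
    (('d::finite, 'j::finite) L2 \<times> ('d, 'i::finite) L2) set" where
  "op_adjoint A = {(v, w). \<forall>(u, f)\<in>A. L2_cinner f v = L2_cinner u w}"

text \<open>
  The inverse \<open>R\<close> of a complex linear \<open>A\<close> is automatically complex linear, so real linearity
  suffices here.
\<close>

definition boundedly_invertible :: "('a::real_normed_vector \<times> 'b::real_normed_vector) set \<Rightarrow> bool" where
  "boundedly_invertible A \<longleftrightarrow> (\<exists>R. bounded_linear R \<and> (\<forall>u f. (u, f) \<in> A \<longleftrightarrow> u = R f))"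

definition op_inv :: "('a \<times> 'b) set \<Rightarrow> 'b \<Rightarrow> 'a" where
  "op_inv A f = (THE u. (u, f) \<in> A)"

definition op_grad :: "(('d::finite, 'n::finite) L2 \<times> ('d, 'n \<times> 'd) L2) set" where
  "op_grad = {(u, abs_L2 (nabla UNIV (rep_L2 u))) |u. rep_L2 u \<in> H1_vec UNIV}"

definition op_div :: "(('d::finite, 'n::finite \<times> 'd) L2 \<times> ('d, 'n) L2) set" where
  "op_div = op_neg (op_adjoint op_grad)"

definition op_mult :: "(real^'d::finite \<Rightarrow> complex^'i^'i::finite) \<Rightarrow> (('d, 'i) L2 \<times> ('d, 'i) L2) set" where
  "op_mult b = {(f, g). AE x in lebesgue. rep_L2 g x = b x *v rep_L2 f x}"

definition op_elliptic :: "(real^'d::finite \<Rightarrow> complex^('n::finite \<times> 'd::finite)^('n \<times> 'd)) \<Rightarrow>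
    (real^'d \<Rightarrow> complex^'n^'n) \<Rightarrow> (('d, 'n::finite) L2 \<times> ('d, 'n) L2) set" where
  "op_elliptic a s = op_add (op_neg (op_grad O op_mult a O op_div)) (op_mult s)"

end

theory Submission
  imports Defs "HOL-Computational_Algebra.Polynomial"
begin

text \<open>
  The homogenized solution \<open>u\<close> is compared with the ansatz \<open>w = u + \<epsilon> N(x/\<epsilon>) A \<nabla>u\<close>, where \<open>N\<close> is the
  corrector field and \<open>A\<close> averages over cells of size \<open>\<epsilon>\<close>. The average keeps the ansatz in \<open>H\<^sup>1\<close> although \<open>N\<close> need
  not be bounded, and it costs only \<open>O(\<epsilon>)\<close> because \<open>u\<close> is in \<open>H\<^sup>2\<close>. What remains of the equation for \<open>w\<close> is
  \<open>g(x/\<epsilon>) A \<nabla>u\<close> with \<open>g = a (\<nabla>N + 1) - a_hom\<close>, tested with \<open>\<nabla>v\<close>. Since \<open>g\<close> is divergence free, the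
  derivative moves from \<open>v\<close> to \<open>\<nabla>u\<close>; since \<open>g\<close> has mean zero, \<open>v\<close> may then be replaced by differences
  \<open>v(x + \<epsilon> z) - v(x)\<close> with \<open>z\<close> in the unit cell, of norm \<open>O(\<epsilon>)\<close> times that of \<open>\<nabla>v\<close>. Coercivity turns this into
  the error estimate.
\<close>

text \<open>For systems a corrector is in general only square integrable on the cell, so
  \<open>N(x/eps)\<close> alone is no multiplier on L^2. Together with the average it is one:
  shifting the integrand back turns \<open>G(x/eps)\<close> into \<open>G(x/eps + w)\<close>, and
  integrating the square over \<open>w\<close> in a full period leaves the number
  \<open>cellnorm G ^ 2\<close>, whatever \<open>x\<close> and \<open>eps\<close> are. All constants
  are therefore free of eps, and identities proved for bounded or smooth fields pass to square
  integrable ones by density in \<open>cellnorm\<close>.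

  Translations are the common instrument. Difference quotients give weak derivatives, regularity of
  second order (constant coefficients commute with shifts), density of test functions in H^1 and the
  Poincare inequality on the cell. The coefficients are not selfadjoint, so all solutions come from
  Lax-Milgram, applied to closed graphs of gradients.

  All Hilbert spaces carry the real inner product. A complex identity is recovered by testing twice,
  with a function and with its multiple by the imaginary unit.\<close>

abbreviation "LY \<equiv> lebesgue_on Ycell"
abbreviation "sqint \<equiv> square_integrable"
abbreviation "pd \<equiv> pderiv_cl"
abbreviation "borelf \<equiv> borel_measurable borel"
abbreviation seq_tendsto (infix "---->" 60) where "X ----> L \<equiv> (X \<longlongrightarrow> L) sequentially"
notation scaleR (infixr "*R" 75)
notation inner (infix "*." 70)

lemmas LINT_cong = Bochner_Integration.integral_cong
lemmas integrable_dominated = Bochner_Integration.integrable_bound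

section \<open>Abstract Hilbert space tools and completeness of L^2\<close>

section \<open>Hilbert spaces\<close>

text \<open>The subspace need not be closed and the functional is given only on it, so that the
  dense space of test functions (\<open>vtest_dense\<close>, \<open>wder_ex_if_bounded\<close>) is
  covered as well as a closed subspace (\<open>lax_milgram\<close>).\<close>

lemma riesz_on_subspace:
  fixes D :: "'a::{real_inner,complete_space} set"
  assumes sub: "subspace D"
    and add: "!!x y. x : D ==> y : D ==> l (x + y) = l x + l y"
    and scale: "!!c x. x : D ==> l (c *R x) = c * (l x :: real)"
    and bd: "!!x. x : D ==> \<bar>l x\<bar> <= C * norm x"
    and C: "0 <= C"
  obtains g where "g : closure D" "!!x. x : D ==> l x = g *. x" "norm g <= C"
proof -
  \<comment> \<open>A minimizing sequence of \<open>J\<close> is Cauchy by the parallelogram law.\<close>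
  define J where "J x = (norm x)^2 - 2 * l x" for x
  have Jlow: "- (C^2) <= J x" if "x : D" for x
  proof -
    have "2 * l x <= 2 * (C * norm x)" using bd[OF that] by simp
    moreover have "0 <= (norm x - C)^2" by simp
    ultimately show ?thesis unfolding J_def by (simp add: power2_diff algebra_simps)
  qed
  have D0: "0 : D" using sub by (rule subspace_0)
  define m where "m = (INF x\<in>D. J x)"
  have bdd: "bdd_below (J ` D)" using Jlow by (auto intro!: bdd_belowI)
  have mle: "m <= J x" if "x : D" for x unfolding m_def by (rule cINF_lower[OF bdd that])
  have "EX x:D. J x < m + 1 / (real n + 1)" for n
  proof (rule ccontr)
    assume "\<not> ?thesis"
    hence "m + 1 / (real n + 1) <= m" unfolding m_def using D0
      by (intro cINF_greatest) (auto simp: m_def not_less)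
    moreover have "0 < 1 / (real n + 1)" by simp
    ultimately show False by linarith
  qed
  then obtain X where XD: "!!n. X n : D" and XJ: "!!n. J (X n) < m + 1 / (real n + 1)" by metis
  have par: "(norm (x - y))^2 <= 2 * (J x - m) + 2 * (J y - m)" if "x : D" "y : D" for x y
  proof -
    have xy: "x + y : D" using sub that by (rule subspace_add)
    have h: "(1/2) *R (x + y) : D" by (rule subspace_scale[OF sub xy])
    have "m <= J ((1/2) *R (x + y))" using mle[OF h] .
    also have "... = (norm (x + y))^2 / 4 - (l x + l y)"
      using that xy by (simp add: J_def scale add power_divide add_divide_distrib)
    finally have "4 * m <= (norm (x + y))^2 - 4 * (l x + l y)" by simp
    moreover have "(norm (x - y))^2 = 2 * (norm x)^2 + 2 * (norm y)^2 - (norm (x + y))^2"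
      by (simp add: power2_norm_eq_inner algebra_simps inner_commute)
    ultimately show ?thesis by (simp add: J_def)
  qed
  have "Cauchy X"
  proof (rule metric_CauchyI)
    fix e :: real assume e: "0 < e"
    obtain N where N: "4 / e^2 < real N" using reals_Archimedean2 by blast
    show "EX M. ALL a>=M. ALL b>=M. dist (X a) (X b) < e"
    proof (intro exI allI impI)
      fix a b assume ab: "N <= a" "N <= b"
      have inv: "1 / (real k + 1) < e^2 / 4" if "N <= k" for k
      proof -
        have "4 / e^2 < real k + 1" using N that by linarith
        thus ?thesis using e by (simp add: field_simps)
      qed
      have "(norm (X a - X b))^2 < e^2"
        using par[OF XD XD, of a b] order.strict_trans[OF XJ[of a] add_strict_left_mono[OF inv[OF ab(1)]]]
          order.strict_trans[OF XJ[of b] add_strict_left_mono[OF inv[OF ab(2)]]] by (simp add: field_simps)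
      thus "dist (X a) (X b) < e" using e
        by (simp add: dist_norm power_less_imp_less_base)
    qed
  qed
  then obtain g where g: "X ----> g" using Cauchy_convergent convergent_def by blast
  have gcl: "g : closure D" using g XD by (auto simp: closure_sequential)
  have eq: "l x = g *. x" if x: "x : D" for x
  proof -
    \<comment> \<open>First variation along \<open>t *R x\<close>: \<open>X n\<close> minimizes
      \<open>J\<close> up to \<open>1 / (n + 1)\<close>, and this defect disappears in the
      limit.\<close>
    have key: "0 <= 2 * t * (g *. x - l x) + t^2 * (norm x)^2" for t
    proof (rule LIMSEQ_le)
      show "(%n. 0 - 1 / (real n + 1)) ----> 0"
        using LIMSEQ_inverse_real_of_nat by (simp add: inverse_eq_divide tendsto_minus_cancel_left add.commute) (metis tendsto_minus minus_zero)
      show "(%n. 2 * t * (X n *. x - l x) + t^2 * (norm x)^2)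
          ----> 2 * t * (g *. x - l x) + t^2 * (norm x)^2"
        by (intro tendsto_intros g)
      have "0 - 1 / (real n + 1) <= 2 * t * (X n *. x - l x) + t^2 * (norm x)^2" for n
      proof -
        have tx: "t *R x : D" by (rule subspace_scale[OF sub x])
        have "m <= J (X n + t *R x)" by (rule mle[OF subspace_add[OF sub XD tx]])
        also have "... = J (X n) + 2 * t * (X n *. x - l x) + t^2 * (norm x)^2"
          unfolding J_def add[OF XD tx] scale[OF x] power2_norm_eq_inner
          by (simp add: inner_add_left inner_add_right inner_commute algebra_simps power2_eq_square)
        finally show ?thesis using XJ[of n] by linarith
      qed
      thus "EX N. ALL n>=N. 0 - 1 / (real n + 1) <= 2 * t * (X n *. x - l x) + t^2 * (norm x)^2" by blast
    qed
    show ?thesis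
    proof (cases "x = 0")
      case True
      thus ?thesis using scale[OF x, of 0] by simp
    next
      case False
      define q where "q = (norm x)^2"
      have q: "q > 0" using False by (simp add: q_def)
      define z where "z = g *. x - l x"
      have "0 <= 2 * (- z / q) * z + (- z / q)^2 * q" using key[of "- z / q"] by (simp add: q_def z_def)
      also have "... = - (z^2 / q)" using q by (simp add: field_simps power2_eq_square)
      finally have "z^2 <= 0" using q by (simp add: field_simps)
      thus ?thesis by (simp add: z_def)
    qed
  qed
  have "norm g <= C"
  proof (cases "g = 0")
    case True
    thus ?thesis using C by simp
  next
    case False
    have "g *. g <= C * norm g"
    proof (rule LIMSEQ_le)
      show "(%n. g *. X n) ----> g *. g" "(%n. C * norm (X n)) ----> C * norm g"
        by (intro tendsto_intros g)+
      show "EX N. ALL n>=N. g *. X n <= C * norm (X n)"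
        using bd[OF XD] eq[OF XD] by (metis abs_le_iff)
    qed
    thus ?thesis using False
      by (simp add: power2_norm_eq_inner[symmetric] power2_eq_square)
  qed
  thus thesis using that gcl eq by blast
qed

text \<open>Without symmetry of \<open>T\<close> the solution is no minimizer. It is the fixed point
  of \<open>x - r *R P (T x - b)\<close>, where \<open>P\<close> is the orthogonal projection onto
  \<open>V\<close>; coercivity makes this map a contraction for small \<open>r\<close>.\<close>

lemma lax_milgram:
  fixes V :: "'a::{real_inner,complete_space} set" and T :: "'a => 'a"
  assumes sub: "subspace V" and cl: "closed V" and T: "bounded_linear T"
    and c: "0 < c" and coer: "!!x. x : V ==> c * (norm x)^2 <= T x *. x"
  shows "EX! x. x : V & (ALL y:V. T x *. y = b *. y)"
proof -
  have "EX g:V. ALL y:V. g *. y = z *. y" for z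
  proof -
    have "\<bar>z *. x\<bar> <= norm z * norm x" for x by (rule Cauchy_Schwarz_ineq2)
    then obtain g where "g : closure V" "!!x. x : V ==> z *. x = g *. x" "norm g <= norm z"
      using riesz_on_subspace[OF sub, of "%x. z *. x" "norm z"]
      by (auto simp: inner_add_right)
    thus ?thesis using cl by (auto simp: closure_closed intro!: bexI[of _ g])
  qed
  then obtain P where PV: "!!z. P z : V" and P: "!!z y. y : V ==> P z *. y = z *. y" by metis
  obtain K0 where K0: "!!x. norm (T x) <= norm x * K0" using bounded_linear.bounded[OF T] by blast
  \<comment> \<open>The maximum with \<open>c\<close> makes \<open>c <= K\<close>, so the
    contraction factor \<open>q\<close> below is a real number in [0,1).\<close>
  define K where "K = max c K0"
  have K: "0 < K" "c <= K" and TK: "norm (T x) <= K * norm x" for x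
    using c K0[of x] mult_left_mono[of K0 K "norm x"] by (auto simp: K_def mult.commute)
  \<comment> \<open>This \<open>r\<close> minimizes \<open>1 - 2 * r * c + r^2 * K^2\<close>, the
    bound for the squared contraction factor.\<close>
  define r where "r = c / K^2"
  define q where "q = sqrt (1 - (c / K)^2)"
  have ck: "0 <= 1 - (c / K)^2" using c K by (simp add: power_le_one)
  have q: "0 <= q" "q < 1" using ck c K by (auto simp: q_def)
  define F where "F x = x - r *R P (T x - b)" for x
  have r: "0 < r" using c K by (simp add: r_def)
  have FV: "F x : V" if "x : V" for x
    unfolding F_def using sub that PV by (intro subspace_diff subspace_scale)
  have contr: "dist (F x) (F y) <= q * dist x y" if x: "x : V" and y: "y : V" for x y
  proof -
    define e where "e = x - y"
    define p where "p = P (T x - b) - P (T y - b)"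
    have eV: "e : V" unfolding e_def using sub x y by (rule subspace_diff)
    have pV: "p : V" unfolding p_def using sub PV by (intro subspace_diff)
    have pe: "p *. y' = T e *. y'" if "y' : V" for y'
      using that by (simp add: p_def e_def inner_diff_left P linear_diff[OF bounded_linear.linear[OF T]])
    have "(norm p)^2 = T e *. p" using pe[OF pV] by (simp add: power2_norm_eq_inner)
    also have "... <= norm (T e) * norm p" by (rule norm_cauchy_schwarz)
    also have "... <= K * norm e * norm p" by (rule mult_right_mono[OF TK norm_ge_zero])
    finally have np: "norm p <= K * norm e"
      by (cases "p = 0") (use K in \<open>auto simp: power2_eq_square\<close>)
    have eq: "F x - F y = e - r *R p" by (simp add: F_def e_def p_def algebra_simps)
    have "(norm (F x - F y))^2 = (norm e)^2 - 2 * r * (p *. e) + r^2 * (norm p)^2"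
      unfolding eq using dot_norm_neg[of e "r *R p"] by (simp add: power_mult_distrib inner_commute)
    also have "... <= (norm e)^2 - 2 * r * (c * (norm e)^2) + r^2 * (K * norm e)^2"
      using pe[OF eV] coer[OF eV] r power_mono[OF np norm_ge_zero, of 2]
      by (intro add_mono diff_mono mult_left_mono) auto
    also have "... = (1 - (c / K)^2) * (norm e)^2"
      using K by (simp add: r_def field_simps power2_eq_square)
    also have "... = (q * norm e)^2" using ck by (simp add: q_def power_mult_distrib)
    finally have "norm (F x - F y) <= q * norm e"
      by (rule power2_le_imp_le) (use q in auto)
    thus ?thesis by (simp add: dist_norm e_def)
  qed
  have "complete V" using cl by (simp add: complete_eq_closed)
  moreover have "V ~= {}" using subspace_0[OF sub] by blast
  ultimately have "EX! x:V. F x = x"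
    using q FV contr by (intro Banach_fix) auto
  then obtain x where x: "x : V" "F x = x" by blast
  have sol: "T x *. y = b *. y" if "y : V" for y
    using x(2) r P[OF that, of "T x - b"] by (auto simp: F_def inner_diff_left)
  show ?thesis
  proof (rule ex1I[of _ x])
    show "x : V & (ALL y:V. T x *. y = b *. y)" using x sol by blast
  next
    fix x' assume x': "x' : V & (ALL y:V. T x' *. y = b *. y)"
    have e: "x' - x : V" using sub x' x by (intro subspace_diff) auto
    have "c * (norm (x' - x))^2 <= T (x' - x) *. (x' - x)" by (rule coer[OF e])
    also have "... = 0" using x' sol e by (simp add: linear_diff[OF bounded_linear.linear[OF T]] inner_diff_left)
    finally show "x' = x" using c by (simp add: mult_le_0_iff)
  qed
qed

text \<open>The best choice is \<open>t = B / A\<close>. Integrating Young's inequality with weight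
  \<open>t\<close> and applying this gives a Cauchy-Schwarz bound for integrals of
  \<open>L2\<close>-valued functions, in \<open>cube_integral_inner_bound\<close>.\<close>

lemma Cauchy_Schwarz_from_scaling:
  fixes x A B :: real
  assumes "0 <= A" "0 <= B" and "!!t. 0 < t ==> 2 * x <= t * A^2 + B^2 / t"
  shows "x <= A * B"
proof (rule field_le_epsilon)
  fix e :: real assume e: "0 < e"
  define d where "d = min 1 (e / (A + B + 1))"
  have AB: "0 < A + B + 1" using assms by linarith
  have d: "0 < d" "d <= 1" using e AB by (auto simp: d_def)
  have "d <= e / (A + B + 1)" by (simp add: d_def)
  hence de: "d * (A + B + 1) <= e" using AB by (simp add: pos_le_divide_eq)
  \<comment> \<open>\<open>A\<close> or \<open>B\<close> may vanish; adding \<open>d\<close> to both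
    keeps \<open>t\<close> positive and finite.\<close>
  define t where "t = (B + d) / (A + d)"
  have t: "0 < t" using assms d by (simp add: t_def add_nonneg_pos)
  have "t * A^2 <= t * (A + d)^2" using t d assms by (intro mult_left_mono power_mono) auto
  also have "... = (B + d) * (A + d)" using assms d by (simp add: t_def power2_eq_square)
  finally have 1: "t * A^2 <= (B + d) * (A + d)" .
  have "B^2 / t <= (B + d)^2 / t" using t d assms by (intro divide_right_mono power_mono) auto
  also have "... = (B + d) * (A + d)" using assms d by (simp add: t_def power2_eq_square)
  finally have 2: "B^2 / t <= (B + d) * (A + d)" .
  have "x <= (B + d) * (A + d)" using 1 2 assms(3)[OF t] by linarith
  also have "... = A * B + d * (A + B + d)" by (simp add: algebra_simps)
  also have "... <= A * B + d * (A + B + 1)" using d by simp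
  also have "... <= A * B + e" using de by simp
  finally show "x <= A * B + e" .
qed

section \<open>Completeness of \<open>L^2\<close>\<close>

lemma rep_L2_sqint: "rep_L2 u : sqint lebesgue"
  using Quotient3_rep_reflp[OF Quotient3_L2, of u] by (simp add: L2_eq_def)

lemma abs_rep_L2 [simp]: "abs_L2 (rep_L2 u) = u"
  by (rule Quotient3_abs_rep[OF Quotient3_L2])

lemma abs_L2_eq_iff:
  "f : sqint lebesgue ==> g : sqint lebesgue ==>
   abs_L2 f = abs_L2 g \<longleftrightarrow> (AE x in lebesgue. f x = g x)"
  using Quotient3_rel[OF Quotient3_L2, of f g] by (auto simp: L2_eq_def)

lemma rep_abs_L2: "f : sqint lebesgue ==> AE x in lebesgue. rep_L2 (abs_L2 f) x = f x"
  by (subst abs_L2_eq_iff[symmetric]) (auto simp: rep_L2_sqint)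

context
  fixes f g :: "real^'d => complex^'i"
  assumes f: "f : sqint lebesgue" and g: "g : sqint lebesgue"
begin

lemma plus_abs_L2: "abs_L2 f + abs_L2 g = abs_L2 (%x. f x + g x)"
  using f g by (intro plus_L2.abs_eq) (auto simp: L2_eq_def)

lemma minus_abs_L2: "abs_L2 f - abs_L2 g = abs_L2 (%x. f x - g x)"
  using f g by (intro minus_L2.abs_eq) (auto simp: L2_eq_def)

lemma scaleR_abs_L2: "c *R abs_L2 f = abs_L2 (%x. c *R f x)"
  using f g by (intro scaleR_L2.abs_eq) (auto simp: L2_eq_def)

lemma inner_abs_L2: "abs_L2 f *. abs_L2 g = (LINT x|lebesgue. f x *. g x)"
  using f g by (intro inner_L2.abs_eq) (auto simp: L2_eq_def)

end

lemma zero_abs_L2: "0 = abs_L2 (%x. 0)"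
  by (rule zero_L2.abs_eq)

lemma norm_abs_L2_nn:
  fixes f :: "real^'d => complex^'i"
  assumes f: "f : sqint lebesgue"
  shows "ennreal ((norm (abs_L2 f))^2) = (nn_integral lebesgue (%x. ennreal ((norm (f x))^2)))"
proof -
  have "(norm (abs_L2 f))^2 = (LINT x|lebesgue. (norm (f x))^2)"
    by (simp add: power2_norm_eq_inner inner_abs_L2[OF f f])
  thus ?thesis using f
    by (simp add: nn_integral_eq_integral square_integrable_def)
qed

lemma sqint_iff_nn:
  fixes f :: "'a => 'b::{real_normed_vector,second_countable_topology}"
  shows "f : sqint M \<longleftrightarrow>
    f : borel_measurable M & (nn_integral M (%x. ennreal ((norm (f x))^2))) < \<infinity>"
  unfolding square_integrable_def by (auto simp: integrable_iff_bounded)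

text \<open>Riesz-Fischer: a rapidly convergent subsequence converges almost everywhere, and Fatou's
  lemma turns the pointwise limit into a limit in norm.\<close>

lemma L2_Cauchy_convergent:
  fixes X :: "nat => ('d::finite, 'i::finite) L2"
  assumes X: "Cauchy X"
  shows "convergent X"
proof -
  have "ALL k. EX N. ALL m>=N. ALL n>=N. norm (X m - X n) < (1/2)^k"
    using CauchyD[OF X] by (metis half_gt_zero_iff zero_less_one zero_less_power)
  then obtain N where N: "!!k m n. N k <= m ==> N k <= n ==> norm (X m - X n) < (1/2)^k" by metis
  \<comment> \<open>The partial sum dominates \<open>N j\<close> for every \<open>j <= k\<close>, so
    all earlier Cauchy bounds hold from index \<open>r k\<close> on.\<close>
  define r where "r k = (\<Sum>i\<le>k. N i)" for k
  have r: "N j <= r k" if "j <= k" for j k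
    unfolding r_def using that by (intro member_le_sum) auto
  define f where "f k = rep_L2 (X (r k))" for k
  \<comment> \<open>The squared increments have integral at most \<open>(1/4)^k\<close>. The weight
    \<open>2^k\<close> keeps the series integrable, and where it is finite the increments decay like
    \<open>(sqrt (1/2))^k\<close>.\<close>
  let ?E = "%k x. 2^k * (norm (f (Suc k) x - f k x))^2"
  have fs: "f k : sqint lebesgue" for k by (simp add: f_def rep_L2_sqint)
  have [measurable]: "f k : borel_measurable lebesgue" for k
    using fs[of k] by (simp add: square_integrable_def)
  have diff: "(nn_integral lebesgue (%x. ennreal ((norm (f m x - f n x))^2))) <= ennreal (((1/2)^k)^2)"
    if "k <= m" "k <= n" for k m n
  proof -
    have "X (r m) - X (r n) = abs_L2 (%x. f m x - f n x)"
      using minus_abs_L2[OF fs fs, of m n] by (simp add: f_def)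
    moreover have "norm (X (r m) - X (r n)) < (1/2)^k" by (intro N r that)
    ultimately show ?thesis
      using norm_abs_L2_nn[OF square_integrable_diff[OF fs fs], of m n]
      by (metis ennreal_leI less_imp_le norm_ge_zero power_mono)
  qed
  have "(nn_integral lebesgue (%x. (\<Sum>k. ennreal (?E k x)))) ~= \<infinity>"
  proof -
    have "(nn_integral lebesgue (%x. (\<Sum>k. ennreal (?E k x))))
        = (\<Sum>k. nn_integral lebesgue (%x. ennreal (?E k x)))"
      by (rule nn_integral_suminf) measurable
    also have "... <= (\<Sum>k. ennreal ((1/2)^k))"
    proof (rule suminf_le)
      fix k
      have "(nn_integral lebesgue (%x. ennreal (?E k x)))
          = ennreal (2^k) * (nn_integral lebesgue (%x. ennreal ((norm (f (Suc k) x - f k x))^2)))"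
        by (simp add: ennreal_mult nn_integral_cmult)
      also have "... <= ennreal (2^k) * ennreal (((1/2)^k)^2)"
        by (intro mult_left_mono diff) auto
      also have "... = ennreal ((1/2)^k)"
        by (simp add: ennreal_mult[symmetric] power2_eq_square power_one_over field_simps)
      finally show "(nn_integral lebesgue (%x. ennreal (?E k x))) <= ennreal ((1/2)^k)" .
    qed auto
    also have "... = ennreal (\<Sum>k. (1/2)^k)"
      by (rule suminf_ennreal2) (auto intro: summable_geometric)
    finally show ?thesis by (auto simp: top_unique)
  qed
  hence "AE x in lebesgue. (\<Sum>k. ennreal (?E k x)) ~= \<infinity>"
    by (intro nn_integral_noteq_infinite) measurable
  hence ae: "AE x in lebesgue. convergent (%k. f k x)"
  proof (rule eventually_mono)
    fix x assume "(\<Sum>k. ennreal (?E k x)) ~= \<infinity>"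
    hence s: "summable (%k. ?E k x)"
      by (intro summable_suminf_not_top) auto
    define K where "K = (\<Sum>k. ?E k x)"
    have le: "?E k x <= K" for k
      unfolding K_def using sum_le_suminf[OF s, of "{k}"] by simp
    have K0: "0 <= K" using le[of 0] by (rule order_trans[rotated]) simp
    have bd: "norm (f (Suc k) x - f k x) <= sqrt K * (sqrt (1/2))^k" for k
    proof (rule power2_le_imp_le)
      have "(norm (f (Suc k) x - f k x))^2 <= K * (1/2)^k"
        using le[of k] by (simp add: power_one_over field_simps)
      also have "... = (sqrt K * (sqrt (1/2))^k)^2"
      proof -
        have "((sqrt (1/2))^k)^2 = ((sqrt (1/2))^2)^k" by (metis power_mult mult.commute)
        thus ?thesis using K0 by (simp add: power_mult_distrib)
      qed
      finally show "(norm (f (Suc k) x - f k x))^2 <= (sqrt K * (sqrt (1/2))^k)^2" .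
    qed (use K0 in auto)
    have "summable (%k. sqrt K * (sqrt (1/2))^k)"
      by (intro summable_mult summable_geometric) (simp add: real_sqrt_divide)
    hence "summable (%k. f (Suc k) x - f k x)"
      by (rule summable_comparison_test'[where N=0]) (use bd in auto)
    hence "convergent (%n. \<Sum>k<n. f (Suc k) x - f k x)" by (simp add: summable_iff_convergent)
    hence "convergent (%n. f n x - f 0 x)" by (simp only: sum_lessThan_telescope[of "%k. f k x"])
    hence "convergent (%n. (f n x - f 0 x) + f 0 x)" by (intro convergent_add convergent_const)
    thus "convergent (%k. f k x)" by simp
  qed
  define F where "F x = lim (%k. f k x)" for x
  let ?G = "%m n x. ennreal ((norm (f m x - f n x))^2)" and ?H = "%n x. ennreal ((norm (F x - f n x))^2)"
  have [measurable]: "F : borel_measurable lebesgue"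
    unfolding F_def by (intro borel_measurable_lim_metric) simp
  have lim: "(nn_integral lebesgue (%x. ?H n x)) <= ennreal (((1/2)^n)^2)" for n
  proof -
    have "(nn_integral lebesgue (%x. ?H n x))
        = (nn_integral lebesgue (%x. liminf (%m. ?G m n x)))"
    proof (rule nn_integral_cong_AE)
      show "AE x in lebesgue. ?H n x = liminf (%m. ?G m n x)"
        using ae
      proof (rule eventually_mono)
        fix x assume "convergent (%k. f k x)"
        hence "(%m. f m x) ----> F x" by (simp add: F_def convergent_LIMSEQ_iff)
        hence "(%m. ?G m n x) ----> ?H n x"
          by (intro tendsto_ennrealI tendsto_intros)
        thus "?H n x = liminf (%m. ?G m n x)"
          by (rule lim_imp_Liminf[OF trivial_limit_sequentially, symmetric])
      qed
    qed
    also have "... <= liminf (%m. nn_integral lebesgue (%x. ?G m n x))"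
      by (rule nn_integral_liminf) measurable
    also have "... <= liminf (%m::nat. ennreal (((1/2)^n)^2))"
      using diff by (intro Liminf_mono eventually_sequentiallyI[of n]) auto
    also have "... = ennreal (((1/2)^n)^2)" by (simp add: Liminf_const)
    finally show ?thesis .
  qed
  have Fd: "(%x. F x - f n x) : sqint lebesgue" for n
    unfolding sqint_iff_nn using lim[of n] by (auto simp: le_less_trans)
  have Fs: "F : sqint lebesgue"
    using square_integrable_add[OF Fd[of 0] fs[of 0]] by simp
  have dist: "norm (abs_L2 F - X (r n)) <= (1/2)^n" for n
  proof -
    have "abs_L2 F - X (r n) = abs_L2 (%x. F x - f n x)"
      using minus_abs_L2[OF Fs fs, of n] by (simp add: f_def)
    hence "ennreal ((norm (abs_L2 F - X (r n)))^2) <= ennreal (((1/2)^n)^2)"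
      using norm_abs_L2_nn[OF Fd, of n] lim[of n] by simp
    hence "(norm (abs_L2 F - X (r n)))^2 <= ((1/2)^n)^2" by (simp add: ennreal_le_iff)
    thus ?thesis by (rule power2_le_imp_le) simp
  qed
  have "X ----> abs_L2 F"
  proof (rule LIMSEQ_I)
    fix e :: real assume e: "0 < e"
    obtain n where n: "(1/2)^n < e / 2" using e by (metis half_gt_zero_iff real_arch_pow_inv one_less_numeral_iff semiring_norm(76) half_gt_zero divide_less_eq_1_pos zero_less_numeral)
    have "norm (X m - abs_L2 F) < e" if m: "r n <= m" for m
    proof -
      have "norm (X m - X (r n)) < (1/2)^n"
        by (rule N) (use m r[of n n] in auto)
      moreover have "norm (X m - abs_L2 F) <= norm (X m - X (r n)) + norm (abs_L2 F - X (r n))"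
        using norm_triangle_ineq4[of "X m - X (r n)" "abs_L2 F - X (r n)"] by simp
      ultimately show ?thesis using n dist[of n] by linarith
    qed
    thus "EX no. ALL n>=no. norm (X n - abs_L2 F) < e" by blast
  qed
  thus ?thesis by (rule convergentI)
qed

instance L2 :: (finite, finite) complete_space
  by standard (rule L2_Cauchy_convergent)

section \<open>Smooth functions, cutoffs and the fundamental lemma\<close>

section \<open>Smooth functions\<close>

lemma pderiv_clI: "(f has_derivative f') (at x) ==> pd j f x = f' (axis j 1)"
  unfolding pderiv_cl_def using frechet_derivative_at by metis

lemma smooth_fun_diffble: "smooth_fun f ==> f differentiable (at x)"
  unfolding smooth_fun_def by (drule spec[of _ "[]"]) (simp add: differentiable_on_def)

lemma smooth_fun_pderiv: "smooth_fun f ==> smooth_fun (pd j f)"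
  unfolding smooth_fun_def
proof
  fix js
  assume "ALL js. foldr pd js f differentiable_on UNIV"
  hence "foldr pd (js @ [j]) f differentiable_on UNIV" by blast
  thus "foldr pd js (pd j f) differentiable_on UNIV" by simp
qed

lemma smooth_fun_cont: "smooth_fun f ==> continuous_on S f"
  by (intro continuous_at_imp_continuous_on ballI differentiable_imp_continuous_within smooth_fun_diffble)

lemma smooth_fun_measurable [measurable_dest]: "smooth_fun f ==> f : borelf"
  by (intro borel_measurable_continuous_onI smooth_fun_cont)

text \<open>A class of differentiable functions that is closed under \<open>pd\<close> contains all
  iterated derivatives of its members. This replaces inductions over lists of derivatives.\<close>

lemma smooth_fun_coinduct:
  assumes "f : F"
    and "!!f x. f : F ==> f differentiable (at x)"
    and "!!f j. f : F ==> pd j f : F"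
  shows "smooth_fun f"
proof -
  have "foldr pd js f : F" for js by (induction js) (auto intro: assms)
  thus ?thesis unfolding smooth_fun_def differentiable_on_def
    using assms(2) differentiable_at_withinI by blast
qed

text \<open>Closure of \<open>smooth_fun\<close> under one operation is not self-contained:
  derivatives of products are sums of products. The class generated by all operations together is
  closed under \<open>pd\<close>, so one application of \<open>smooth_fun_coinduct\<close> settles
  them all.\<close>

inductive smooth_gen :: "(real^'d => complex) => bool" where
  base: "smooth_fun f ==> smooth_gen f"
| const: "smooth_gen (%x. c)"
| add: "smooth_gen f ==> smooth_gen g ==> smooth_gen (%x. f x + g x)"
| mult: "smooth_gen f ==> smooth_gen g ==> smooth_gen (%x. f x * g x)"
| exp: "smooth_gen f ==> smooth_gen (%x. exp (f x))"
| cnj: "smooth_gen f ==> smooth_gen (%x. cnj (f x))"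
| affine: "smooth_gen f ==> smooth_gen (%x. f (c *R x + h))"

lemma has_derivative_pderiv_cl:
  fixes f :: "real^'d => complex"
  assumes "f differentiable (at x)"
  shows "(f has_derivative (%h. SUM j:UNIV. h $ j *R pd j f x)) (at x)"
proof -
  let ?D = "frechet_derivative f (at x)"
  have D: "(f has_derivative ?D) (at x)" using assms by (simp add: frechet_derivative_works)
  have lin: "linear ?D" using D by (rule has_derivative_linear)
  have "?D h = (SUM j:UNIV. h $ j *R pd j f x)" for h
  proof -
    have "?D h = ?D (SUM j:UNIV. h $ j *R axis j 1)"
      using basis_expansion[of h] by (simp add: scalar_mult_eq_scaleR)
    thus ?thesis by (simp add: linear_sum[OF lin] linear_scale[OF lin] pderiv_cl_def)
  qed
  hence "?D = (%h. SUM j:UNIV. h $ j *R pd j f x)" by blast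
  thus ?thesis using D by simp
qed

lemma pderiv_cl_const: "pd j (%x. c) = (%x. 0)"
proof
  fix x
  show "pd j (%x. c) x = 0" by (rule pderiv_clI[OF has_derivative_const])
qed

lemma pderiv_cl_add:
  assumes "!!x. f differentiable (at x)" "!!x. g differentiable (at x)"
  shows "pd j (%x. f x + g x) = (%x. pd j f x + pd j g x)"
proof
  fix x
  have "(f has_derivative frechet_derivative f (at x)) (at x)"
       "(g has_derivative frechet_derivative g (at x)) (at x)"
    using assms by (simp_all add: frechet_derivative_works)
  from pderiv_clI[OF has_derivative_add[OF this]]
  show "pd j (%x. f x + g x) x = pd j f x + pd j g x"
    by (simp add: pderiv_cl_def)
qed

lemma pderiv_cl_mult:
  assumes "!!x. f differentiable (at x)" "!!x. g differentiable (at x)"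
  shows "pd j (%x. f x * g x) = (%x. f x * pd j g x + pd j f x * g x)"
proof
  fix x
  have "(f has_derivative frechet_derivative f (at x)) (at x)"
       "(g has_derivative frechet_derivative g (at x)) (at x)"
    using assms by (simp_all add: frechet_derivative_works)
  from pderiv_clI[OF has_derivative_mult[OF this]]
  show "pd j (%x. f x * g x) x = f x * pd j g x + pd j f x * g x"
    by (simp add: pderiv_cl_def)
qed

lemma pderiv_cl_exp:
  assumes "!!x. f differentiable (at x)"
  shows "pd j (%x. exp (f x)) = (%x. exp (f x) * pd j f x)"
proof
  fix x
  have "(f has_derivative frechet_derivative f (at x)) (at x)"
    using assms by (simp add: frechet_derivative_works)
  moreover have "(exp has_derivative (%h. exp (f x) * h)) (at (f x))"
    using DERIV_exp[of "f x"] by (simp add: has_field_derivative_def)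
  ultimately have "((%x. exp (f x)) has_derivative (%h. exp (f x) * frechet_derivative f (at x) h)) (at x)"
    by (rule has_derivative_compose)
  from pderiv_clI[OF this] show "pd j (%x. exp (f x)) x = exp (f x) * pd j f x"
    by (simp add: pderiv_cl_def)
qed

lemma pderiv_cl_cnj:
  assumes "!!x. f differentiable (at x)"
  shows "pd j (%x. cnj (f x)) = (%x. cnj (pd j f x))"
proof
  fix x
  have "(f has_derivative frechet_derivative f (at x)) (at x)"
    using assms by (simp add: frechet_derivative_works)
  hence "((%x. cnj (f x)) has_derivative (%h. cnj (frechet_derivative f (at x) h))) (at x)"
    by (rule bounded_linear.has_derivative[OF bounded_linear_cnj])
  from pderiv_clI[OF this] show "pd j (%x. cnj (f x)) x = cnj (pd j f x)"
    by (simp add: pderiv_cl_def)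
qed

lemma has_derivative_affine_arg:
  fixes f :: "real^'d => complex"
  assumes "f differentiable (at (c *R x + h))"
  shows "((%x. f (c *R x + h)) has_derivative (%y. frechet_derivative f (at (c *R x + h)) (c *R y))) (at x)"
proof -
  have "(f has_derivative frechet_derivative f (at (c *R x + h))) (at (c *R x + h))"
    using assms by (simp add: frechet_derivative_works)
  moreover have "((%x. c *R x + h) has_derivative (%y. c *R y)) (at x)"
    by (auto intro!: derivative_eq_intros)
  ultimately show ?thesis by (rule has_derivative_compose[rotated])
qed

lemma pderiv_cl_affine:
  fixes f :: "real^'d => complex"
  assumes "!!x. f differentiable (at x)"
  shows "pd j (%x. f (c *R x + h)) = (%x. of_real c * pd j f (c *R x + h))"
proof
  fix x
  have lin: "linear (frechet_derivative f (at (c *R x + h)))"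
    using assms by (simp add: linear_frechet_derivative)
  show "pd j (%x. f (c *R x + h)) x = of_real c * pd j f (c *R x + h)"
    using pderiv_clI[OF has_derivative_affine_arg[of f c x h, OF assms], of j]
    by (simp add: linear_scale[OF lin] pderiv_cl_def scaleR_conv_of_real[where 'a=complex])
qed

lemma smooth_gen_step:
  fixes f :: "real^'d => complex"
  assumes "smooth_gen f"
  shows "(ALL x. f differentiable (at x)) & (ALL j. smooth_gen (pd j f))"
  using assms
proof induction
  case (base f)
  thus ?case by (auto intro: smooth_gen.base smooth_fun_diffble smooth_fun_pderiv)
next
  case (const c)
  thus ?case by (auto simp: pderiv_cl_const intro: smooth_gen.const)
next
  case (add f g)
  thus ?case by (auto simp: pderiv_cl_add intro: smooth_gen.add)
next
  case (mult f g)
  thus ?case by (auto simp: pderiv_cl_mult intro!: smooth_gen.add smooth_gen.mult)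
next
  case (exp f)
  have "(%x. exp (f x)) differentiable (at x)" for x
  proof -
    have "(f has_derivative frechet_derivative f (at x)) (at x)"
      using exp by (simp add: frechet_derivative_works)
    moreover have "(exp has_derivative (%h. exp (f x) * h)) (at (f x))"
      using DERIV_exp[of "f x"] by (simp add: has_field_derivative_def)
    ultimately show ?thesis unfolding differentiable_def using has_derivative_compose by blast
  qed
  thus ?case using exp by (auto simp: pderiv_cl_exp intro!: smooth_gen.exp smooth_gen.mult)
next
  case (cnj f)
  have "(%x. cnj (f x)) differentiable (at x)" for x
    using cnj unfolding differentiable_def
    using bounded_linear.has_derivative[OF bounded_linear_cnj] by blast
  thus ?case using cnj by (auto simp: pderiv_cl_cnj intro!: smooth_gen.cnj)
next
  case (affine f c h)
  have "(%x. f (c *R x + h)) differentiable (at x)" for x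
    using has_derivative_affine_arg affine unfolding differentiable_def by blast
  thus ?case using affine
    by (auto simp: pderiv_cl_affine intro!: smooth_gen.affine smooth_gen.mult smooth_gen.const)
qed

lemma smooth_gen_smooth:
  fixes f :: "real^'d => complex"
  shows "smooth_gen f ==> smooth_fun f"
  using smooth_fun_coinduct[of f "Collect smooth_gen"] smooth_gen_step by blast

context
  fixes f g :: "real^'d => complex"
begin

lemma smooth_fun_const: "smooth_fun (%x::real^'d. c)"
  by (rule smooth_gen_smooth[OF smooth_gen.const])

lemma smooth_fun_add: "smooth_fun f ==> smooth_fun g ==> smooth_fun (%x. f x + g x)"
  by (rule smooth_gen_smooth[OF smooth_gen.add[OF smooth_gen.base smooth_gen.base]])

lemma smooth_fun_mult: "smooth_fun f ==> smooth_fun g ==> smooth_fun (%x. f x * g x)"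
  by (rule smooth_gen_smooth[OF smooth_gen.mult[OF smooth_gen.base smooth_gen.base]])

lemma smooth_fun_exp: "smooth_fun f ==> smooth_fun (%x. exp (f x))"
  by (rule smooth_gen_smooth[OF smooth_gen.exp[OF smooth_gen.base]])

lemma smooth_fun_cnj: "smooth_fun f ==> smooth_fun (%x. cnj (f x))"
  by (rule smooth_gen_smooth[OF smooth_gen.cnj[OF smooth_gen.base]])

lemma smooth_fun_affine: "smooth_fun f ==> smooth_fun (%x. f (c *R x + h))"
  by (rule smooth_gen_smooth[OF smooth_gen.affine[OF smooth_gen.base]])

lemma smooth_fun_diff: "smooth_fun f ==> smooth_fun g ==> smooth_fun (%x. f x - g x)"
  using smooth_gen_smooth[OF smooth_gen.add[OF smooth_gen.base smooth_gen.mult[OF smooth_gen.const[of "-1"] smooth_gen.base]], of f g]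
  by simp

end

lemma smooth_fun_prod:
  fixes f :: "'i => real^'d => complex"
  shows "(!!i. i : I ==> smooth_fun (f i)) ==> smooth_fun (%x. PROD i:I. f i x)"
  by (induction I rule: infinite_finite_induct) (auto intro: smooth_fun_const smooth_fun_mult)

lemma smooth_fun_sum:
  fixes f :: "'i => real^'d => complex"
  shows "(!!i. i : I ==> smooth_fun (f i)) ==> smooth_fun (%x. SUM i:I. f i x)"
  by (induction I rule: infinite_finite_induct) (auto intro: smooth_fun_const smooth_fun_add)

section \<open>Bump functions\<close>

text \<open>The flat function \<open>exp (- 1 / t)\<close>, extended by 0 to \<open>t <= 0\<close>.
  The polynomial in \<open>1 / t\<close> is carried along to make the family closed under
  differentiation.\<close>

definition flat :: "real poly => real => real" where
  "flat p t = (if t > 0 then poly p (1 / t) * exp (- 1 / t) else 0)"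

lemma poly_over_exp_tendsto_0: "((%s. poly p s / exp s) \<longlongrightarrow> (0::real)) at_top"
proof -
  have "((%s. \<Sum>i\<le>degree p. coeff p i * (s ^ i / exp s)) \<longlongrightarrow> (\<Sum>i\<le>degree p. coeff p i * 0)) at_top"
    by (intro tendsto_sum tendsto_mult tendsto_const tendsto_power_div_exp_0)
  thus ?thesis by (simp add: poly_altdef sum_divide_distrib)
qed

lemma flat_tendsto_0: "((%t. flat p t) \<longlongrightarrow> 0) (at 0)"
proof (rule filterlim_split_at)
  show "(flat p \<longlongrightarrow> 0) (at_left 0)"
    by (rule tendsto_eventually) (auto simp: flat_def eventually_at_filter)
  have "flat p t = poly p (inverse t) / exp (inverse t)" if "0 < t" for t
  proof -
    have "exp (- 1 / t) = inverse (exp (inverse t))"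
      by (simp add: exp_minus inverse_eq_divide)
    thus ?thesis using that by (simp add: flat_def inverse_eq_divide)
  qed
  hence "\<forall>\<^sub>F t in at_right 0. poly p (inverse t) / exp (inverse t) = flat p t"
    by (auto simp: eventually_at_filter intro!: always_eventually)
  moreover have "((%t. poly p (inverse t) / exp (inverse t)) \<longlongrightarrow> 0) (at_right 0)"
    by (rule filterlim_compose[OF poly_over_exp_tendsto_0 filterlim_inverse_at_top_right])
  ultimately show "(flat p \<longlongrightarrow> 0) (at_right 0)" by (rule Lim_transform_eventually[rotated])
qed

text \<open>With \<open>s = 1 / t\<close> the chain rule produces the factor \<open>- s^2\<close>,
  hence the new polynomial \<open>s^2 * (p - p')\<close>. At \<open>t = 0\<close> the difference
  quotient belongs to the family again, with polynomial \<open>s * p\<close>, and tends to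
  0.\<close>

lemma DERIV_flat: "(flat p has_real_derivative flat ([:0, 0, 1:] * (p - pderiv p)) t) (at t)"
proof -
  consider "t < 0" | "t = 0" | "t > 0" by linarith
  thus ?thesis
  proof cases
    case 1
    have "((%t. 0) has_real_derivative 0) (at t)" by simp
    hence "(flat p has_real_derivative 0) (at t)"
      by (rule has_field_derivative_transform_within_open[of _ _ _ "{..<0}"])
        (use 1 in \<open>auto simp: flat_def\<close>)
    thus ?thesis using 1 by (simp add: flat_def)
  next
    case 3
    have d: "((%t. 1 / t) has_real_derivative - 1 / t^2) (at t)"
      using 3 by (auto intro!: derivative_eq_intros simp: power2_eq_square)
    have "((%t. poly p (1 / t)) has_real_derivative poly (pderiv p) (1 / t) * (- 1 / t^2)) (at t)"
      by (rule DERIV_chain2[OF poly_DERIV d])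
    moreover have "((%t. exp (- (1 / t))) has_real_derivative exp (- (1 / t)) * - (- 1 / t^2)) (at t)"
      by (rule DERIV_chain2[OF DERIV_exp DERIV_minus[OF d]])
    ultimately have "((%t. poly p (1 / t) * exp (- (1 / t))) has_real_derivative
        poly (pderiv p) (1 / t) * (- 1 / t^2) * exp (- (1 / t)) + exp (- (1 / t)) * - (- 1 / t^2) * poly p (1 / t)) (at t)"
      by (rule DERIV_mult)
    moreover have "poly (pderiv p) (1 / t) * (- 1 / t^2) * exp (- (1 / t)) + exp (- (1 / t)) * - (- 1 / t^2) * poly p (1 / t)
        = flat ([:0, 0, 1:] * (p - pderiv p)) t"
      using 3 by (simp add: flat_def power2_eq_square algebra_simps)
    ultimately have "((%t. poly p (1 / t) * exp (- (1 / t))) has_real_derivative flat ([:0, 0, 1:] * (p - pderiv p)) t) (at t)"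
      by simp
    thus ?thesis
      by (rule has_field_derivative_transform_within_open[of _ _ _ "{0<..}"])
        (use 3 in \<open>auto simp: flat_def\<close>)
  next
    case 2
    have "((%h. flat ([:0, 1:] * p) h) \<longlongrightarrow> 0) (at 0)" by (rule flat_tendsto_0)
    moreover have "flat ([:0, 1:] * p) h = (flat p (0 + h) - flat p 0) / h" for h
      by (simp add: flat_def)
    ultimately have "((%h. (flat p (0 + h) - flat p 0) / h) \<longlongrightarrow> 0) (at 0)" by simp
    thus ?thesis using 2 by (simp add: DERIV_def flat_def)
  qed
qed

lemma smooth_fun_flat: "smooth_fun (%x::real^'d. of_real (flat p (\<sigma> * x $ k - e)))"
proof -
  define F where "F = {(%x::real^'d. of_real (c * flat p (\<sigma> * x $ k - e)) :: complex) | c p. True}"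
  have der: "((%x::real^'d. of_real (c * flat p (\<sigma> * x $ k - e)) :: complex) has_derivative
      (%h. of_real (c * (flat ([:0, 0, 1:] * (p - pderiv p)) (\<sigma> * x $ k - e) * (\<sigma> * h $ k))))) (at x)" for c p x
  proof -
    have 1: "((%x::real^'d. \<sigma> * x $ k - e) has_derivative (%h. \<sigma> * h $ k)) (at x)"
      by (auto intro!: derivative_eq_intros bounded_linear.has_derivative[OF bounded_linear_vec_nth])
    have 2: "(flat p has_derivative (*) (flat ([:0, 0, 1:] * (p - pderiv p)) (\<sigma> * x $ k - e))) (at (\<sigma> * x $ k - e))"
      using DERIV_flat[of p "\<sigma> * x $ k - e"] by (simp only: has_field_derivative_def)
    have "((%x::real^'d. flat p (\<sigma> * x $ k - e)) has_derivative
        (%h. flat ([:0, 0, 1:] * (p - pderiv p)) (\<sigma> * x $ k - e) * (\<sigma> * h $ k))) (at x)"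
      by (rule has_derivative_compose[OF 1 2])
    thus ?thesis
      by (intro bounded_linear.has_derivative[OF bounded_linear_of_real] has_derivative_mult_right)
  qed
  show ?thesis
  proof (rule smooth_fun_coinduct[of _ F])
    show "(%x. of_real (flat p (\<sigma> * x $ k - e))) : F"
      unfolding F_def by (auto intro!: exI[of _ 1] exI[of _ p])
  next
    fix f x assume "f : F" thus "f differentiable (at x)"
      unfolding F_def differentiable_def using der by blast
  next
    fix f j assume "f : F"
    then obtain c p where f: "f = (%x. of_real (c * flat p (\<sigma> * x $ k - e)))" unfolding F_def by blast
    have "pd j f = (%x. of_real ((c * \<sigma> * axis j 1 $ k) * flat ([:0, 0, 1:] * (p - pderiv p)) (\<sigma> * x $ k - e)))"
      unfolding f by (rule ext, subst pderiv_clI[OF der]) (simp add: mult_ac)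
    thus "pd j f : F" unfolding F_def by blast
  qed
qed

definition box_bump :: "real^'d => real^'d => real^'d => real" where
  "box_bump a b x = (PROD j:UNIV. flat 1 (x $ j - a $ j) * flat 1 (b $ j - x $ j))"

lemma smooth_fun_box_bump: "smooth_fun (%x::real^'d. of_real (box_bump a b x))"
proof -
  have "smooth_fun (%x::real^'d. of_real (flat 1 (1 * x $ j - a $ j)) * of_real (flat 1 ((-1) * x $ j - (- b $ j))))" for j
    by (intro smooth_fun_mult smooth_fun_flat)
  hence "smooth_fun (%x::real^'d. of_real (flat 1 (x $ j - a $ j)) * of_real (flat 1 (b $ j - x $ j)))" for j
    by simp
  thus ?thesis unfolding box_bump_def of_real_prod of_real_mult by (intro smooth_fun_prod) auto
qed

lemma flat_1: "flat 1 t >= 0" "flat 1 t > 0 \<longleftrightarrow> t > 0"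
  by (auto simp: flat_def)

lemma box_bump_nonneg: "0 <= box_bump a b x"
  unfolding box_bump_def by (intro prod_nonneg) (auto simp: flat_1)

lemma box_bump_pos: "x : box a b ==> 0 < box_bump a b x"
  unfolding box_bump_def by (intro prod_pos) (auto simp: flat_1 mem_box_cart)

lemma box_bump_0: "x ~: box a b ==> box_bump a b (x::real^'d) = 0"
  unfolding box_bump_def by (intro prod_zero) (auto simp: flat_def mem_box_cart)

section \<open>Test functions\<close>

lemma test_fun_iff:
  "psi : test_fun \<Omega> \<longleftrightarrow> smooth_fun psi & (EX K. compact K & K \<subseteq> \<Omega> & (ALL x. x ~: K --> psi x = 0))"
proof
  assume "psi : test_fun \<Omega>"
  thus "smooth_fun psi & (EX K. compact K & K \<subseteq> \<Omega> & (ALL x. x ~: K --> psi x = 0))"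
    unfolding test_fun_def using closure_subset[of "{x. psi x ~= 0}"] by blast
next
  assume r: "smooth_fun psi & (EX K. compact K & K \<subseteq> \<Omega> & (ALL x. x ~: K --> psi x = 0))"
  then obtain K where K: "compact K" "K \<subseteq> \<Omega>" "!!x. x ~: K ==> psi x = 0" by blast
  have "{x. psi x ~= 0} \<subseteq> K" using K by blast
  hence "closure {x. psi x ~= 0} \<subseteq> K" using K compact_imp_closed closure_minimal by blast
  thus "psi : test_fun \<Omega>" unfolding test_fun_def using r K
    by (auto intro: compact_closure[THEN iffD2] bounded_subset[OF compact_imp_bounded[OF K(1)]] closure_subset dest: subsetD)
qed

lemma test_fun_smooth: "psi : test_fun \<Omega> ==> smooth_fun psi"
  by (simp add: test_fun_iff)

lemma pderiv_cl_0_outside: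
  assumes "closed K" "!!x. x ~: K ==> f x = 0" "x ~: K"
  shows "pd j f x = 0"
proof -
  have "((%x. 0) has_derivative (%h. 0)) (at x)" by simp
  hence "(f has_derivative (%h. 0)) (at x)"
    by (rule has_derivative_transform_within_open[of _ _ _ _ "- K"]) (use assms in auto)
  thus ?thesis by (rule pderiv_clI)
qed

lemma test_fun_smaller_support:
  fixes psi :: "real^'d => complex"
  assumes "psi : test_fun \<Omega>" "smooth_fun phi"
    and "!!K. closed K ==> (!!x. x ~: K ==> psi x = 0) ==> (!!x. x ~: K ==> phi x = 0)"
  shows "phi : test_fun \<Omega>"
proof -
  obtain K where K: "compact K" "K \<subseteq> \<Omega>" "!!x. x ~: K ==> psi x = 0"
    using assms(1) by (auto simp: test_fun_iff)
  hence "phi x = 0" if "x ~: K" for x using assms(3)[of K] compact_imp_closed that by blast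
  thus ?thesis unfolding test_fun_iff using assms(2) K(1,2) by blast
qed

lemma test_fun_pderiv:
  fixes psi :: "real^'d => complex"
  assumes "psi : test_fun \<Omega>"
  shows "pd j psi : test_fun \<Omega>"
  using assms smooth_fun_pderiv[OF test_fun_smooth[OF assms]]
  by (rule test_fun_smaller_support) (rule pderiv_cl_0_outside)

lemma test_fun_mult:
  fixes psi :: "real^'d => complex"
  assumes "psi : test_fun \<Omega>" "smooth_fun f"
  shows "(%x. f x * psi x) : test_fun \<Omega>"
  using assms(1) smooth_fun_mult[OF assms(2) test_fun_smooth[OF assms(1)]]
  by (rule test_fun_smaller_support) simp

lemma test_fun_add:
  fixes psi :: "real^'d => complex"
  assumes "psi : test_fun \<Omega>" "phi : test_fun \<Omega>"
  shows "(%x. psi x + phi x) : test_fun \<Omega>"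
proof -
  obtain K K' where "compact K" "K \<subseteq> \<Omega>" "ALL x. x ~: K --> psi x = 0" "compact K'" "K' \<subseteq> \<Omega>" "ALL x. x ~: K' --> phi x = 0"
    using assms by (auto simp: test_fun_iff)
  hence "compact (K \<union> K') & K \<union> K' \<subseteq> \<Omega> & (ALL x. x ~: K \<union> K' --> psi x + phi x = 0)" by auto
  thus ?thesis using assms smooth_fun_add unfolding test_fun_iff by blast
qed

lemma test_fun_0: "(%x::real^'d. 0) : test_fun \<Omega>"
  unfolding test_fun_iff using smooth_fun_const compact_empty by blast

lemma test_fun_cnj:
  fixes psi :: "real^'d => complex"
  assumes "psi : test_fun \<Omega>"
  shows "(%x. cnj (psi x)) : test_fun \<Omega>"
  using assms smooth_fun_cnj[OF test_fun_smooth[OF assms]]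
  by (rule test_fun_smaller_support) simp

lemma test_fun_affine:
  fixes psi :: "real^'d => complex"
  assumes "psi : test_fun UNIV" "c ~= 0"
  shows "(%x. psi (c *R x + h)) : test_fun UNIV"
proof -
  obtain K where K: "compact K" "ALL x. x ~: K --> psi x = 0" using assms by (auto simp: test_fun_iff)
  let ?K = "(%y. (1 / c) *R (y - h)) ` K"
  have "compact ?K" using K by (intro compact_continuous_image continuous_intros)
  moreover have "x : ?K" if "c *R x + h : K" for x
    using that assms(2) by (intro image_eqI[of _ _ "c *R x + h"]) auto
  ultimately show ?thesis using assms K smooth_fun_affine unfolding test_fun_iff by blast
qed

lemma test_fun_bounded:
  fixes psi :: "real^'d => complex"
  assumes "psi : test_fun \<Omega>"
  obtains B where "0 <= B" "!!x. norm (psi x) <= B"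
proof -
  obtain K where K: "compact K" "ALL x. x ~: K --> psi x = 0" using assms by (auto simp: test_fun_iff)
  have "compact (psi ` K)" using K assms by (intro compact_continuous_image smooth_fun_cont test_fun_smooth)
  then obtain B where "!!y. y : psi ` K ==> norm y <= B" using compact_imp_bounded bounded_iff by metis
  hence "norm (psi x) <= max B 0" for x using K by (cases "x : K") fastforce+
  thus ?thesis using that[of "max B 0"] by simp
qed

text \<open>The function \<open>1 - exp (- c * b)\<close> vanishes with the bump \<open>b\<close>,
  has values in [0,1] for \<open>c >= 0\<close>, and tends to the indicator of the set
  \<open>b > 0\<close> as \<open>c\<close> grows.\<close>

lemma box_cutoff_test_fun:
  fixes a b :: "real^'d"
  assumes "cbox a b \<subseteq> \<Omega>"
  shows "(%x. of_real (1 - exp (- (c * box_bump a b x)))) : test_fun \<Omega>"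
proof -
  have "smooth_fun (%x. 1 - exp ((- of_real c) * complex_of_real (box_bump a b x)))"
    by (intro smooth_fun_diff smooth_fun_exp smooth_fun_mult smooth_fun_const smooth_fun_box_bump)
  moreover have "(%x. 1 - exp ((- of_real c) * complex_of_real (box_bump a b x)))
      = (%x. of_real (1 - exp (- (c * box_bump a b x))))"
    by (simp add: exp_of_real[symmetric])
  moreover have "box_bump a b x = 0" if "x ~: cbox a b" for x
    using that box_subset_cbox[of a b] by (intro box_bump_0) blast
  ultimately show ?thesis unfolding test_fun_iff using assms
    by (auto intro!: exI[of _ "cbox a b"])
qed

section \<open>The fundamental lemma of the calculus of variations\<close>

text \<open>Boxes form an intersection-stable generator of the Borel sets, so a Dynkin argument
  yields zero integrals over all Borel sets, in particular over the sets where \<open>f\<close> is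
  positive or negative.\<close>

lemma AE_zero_if_box_integrals_zero:
  fixes f :: "'a::euclidean_space => real"
  assumes f: "integrable lborel f"
    and box: "!!a b. (LINT x|lborel. indicator (box a b) x * f x) = 0"
  shows "AE x in lborel. f x = 0"
proof -
  have [measurable]: "f : borelf" using f by auto
  have int: "integrable lborel (%x. indicator A x * f x)" if [measurable]: "A : sets borel" for A
    using integrable_mult_indicator[of A lborel f] f by simp
  \<comment> \<open>Complements in the Dynkin argument require the integral over the whole space;
    boxes exhaust it.\<close>
  have UN: "(LINT x|lborel. f x) = 0"
  proof -
    have "(%n. LINT x|lborel. indicator (box (- (real n *R One)) (real n *R One)) x * f x) ----> (LINT x|lborel. f x)"
    proof (rule integral_dominated_convergence[where w="%x. \<bar>f x\<bar>"])
      show "AE x in lborel. (%n. indicator (box (- (real n *R One)) (real n *R One)) x * f x) ----> f x"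
      proof (rule AE_I2)
        fix x :: 'a
        obtain N where N: "norm x < real N" using reals_Archimedean2 by blast
        have "x : box (- (real n *R One)) (real n *R One)" if "N <= n" for n
        proof -
          have "\<bar>x *. i\<bar> < real n" if "i : Basis" for i
            using Basis_le_norm[OF that, of x] N \<open>N <= n\<close> by linarith
          thus ?thesis by (force simp: mem_box abs_less_iff minus_less_iff)
        qed
        hence "\<forall>\<^sub>F n in sequentially. f x = indicator (box (- (real n *R One)) (real n *R One)) x * f x"
          by (intro eventually_sequentiallyI[of N]) simp
        thus "(%n. indicator (box (- (real n *R One)) (real n *R One)) x * f x) ----> f x"
          by (rule Lim_transform_eventually[OF tendsto_const])
      qed
      show "AE x in lborel. norm (indicator (box (- (real n *R One)) (real n *R One)) x * f x) <= \<bar>f x\<bar>" for n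
        by (auto simp: indicator_def)
    qed (use f in auto)
    thus ?thesis unfolding box by (simp add: LIMSEQ_const_iff)
  qed
  have zero: "(LINT x|lborel. indicator A x * f x) = 0" if A: "A : sets borel" for A
  proof -
    have "Int_stable (range (%(a, b). box a b :: 'a set))"
      by (auto simp: Int_stable_def box_Int_box)
    moreover have "(range (%(a, b). box a b :: 'a set)) \<subseteq> Pow UNIV" by auto
    moreover have "A : sigma_sets UNIV (range (%(a, b). box a b))"
      using A unfolding borel_eq_box by simp
    ultimately show ?thesis
    proof (induction rule: sigma_sets_induct_disjoint)
      case (basic A)
      thus ?case using box by auto
    next
      case empty
      thus ?case by simp
    next
      case (compl A)
      hence [measurable]: "A : sets borel" by (simp add: borel_eq_box)
      have "(LINT x|lborel. indicator (UNIV - A) x * f x) = (LINT x|lborel. f x - indicator A x * f x)"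
        by (intro LINT_cong) (auto simp: indicator_def)
      also have "... = 0" using f int[of A] compl UN by (simp add: Bochner_Integration.integral_diff)
      finally show ?case .
    next
      case (union F)
      hence [measurable]: "!!i. F i : sets borel" by (simp add: borel_eq_box subset_eq)
      have "(LINT x:(\<Union>i. F i)|lborel. f x) = (\<Sum>i. (LINT x:(F i)|lborel. f x))"
        using union(1) int[of "\<Union>i. F i"]
        by (intro lebesgue_integral_countable_add) (auto simp: disjoint_family_on_def set_integrable_def)
      thus ?case using union by (simp add: set_lebesgue_integral_def)
    qed
  qed
  have half: "AE x in lborel. indicator {x. 0 < c * f x} x * (c * f x) = 0" for c
  proof -
    have [measurable]: "{x. 0 < c * f x} : sets borel" by measurable
    have i: "integrable lborel (%x. indicator {x. 0 < c * f x} x * (c * f x))"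
      using int[of "{x. 0 < c * f x}"] by (auto simp: mult.left_commute)
    have "(LINT x|lborel. indicator {x. 0 < c * f x} x * (c * f x)) = 0"
      using zero[of "{x. 0 < c * f x}"] by (simp add: mult.left_commute)
    thus ?thesis
      using integral_nonneg_eq_0_iff_AE[OF i] by (auto simp: indicator_def)
  qed
  show ?thesis using half[of 1] half[of "-1"]
    by eventually_elim (auto simp: indicator_def split: if_splits)
qed

text \<open>The boxes shrink by \<open>1 / (m + 1)\<close> so that the closed support lies inside
  the open box; still, at an inner point the bumps converge to a positive number, and the factor
  \<open>m\<close> drives the exponential to 0.\<close>

lemma box_cutoff_tendsto:
  fixes a b x :: "real^'d"
  defines "u \<equiv> (\<chi> i. 1)"
  shows "(%m. 1 - exp (- (real m * box_bump (a + (1 / real (Suc m)) *R u) (b - (1 / real (Suc m)) *R u) x)))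
    ----> indicator (box a b) x"
proof (cases "x : box a b")
  case True
  have c: "isCont (flat 1) t" for t using DERIV_isCont[OF DERIV_flat] .
  have s: "(%m. 1 / real (Suc m)) ----> 0"
    using LIMSEQ_inverse_real_of_nat by (simp add: inverse_eq_divide)
  have "(%m. box_bump (a + (1 / real (Suc m)) *R u) (b - (1 / real (Suc m)) *R u) x)
      ----> (PROD j:UNIV. flat 1 (x $ j - (a $ j + 0 * u $ j)) * flat 1 ((b $ j - 0 * u $ j) - x $ j))"
    unfolding box_bump_def vector_add_component vector_minus_component vector_scaleR_component real_scaleR_def
    by (intro tendsto_prod tendsto_mult isCont_tendsto_compose[OF c] tendsto_intros s)
  also have "(PROD j:UNIV. flat 1 (x $ j - (a $ j + 0 * u $ j)) * flat 1 ((b $ j - 0 * u $ j) - x $ j)) = box_bump a b x"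
    by (simp add: box_bump_def)
  finally have "filterlim (%m. box_bump (a + (1 / real (Suc m)) *R u) (b - (1 / real (Suc m)) *R u) x * real m) at_top sequentially"
    by (rule filterlim_tendsto_pos_mult_at_top[OF _ box_bump_pos[OF True] filterlim_real_sequentially])
  hence "(%m. exp (- (box_bump (a + (1 / real (Suc m)) *R u) (b - (1 / real (Suc m)) *R u) x * real m))) ----> 0"
    by (intro filterlim_compose[OF exp_at_bot] filterlim_compose[OF filterlim_uminus_at_bot_at_top])
  hence "(%m. 1 - exp (- (box_bump (a + (1 / real (Suc m)) *R u) (b - (1 / real (Suc m)) *R u) x * real m))) ----> 1 - 0"
    by (intro tendsto_intros)
  thus ?thesis using True by (simp add: mult.commute)
next
  case False
  have "x ~: box (a + (1 / real (Suc m)) *R u) (b - (1 / real (Suc m)) *R u)" for m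
  proof
    assume "x : box (a + (1 / real (Suc m)) *R u) (b - (1 / real (Suc m)) *R u)"
    hence "ALL i. a $ i + 1 / real (Suc m) < x $ i & x $ i < b $ i - 1 / real (Suc m)"
      by (simp add: mem_box_cart u_def)
    moreover have "0 < 1 / real (Suc m)" by simp
    ultimately have "ALL i. a $ i < x $ i & x $ i < b $ i" by (smt (verit))
    thus False using False by (simp add: mem_box_cart)
  qed
  thus ?thesis using False by (simp add: box_bump_0)
qed

lemma box_cutoff_bounds: "0 <= 1 - exp (- (real m * box_bump a b x))" "1 - exp (- (real m * box_bump a b x)) <= 1"
  by (auto simp: box_bump_nonneg)

lemma fundamental_lemma_box:
  fixes g :: "real^'d => complex"
  assumes \<Omega>: "\<Omega> : sets lebesgue" and sub: "box c e \<subseteq> \<Omega>"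
    and g: "g : sqint (lebesgue_on \<Omega>)"
    and test: "!!psi. psi : test_fun \<Omega> ==> (LINT x|lebesgue_on \<Omega>. g x * psi x) = 0"
  shows "AE x in lebesgue. x : box c e --> g x = 0"
proof -
  define G where "G x = indicator (box c e) x *R g x" for x
  have gm: "(%x. indicator \<Omega> x *R g x) : borel_measurable lebesgue"
    using g \<Omega> by (simp add: square_integrable_def borel_measurable_restrict_space_iff)
  have "(%x. indicator (box c e) x *R (indicator \<Omega> x *R g x)) : borel_measurable lebesgue"
    by (intro borel_measurable_scaleR[OF _ gm] borel_measurable_indicator) auto
  moreover have "(%x. indicator (box c e) x *R (indicator \<Omega> x *R g x)) = G"
    using sub by (auto simp: G_def indicator_def fun_eq_iff)
  ultimately have Gm [measurable]: "G : borel_measurable lebesgue" by simp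
  have "integrable lebesgue (%x. indicator \<Omega> x *R (norm (g x))^2 + indicator (box c e) x)"
  proof (rule Bochner_Integration.integrable_add)
    show "integrable lebesgue (%x. indicator \<Omega> x *R (norm (g x))^2)"
      using g \<Omega> by (simp add: square_integrable_def integrable_restrict_space)
    show "integrable lebesgue (indicator (box c e) :: real^'d => real)"
      using emeasure_lborel_box_finite[of c e] by (intro integrable_real_indicator) (auto simp: less_top)
  qed
  hence Gi: "integrable lebesgue G"
  proof (rule integrable_dominated)
    show "AE x in lebesgue. norm (G x) <= norm (indicator \<Omega> x *R (norm (g x))^2 + indicator (box c e) x)"
    proof (rule AE_I2)
      fix x
      have "2 * norm (g x) <= (norm (g x))^2 + 1"
        using sum_squares_bound[of "norm (g x)" 1] by simp
      hence "norm (g x) <= (norm (g x))^2 + 1" using norm_ge_zero[of "g x"] by linarith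
      thus "norm (G x) <= norm (indicator \<Omega> x *R (norm (g x))^2 + indicator (box c e) x)"
        using sub by (auto simp: G_def indicator_def)
    qed
  qed measurable
  \<comment> \<open>Cutoffs must be supported in \<open>\<Omega>\<close>. Since \<open>G\<close>
    vanishes outside \<open>box c e\<close>, an arbitrary box may be intersected with it
    first.\<close>
  have box0: "(LINT x|lebesgue. indicator (box a b) x *R G x) = 0" for a b
  proof -
    define a' where "a' = (\<chi> i. max (a $ i) (c $ i))"
    define b' where "b' = (\<chi> i. min (b $ i) (e $ i))"
    have ab: "box a b \<inter> box c e = box a' b'" by (auto simp: mem_box_cart a'_def b'_def)
    define u :: "real^'d" where "u = (\<chi> i. 1)"
    define psi where "psi m x = 1 - exp (- (real m * box_bump (a' + (1 / real (Suc m)) *R u) (b' - (1 / real (Suc m)) *R u) x))" for m x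
    have cb: "cbox (a' + (1 / real (Suc m)) *R u) (b' - (1 / real (Suc m)) *R u) \<subseteq> box a' b'" for m
    proof
      fix x assume x: "x : cbox (a' + (1 / real (Suc m)) *R u) (b' - (1 / real (Suc m)) *R u)"
      have "0 < 1 / real (Suc m)" by simp
      moreover have "a' $ i + 1 / real (Suc m) <= x $ i & x $ i <= b' $ i - 1 / real (Suc m)" for i
        using x by (simp add: mem_box_cart u_def)
      ultimately have "a' $ i < x $ i & x $ i < b' $ i" for i by (smt (verit))
      thus "x : box a' b'" by (simp add: mem_box_cart)
    qed
    have t: "(%x. of_real (psi m x)) : test_fun \<Omega>" for m
      unfolding psi_def using cb[of m] sub ab by (intro box_cutoff_test_fun) blast
    have psi0: "psi m x = 0" if "x ~: box c e" for m x
    proof -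
      have "x ~: box (a' + (1 / real (Suc m)) *R u) (b' - (1 / real (Suc m)) *R u)"
        using that cb[of m] ab subsetD[OF box_subset_cbox] by blast
      from box_bump_0[OF this] show ?thesis unfolding psi_def by simp
    qed
    have [measurable]: "psi m : borel_measurable lebesgue" for m
    proof -
      have "(%x. complex_of_real (psi m x)) : borelf"
        by (rule smooth_fun_measurable[OF test_fun_smooth[OF t]])
      from measurable_compose[OF this borel_measurable_Re] show ?thesis
        by (simp add: measurable_completion)
    qed
    have "(LINT x|lebesgue. psi m x *R G x) = 0" for m
    proof -
      have "0 = (LINT x|lebesgue_on \<Omega>. g x * of_real (psi m x))" using test[OF t] by simp
      also have "... = (LINT x|lebesgue. indicator \<Omega> x *R (g x * of_real (psi m x)))"
        using \<Omega> by (simp add: integral_restrict_space)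
      also have "... = (LINT x|lebesgue. psi m x *R G x)"
        using sub psi0 by (intro LINT_cong)
          (auto simp: G_def indicator_def scaleR_conv_of_real mult.commute)
      finally show ?thesis by simp
    qed
    moreover have "(%m. LINT x|lebesgue. psi m x *R G x) ----> (LINT x|lebesgue. indicator (box a' b') x *R G x)"
    proof (rule integral_dominated_convergence[where w="%x. norm (G x)"])
      show "AE x in lebesgue. (%m. psi m x *R G x) ----> indicator (box a' b') x *R G x"
        unfolding psi_def u_def by (intro AE_I2 tendsto_scaleR box_cutoff_tendsto tendsto_const)
      show "AE x in lebesgue. norm (psi m x *R G x) <= norm (G x)" for m
      proof (rule AE_I2)
        fix x
        have "0 <= psi m x" "psi m x <= 1" unfolding psi_def by (rule box_cutoff_bounds)+
        thus "norm (psi m x *R G x) <= norm (G x)" by (simp add: mult_left_le_one_le)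
      qed
    qed (use Gi in \<open>auto intro!: borel_measurable_scaleR borel_measurable_indicator\<close>)
    ultimately have "(LINT x|lebesgue. indicator (box a' b') x *R G x) = 0"
      by (simp add: LIMSEQ_const_iff)
    moreover have "(%x. indicator (box a b) x *R G x) = (%x. indicator (box a' b') x *R G x)"
      using ab by (auto simp: G_def indicator_def fun_eq_iff)
    ultimately show ?thesis by simp
  qed
  have part: "AE x in lebesgue. L (G x) = 0" if L: "bounded_linear L" for L :: "complex => real"
  proof -
    have i: "integrable lebesgue (%x. L (G x))" using L Gi by (rule integrable_bounded_linear)
    then obtain f where f: "f : borel_measurable lborel" "AE x in lborel. L (G x) = f x"
      using completion_ex_borel_measurable_real[of "%x. L (G x)" lborel] by auto
    have fm: "f : borel_measurable lebesgue" using f(1) by (simp add: measurable_completion)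
    have ae: "AE x in lebesgue. L (G x) = f x" using f(2) by (simp add: AE_completion_iff)
    have "integrable lebesgue f" using i ae fm by (subst integrable_cong_AE[symmetric]) auto
    hence fi: "integrable lborel f" using f(1) by (simp add: integrable_completion)
    have "(LINT x|lborel. indicator (box a b) x * f x) = 0" for a b
    proof -
      have "(LINT x|lborel. indicator (box a b) x * f x) = (LINT x|lebesgue. indicator (box a b) x * f x)"
        using f(1) by (intro integral_completion[symmetric]) auto
      also have "... = (LINT x|lebesgue. L (indicator (box a b) x *R G x))"
        using ae fm i by (intro integral_cong_AE)
          (auto simp: linear_scale[OF bounded_linear.linear[OF L]] intro!: borel_measurable_times borel_measurable_indicator)
      also have "... = L (LINT x|lebesgue. indicator (box a b) x *R G x)"
        using integrable_mult_indicator[of "box a b" lebesgue G] Gi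
        by (intro integral_bounded_linear[OF L]) auto
      finally show ?thesis by (simp add: box0 linear_0[OF bounded_linear.linear[OF L]])
    qed
    from AE_zero_if_box_integrals_zero[OF fi this] have "AE x in lebesgue. f x = 0"
      by (simp add: AE_completion_iff)
    with ae show ?thesis by eventually_elim simp
  qed
  show ?thesis using part[OF bounded_linear_Re] part[OF bounded_linear_Im]
    by eventually_elim (auto simp: G_def complex_eq_iff)
qed

lemma fundamental_lemma_UNIV:
  fixes g :: "real^'d => complex"
  assumes "g : sqint lebesgue"
    and "!!psi. psi : test_fun UNIV ==> (LINT x|lebesgue. g x * psi x) = 0"
  shows "AE x in lebesgue. g x = 0"
proof -
  have "AE x in lebesgue. x : box (\<chi> i. - real n) (\<chi> i. real n) --> g x = 0" for n
    using fundamental_lemma_box[of UNIV "\<chi> i. - real n" "\<chi> i. real n" g] assms by (simp add: lebesgue_on_UNIV_eq)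
  hence "AE x in lebesgue. ALL n. x : box (\<chi> i. - real n) (\<chi> i. real n) --> g x = 0"
    by (subst AE_all_countable) blast
  thus ?thesis
  proof eventually_elim
    case (elim x)
    obtain n where n: "norm x < real n" using reals_Archimedean2 by blast
    have "\<bar>x $ i\<bar> < real n" for i using component_le_norm_cart[of x i] n by linarith
    hence "x : box (\<chi> i. - real n) (\<chi> i. real n)"
      by (simp add: mem_box_cart abs_less_iff) (metis minus_less_iff)
    thus ?case using elim by blast
  qed
qed

lemma Ycell_eq_box: "Ycell = box 0 (\<chi> i. 1)"
  by (auto simp: Ycell_def mem_box_cart)

lemma Ycell_sets [measurable]: "Ycell : sets borel" "Ycell : sets lebesgue"
  by (auto simp: Ycell_eq_box)

lemma fundamental_lemma_Ycell:
  fixes g :: "real^'d => complex"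
  assumes "g : sqint LY"
    and "!!psi. psi : test_fun Ycell ==> (LINT x|LY. g x * psi x) = 0"
  shows "AE x in LY. g x = 0"
  using fundamental_lemma_box[OF _ _ assms, of 0 "\<chi> i. 1"]
  by (auto simp: AE_restrict_space_iff Ycell_eq_box[symmetric] Ycell_sets)

section \<open>L^2 through Borel representatives: translations and multiplication operators\<close>

section \<open>Square integrable functions and Borel representatives\<close>

lemma sqint_mult:
  fixes f g :: "'a => 'b::{real_normed_algebra,banach,second_countable_topology}"
  assumes "f : sqint M" "g : sqint M"
  shows "integrable M (%x. f x * g x)"
proof -
  have [measurable]: "f : borel_measurable M" "g : borel_measurable M"
    using assms by (auto simp: square_integrable_def)
  have "integrable M (%x. (norm (f x))^2 + (norm (g x))^2)"
    using assms by (auto simp: square_integrable_def)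
  thus ?thesis
  proof (rule integrable_dominated)
    have "norm (f x * g x) <= (norm (f x))^2 + (norm (g x))^2" for x
      using norm_mult_ineq[of "f x" "g x"] sum_squares_bound[of "norm (f x)" "norm (g x)"]
        mult_nonneg_nonneg[OF norm_ge_zero[of "f x"] norm_ge_zero[of "g x"]] by linarith
    thus "AE x in M. norm (f x * g x) <= norm ((norm (f x))^2 + (norm (g x))^2)" by auto
  qed measurable
qed

lemma sqint_lb_leb:
  fixes f :: "'a::euclidean_space => 'b::{real_normed_vector,second_countable_topology}"
  assumes "f : sqint lborel"
  shows "f : sqint lebesgue"
proof -
  have [measurable]: "f : borelf" using assms by (simp add: square_integrable_def)
  show ?thesis using assms
    by (auto simp: square_integrable_def measurable_completion integrable_completion)
qed

text \<open>Translations, scalings and Fubini are carried out on \<open>lborel\<close>, so every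
  class in \<open>L2\<close> is given a Borel representative, coordinate by coordinate.\<close>

lemma lebesgue_measurable_ex_borel:
  fixes f :: "'a::euclidean_space => 'b::euclidean_space"
  assumes "f : borel_measurable lebesgue"
  obtains g where "g : borelf" "AE x in lebesgue. f x = g x"
proof -
  have "EX h:borel_measurable lborel. AE x in lborel. f x *. b = h x" for b
    by (rule completion_ex_borel_measurable_real) (use assms in measurable)
  then obtain h where h: "!!b. h b : borelf" "!!b. AE x in lebesgue. f x *. b = h b x"
    unfolding AE_completion_iff by simp metis
  define g where "g x = (SUM b:Basis. h b x *R b)" for x
  have "g : borelf" unfolding g_def using h by measurable
  moreover have "AE x in lebesgue. ALL b:Basis. f x *. b = h b x"
    using h by (intro AE_finite_allI) auto
  hence "AE x in lebesgue. f x = g x"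
  proof eventually_elim
    case (elim x)
    hence "g x = (SUM b:Basis. (f x *. b) *R b)" unfolding g_def by simp
    thus ?case by (simp add: euclidean_representation)
  qed
  ultimately show thesis using that by blast
qed

lemma sqint_cong_AE:
  fixes f g :: "'a => 'b::{real_normed_vector,second_countable_topology}"
  assumes "f : sqint M" "g : borel_measurable M" "AE x in M. f x = g x"
  shows "g : sqint M"
proof -
  have "(nn_integral M (%x. ennreal ((norm (g x))^2))) = (nn_integral M (%x. ennreal ((norm (f x))^2)))"
    by (rule nn_integral_cong_AE) (use assms(3) in auto)
  thus ?thesis using assms by (auto simp: sqint_iff_nn)
qed

lemma L2_borel_cases:
  fixes u :: "('d::finite, 'i::finite) L2"
  obtains f where "f : sqint lborel" "u = abs_L2 f"
proof -
  have r: "rep_L2 u : sqint lebesgue" by (rule rep_L2_sqint)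
  then obtain g where g: "g : borelf" "AE x in lebesgue. rep_L2 u x = g x"
    using lebesgue_measurable_ex_borel unfolding square_integrable_def by blast
  have gs: "g : sqint lebesgue"
    by (rule sqint_cong_AE[OF r _ g(2)]) (use g(1) in \<open>simp add: measurable_completion\<close>)
  hence "g : sqint lborel"
    using g(1) by (auto simp: square_integrable_def integrable_completion)
  moreover have "u = abs_L2 g" using abs_L2_eq_iff[OF r gs] g(2) by simp
  ultimately show thesis using that by blast
qed

lemma inner_abs_L2_lborel:
  fixes f g :: "real^'d => complex^'i"
  assumes "f : sqint lborel" "g : sqint lborel"
  shows "abs_L2 f *. abs_L2 g = (LINT x|lborel. f x *. g x)"
proof -
  have [measurable]: "f : borelf" "g : borelf"
    using assms by (simp_all add: square_integrable_def)
  show ?thesis using assms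
    by (simp add: inner_abs_L2 sqint_lb_leb integral_completion)
qed

lemma abs_L2_eq_iff_lb:
  fixes f g :: "real^'d => complex^'i"
  assumes "f : sqint lborel" "g : sqint lborel"
  shows "abs_L2 f = abs_L2 g \<longleftrightarrow> (AE x in lborel. f x = g x)"
  using assms by (simp add: abs_L2_eq_iff sqint_lb_leb AE_completion_iff)

lemma norm_abs_L2_nn_lb:
  fixes f :: "real^'d => complex^'i"
  assumes "f : sqint lborel"
  shows "ennreal ((norm (abs_L2 f))^2) = (nn_integral lborel (%x. ennreal ((norm (f x))^2)))"
  using assms by (simp add: norm_abs_L2_nn sqint_lb_leb nn_integral_completion)

lemma sqint_cont_compact_support:
  fixes f :: "'a::euclidean_space => 'b::euclidean_space"
  assumes f: "continuous_on UNIV f" and K: "compact K" "!!x. x ~: K ==> f x = 0"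
  shows "f : sqint lborel"
proof -
  have [measurable]: "f : borelf" using f by (rule borel_measurable_continuous_onI)
  have "compact (f ` K)" using K f by (intro compact_continuous_image) (auto intro: continuous_on_subset)
  then obtain B where B: "!!x. x : K ==> norm (f x) <= B" using compact_imp_bounded bounded_iff by (metis imageI)
  have "integrable lborel (%x. B^2 * indicator K x)"
    using K by (intro integrable_mult_right integrable_real_indicator emeasure_compact_finite) (auto simp: compact_imp_closed borel_closed)
  hence "integrable lborel (%x. (norm (f x))^2)"
  proof (rule integrable_dominated)
    show "AE x in lborel. norm ((norm (f x))^2) <= norm (B^2 * indicator K x)"
      using B K by (intro AE_I2) (auto simp: indicator_def intro!: power_mono)
  qed measurable
  thus ?thesis by (simp add: square_integrable_def)
qed

lemma test_fun_sqint:
  fixes psi :: "real^'d => complex"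
  shows "psi : test_fun \<Omega> ==> psi : sqint lborel"
  by (auto simp: test_fun_iff intro!: sqint_cont_compact_support smooth_fun_cont)

lemma sqint_vec:
  fixes f :: "'a => complex^'i"
  shows "f : sqint M \<longleftrightarrow> (ALL i. (%x. f x $ i) : sqint M)"
proof
  assume f: "f : sqint M"
  have [measurable]: "f : borel_measurable M" using f by (simp add: square_integrable_def)
  have m: "(%x. f x $ i) : borel_measurable M" for i
    using measurable_compose[OF _ borel_measurable_continuous_onI, of f M "%x. x $ i"] by (simp add: continuous_on_component)
  have "integrable M (%x. (norm (f x $ i))^2)" for i
  proof (rule integrable_dominated)
    show "integrable M (%x. (norm (f x))^2)" using f by (simp add: square_integrable_def)
    show "AE x in M. norm ((norm (f x $ i))^2) <= norm ((norm (f x))^2)"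
      by (intro AE_I2) (auto intro!: power_mono Finite_Cartesian_Product.norm_nth_le)
  qed (use m in measurable)
  thus "ALL i. (%x. f x $ i) : sqint M" using m by (simp add: square_integrable_def)
next
  assume f: "ALL i. (%x. f x $ i) : sqint M"
  have "(%x. SUM i:UNIV. axis i (f x $ i)) : borel_measurable M"
  proof (rule borel_measurable_sum)
    fix i
    have "continuous_on UNIV (%z::complex. (\<chi> j. if j = i then z else 0) :: complex^'i)"
    proof (intro continuous_on_vec_lambda)
      fix j show "continuous_on UNIV (%z::complex. if j = i then z else 0)" by (cases "j = i") auto
    qed
    hence "continuous_on UNIV (%z::complex. axis i z :: complex^'i)" by (simp add: axis_def)
    hence "(axis i :: complex => complex^'i) : borel \<rightarrow>\<^sub>M borel"
      by (intro borel_measurable_continuous_onI)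
    moreover have "(%x. f x $ i) : borel_measurable M" using f by (simp add: square_integrable_def)
    ultimately show "(%x. axis i (f x $ i)) : borel_measurable M"
      by (rule measurable_compose[rotated])
  qed
  moreover have "(SUM i:UNIV. axis i (v $ i)) = v" for v :: "complex^'i"
    by (simp add: vec_eq_iff axis_def)
  ultimately have "f : borel_measurable M" by simp
  moreover have "integrable M (%x. (norm (f x))^2)"
    using f by (simp add: square_integrable_def norm_vec_def L2_set_def sum_nonneg)
  ultimately show "f : sqint M" by (simp add: square_integrable_def)
qed

lemma has_weak_pderiv_unique:
  fixes u :: "real^'d => complex"
  assumes "\<Omega> = UNIV \<or> \<Omega> = Ycell"
    and g: "g : sqint (lebesgue_on \<Omega>)" "has_weak_pderiv \<Omega> j u g"
    and h: "h : sqint (lebesgue_on \<Omega>)" "has_weak_pderiv \<Omega> j u h"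
  shows "AE x in lebesgue_on \<Omega>. g x = h x"
proof -
  have \<Omega>: "\<Omega> : sets lebesgue" using assms(1) Ycell_sets by auto
  have t0: "(LINT x|lebesgue_on \<Omega>. (g x - h x) * psi x) = 0" if psi: "psi : test_fun \<Omega>" for psi
  proof -
    have "psi : sqint lebesgue"
      by (intro sqint_lb_leb test_fun_sqint[OF psi])
    hence s: "psi : sqint (lebesgue_on \<Omega>)"
      using \<Omega> integrable_mult_indicator[of \<Omega> lebesgue "%x. (norm (psi x))^2"]
      by (simp add: square_integrable_def integrable_restrict_space measurable_restrict_space1)
    show ?thesis
      using sqint_mult[OF g(1) s] sqint_mult[OF h(1) s] g(2) h(2) psi
      by (simp add: left_diff_distrib has_weak_pderiv_def)
  qed
  have "AE x in lebesgue_on \<Omega>. g x - h x = 0"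
    using assms(1)
  proof (elim disjE)
    assume "\<Omega> = UNIV"
    with square_integrable_diff[OF g(1) h(1)] t0 show ?thesis
      using fundamental_lemma_UNIV[of "%x. g x - h x"] unfolding \<open>\<Omega> = UNIV\<close> lebesgue_on_UNIV_eq by blast
  next
    assume "\<Omega> = Ycell"
    with square_integrable_diff[OF g(1) h(1)] t0 show ?thesis
      using fundamental_lemma_Ycell[of "%x. g x - h x"] unfolding \<open>\<Omega> = Ycell\<close> by blast
  qed
  thus ?thesis by simp
qed

lemma weak_pderiv_works:
  assumes "u : H1 \<Omega>"
  shows "weak_pderiv \<Omega> j u : sqint (lebesgue_on \<Omega>)" "has_weak_pderiv \<Omega> j u (weak_pderiv \<Omega> j u)"
proof -
  have "EX g. g : sqint (lebesgue_on \<Omega>) & has_weak_pderiv \<Omega> j u g"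
    using assms by (auto simp: H1_def)
  from someI_ex[OF this] show "weak_pderiv \<Omega> j u : sqint (lebesgue_on \<Omega>)"
    "has_weak_pderiv \<Omega> j u (weak_pderiv \<Omega> j u)" by (auto simp: weak_pderiv_def)
qed

lemma weak_pderiv_eq:
  fixes u :: "real^'d => complex"
  assumes "\<Omega> = UNIV \<or> \<Omega> = Ycell"
    and g: "g : sqint (lebesgue_on \<Omega>)" "has_weak_pderiv \<Omega> j u g"
  shows "weak_pderiv \<Omega> j u : sqint (lebesgue_on \<Omega>)" "AE x in lebesgue_on \<Omega>. weak_pderiv \<Omega> j u x = g x"
proof -
  have "EX g. g : sqint (lebesgue_on \<Omega>) & has_weak_pderiv \<Omega> j u g" using g by blast
  from someI_ex[OF this] have w: "weak_pderiv \<Omega> j u : sqint (lebesgue_on \<Omega>)"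
    "has_weak_pderiv \<Omega> j u (weak_pderiv \<Omega> j u)" by (auto simp: weak_pderiv_def)
  thus "weak_pderiv \<Omega> j u : sqint (lebesgue_on \<Omega>)" by blast
  show "AE x in lebesgue_on \<Omega>. weak_pderiv \<Omega> j u x = g x"
    using has_weak_pderiv_unique[OF assms(1) w g] .
qed

section \<open>Complex vectors and matrices\<close>

lemma inner_complex_Re: "x *. y = Re (x * cnj y)"
  by (simp add: inner_complex_def)

lemma inner_cvec: "(x::complex^'i) *. y = Re (SUM i:UNIV. x $ i * cnj (y $ i))"
  by (simp add: inner_vec_def inner_complex_Re)

lemma Re_cinner: "Re (cinner x y) = x *. y"
  by (simp add: cinner_def inner_cvec)

text \<open>\<open>conj_transpose\<close> for rectangular matrices.\<close>

definition adj :: "complex^'j^'i => complex^'i^'j" where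
  "adj A = (\<chi> j i. cnj (A $ i $ j))"

lemma inner_adj: "((A::complex^'j^'i) *v x) *. y = x *. (adj A *v y)"
proof -
  have "(SUM i:UNIV. (A *v x) $ i * cnj (y $ i)) = (SUM i:UNIV. SUM j:UNIV. A $ i $ j * x $ j * cnj (y $ i))"
    by (simp add: matrix_vector_mult_def sum_distrib_right)
  also have "... = (SUM j:UNIV. SUM i:UNIV. A $ i $ j * x $ j * cnj (y $ i))" by (rule sum.swap)
  also have "... = (SUM j:UNIV. x $ j * cnj ((adj A *v y) $ j))"
    by (simp add: matrix_vector_mult_def adj_def sum_distrib_left mult_ac)
  finally show ?thesis by (simp add: inner_cvec)
qed

lemma norm_cvec: "norm (x::complex^'i) = L2_set (%i. norm (x $ i)) UNIV"
  by (simp add: norm_vec_def)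

lemma norm_mv_le: "norm ((A::complex^'j^'i) *v x) <= norm A * norm x"
proof -
  have row: "norm ((A *v x) $ i) <= norm (A $ i) * norm x" for i
  proof -
    have "norm ((A *v x) $ i) <= (SUM j:UNIV. \<bar>norm (A $ i $ j)\<bar> * \<bar>norm (x $ j)\<bar>)"
      unfolding matrix_vector_mult_def by (auto intro!: order_trans[OF norm_sum] sum_mono simp: norm_mult)
    also have "... <= L2_set (%j. norm (A $ i $ j)) UNIV * L2_set (%j. norm (x $ j)) UNIV"
      by (rule L2_set_mult_ineq)
    finally show ?thesis by (simp add: norm_cvec)
  qed
  have "norm (A *v x) <= L2_set (%i. norm (A $ i) * norm x) UNIV"
    unfolding norm_cvec[of "A *v x"] by (intro L2_set_mono row) auto
  also have "... = norm A * norm x"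
    by (simp add: L2_set_left_distrib[symmetric] norm_vec_def[of A])
  finally show ?thesis .
qed

lemma scaleR_cmv: "(c *R (A::complex^'j^'i)) *v x = c *R (A *v x)" "A *v (c *R x) = c *R (A *v x)"
  by (simp_all add: vec_eq_iff matrix_vector_mult_def scaleR_sum_right)

lemma bilinear_mv: "bounded_bilinear ((*v) :: complex^'j^'i => _)"
proof (rule bounded_bilinear.intro)
  show "EX K. ALL a b. norm ((a::complex^'j^'i) *v b) <= norm a * norm b * K"
    by (rule exI[of _ 1]) (simp add: norm_mv_le)
qed (simp_all add: matrix_vector_mult_add_rdistrib matrix_vector_right_distrib scaleR_cmv)

lemmas continuous_on_mv [continuous_intros] =
  bounded_bilinear.continuous_on[OF bilinear_mv]

lemma bm_mv [measurable (raw)]: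
  fixes b :: "'a => complex^'j^'i"
  assumes "b : borel_measurable M" "f : borel_measurable M"
  shows "(%x. b x *v f x) : borel_measurable M"
proof -
  have "continuous_on UNIV (%p. fst p *v snd p :: complex^'i)" by (intro continuous_intros)
  from borel_measurable_continuous_Pair[OF assms this] show ?thesis by simp
qed

lemma adj_add: "adj (A + B) = adj A + adj B" and adj_scaleR: "adj (c *R A) = c *R adj A"
  and adj_diff: "adj (A - B) = adj A - adj B"
  and adj_adj [simp]: "adj (adj A) = A"
  by (simp_all add: adj_def vec_eq_iff)

lemma norm_adj: "norm (adj (A::complex^'j^'i)) = norm A"
proof -
  have "(norm (adj A))^2 = (SUM j:UNIV. SUM i:UNIV. (norm (A $ i $ j))^2)"
    by (simp add: norm_vec_def L2_set_def sum_nonneg adj_def)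
  also have "... = (SUM i:UNIV. SUM j:UNIV. (norm (A $ i $ j))^2)" by (rule sum.swap)
  also have "... = (norm A)^2"
    by (simp add: norm_vec_def L2_set_def sum_nonneg)
  finally show ?thesis by (metis norm_ge_zero power2_eq_imp_eq)
qed

lemma bm_adj [measurable (raw)]:
  fixes b :: "'a => complex^'j^'i"
  assumes "b : borel_measurable M"
  shows "(%x. adj (b x)) : borel_measurable M"
proof -
  have "linear (adj :: complex^'j^'i => _)" by (rule linearI) (simp_all add: adj_add adj_scaleR)
  hence "continuous_on UNIV (adj :: complex^'j^'i => _)"
    by (simp add: linear_continuous_on linear_conv_bounded_linear)
  from measurable_compose[OF assms borel_measurable_continuous_onI[OF this]] show ?thesis by simp
qed

lemma bounded_linear_axis: "bounded_linear (axis i :: 'a::real_normed_vector => 'a^'i)"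
proof (rule bounded_linear_intro[where K=1])
  fix x :: 'a
  have "norm (axis i x :: 'a^'i) = sqrt (SUM j:UNIV. if j = i then (norm x)^2 else 0)"
    unfolding norm_vec_def L2_set_def by (intro arg_cong[of _ _ sqrt] sum.cong) (auto simp: axis_def)
  thus "norm (axis i x :: 'a^'i) <= norm x * 1" by simp
qed (auto simp: axis_def vec_eq_iff)

lemma sum_axis: "(SUM i:UNIV. axis i (v $ i)) = (v :: 'a::comm_monoid_add^'i)"
  by (simp add: vec_eq_iff axis_def)

section \<open>Translations on \<open>L^2\<close>\<close>

text \<open>A Borel representative; \<open>rep_L2\<close> promises only Lebesgue
  measurability.\<close>

definition brep :: "('d::finite, 'i::finite) L2 => real^'d => complex^'i" where
  "brep u = (SOME f. f : sqint lborel & u = abs_L2 f)"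

lemma brep: "brep u : sqint lborel" "abs_L2 (brep u) = u"
proof -
  have "EX f. f : sqint lborel & u = abs_L2 f" by (meson L2_borel_cases)
  from someI_ex[OF this] show "brep u : sqint lborel" "abs_L2 (brep u) = u"
    by (auto simp: brep_def)
qed

lemma brep_measurable [measurable]: "brep u : borelf"
  using brep(1)[of u] by (simp add: square_integrable_def)

lemma brep_abs_L2: "f : sqint lborel ==> AE x in lborel. brep (abs_L2 f) x = f x"
  using abs_L2_eq_iff_lb[OF brep(1)] brep(2) by blast

lemma AE_lborel_affine:
  fixes h :: "'a::euclidean_space"
  assumes "c ~= 0" "AE x in lborel. P x"
  shows "AE x in lborel. P (h + c *R x)"
proof -
  have "AE x in density (distr lborel borel (%x. h + c *R x)) (%_. ennreal (\<bar>c\<bar> ^ DIM('a))). P x"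
    by (subst lborel_affine[OF assms(1), of h, symmetric]) (rule assms)
  hence "AE x in distr lborel borel (%x. h + c *R x). P x"
    using assms(1) by (subst (asm) AE_density) auto
  thus ?thesis by (rule AE_distrD[rotated]) measurable
qed

lemma AE_lborel_shift:
  fixes h :: "'a::euclidean_space"
  assumes "AE x in lborel. P x"
  shows "AE x in lborel. P (x + h)"
  using AE_lborel_affine[of 1 P h] assms by (simp add: add.commute)

lemma nn_lborel_shift:
  fixes h :: "'a::euclidean_space"
  assumes [measurable]: "f : borelf"
  shows "(nn_integral lborel (%x. f (x + h))) = (nn_integral lborel (%x. f x))"
proof -
  have "(nn_integral lborel (%x. f x)) = (nn_integral (distr lborel borel ((+) h)) (%x. f x))" by (simp add: lborel_distr_plus)
  also have "... = (nn_integral lborel (%x. f (h + x)))" by (rule nn_integral_distr) auto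
  finally show ?thesis by (simp add: add.commute)
qed

lemma integral_lborel_shift:
  fixes h :: "'a::euclidean_space" and f :: "'a => 'b::{banach,second_countable_topology}"
  assumes [measurable]: "f : borelf"
  shows "(LINT x|lborel. f (x + h)) = (LINT x|lborel. f x)"
proof -
  have "(LINT x|lborel. f x) = (LINT x|distr lborel borel ((+) h). f x)" by (simp add: lborel_distr_plus)
  also have "... = (LINT x|lborel. f (h + x))" by (rule integral_distr) auto
  finally show ?thesis by (simp add: add.commute)
qed

lemma sqint_shift:
  fixes f :: "'a::euclidean_space => 'b::{real_normed_vector,second_countable_topology}"
  assumes "f : sqint lborel"
  shows "(%x. f (x + h)) : sqint lborel"
proof -
  have [measurable]: "f : borelf" using assms by (simp add: square_integrable_def)
  show ?thesis using assms nn_lborel_shift[of "%x. ennreal ((norm (f x))^2)" h]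
    by (simp add: sqint_iff_nn)
qed

definition shift :: "real^'d => ('d, 'i::finite) L2 => ('d, 'i) L2" where
  "shift h u = abs_L2 (%x. brep u (x + h))"

lemma shift_abs_L2:
  assumes f: "f : sqint lborel"
  shows "shift h (abs_L2 f) = abs_L2 (%x. f (x + h))"
  unfolding shift_def
  by (subst abs_L2_eq_iff_lb) (auto intro!: sqint_shift f brep AE_lborel_shift[OF brep_abs_L2])

lemma plus_abs_L2_lborel:
  assumes "f : sqint lborel" "g : sqint lborel"
  shows "abs_L2 f + abs_L2 g = abs_L2 (%x. f x + g x)"
  using assms by (intro plus_abs_L2 sqint_lb_leb)

lemma minus_abs_L2_lborel:
  assumes "f : sqint lborel" "g : sqint lborel"
  shows "abs_L2 f - abs_L2 g = abs_L2 (%x. f x - g x)"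
  using assms by (intro minus_abs_L2 sqint_lb_leb)

lemma scaleR_abs_L2_lborel:
  assumes "f : sqint lborel"
  shows "c *R abs_L2 f = abs_L2 (%x. c *R f x)"
  using scaleR_abs_L2[OF sqint_lb_leb sqint_lb_leb, of f f c] assms by simp

lemma inner_shift_shift: "shift h u *. shift h v = u *. v"
proof -
  have "shift h u *. shift h v = (LINT x|lborel. brep u (x + h) *. brep v (x + h))"
    unfolding shift_def by (intro inner_abs_L2_lborel sqint_shift brep)
  also have "... = (LINT x|lborel. brep u x *. brep v x)"
    by (rule integral_lborel_shift[of "%x. brep u x *. brep v x"]) measurable
  finally show ?thesis using inner_abs_L2_lborel[OF brep(1) brep(1), of u v] by (simp add: brep)
qed

lemma bl_shift: "bounded_linear (shift h :: ('d::finite, 'i::finite) L2 => _)"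
proof -
  have add: "shift h (u + v) = shift h u + shift h v" for u v :: "('d::finite, 'i::finite) L2"
  proof -
    have "shift h (u + v) = shift h (abs_L2 (%x. brep u x + brep v x))"
      using plus_abs_L2_lborel[OF brep(1) brep(1), of u v] by (simp add: brep)
    also have "... = abs_L2 (%x. brep u (x + h) + brep v (x + h))"
      by (rule shift_abs_L2[OF square_integrable_add[OF brep(1) brep(1)]])
    finally show ?thesis
      unfolding shift_def[of h u] shift_def[of h v]
      by (simp add: plus_abs_L2_lborel sqint_shift brep)
  qed
  have scale: "shift h (c *R u) = c *R shift h u" for c and u :: "('d::finite, 'i::finite) L2"
  proof -
    have "shift h (c *R u) = shift h (abs_L2 (%x. c *R brep u x))"
      using scaleR_abs_L2_lborel[OF brep(1), of c u] by (simp add: brep)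
    also have "... = abs_L2 (%x. c *R brep u (x + h))"
      by (rule shift_abs_L2[OF square_integrable_scaleR[OF brep(1)]])
    finally show ?thesis
      unfolding shift_def[of h u]
      by (simp add: scaleR_abs_L2_lborel sqint_shift brep)
  qed
  show "bounded_linear (shift h :: ('d::finite, 'i::finite) L2 => _)"
    by (rule bounded_linear_intro[where K=1]) (auto simp: add scale norm_eq_sqrt_inner inner_shift_shift)
qed

lemmas shift_linear = linear_add[OF bounded_linear.linear[OF bl_shift]]
  linear_diff[OF bounded_linear.linear[OF bl_shift]]
  linear_scale[OF bounded_linear.linear[OF bl_shift]]
  linear_0[OF bounded_linear.linear[OF bl_shift]]
  linear_neg[OF bounded_linear.linear[OF bl_shift]]

lemma norm_shift [simp]: "norm (shift h u) = norm u"
  by (simp add: norm_eq_sqrt_inner inner_shift_shift)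

lemma shift_shift: "shift a (shift b u) = shift (a + b) u"
proof -
  have "shift a (shift b u) = abs_L2 (%x. brep u ((x + a) + b))"
    unfolding shift_def[of b u] by (rule shift_abs_L2[OF sqint_shift[OF brep(1)]])
  thus ?thesis by (simp add: shift_def add.assoc)
qed

lemma shift_0 [simp]: "shift 0 u = u"
  by (simp add: shift_def brep)

lemma inner_shift_left: "shift h u *. v = u *. shift (- h) v"
  using inner_shift_shift[of "- h" "shift h u" v] by (simp add: shift_shift)

section \<open>Multiplication operators\<close>

text \<open>Bounded at every point and Borel. Coefficients known only almost everywhere are replaced
  by such functions in \<open>ell_coeffs_regular\<close>, which keeps null sets out of all
  estimates.\<close>

definition bmat :: "(real^'d => complex^'j^'i) => bool" where
  "bmat b \<longleftrightarrow> b : borelf & (EX C. ALL x. norm (b x) <= C)"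

lemma bmat_measurable [measurable_dest]: "bmat b ==> b : borelf"
  by (simp add: bmat_def)

lemma bmat_const [simp]: "bmat (%_. A)"
  by (auto simp: bmat_def)

lemma bmat_adj: "bmat b ==> bmat (%x. adj (b x))"
  by (auto simp: bmat_def norm_adj)

lemma bmat_compose: "bmat b ==> t : borelf ==> bmat (%x. b (t x))"
  unfolding bmat_def by (auto intro: measurable_compose)

definition mult :: "(real^'d => complex^'j^'i) => ('d, 'j) L2 => ('d, 'i) L2" where
  "mult b u = abs_L2 (%x. b x *v brep u x)"

lemma sqint_mv:
  fixes b :: "real^'d => complex^'j^'i"
  assumes b: "bmat b" and f: "f : sqint lborel"
  shows "(%x. b x *v f x) : sqint lborel"
proof -
  have [measurable]: "f : borelf" "b : borelf"
    using assms by (auto simp: square_integrable_def bmat_def)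
  obtain C where C: "!!x. norm (b x) <= C" using b by (auto simp: bmat_def)
  have "integrable lborel (%x. C^2 * (norm (f x))^2)" using f by (simp add: square_integrable_def)
  hence "integrable lborel (%x. (norm (b x *v f x))^2)"
  proof (rule integrable_dominated)
    have "norm (b x *v f x) <= C * norm (f x)" for x
      using norm_mv_le[of "b x" "f x"] mult_right_mono[OF C, of "norm (f x)" x] by simp
    hence "(norm (b x *v f x))^2 <= (C * norm (f x))^2" for x by (intro power_mono) auto
    thus "AE x in lborel. norm ((norm (b x *v f x))^2) <= norm (C^2 * (norm (f x))^2)"
      by (auto simp: power_mult_distrib)
  qed measurable
  thus ?thesis by (simp add: square_integrable_def)
qed

lemma mult_abs_L2:
  assumes b: "bmat b" and f: "f : sqint lborel"
  shows "mult b (abs_L2 f) = abs_L2 (%x. b x *v f x)"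
proof -
  have "AE x in lborel. b x *v brep (abs_L2 f) x = b x *v f x"
    using brep_abs_L2[OF f] by eventually_elim simp
  thus ?thesis unfolding mult_def
    by (subst abs_L2_eq_iff_lb) (auto intro!: sqint_mv b f brep)
qed

lemma norm_mult_le:
  assumes b: "bmat b" and C: "!!x. norm (b x) <= C"
  shows "norm (mult b u) <= C * norm u"
proof -
  have C0: "0 <= C" using C[of 0] norm_ge_zero order_trans by blast
  have [measurable]: "b : borelf" using b by (auto simp: bmat_def)
  have "ennreal ((norm (mult b u))^2) = (nn_integral lborel (%x. ennreal ((norm (b x *v brep u x))^2)))"
    unfolding mult_def by (rule norm_abs_L2_nn_lb[OF sqint_mv[OF b brep(1)]])
  also have "... <= (nn_integral lborel (%x. ennreal (C^2) * ennreal ((norm (brep u x))^2)))"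
  proof (rule nn_integral_mono)
    fix x
    have "norm (b x *v brep u x) <= C * norm (brep u x)"
      using norm_mv_le[of "b x" "brep u x"] mult_right_mono[OF C, of "norm (brep u x)" x] by simp
    hence "(norm (b x *v brep u x))^2 <= (C * norm (brep u x))^2" by (intro power_mono) auto
    thus "ennreal ((norm (b x *v brep u x))^2) <= ennreal (C^2) * ennreal ((norm (brep u x))^2)"
      by (simp add: power_mult_distrib ennreal_mult[symmetric])
  qed
  also have "... = ennreal (C^2) * ennreal ((norm u)^2)"
    using norm_abs_L2_nn_lb[OF brep(1), of u] by (simp add: nn_integral_cmult brep)
  also have "... = ennreal ((C * norm u)^2)" by (simp add: ennreal_mult[symmetric] power_mult_distrib)
  finally have "(norm (mult b u))^2 <= (C * norm u)^2" by simp
  thus ?thesis by (rule power2_le_imp_le) (use C0 in auto)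
qed

lemma mult_add_right: "bmat b ==> mult b (u + v) = mult b u + mult b v"
proof -
  assume b: "bmat b"
  have "mult b (u + v) = mult b (abs_L2 (%x. brep u x + brep v x))"
    using plus_abs_L2_lborel[OF brep(1) brep(1), of u v] by (simp add: brep)
  also have "... = abs_L2 (%x. b x *v brep u x + b x *v brep v x)"
    by (simp add: mult_abs_L2 b square_integrable_add brep matrix_vector_right_distrib)
  finally show ?thesis unfolding mult_def[of b u] mult_def[of b v]
    by (simp add: plus_abs_L2_lborel sqint_mv b brep)
qed

lemma mult_scaleR_right: "bmat b ==> mult b (c *R u) = c *R mult b u"
proof -
  assume b: "bmat b"
  have "mult b (c *R u) = mult b (abs_L2 (%x. c *R brep u x))"
    using scaleR_abs_L2_lborel[OF brep(1), of c u] by (simp add: brep)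
  also have "... = abs_L2 (%x. c *R (b x *v brep u x))"
    by (simp add: mult_abs_L2 b square_integrable_scaleR brep scaleR_cmv)
  finally show ?thesis unfolding mult_def[of b u]
    by (simp add: scaleR_abs_L2_lborel sqint_mv b brep)
qed

lemma bounded_linear_mult: "bmat b ==> bounded_linear (mult b)"
proof -
  assume b: "bmat b"
  obtain C where "!!x. norm (b x) <= C" using b by (auto simp: bmat_def)
  thus ?thesis using norm_mult_le[OF b]
    by (intro bounded_linear_intro[where K=C]) (auto simp: mult_add_right mult_scaleR_right b mult.commute)
qed

lemmas mult_linear = linear_diff[OF bounded_linear.linear[OF bounded_linear_mult]]
  linear_0[OF bounded_linear.linear[OF bounded_linear_mult]]
  linear_neg[OF bounded_linear.linear[OF bounded_linear_mult]]
  linear_sum[OF bounded_linear.linear[OF bounded_linear_mult]]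

lemma inner_mult: "bmat b ==> mult b u *. v = u *. mult (%x. adj (b x)) v"
proof -
  assume b: "bmat b"
  have "mult b u *. v = (LINT x|lborel. (b x *v brep u x) *. brep v x)"
    using inner_abs_L2_lborel[OF sqint_mv[OF b brep(1)] brep(1), of u v] by (simp add: brep mult_def)
  also have "... = u *. mult (%x. adj (b x)) v"
    using inner_abs_L2_lborel[OF brep(1) sqint_mv[OF bmat_adj[OF b] brep(1)], of u v]
    by (simp add: brep mult_def inner_adj)
  finally show ?thesis .
qed

lemma shift_mult: "bmat b ==> shift h (mult b u) = mult (%x. b (x + h)) (shift h u)"
proof -
  assume b: "bmat b"
  have "shift h (mult b u) = abs_L2 (%x. b (x + h) *v brep u (x + h))"
    unfolding mult_def by (rule shift_abs_L2[OF sqint_mv[OF b brep(1)]])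
  also have "... = mult (%x. b (x + h)) (shift h u)"
    unfolding shift_def by (rule mult_abs_L2[symmetric]) (auto intro!: bmat_compose[OF b] sqint_shift brep)
  finally show ?thesis .
qed

lemma mult_mult: "bmat b ==> bmat c ==> mult b (mult c u) = mult (%x. b x ** c x) u"
  unfolding mult_def[of c u] mult_def[of _ u]
  by (simp add: mult_abs_L2 sqint_mv brep matrix_vector_mul_assoc)

lemma mult_add_left: "bmat b ==> bmat c ==> mult b u + mult c u = mult (%x. b x + c x) u"
  unfolding mult_def
  by (simp add: plus_abs_L2_lborel sqint_mv brep matrix_vector_mult_add_rdistrib)

lemma mult_diff_left: "bmat b ==> bmat c ==> mult b u - mult c u = mult (%x. b x - c x) u"
  unfolding mult_def
  by (simp add: minus_abs_L2_lborel sqint_mv brep matrix_vector_mult_diff_rdistrib)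

lemma mult_one [simp]: "mult (%_. mat 1) u = u"
  by (simp add: mult_def brep)

section \<open>Test functions and Sobolev functions on the whole space\<close>

section \<open>Vector-valued test functions\<close>

definition vtest :: "(real^'d => complex^'i) set" where
  "vtest = {Psi. ALL i. (%x. Psi x $ i) : test_fun UNIV}"

definition vpd :: "'d => (real^'d => complex^'i) => real^'d => complex^'i" where
  "vpd j Psi x = (\<chi> i. pd j (%x. Psi x $ i) x)"

definition dirderiv :: "real^'d => (real^'d => complex^'i) => real^'d => complex^'i" where
  "dirderiv h Psi x = (SUM j:UNIV. h $ j *R vpd j Psi x)"

definition smooth_vec :: "(real^'d => complex^'i) => bool" where
  "smooth_vec Psi \<longleftrightarrow> (ALL i. smooth_fun (%x. Psi x $ i))"

lemma vtest_smooth: "Psi : vtest ==> smooth_vec Psi"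
  by (auto simp: vtest_def smooth_vec_def intro: test_fun_smooth)

lemma vtest_vpd: "Psi : vtest ==> vpd j Psi : vtest"
  for Psi :: "real^'d => complex^'i"
  by (simp add: vtest_def vpd_def test_fun_pderiv)

lemma vtest_0: "(%x::real^'d. 0) : vtest"
  by (simp add: vtest_def test_fun_0)

lemma vtest_add: "Psi : vtest ==> Phi : vtest ==> (%x::real^'d. Psi x + Phi x) : vtest"
  by (simp add: vtest_def test_fun_add)

lemma vtest_scaleR: "Psi : vtest ==> (%x::real^'d. c *R Psi x) : vtest"
proof -
  assume "Psi : vtest"
  hence "(%x. complex_of_real c * Psi x $ i) : test_fun UNIV" for i
    by (intro test_fun_mult smooth_fun_const) (simp add: vtest_def)
  thus ?thesis by (simp add: vtest_def scaleR_conv_of_real[where 'a=complex])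
qed

lemma vtest_sum: "(!!k. k : S ==> f k : vtest) ==> (%x::real^'d. SUM k:S. f k x) : vtest"
  by (induction S rule: infinite_finite_induct) (auto intro: vtest_0 vtest_add)

lemma vtest_dirderiv: "Psi : vtest ==> dirderiv h Psi : vtest"
  unfolding dirderiv_def by (intro vtest_sum vtest_scaleR vtest_vpd)

lemma vtest_shift: "Psi : vtest ==> (%x::real^'d. Psi (x + h)) : vtest"
  using test_fun_affine[of "%x. Psi x $ i" 1 h for i] by (simp add: vtest_def)

lemma vtest_matrix:
  fixes q :: "real^'d => complex^'j^'i"
  assumes "!!i k. smooth_fun (%x. q x $ i $ k)" "Psi : vtest"
  shows "(%x. q x *v Psi x) : vtest"
proof -
  have "(%x. SUM k:S. q x $ i $ k * Psi x $ k) : test_fun UNIV" for i S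
  proof (induction S rule: infinite_finite_induct)
    case (insert k S)
    have "(%x. q x $ i $ k * Psi x $ k) : test_fun UNIV"
      using assms by (intro test_fun_mult) (auto simp: vtest_def)
    from test_fun_add[OF this insert.IH] insert.hyps show ?case by simp
  qed (simp_all add: test_fun_0)
  thus ?thesis by (simp add: vtest_def matrix_vector_mult_def)
qed

lemma smooth_vec_continuous: "smooth_vec Psi ==> continuous_on S Psi"
  for Psi :: "real^'d => complex^'i"
proof -
  assume "smooth_vec Psi"
  hence "continuous_on S (%x. \<chi> i. Psi x $ i)"
    by (intro continuous_on_vec_lambda smooth_fun_cont) (auto simp: smooth_vec_def)
  thus ?thesis by simp
qed

lemma smooth_vec_measurable [measurable_dest]: "smooth_vec Psi ==> Psi : borelf"
  for Psi :: "real^'d => complex^'i"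
  by (intro borel_measurable_continuous_onI smooth_vec_continuous)

lemma vtest_support:
  fixes Psi :: "real^'d => complex^'i"
  assumes "Psi : vtest"
  obtains R where "0 <= R" "!!x. R < norm x ==> Psi x = 0"
proof -
  have "EX R. ALL x. R < norm x --> Psi x $ i = 0" for i
  proof -
    have "(%x. Psi x $ i) : test_fun UNIV" using assms by (simp add: vtest_def)
    then obtain K where K: "compact K" "!!x. x ~: K ==> Psi x $ i = 0" by (auto simp: test_fun_iff)
    obtain R where "!!x. x : K ==> norm x <= R" using compact_imp_bounded[OF K(1)] bounded_iff by metis
    thus ?thesis using K(2) by (intro exI[of _ R]) (meson not_le)
  qed
  then obtain R where R: "!!i x. R i < norm x ==> Psi x $ i = 0" by metis
  define R0 where "R0 = (SUM i:UNIV. \<bar>R i\<bar>)"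
  have "R i <= R0" for i
    unfolding R0_def by (rule order_trans[OF abs_ge_self member_le_sum[of i UNIV "%i. \<bar>R i\<bar>"]]) auto
  hence "Psi x = 0" if "R0 < norm x" for x
    using R that by (auto simp: vec_eq_iff intro: le_less_trans)
  moreover have "0 <= R0" by (simp add: R0_def sum_nonneg)
  ultimately show thesis using that by blast
qed

lemma vtest_sqint:
  fixes Psi :: "real^'d => complex^'i"
  shows "Psi : vtest ==> Psi : sqint lborel"
  by (auto simp: sqint_vec vtest_def intro: test_fun_sqint)

lemma vtest_bounded:
  fixes Psi :: "real^'d => complex^'i"
  assumes "Psi : vtest"
  obtains B where "0 <= B" "!!x. norm (Psi x) <= B"
proof -
  have "EX B. ALL x. norm (Psi x $ i) <= B" for i
  proof -
    have "(%x. Psi x $ i) : test_fun UNIV" using assms by (simp add: vtest_def)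
    thus ?thesis by (rule test_fun_bounded) blast
  qed
  then obtain B where B: "!!i x. norm (Psi x $ i) <= B i" by metis
  have "norm (Psi x) <= (SUM i:UNIV. B i)" for x
  proof -
    have "norm (Psi x) <= (SUM i:UNIV. norm (Psi x $ i))" unfolding norm_vec_def by (rule L2_set_le_sum) auto
    also have "... <= (SUM i:UNIV. B i)" by (intro sum_mono B)
    finally show ?thesis .
  qed
  moreover from this[of 0] have "0 <= (SUM i:UNIV. B i)" using norm_ge_zero order_trans by blast
  ultimately show thesis using that by blast
qed

lemma smooth_vec_has_derivative:
  fixes Psi :: "real^'d => complex^'i"
  assumes "smooth_vec Psi"
  shows "(Psi has_derivative (%h. dirderiv h Psi x)) (at x)"
proof -
  have "((%x. SUM i:UNIV. axis i (Psi x $ i)) has_derivative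
      (%h. SUM i:UNIV. axis i (SUM j:UNIV. h $ j *R pd j (%x. Psi x $ i) x))) (at x)"
    using assms
    by (intro has_derivative_sum bounded_linear.has_derivative[OF bounded_linear_axis] has_derivative_pderiv_cl
        smooth_fun_diffble) (auto simp: smooth_vec_def)
  moreover have "(SUM i:UNIV. axis i (SUM j:UNIV. h $ j *R pd j (%x. Psi x $ i) x)) = dirderiv h Psi x" for h
    by (simp add: vec_eq_iff axis_def dirderiv_def vpd_def)
  ultimately show ?thesis by (simp add: sum_axis)
qed

lemma vtest_Lipschitz:
  fixes Psi :: "real^'d => complex^'i"
  assumes "Psi : vtest"
  obtains B where "0 <= B" "!!x y. norm (Psi x - Psi y) <= B * norm (x - y)" "!!h x. norm (dirderiv h Psi x) <= B * norm h"
proof -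
  have "EX B. ALL x. norm (vpd j Psi x) <= B" for j
    by (rule vtest_bounded[OF vtest_vpd[OF assms, of j]]) blast
  then obtain B where B: "!!j x. norm (vpd j Psi x) <= B j" by metis
  have B0: "0 <= B j" for j using B[of j 0] norm_ge_zero order_trans by blast
  define C where "C = (SUM j:UNIV. B j)"
  have C: "norm (dirderiv h Psi x) <= C * norm h" for h x
  proof -
    have "norm (dirderiv h Psi x) <= (SUM j:UNIV. \<bar>h $ j\<bar> * norm (vpd j Psi x))"
      unfolding dirderiv_def by (rule order_trans[OF norm_sum]) simp
    also have "... <= (SUM j:UNIV. norm h * B j)"
      by (intro sum_mono mult_mono component_le_norm_cart B) auto
    finally show ?thesis by (simp add: C_def sum_distrib_left mult.commute)
  qed
  have "norm (Psi x - Psi y) <= C * norm (x - y)" for x y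
  proof (rule differentiable_bound[of UNIV])
    fix x show "(Psi has_derivative (%h. dirderiv h Psi x)) (at x within UNIV)"
      using smooth_vec_has_derivative[OF vtest_smooth[OF assms]] by simp
    show "onorm (%h. dirderiv h Psi x) <= C" by (rule onorm_le[OF C])
  qed auto
  moreover have "0 <= C" unfolding C_def by (intro sum_nonneg B0)
  ultimately show thesis using that C by blast
qed

lemma abs_L2_sum:
  fixes f :: "'k => real^'d => complex^'i"
  assumes "!!k. k : S ==> f k : sqint lborel"
  shows "(%x. SUM k:S. f k x) : sqint lborel & abs_L2 (%x. SUM k:S. f k x) = (SUM k:S. abs_L2 (f k))"
  using assms
proof (induction S rule: infinite_finite_induct)
  case (insert k S)
  thus ?case by (simp add: square_integrable_add plus_abs_L2_lborel[symmetric])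
qed (simp_all add: zero_abs_L2 square_integrable_0)

section \<open>Difference quotients\<close>

text \<open>Dominated convergence: along a null sequence of steps the quotients are bounded by the
  Lipschitz constant and supported in one ball. Through this limit, statements about derivatives
  become statements about shifts.\<close>

lemma diff_quot_tendsto:
  fixes Psi :: "real^'d => complex^'i"
  assumes Psi: "Psi : vtest"
  shows "((%t. (1 / t) *R (shift (t *R h) (abs_L2 Psi) - abs_L2 Psi)) \<longlongrightarrow> abs_L2 (dirderiv h Psi)) (at 0)"
  unfolding tendsto_at_iff_sequentially
proof (intro allI impI)
  fix X :: "nat => real" assume X0: "ALL i. X i : UNIV - {0}" and X: "X ----> 0"
  obtain M where M: "!!n. \<bar>X n\<bar> <= M" using convergent_imp_Bseq[OF convergentI[OF X]] by (auto simp: Bseq_def)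
  define r where "r n x = (1 / X n) *R (Psi (x + X n *R h) - Psi x) - dirderiv h Psi x" for n x
  have D: "dirderiv h Psi : vtest" by (rule vtest_dirderiv[OF Psi])
  note sq = vtest_sqint[OF Psi] vtest_sqint[OF D]
  have rs: "r n : sqint lborel" for n
    unfolding r_def by (intro square_integrable_diff square_integrable_scaleR sqint_shift sq)
  hence [measurable]: "r n : borelf" for n by (simp add: square_integrable_def)
  have eq: "(1 / X n) *R (shift (X n *R h) (abs_L2 Psi) - abs_L2 Psi) - abs_L2 (dirderiv h Psi) = abs_L2 (r n)" for n
    unfolding r_def
    by (simp add: shift_abs_L2 sq minus_abs_L2_lborel scaleR_abs_L2_lborel square_integrable_diff
        square_integrable_scaleR sqint_shift)
  obtain B where B: "0 <= B" "!!x y. norm (Psi x - Psi y) <= B * norm (x - y)" "!!h x. norm (dirderiv h Psi x) <= B * norm h"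
    by (rule vtest_Lipschitz[OF Psi]) blast
  obtain R1 where R1: "!!x. R1 < norm x ==> Psi x = 0" by (rule vtest_support[OF Psi]) blast
  obtain R2 where R2: "!!x. R2 < norm x ==> dirderiv h Psi x = 0" by (rule vtest_support[OF D]) blast
  \<comment> \<open>Translation by \<open>X n *R h\<close> moves the support by at most
    \<open>M * norm h\<close>.\<close>
  define R where "R = max R1 R2 + M * norm h"
  have M0: "0 <= M" using M[of 0] by linarith
  have supp: "r n x = 0" if "R < norm x" for n x
  proof -
    have "norm (X n *R h) <= M * norm h" using M[of n] by (simp add: mult_right_mono)
    moreover have "norm x <= norm (x + X n *R h) + norm (X n *R h)"
      using norm_triangle_ineq4[of "x + X n *R h" "X n *R h"] by simp
    moreover have "0 <= M * norm h" using M0 by simp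
    ultimately have "R1 < norm (x + X n *R h)" "R1 < norm x" "R2 < norm x"
      using that unfolding R_def by linarith+
    thus ?thesis by (simp add: r_def R1 R2)
  qed
  have bd: "norm (r n x) <= 2 * B * norm h" for n x
  proof -
    have "norm (Psi (x + X n *R h) - Psi x) <= B * norm (X n *R h)"
      using B(2)[of "x + X n *R h" x] by simp
    hence "norm ((1 / X n) *R (Psi (x + X n *R h) - Psi x)) <= \<bar>1 / X n\<bar> * (B * norm (X n *R h))"
      unfolding norm_scaleR by (intro mult_left_mono) auto
    also have "... = B * norm h" using X0 by simp
    finally show ?thesis unfolding r_def using B(3)[of h x]
      norm_triangle_ineq4[of "(1 / X n) *R (Psi (x + X n *R h) - Psi x)" "dirderiv h Psi x"] by linarith
  qed
  have ptw: "(%n. (norm (r n x))^2) ----> 0" for x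
  proof -
    have "((%t. Psi (x + t *R h)) has_derivative (%t. dirderiv (t *R h) Psi (x + 0 *R h))) (at (0::real))"
      by (rule has_derivative_compose[OF _ smooth_vec_has_derivative[OF vtest_smooth[OF Psi]]])
        (auto intro!: derivative_eq_intros)
    hence "((%t. norm (Psi (x + (0 + t) *R h) - Psi (x + 0 *R h) - dirderiv (t *R h) Psi (x + 0 *R h)) / norm t) \<longlongrightarrow> 0) (at 0)"
      unfolding has_derivative_at by blast
    hence "(%n. norm (Psi (x + (0 + X n) *R h) - Psi (x + 0 *R h) - dirderiv (X n *R h) Psi (x + 0 *R h)) / norm (X n)) ----> 0"
      unfolding tendsto_at_iff_sequentially o_def using X X0 by blast
    moreover have "norm (Psi (x + (0 + X n) *R h) - Psi (x + 0 *R h) - dirderiv (X n *R h) Psi (x + 0 *R h)) / norm (X n) = norm (r n x)" for n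
    proof -
      have "X n ~= 0" using X0 by blast
      hence "r n x = (1 / X n) *R (Psi (x + X n *R h) - Psi x - dirderiv (X n *R h) Psi x)"
        by (simp add: r_def dirderiv_def scaleR_right_diff_distrib scaleR_sum_right)
      thus ?thesis by simp
    qed
    ultimately have "(%n. norm (r n x)) ----> 0" by simp
    from tendsto_power[OF this, of 2] show ?thesis by simp
  qed
  have "(%n. LINT x|lborel. (norm (r n x))^2) ----> (LINT x|(lborel::(real^'d) measure). 0)"
  proof (rule integral_dominated_convergence[where w="%x. (2 * B * norm h)^2 * indicator (cball 0 R) x"])
    show "integrable lborel (%x::real^'d. (2 * B * norm h)^2 * indicator (cball 0 R) x)"
      by (intro integrable_mult_right integrable_real_indicator emeasure_compact_finite) auto
    show "AE x in lborel. norm ((norm (r n x))^2) <= (2 * B * norm h)^2 * indicator (cball 0 R) x" for n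
      using bd[of n] supp[of _ n] by (intro AE_I2) (auto simp: indicator_def not_le intro!: power_mono)
  qed (use ptw in auto)
  moreover have "(LINT x|lborel. (norm (r n x))^2) = (norm (abs_L2 (r n)))^2" for n
    using inner_abs_L2_lborel[OF rs rs, of n n] by (simp add: power2_norm_eq_inner)
  ultimately have "(%n. (norm (abs_L2 (r n)))^2) ----> 0" by simp
  from tendsto_real_sqrt[OF this] have "(%n. norm (abs_L2 (r n))) ----> 0" by simp
  hence "(%n. (1 / X n) *R (shift (X n *R h) (abs_L2 Psi) - abs_L2 Psi) - abs_L2 (dirderiv h Psi)) ----> 0"
    unfolding eq by (rule tendsto_norm_zero_cancel)
  thus "((%t. (1 / t) *R (shift (t *R h) (abs_L2 Psi) - abs_L2 Psi)) \<circ> X) ----> abs_L2 (dirderiv h Psi)"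
    unfolding o_def by (simp add: LIM_zero_iff)
qed

text \<open>By the group law the difference quotient at \<open>t\<close> is the shift by
  \<open>t *R h\<close> of the one at 0, and shifts are isometries.\<close>

lemma shift_vtest_has_vector_derivative:
  fixes Psi :: "real^'d => complex^'i"
  assumes Psi: "Psi : vtest"
  shows "((%t. shift (t *R h) (abs_L2 Psi)) has_vector_derivative shift (t *R h) (abs_L2 (dirderiv h Psi))) (at t within S)"
proof -
  let ?r = "%s. (1 / s) *R (shift (s *R h) (abs_L2 Psi) - abs_L2 Psi) - abs_L2 (dirderiv h Psi)"
  have "((%s. norm (?r s)) \<longlongrightarrow> 0) (at 0)"
    using diff_quot_tendsto[OF Psi, of h] by (intro tendsto_norm_zero) (simp add: LIM_zero_iff)
  hence "((%s. norm (shift ((t + s) *R h) (abs_L2 Psi) - shift (t *R h) (abs_L2 Psi)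
      - s *R shift (t *R h) (abs_L2 (dirderiv h Psi))) / norm s) \<longlongrightarrow> 0) (at 0)"
  proof (rule Lim_transform_eventually)
    show "\<forall>\<^sub>F s in at 0. norm (?r s)
      = norm (shift ((t + s) *R h) (abs_L2 Psi) - shift (t *R h) (abs_L2 Psi)
      - s *R shift (t *R h) (abs_L2 (dirderiv h Psi))) / norm s"
      unfolding eventually_at_filter
    proof (intro always_eventually allI impI)
      fix s :: real assume s: "s ~= 0"
      have "shift ((t + s) *R h) (abs_L2 Psi) - shift (t *R h) (abs_L2 Psi) - s *R shift (t *R h) (abs_L2 (dirderiv h Psi))
        = shift (t *R h) (s *R (?r s))"
        using s by (simp add: shift_linear shift_shift scaleR_add_left scaleR_right_diff_distrib)
      thus "norm (?r s)
      = norm (shift ((t + s) *R h) (abs_L2 Psi) - shift (t *R h) (abs_L2 Psi)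
      - s *R shift (t *R h) (abs_L2 (dirderiv h Psi))) / norm s"
        using s by (simp only: norm_shift norm_scaleR real_norm_def) simp
    qed
  qed
  hence "((%t. shift (t *R h) (abs_L2 Psi)) has_derivative (%s. s *R shift (t *R h) (abs_L2 (dirderiv h Psi)))) (at t)"
    unfolding has_derivative_at by (simp add: bounded_linear_scaleR_left)
  thus ?thesis unfolding has_vector_derivative_def by (rule has_derivative_at_withinI)
qed

lemma norm_shift_vtest_diff_le:
  fixes Psi :: "real^'d => complex^'i"
  assumes Psi: "Psi : vtest"
  shows "norm (shift h (abs_L2 Psi) - abs_L2 Psi) <= (SUM j:UNIV. \<bar>h $ j\<bar> * norm (abs_L2 (vpd j Psi)))"
proof -
  let ?F = "%t. shift (t *R h) (abs_L2 Psi)"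
  have "norm (?F 1 - ?F 0) <= norm (abs_L2 (dirderiv h Psi)) * norm ((1::real) - 0)"
  proof (rule differentiable_bound[of "{0..1}" ?F "%t s. s *R shift (t *R h) (abs_L2 (dirderiv h Psi))"])
    fix t :: real
    show "(?F has_derivative (%s. s *R shift (t *R h) (abs_L2 (dirderiv h Psi)))) (at t within {0..1})"
      using shift_vtest_has_vector_derivative[OF Psi] unfolding has_vector_derivative_def .
    show "onorm (%s. s *R shift (t *R h) (abs_L2 (dirderiv h Psi))) <= norm (abs_L2 (dirderiv h Psi))"
      by (rule onorm_le) (simp add: mult.commute)
  qed auto
  hence "norm (shift h (abs_L2 Psi) - abs_L2 Psi) <= norm (abs_L2 (dirderiv h Psi))" by simp
  also have "abs_L2 (dirderiv h Psi) = (SUM j:UNIV. abs_L2 (%x. h $ j *R vpd j Psi x))"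
    unfolding dirderiv_def
    using abs_L2_sum[of UNIV "%j x. h $ j *R vpd j Psi x"] vtest_sqint[OF vtest_scaleR[OF vtest_vpd[OF Psi]]] by blast
  also have "... = (SUM j:UNIV. h $ j *R abs_L2 (vpd j Psi))"
    by (simp add: scaleR_abs_L2_lborel vtest_sqint vtest_vpd[OF Psi])
  also have "norm ... <= (SUM j:UNIV. \<bar>h $ j\<bar> * norm (abs_L2 (vpd j Psi)))"
    by (rule order_trans[OF norm_sum]) simp
  finally show ?thesis .
qed

section \<open>Density of test functions in \<open>L^2\<close>\<close>

lemma orthogonal_vtest_imp_0:
  fixes w :: "('d::finite, 'i::finite) L2"
  assumes "!!Psi. Psi : vtest ==> w *. abs_L2 Psi = 0"
  shows "w = 0"
proof -
  have sq: "(%x. brep w x $ i) : sqint lborel" for i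
    using brep(1)[of w] sqint_vec[of "brep w" lborel] by blast
  have "AE x in lebesgue. brep w x $ i = 0" for i
  proof (rule fundamental_lemma_UNIV)
    show "(%x. brep w x $ i) : sqint lebesgue"
      by (rule sqint_lb_leb[OF sq])
    fix psi :: "real^'d => complex" assume psi: "psi : test_fun UNIV"
    have i: "integrable lborel (%x. brep w x $ i * psi x)"
      by (rule sqint_mult[OF sq test_fun_sqint[OF psi]])
    \<comment> \<open>The inner product of \<open>L2\<close> only sees real parts;
      \<open>c = 1\<close> and \<open>c = \<i>\<close> together recover the complex
      integral.\<close>
    have Re0: "Re (c * (LINT x|lborel. brep w x $ i * psi x)) = 0" for c
    proof -
      have v: "(%x. axis i (cnj (c * psi x)) :: complex^'i) : vtest"
        unfolding vtest_def
      proof (intro CollectI allI)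
        fix k
        have "(%x. cnj (c * psi x)) : test_fun UNIV"
          by (intro test_fun_cnj test_fun_mult smooth_fun_const psi)
        thus "(%x. axis i (cnj (c * psi x)) $ k) : test_fun UNIV"
          by (cases "k = i") (auto simp: axis_def test_fun_0)
      qed
      have "0 = (LINT x|lborel. brep w x *. axis i (cnj (c * psi x)))"
        using assms[OF v] inner_abs_L2_lborel[OF brep(1) vtest_sqint[OF v], of w] by (simp add: brep)
      also have "... = (LINT x|lborel. Re (c * (brep w x $ i * psi x)))"
        by (simp add: inner_axis inner_complex_Re mult_ac)
      also have "... = Re (LINT x|lborel. c * (brep w x $ i * psi x))"
        using i by (intro integral_Re integrable_mult_right)
      finally show ?thesis by simp
    qed
    have "(LINT x|lborel. brep w x $ i * psi x) = 0"
      using Re0[of 1] Re0[of "\<i>"] by (simp add: complex_eq_iff)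
    thus "(LINT x|lebesgue. brep w x $ i * psi x) = 0"
      using i by (subst integral_completion) auto
  qed
  hence "AE x in lebesgue. ALL i. brep w x $ i = 0" by (intro AE_finite_allI[of UNIV, simplified]) auto
  hence "AE x in lborel. brep w x = 0" by (simp add: AE_completion_iff vec_eq_iff)
  hence "abs_L2 (brep w) = abs_L2 (%x. 0)"
    by (subst abs_L2_eq_iff_lb) (auto simp: brep square_integrable_0)
  thus ?thesis by (simp add: brep zero_abs_L2[symmetric])
qed

lemma subspace_vtest: "subspace (abs_L2 ` (vtest :: (real^'d => complex^'i) set))"
proof (rule subspaceI)
  show "0 : abs_L2 ` (vtest :: (real^'d => complex^'i) set)"
    unfolding zero_abs_L2 by (intro imageI vtest_0)
next
  fix u v :: "('d, 'i) L2" assume "u : abs_L2 ` vtest" "v : abs_L2 ` vtest"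
  thus "u + v : abs_L2 ` vtest"
    by (auto simp: plus_abs_L2_lborel vtest_sqint intro!: imageI vtest_add)
next
  fix c and u :: "('d, 'i) L2" assume "u : abs_L2 ` vtest"
  thus "c *R u : abs_L2 ` vtest"
    by (auto simp: scaleR_abs_L2_lborel vtest_sqint intro!: imageI vtest_scaleR)
qed

lemma vtest_dense: "closure (abs_L2 ` vtest) = (UNIV :: ('d::finite, 'i::finite) L2 set)"
proof -
  have "u : closure (abs_L2 ` vtest)" for u :: "('d, 'i) L2"
  proof -
    \<comment> \<open>\<open>g\<close> is the orthogonal projection of \<open>u\<close> onto the
      closure of the test functions.\<close>
    obtain g where g: "g : closure (abs_L2 ` vtest)" "!!x. x : abs_L2 ` vtest ==> u *. x = g *. x"
      by (rule riesz_on_subspace[OF subspace_vtest, of "(*.) u" "norm u"]) (auto simp: inner_add_right Cauchy_Schwarz_ineq2)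
    have "u - g = 0" by (rule orthogonal_vtest_imp_0) (simp add: inner_diff_left g)
    thus ?thesis using g by simp
  qed
  thus ?thesis by blast
qed

lemma vtest_approx:
  fixes u :: "('d::finite, 'i::finite) L2"
  assumes "0 < e"
  obtains Psi where "Psi : vtest" "norm (u - abs_L2 Psi) < e"
proof -
  have "u : closure (abs_L2 ` vtest)" by (simp add: vtest_dense)
  then obtain v where "v : abs_L2 ` vtest" "dist v u < e" using assms closure_approachable by blast
  thus thesis using that by (auto simp: dist_norm norm_minus_commute)
qed

lemma shift_near_0:
  fixes u :: "('d::finite, 'i::finite) L2"
  assumes e: "0 < e"
  obtains r where "0 < r" "!!h. norm h <= r ==> norm (shift h u - u) < e"
proof -
  obtain Psi where Psi: "Psi : vtest" "norm (u - abs_L2 Psi) < e / 3"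
    using vtest_approx[of "e / 3" u] e by auto
  define C where "C = (SUM j:UNIV. norm (abs_L2 (vpd j Psi)))"
  have C: "0 <= C" by (simp add: C_def sum_nonneg)
  define r where "r = e / (3 * (C + 1))"
  have r: "0 < r" using e C by (simp add: r_def)
  have "norm (shift h u - u) < e" if h: "norm h <= r" for h
  proof -
    have "norm (shift h (abs_L2 Psi) - abs_L2 Psi) <= (SUM j:UNIV. \<bar>h $ j\<bar> * norm (abs_L2 (vpd j Psi)))"
      by (rule norm_shift_vtest_diff_le[OF Psi(1)])
    also have "... <= (SUM j:UNIV. r * norm (abs_L2 (vpd j Psi)))"
      using component_le_norm_cart[of h] h by (intro sum_mono mult_right_mono) (auto intro: order_trans)
    also have "... = r * C" by (simp add: C_def sum_distrib_left)
    also have "... < e / 3" using e C by (simp add: r_def field_simps)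
    finally have 1: "norm (shift h (abs_L2 Psi) - abs_L2 Psi) < e / 3" .
    have "shift h u - u = shift h (u - abs_L2 Psi) + (shift h (abs_L2 Psi) - abs_L2 Psi) - (u - abs_L2 Psi)"
      by (simp add: shift_linear)
    hence "norm (shift h u - u) <= norm (shift h (u - abs_L2 Psi)) + norm (shift h (abs_L2 Psi) - abs_L2 Psi) + norm (u - abs_L2 Psi)"
      using norm_triangle_ineq4[of "shift h (u - abs_L2 Psi) + (shift h (abs_L2 Psi) - abs_L2 Psi)" "u - abs_L2 Psi"]
        norm_triangle_ineq[of "shift h (u - abs_L2 Psi)" "shift h (abs_L2 Psi) - abs_L2 Psi"] by simp
    thus ?thesis using 1 Psi(2) by simp
  qed
  thus thesis using r that by blast
qed

lemma continuous_on_shift: "continuous_on S (%h. shift h u)"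
  unfolding continuous_on_iff
proof (intro ballI allI impI)
  fix h and e :: real assume "h : S" and e: "0 < e"
  obtain r where r: "0 < r" "!!h. norm h <= r ==> norm (shift h u - u) < e" using shift_near_0[OF e] by blast
  show "EX d>0. ALL h':S. dist h' h < d --> dist (shift h' u) (shift h u) < e"
  proof (intro exI conjI ballI impI)
    fix h' assume "dist h' h < r"
    hence "norm (shift (h' - h) u - u) < e" by (intro r) (simp add: dist_norm)
    moreover have "shift h' u - shift h u = shift h (shift (h' - h) u - u)" by (simp add: shift_linear shift_shift)
    ultimately show "dist (shift h' u) (shift h u) < e" by (simp add: dist_norm)
  qed (rule r)
qed

instance L2 :: (finite, finite) banach ..

section \<open>Weak derivatives\<close>

text \<open>The weak derivative of all components at once, tested with the real inner product. Its
  agreement with the componentwise complex notion is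
  \<open>has_weak_pderiv_iff_wder\<close>.\<close>

definition wder :: "'d => ('d::finite, 'i::finite) L2 => ('d, 'i) L2 => bool" where
  "wder j u g \<longleftrightarrow> (ALL Psi:vtest. u *. abs_L2 (vpd j Psi) = - (g *. abs_L2 Psi))"

lemma wderD: "wder j u g ==> Psi : vtest ==> u *. abs_L2 (vpd j Psi) = - (g *. abs_L2 Psi)"
  by (simp add: wder_def)

lemma wder_unique: "wder j u g ==> wder j u h ==> g = h"
  using orthogonal_vtest_imp_0[of "g - h"] by (simp add: wder_def inner_diff_left)

lemma wder_0: "wder j 0 0"
  by (simp add: wder_def)

lemma wder_add: "wder j u g ==> wder j v h ==> wder j (u + v) (g + h)"
  by (simp add: wder_def inner_add_left)

lemma wder_scaleR: "wder j u g ==> wder j (c *R u) (c *R g)"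
  by (simp add: wder_def)

lemma wder_diff: "wder j u g ==> wder j v h ==> wder j (u - v) (g - h)"
  by (simp add: wder_def inner_diff_left)

lemma wder_limit:
  assumes "!!n. wder j (u n) (g n)" "u ----> u'" "g ----> g'"
  shows "wder j u' g'"
  unfolding wder_def
proof
  fix Psi :: "real^'a => complex^'b" assume "Psi : vtest"
  hence "(%n. - (g n *. abs_L2 Psi)) = (%n. u n *. abs_L2 (vpd j Psi))"
    using assms(1) by (simp add: wder_def)
  moreover have "(%n. - (g n *. abs_L2 Psi)) ----> - (g' *. abs_L2 Psi)"
    "(%n. u n *. abs_L2 (vpd j Psi)) ----> u' *. abs_L2 (vpd j Psi)"
    by (intro tendsto_intros assms)+
  ultimately show "u' *. abs_L2 (vpd j Psi) = - (g' *. abs_L2 Psi)" using LIMSEQ_unique by metis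
qed

lemma dirderiv_axis: "dirderiv (axis j c) Psi = (%x. c *R vpd j Psi x)"
proof
  fix x
  have "dirderiv (axis j c) Psi x = (SUM k:UNIV. if k = j then c *R vpd j Psi x else 0)"
    unfolding dirderiv_def by (rule sum.cong) (auto simp: axis_def)
  thus "dirderiv (axis j c) Psi x = c *R vpd j Psi x" by simp
qed

lemma norm_axis: "norm (axis i x :: 'a::real_normed_vector^'i) = norm x"
proof -
  have "norm (axis i x :: 'a^'i) = sqrt (SUM j:UNIV. if j = i then (norm x)^2 else 0)"
    unfolding norm_vec_def L2_set_def by (intro arg_cong[of _ _ sqrt] sum.cong) (auto simp: axis_def)
  thus ?thesis by simp
qed

lemma abs_L2_dirderiv_axis:
  fixes Psi :: "real^'d => complex^'i"
  shows "Psi : vtest ==> abs_L2 (dirderiv (axis j c) Psi) = c *R abs_L2 (vpd j Psi)"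
  by (simp add: dirderiv_axis scaleR_abs_L2_lborel vtest_sqint vtest_vpd)

text \<open>Integration by parts as a limit: the adjoint of a shift by \<open>h\<close> is the shift
  by \<open>- h\<close>, and the difference quotients on both sides converge.\<close>

lemma wder_vtest:
  fixes Psi :: "real^'d => complex^'i"
  assumes Psi: "Psi : vtest"
  shows "wder j (abs_L2 Psi) (abs_L2 (vpd j Psi))"
  unfolding wder_def
proof
  fix Phi :: "real^'d => complex^'i" assume Phi: "Phi : vtest"
  have "((%t. ((1 / t) *R (shift (t *R axis j 1) (abs_L2 Psi) - abs_L2 Psi)) *. abs_L2 Phi) \<longlongrightarrow> abs_L2 (vpd j Psi) *. abs_L2 Phi) (at 0)"
    using diff_quot_tendsto[OF Psi, of "axis j 1"]
    by (intro tendsto_intros) (simp add: abs_L2_dirderiv_axis Psi)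
  moreover have "((1 / t) *R (shift (t *R axis j 1) (abs_L2 Psi) - abs_L2 Psi)) *. abs_L2 Phi
    = abs_L2 Psi *. ((1 / t) *R (shift (t *R axis j (-1)) (abs_L2 Phi) - abs_L2 Phi))" for t
  proof -
    have "- (t *R axis j 1) = (t *R axis j (-1) :: real^'d)" by (simp add: vec_eq_iff axis_def)
    thus ?thesis by (simp add: inner_diff_left inner_diff_right inner_shift_left)
  qed
  moreover have "((%t. abs_L2 Psi *. ((1 / t) *R (shift (t *R axis j (-1)) (abs_L2 Phi) - abs_L2 Phi))) \<longlongrightarrow> abs_L2 Psi *. (- abs_L2 (vpd j Phi))) (at 0)"
    using diff_quot_tendsto[OF Phi, of "axis j (-1)"]
    by (intro tendsto_intros) (simp add: abs_L2_dirderiv_axis Phi)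
  ultimately have "abs_L2 (vpd j Psi) *. abs_L2 Phi = abs_L2 Psi *. (- abs_L2 (vpd j Phi))"
    by (simp only: tendsto_unique[OF at_neq_bot])
  thus "abs_L2 Psi *. abs_L2 (vpd j Phi) = - (abs_L2 (vpd j Psi) *. abs_L2 Phi)" by simp
qed

lemma vpd_shift:
  fixes Psi :: "real^'d => complex^'i"
  assumes Psi: "smooth_vec Psi"
  shows "vpd j (%x. Psi (x + h)) = (%x. vpd j Psi (x + h))"
  using pderiv_cl_affine[of "%x. Psi x $ i" j 1 h for i] smooth_fun_diffble assms
  by (auto simp: vpd_def smooth_vec_def fun_eq_iff)

lemma wder_shift:
  assumes "wder j u g"
  shows "wder j (shift h u) (shift h g)"
  unfolding wder_def
proof
  fix Psi :: "real^'a => complex^'b" assume Psi: "Psi : vtest"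
  have s: "shift (- h) (abs_L2 Phi) = abs_L2 (%x. Phi (x - h))" if "Phi : vtest" for Phi :: "real^'a => complex^'b"
    using that by (simp add: shift_abs_L2 vtest_sqint)
  show "shift h u *. abs_L2 (vpd j Psi) = - (shift h g *. abs_L2 Psi)"
    using wderD[OF assms vtest_shift[OF Psi, of "- h"]] vpd_shift[OF vtest_smooth[OF Psi], of j "- h"]
    by (simp add: inner_shift_left s Psi vtest_vpd)
qed

section \<open>Averages of translations\<close>

text \<open>The integrand is continuous with values in the Banach space \<open>L2\<close>. The
  parameter space is left open for two uses: \<open>T w = (- eps) *R w\<close> on the full space
  gives the cell average, and \<open>T t = t *R axis k del\<close> on the reals averages in one
  direction.\<close>

definition avg :: "('b::euclidean_space => real^'d) => ('d, 'i::finite) L2 => ('d, 'i) L2" where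
  "avg T u = integral (cbox 0 One) (%w. shift (T w) u)"

context
  fixes T :: "'b::euclidean_space => real^'d"
  assumes T: "bounded_linear T"
begin

lemma continuous_on_shift_compose: "continuous_on S (%w. shift (T w) u)"
  by (intro continuous_on_compose2[OF continuous_on_shift[of UNIV]] linear_continuous_on T) auto

lemma avg_integrable: "(%w. shift (T w) u) integrable_on cbox 0 One"
  by (intro integrable_continuous continuous_on_shift_compose)

lemma inner_avg: "avg T u *. v = integral (cbox 0 One) (%w. shift (T w) u *. v)"
  unfolding avg_def
  using integral_linear[OF avg_integrable bounded_linear_inner_left, of v u] by (simp add: o_def)

lemma norm_avg_diff_le:
  assumes "!!w. w : cbox 0 One ==> norm (shift (T w) u - v) <= B"
  shows "norm (avg T u - v) <= B"
proof -
  have B: "0 <= B" using assms[of 0] by (simp add: mem_box) (meson norm_ge_zero order_trans)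
  have "avg T u - v = integral (cbox 0 One) (%w. shift (T w) u - v)"
    unfolding avg_def
    by (subst Henstock_Kurzweil_Integration.integral_diff[OF avg_integrable integrable_const]) simp
  also have "norm ... <= B * measure lborel (cbox 0 (One::'b))"
    by (rule integrable_bound[OF B]) (auto intro!: integrable_diff avg_integrable assms)
  finally show ?thesis by simp
qed

lemma norm_avg_le: "norm (avg T u) <= norm u"
  using norm_avg_diff_le[of u 0 "norm u"] by simp

lemma bounded_linear_avg: "bounded_linear (avg T)"
proof (rule bounded_linear_intro[where K=1])
  show "avg T (u + v) = avg T u + avg T v" for u v :: "('d, 'i::finite) L2"
    unfolding avg_def by (simp add: shift_linear Henstock_Kurzweil_Integration.integral_add avg_integrable)
  show "avg T (r *R u) = r *R avg T u" for r and u :: "('d, 'i::finite) L2"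
    unfolding avg_def by (simp add: shift_linear)
qed (simp add: norm_avg_le)

lemmas avg_linear = linear_diff[OF bounded_linear.linear[OF bounded_linear_avg]]
  linear_add[OF bounded_linear.linear[OF bounded_linear_avg]]
  linear_scale[OF bounded_linear.linear[OF bounded_linear_avg]]
  linear_sum[OF bounded_linear.linear[OF bounded_linear_avg]]

lemma wder_avg:
  fixes u g :: "('d, 'e::finite) L2"
  assumes "wder j u g"
  shows "wder j (avg T u) (avg T g)"
  unfolding wder_def
proof
  fix Psi :: "real^'d => complex^'e" assume Psi: "Psi : vtest"
  have "(%w. shift (T w) u *. abs_L2 (vpd j Psi)) = (%w. - (shift (T w) g *. abs_L2 Psi))"
    using wderD[OF wder_shift[OF assms] Psi] by blast
  thus "avg T u *. abs_L2 (vpd j Psi) = - (avg T g *. abs_L2 Psi)" by (simp add: inner_avg)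
qed

definition fun_avg :: "(real^'d => complex) => real^'d => complex" where
  "fun_avg f x = integral (cbox 0 One) (%w. f (x + T w))"

lemma continuous_on_T [continuous_intros]: "continuous_on S g ==> continuous_on S (%x. T (g x))"
  by (intro continuous_on_compose2[OF linear_continuous_on[OF T, of UNIV]]) auto

lemma fun_avg_has_derivative:
  assumes f: "smooth_fun f"
  shows "(fun_avg f has_derivative (%h. SUM j:UNIV. h $ j *R fun_avg (pd j f) x)) (at x)"
proof -
  \<comment> \<open>The Leibniz rule asks for a derivative that is jointly continuous in operator
    norm, hence the bounded linear functions.\<close>
  define D :: "real^'d => 'b => (real^'d) \<Rightarrow>\<^sub>L complex" where "D x w = (SUM j:UNIV. blinfun_compose (blinfun_scaleR_left (pd j f (x + T w))) (blinfun_inner_right (axis j 1)))" for x w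
  have Dapp: "blinfun_apply (D x w) h = (SUM j:UNIV. h $ j *R pd j f (x + T w))" for x w and h :: "real^'d"
    by (simp add: D_def blinfun.sum_left inner_commute cart_eq_inner_axis)
  have cont: "continuous_on (UNIV \<times> cbox 0 One) (%(x, w). D x w)"
  proof -
    have "continuous_on S (%p. pd j f (fst p + T (snd p)))" for j and S :: "((real^'d) \<times> 'b) set"
      by (intro continuous_on_compose2[OF smooth_fun_cont[OF smooth_fun_pderiv[OF f], of UNIV]] continuous_intros) auto
    thus ?thesis unfolding D_def case_prod_beta
      by (intro continuous_on_sum continuous_intros bounded_linear.continuous_on[OF bounded_linear_blinfun_scaleR_left]
        bounded_bilinear.continuous_on[OF bounded_bilinear_blinfun_compose]) auto
  qed
  have int: "(%w. g (x + T w)) integrable_on cbox 0 One" if "continuous_on UNIV g" for g :: "real^'d => complex" and x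
    by (intro integrable_continuous continuous_on_compose2[OF that] continuous_intros) auto
  have "((%x. integral (cbox 0 One) (%w. f (x + T w))) has_derivative blinfun_apply (integral (cbox 0 One) (D x))) (at x within UNIV)"
  proof (rule leibniz_rule[where fx=D])
    fix x w
    have "((%x. f (x + T w)) has_derivative (%h. SUM j:UNIV. h $ j *R pd j f (x + T w))) (at x)"
      by (rule has_derivative_compose[OF _ has_derivative_pderiv_cl[OF smooth_fun_diffble[OF f]]])
        (auto intro!: derivative_eq_intros)
    thus "((%x. f (x + T w)) has_derivative blinfun_apply (D x w)) (at x within UNIV)"
      by (simp add: Dapp[abs_def])
  qed (auto intro!: int smooth_fun_cont f cont)
  moreover have "blinfun_apply (integral (cbox 0 One) (D x)) h = (SUM j:UNIV. h $ j *R fun_avg (pd j f) x)" for h :: "real^'d"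
  proof -
    have "continuous_on (cbox 0 One) (D x)"
    proof -
      have "continuous_on (cbox 0 One) (%w. (%(x, w). D x w) (x, w))"
        by (rule continuous_on_compose2[OF cont]) (intro continuous_on_Pair continuous_on_const continuous_on_id, auto)
      thus ?thesis by simp
    qed
    hence "D x integrable_on cbox 0 One" by (rule integrable_continuous)
    hence "blinfun_apply (integral (cbox 0 One) (D x)) h = integral (cbox 0 One) (%w. blinfun_apply (D x w) h)"
      by (rule blinfun_apply_integral)
    also have "... = (SUM j:UNIV. integral (cbox 0 One) (%w. h $ j *R pd j f (x + T w)))"
      unfolding Dapp
      by (intro Henstock_Kurzweil_Integration.integral_sum integrable_cmul int smooth_fun_cont smooth_fun_pderiv f) auto
    finally show ?thesis by (simp add: fun_avg_def)
  qed
  hence "blinfun_apply (integral (cbox 0 One) (D x)) = (%h. SUM j:UNIV. h $ j *R fun_avg (pd j f) x)" by blast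
  ultimately show ?thesis by (simp only: fun_avg_def[of f, abs_def])
qed

lemma smooth_fun_fun_avg:
  assumes "smooth_fun f" shows "smooth_fun (fun_avg f)"
proof (rule smooth_fun_coinduct[of _ "fun_avg ` Collect smooth_fun"])
  show "fun_avg f : fun_avg ` Collect smooth_fun" using assms by blast
next
  fix g x assume "g : fun_avg ` Collect smooth_fun"
  thus "g differentiable (at x)" using fun_avg_has_derivative differentiableI by blast
next
  fix g j assume "g : fun_avg ` Collect smooth_fun"
  then obtain f where f: "smooth_fun f" "g = fun_avg f" by blast
  have "pd j (fun_avg f) x = fun_avg (pd j f) x" for x
  proof -
    have "pd j (fun_avg f) x = (SUM k:UNIV. (axis j 1 :: real^'d) $ k *R fun_avg (pd k f) x)"
      by (rule pderiv_clI[OF fun_avg_has_derivative[OF f(1)]])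
    also have "... = (SUM k:UNIV. if k = j then fun_avg (pd j f) x else 0)"
      by (rule sum.cong) (auto simp: axis_def)
    finally show ?thesis by simp
  qed
  thus "pd j g : fun_avg ` Collect smooth_fun" using f smooth_fun_pderiv by auto
qed

text \<open>An integral with values in \<open>L2\<close> has no values at points. It is identified
  with the pointwise average \<open>Phi\<close> by pairing both with test functions and using
  Fubini.\<close>

lemma avg_vtest:
  fixes Psi :: "real^'d => complex^'i"
  assumes Psi: "Psi : vtest"
  obtains Phi where "Phi : vtest" "avg T (abs_L2 Psi) = abs_L2 Phi"
proof -
  define Phi :: "real^'d => complex^'i" where "Phi x = (\<chi> i. fun_avg (%x. Psi x $ i) x)" for x
  obtain R where R: "!!x. R < norm x ==> Psi x = 0" by (rule vtest_support[OF Psi]) blast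
  have "compact (T ` cbox 0 One)" by (intro compact_continuous_image continuous_intros) auto
  then obtain M where M: "!!w. w : cbox 0 One ==> norm (T w) <= M"
    using compact_imp_bounded bounded_iff by (metis imageI)
  have Phi0: "Phi x = 0" if "R + M < norm x" for x
  proof -
    have "Psi (x + T w) = 0" if w: "w : cbox 0 One" for w
    proof (rule R)
      show "R < norm (x + T w)" using M[OF w] \<open>R + M < norm x\<close> norm_triangle_ineq4[of "x + T w" "T w"] by simp
    qed
    hence "fun_avg (%x. Psi x $ i) x = integral (cbox 0 (One::'b)) (%w. 0)" for i
      unfolding fun_avg_def by (intro integral_cong) simp
    thus ?thesis by (simp add: Phi_def vec_eq_iff)
  qed
  have v: "Phi : vtest"
    unfolding vtest_def test_fun_iff
  proof (intro CollectI allI conjI exI)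
    fix i
    show "smooth_fun (%x. Phi x $ i)" unfolding Phi_def
      using smooth_fun_fun_avg[of "%x. Psi x $ i"] vtest_smooth[OF Psi] by (simp add: smooth_vec_def)
    show "compact (cball (0::real^'d) (R + M))" by simp
    show "x ~: cball 0 (R + M) --> Phi x $ i = 0" for x using Phi0[of x] by simp
  qed simp
  have "avg T (abs_L2 Psi) - abs_L2 Phi = 0"
  proof (rule orthogonal_vtest_imp_0)
    fix \<Theta> :: "real^'d => complex^'i" assume \<Theta>: "\<Theta> : vtest"
    obtain R' where R': "!!x. R' < norm x ==> \<Theta> x = 0" by (rule vtest_support[OF \<Theta>]) blast
    define k where "k w x = Psi (x + T w) *. \<Theta> x" for w x
    have kc: "continuous_on S (%p. k (fst p) (snd p))" for S
      unfolding k_def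
      by (intro continuous_intros continuous_on_compose2[OF smooth_vec_continuous[OF vtest_smooth[OF Psi], of UNIV]]
          continuous_on_compose2[OF smooth_vec_continuous[OF vtest_smooth[OF \<Theta>], of UNIV]]) auto
    define K where "K w x = indicator (cbox 0 One) w *R k w x" for w x
    have "integrable lborel (%p. indicator (cbox 0 One \<times> cball 0 R') p *R k (fst p) (snd p))"
      by (rule borel_integrable_compact[OF _ kc]) (intro compact_Times compact_cbox compact_cball)
    moreover have "indicator (cbox 0 One \<times> cball 0 R') p *R k (fst p) (snd p) = (case p of (w, x) => K w x)" for p
      using R'[of "snd p"] by (auto simp: K_def k_def indicator_def split: prod.split)
    ultimately have Ki: "integrable (lborel \<Otimes>\<^sub>M lborel) (%(w, x). K w x)"
      by (simp add: lborel_prod)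
    have L: "shift (T w) (abs_L2 Psi) *. abs_L2 \<Theta> = (LINT x|lborel. k w x)" for w
      using vtest_sqint[OF Psi] vtest_sqint[OF \<Theta>]
      by (simp add: shift_abs_L2 inner_abs_L2_lborel sqint_shift k_def)
    have "avg T (abs_L2 Psi) *. abs_L2 \<Theta> = integral (cbox 0 One) (%w. LINT x|lborel. k w x)"
      by (simp add: inner_avg L)
    also have "... = (LINT w|lborel. indicator (cbox 0 One) w *R (LINT x|lborel. k w x))"
    proof -
      have "continuous_on (cbox 0 One) (%w. LINT x|lborel. k w x)"
        unfolding L[symmetric] by (intro continuous_on_inner continuous_on_shift_compose continuous_intros)
      from set_borel_integral_eq_integral(2)[OF borel_integrable_compact[OF compact_cbox this, folded set_integrable_def]]
      show ?thesis by (simp add: set_lebesgue_integral_def)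
    qed
    also have "... = (LINT w|lborel. LINT x|lborel. K w x)"
      by (simp add: K_def)
    also have "... = (LINT x|lborel. LINT w|lborel. K w x)"
      using lborel_pair.Fubini_integral[OF Ki] by simp
    also have "... = (LINT x|lborel. Phi x *. \<Theta> x)"
    proof (rule LINT_cong)
      fix x :: "real^'d"
      have c: "continuous_on (cbox 0 One) (%w. Psi (x + T w))"
        by (intro continuous_on_compose2[OF smooth_vec_continuous[OF vtest_smooth[OF Psi], of UNIV]] continuous_intros) auto
      have "(LINT w|lborel. K w x) = (LINT w:cbox 0 One|lborel. Psi (x + T w) *. \<Theta> x)"
        by (simp add: K_def k_def set_lebesgue_integral_def)
      also have "... = integral (cbox 0 One) (%w. Psi (x + T w) *. \<Theta> x)"
        by (rule set_borel_integral_eq_integral(2), unfold set_integrable_def, rule borel_integrable_compact)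
          (auto intro!: continuous_on_inner c continuous_intros)
      also have "... = integral (cbox 0 One) (%w. SUM i:UNIV. Psi (x + T w) $ i *. \<Theta> x $ i)"
        by (simp add: inner_vec_def)
      also have "... = (SUM i:UNIV. integral (cbox 0 One) (%w. Psi (x + T w) $ i *. \<Theta> x $ i))"
        by (intro Henstock_Kurzweil_Integration.integral_sum integrable_continuous continuous_on_inner continuous_on_component c continuous_intros) auto
      also have "... = (SUM i:UNIV. Phi x $ i *. \<Theta> x $ i)"
      proof (rule sum.cong)
        fix i
        have "(%w. Psi (x + T w) $ i) integrable_on cbox 0 One"
          by (intro integrable_continuous continuous_on_component c)
        from integral_linear[OF this bounded_linear_inner_left[of "\<Theta> x $ i"]]
        show "integral (cbox 0 One) (%w. Psi (x + T w) $ i *. \<Theta> x $ i) = Phi x $ i *. \<Theta> x $ i"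
          by (simp add: o_def Phi_def fun_avg_def)
      qed simp
      finally show "(LINT w|lborel. K w x) = Phi x *. \<Theta> x" by (simp add: inner_vec_def)
    qed simp
    also have "... = abs_L2 Phi *. abs_L2 \<Theta>"
      by (simp add: inner_abs_L2_lborel vtest_sqint v \<Theta>)
    finally show "(avg T (abs_L2 Psi) - abs_L2 Phi) *. abs_L2 \<Theta> = 0" by (simp add: inner_diff_left)
  qed
  thus thesis using that v by simp
qed

end

text \<open>Averaging along an axis gains a derivative there: by the fundamental theorem of
  calculus, differentiating the average leaves the difference of the end points. The computation
  takes place on the test function.\<close>

lemma wder_avg_direction:
  fixes u :: "('d::finite, 'i::finite) L2" and del :: real
  assumes del: "del ~= 0"
  shows "wder k (avg (%t::real. t *R axis k del) u) ((1 / del) *R (shift (axis k del) u - u))"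
  unfolding wder_def
proof
  fix Psi :: "real^'d => complex^'i" assume Psi: "Psi : vtest"
  let ?T = "%t::real. t *R (axis k del :: real^'d)"
  have T: "bounded_linear ?T" by (rule bounded_linear_scaleR_left)
  have "((%t. shift (t *R axis k (- del)) (abs_L2 Psi)) has_vector_derivative
      shift (t *R axis k (- del)) ((- del) *R abs_L2 (vpd k Psi))) (at t within {0..1})" for t
    using shift_vtest_has_vector_derivative[OF Psi, of "axis k (- del)" t] by (simp add: abs_L2_dirderiv_axis Psi)
  from bounded_linear.has_vector_derivative[OF bounded_linear_inner_right[of u] this]
  have "((%t. u *. shift (t *R axis k (- del)) (abs_L2 Psi)) has_vector_derivative
      - del * (u *. shift (t *R axis k (- del)) (abs_L2 (vpd k Psi)))) (at t within {0..1})" for t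
    by (simp add: shift_linear)
  from fundamental_theorem_of_calculus[of 0 1, OF _ this]
  have "((%t. - del * (u *. shift (t *R axis k (- del)) (abs_L2 (vpd k Psi)))) has_integral
     (u *. shift (axis k (- del)) (abs_L2 Psi) - u *. abs_L2 Psi)) {0..1}" by simp
  from has_integral_mult_right[OF this, of "- (1 / del)"]
  have "((%t. u *. shift (t *R axis k (- del)) (abs_L2 (vpd k Psi))) has_integral
     - (1 / del) * (u *. shift (axis k (- del)) (abs_L2 Psi) - u *. abs_L2 Psi)) {0..1}" using del by simp
  hence i: "integral {0..1} (%t. u *. shift (t *R axis k (- del)) (abs_L2 (vpd k Psi)))
     = - (1 / del) * (u *. shift (axis k (- del)) (abs_L2 Psi) - u *. abs_L2 Psi)" by (rule integral_unique)
  have neg: "- axis k del = (axis k (- del) :: real^'d)" by (simp add: vec_eq_iff axis_def)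
  have "avg ?T u *. abs_L2 (vpd k Psi) = integral {0..1} (%t. u *. shift (t *R axis k (- del)) (abs_L2 (vpd k Psi)))"
    by (simp add: inner_avg[OF T] inner_shift_left scaleR_minus_right[symmetric] neg del: scaleR_minus_right)
  also have "... = - (1 / del) * (u *. shift (axis k (- del)) (abs_L2 Psi) - u *. abs_L2 Psi)" by (rule i)
  finally show "avg ?T u *. abs_L2 (vpd k Psi) = - (((1 / del) *R (shift (axis k del) u - u)) *. abs_L2 Psi)"
    by (simp add: inner_diff_left inner_shift_left neg)
qed

section \<open>Density of test functions in \<open>H\<^sup>1\<close>\<close>

text \<open>Averaging over all coordinate directions is bounded from \<open>L^2\<close> to \<open>H\<^sup>1\<close> and preserves test functions.\<close>

definition steklov :: "real => 'd list => ('d::finite, 'i::finite) L2 => ('d, 'i) L2" where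
  "steklov del js u = foldr (%k. avg (%t::real. t *R axis k del)) js u"

lemma steklov_Cons: "steklov del (k # js) u = avg (%t::real. t *R axis k del) (steklov del js u)"
  and steklov_Nil: "steklov del [] u = u"
  by (simp_all add: steklov_def)

lemmas avg_axis = bounded_linear_scaleR_left[of "axis k del :: real^'d" for k del]

lemma steklov_diff: "steklov del js (u - v) = steklov del js u - steklov del js v"
  by (induction js) (auto simp: steklov_Nil steklov_Cons avg_linear[OF avg_axis])

lemma norm_steklov_le: "norm (steklov del js u) <= norm u"
  by (induction js) (auto simp: steklov_Nil steklov_Cons intro: order_trans[OF norm_avg_le[OF avg_axis]])

lemma wder_steklov: "wder j u g ==> wder j (steklov del js u) (steklov del js g)"
  by (induction js) (auto simp: steklov_Nil steklov_Cons intro: wder_avg[OF avg_axis])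

lemma steklov_vtest:
  fixes Psi :: "real^'d => complex^'i"
  assumes "Psi : vtest"
  shows "EX Phi:vtest. steklov del js (abs_L2 Psi) = abs_L2 Phi"
proof (induction js)
  case (Cons k js)
  then obtain Phi where "Phi : vtest" "steklov del js (abs_L2 Psi) = abs_L2 Phi" by blast
  thus ?case unfolding steklov_Cons by (metis avg_vtest[OF avg_axis])
qed (use assms in \<open>auto simp: steklov_Nil\<close>)

text \<open>Only the average in direction \<open>k\<close> gains the derivative, at the price
  \<open>2 / del\<close>; the averages applied after it commute with differentiation and do not
  increase the norm.\<close>

lemma steklov_wder_bound:
  assumes "0 < del" "k : set js"
  shows "EX g. wder k (steklov del js u) g & norm g <= 2 / del * norm u"
  using assms(2)
proof (induction js)
  case (Cons j js)
  show ?case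
  proof (cases "k = j")
    case True
    let ?v = "steklov del js u"
    have "norm ((1 / del) *R (shift (axis k del) ?v - ?v)) <= (1 / del) * (norm u + norm u)"
      using assms(1) norm_triangle_ineq4[of "shift (axis k del) ?v" ?v] norm_steklov_le[of del js u]
      by (simp add: divide_right_mono)
    thus ?thesis using wder_avg_direction[of del k ?v] assms(1) True
      by (auto simp: steklov_Cons)
  next
    case False
    then obtain g where "wder k (steklov del js u) g" "norm g <= 2 / del * norm u" using Cons by auto
    thus ?thesis unfolding steklov_Cons
      using wder_avg[OF avg_axis] order_trans[OF norm_avg_le[OF avg_axis]] by blast
  qed
qed simp

lemma steklov_near:
  assumes "0 <= del" "!!h. norm h <= del ==> norm (shift h u - u) <= e"
  shows "norm (steklov del js u - u) <= real (length js) * e"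
proof (induction js)
  case (Cons k js)
  let ?T = "%t::real. t *R (axis k del :: real^'a)"
  have "norm (avg ?T u - u) <= e"
  proof (rule norm_avg_diff_le[OF avg_axis])
    fix t :: real assume "t : cbox 0 One"
    hence "\<bar>t\<bar> * del <= 1 * del" using assms(1) by (intro mult_right_mono) auto
    thus "norm (shift (?T t) u - u) <= e" using assms(1) by (intro assms(2)) (simp add: norm_axis)
  qed
  moreover have "norm (avg ?T (steklov del js u - u)) <= real (length js) * e"
    using norm_avg_le[OF avg_axis] Cons by (rule order_trans)
  moreover have "steklov del (k # js) u - u = avg ?T (steklov del js u - u) + (avg ?T u - u)"
    by (simp add: steklov_Cons avg_linear[OF avg_axis])
  ultimately show ?case
    using norm_triangle_ineq[of "avg ?T (steklov del js u - u)" "avg ?T u - u"] by (simp add: algebra_simps)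
qed (simp add: steklov_Nil)

text \<open>The average \<open>S u\<close> is close to \<open>u\<close> in H^1, because
  \<open>S\<close> commutes with derivatives and is near the identity. Then \<open>u\<close> is
  approximated by a test function in L^2 only; applying \<open>S\<close> upgrades this to H^1, since
  \<open>S\<close> gains one derivative.\<close>

lemma vtest_dense_H1:
  fixes u :: "('d::finite, 'i::finite) L2"
  assumes g: "!!j. wder j u (g j)" and e: "0 < e"
  obtains Psi where "Psi : vtest" "norm (u - abs_L2 Psi) < e" "!!j. norm (g j - abs_L2 (vpd j Psi)) < e"
proof -
  obtain js where js: "set js = (UNIV :: 'd set)" using finite_list[OF finite_class.finite_UNIV] by blast
  \<comment> \<open>Each of the \<open>length js\<close> averages costs \<open>e'\<close>; together
    they stay below \<open>e / 2\<close>.\<close>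
  define e' where "e' = e / (2 * (real (length js) + 1))"
  have e': "0 < e'" "real (length js) * e' < e / 2" using e by (simp_all add: e'_def field_simps)
  obtain r0 where r0: "0 < r0" "!!h. norm h <= r0 ==> norm (shift h u - u) < e'"
    using shift_near_0[OF e'(1)] by blast
  have "ALL j. EX r>0. ALL h. norm h <= r --> norm (shift h (g j) - g j) < e'"
    using shift_near_0[OF e'(1)] by metis
  then obtain r where r: "!!j. 0 < r j" "!!j h. norm h <= r j ==> norm (shift h (g j) - g j) < e'" by metis
  define del where "del = min r0 (Min (range r))"
  have del: "0 < del" "del <= r0" "!!j. del <= r j" using r0 r by (auto simp: del_def min_le_iff_disj)
  let ?S = "%u. steklov del js u"
  have Su: "norm (?S u - u) < e / 2"
    using steklov_near[of del u e' js] del r0(2) e'(2) by (smt (verit) less_imp_le)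
  have Sg: "norm (?S (g j) - g j) < e / 2" for j
  proof -
    have "norm (?S (g j) - g j) <= real (length js) * e'"
    proof (rule steklov_near)
      show "norm (shift h (g j) - g j) <= e'" if "norm h <= del" for h
        using r(2)[of h j] that del(3)[of j] by linarith
    qed (use del in simp)
    thus ?thesis using e'(2) by linarith
  qed
  \<comment> \<open>The second entry absorbs the factor \<open>2 / del\<close> that \<open>S\<close>
    costs on derivatives.\<close>
  define f where "f = min (e / 2) (e * del / 4)"
  have f: "0 < f" using e del by (simp add: f_def)
  obtain Phi where Phi: "Phi : vtest" "norm (u - abs_L2 Phi) < f" using vtest_approx[OF f] by blast
  obtain Psi where Psi: "Psi : vtest" "?S (abs_L2 Phi) = abs_L2 Psi" using steklov_vtest[OF Phi(1)] by blast
  have "norm (?S u - abs_L2 Psi) <= norm (u - abs_L2 Phi)"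
    using norm_steklov_le[of del js "u - abs_L2 Phi"] by (simp add: steklov_diff Psi)
  also have "... < e / 2" using Phi(2) by (simp add: f_def)
  finally have "norm (u - abs_L2 Psi) < e"
    using Su norm_triangle_ineq[of "u - ?S u" "?S u - abs_L2 Psi"] by (simp add: norm_minus_commute)
  moreover have "norm (g j - abs_L2 (vpd j Psi)) < e" for j
  proof -
    obtain g' where g': "wder j (?S (u - abs_L2 Phi)) g'" "norm g' <= 2 / del * norm (u - abs_L2 Phi)"
      using steklov_wder_bound[of del j js] del js by blast
    have "wder j (?S (u - abs_L2 Phi)) (?S (g j) - abs_L2 (vpd j Psi))"
      unfolding steklov_diff Psi(2) by (intro wder_diff wder_steklov g wder_vtest Psi)
    hence eq: "g' = ?S (g j) - abs_L2 (vpd j Psi)" using g'(1) wder_unique by blast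
    have "2 / del * norm (u - abs_L2 Phi) < 2 / del * f" using Phi(2) del by (intro mult_strict_left_mono) auto
    also have "... <= 2 / del * (e * del / 4)" using del by (intro mult_left_mono) (auto simp: f_def)
    also have "... = e / 2" using del by simp
    finally have "norm (?S (g j) - abs_L2 (vpd j Psi)) < e / 2" using g'(2) eq by simp
    thus ?thesis
      using Sg[of j] norm_triangle_ineq[of "g j - ?S (g j)" "?S (g j) - abs_L2 (vpd j Psi)"] by (simp add: norm_minus_commute)
  qed
  ultimately show thesis using that Psi(1) by blast
qed

lemma norm_shift_diff_le:
  fixes u :: "('d::finite, 'i::finite) L2"
  assumes g: "!!j. wder j u (g j)"
  shows "norm (shift h u - u) <= (SUM j:UNIV. \<bar>h $ j\<bar> * norm (g j))"
proof (rule field_le_epsilon)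
  let ?S = "SUM j:UNIV. \<bar>h $ j\<bar> * norm (g j)"
  fix e :: real assume e: "0 < e"
  define H where "H = (SUM j:UNIV. \<bar>h $ j\<bar>)"
  have H: "0 <= H" by (simp add: H_def sum_nonneg)
  define f where "f = e / (H + 2)"
  have f: "0 < f" using e H by (simp add: f_def)
  obtain Psi where Psi: "Psi : vtest" "norm (u - abs_L2 Psi) < f" "!!j. norm (g j - abs_L2 (vpd j Psi)) < f"
    using vtest_dense_H1[OF g f] by blast
  have "shift h u - u = shift h (u - abs_L2 Psi) + (shift h (abs_L2 Psi) - abs_L2 Psi) - (u - abs_L2 Psi)"
    by (simp add: shift_linear)
  hence "norm (shift h u - u) <= norm (shift h (u - abs_L2 Psi)) + norm (shift h (abs_L2 Psi) - abs_L2 Psi) + norm (u - abs_L2 Psi)"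
    using norm_triangle_ineq4[of "shift h (u - abs_L2 Psi) + (shift h (abs_L2 Psi) - abs_L2 Psi)" "u - abs_L2 Psi"]
      norm_triangle_ineq[of "shift h (u - abs_L2 Psi)" "shift h (abs_L2 Psi) - abs_L2 Psi"] by simp
  also have "... <= 2 * f + (SUM j:UNIV. \<bar>h $ j\<bar> * norm (abs_L2 (vpd j Psi)))"
    using Psi(2) norm_shift_vtest_diff_le[OF Psi(1), of h] by simp
  also have "(SUM j:UNIV. \<bar>h $ j\<bar> * norm (abs_L2 (vpd j Psi))) <= (SUM j:UNIV. \<bar>h $ j\<bar> * (norm (g j) + f))"
  proof (intro sum_mono mult_left_mono)
    fix j show "norm (abs_L2 (vpd j Psi)) <= norm (g j) + f"
      using Psi(3)[of j] norm_triangle_ineq2[of "abs_L2 (vpd j Psi)" "g j"] by (simp add: norm_minus_commute)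
  qed simp
  also have "... = ?S + H * f"
    by (simp add: H_def distrib_left sum.distrib sum_distrib_right)
  also have "2 * f + (?S + H * f) = ?S + (H + 2) * f"
    by (simp add: algebra_simps)
  also have "(H + 2) * f = e" using H by (simp add: f_def)
  finally show "norm (shift h u - u) <= ?S + e" by simp
qed

text \<open>Bounded difference quotients make \<open>Psi\<close> to
  \<open>- (u *. abs_L2 (vpd k Psi))\<close> a functional bounded by \<open>C\<close> on the test
  functions; its Riesz representer is the weak derivative.\<close>

lemma wder_ex_if_bounded:
  fixes u :: "('d::finite, 'i::finite) L2"
  assumes C: "0 <= C" and bd: "!!t. norm (shift (t *R axis k 1) u - u) <= C * \<bar>t\<bar>"
  obtains g where "wder k u g" "norm g <= C"
proof -
  let ?s = "%t Psi. shift (t *R axis k 1) (abs_L2 Psi) - abs_L2 Psi"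
  have le: "\<bar>u *. abs_L2 (vpd k Psi)\<bar> <= C * norm (abs_L2 Psi)" if Psi: "Psi : vtest" for Psi :: "real^'d => complex^'i"
  proof (rule tendsto_upperbound)
    show "((%t. \<bar>u *. ((1 / t) *R ?s t Psi)\<bar>) \<longlongrightarrow> \<bar>u *. abs_L2 (vpd k Psi)\<bar>) (at 0)"
      using diff_quot_tendsto[OF Psi, of "axis k 1"]
      by (intro tendsto_intros) (simp add: abs_L2_dirderiv_axis Psi)
    show "\<forall>\<^sub>F t in at 0. \<bar>u *. ((1 / t) *R ?s t Psi)\<bar> <= C * norm (abs_L2 Psi)"
      unfolding eventually_at_filter
    proof (intro always_eventually allI impI)
      fix t :: real assume t: "t ~= 0"
      have "u *. ?s t Psi = (shift ((- t) *R axis k 1) u - u) *. abs_L2 Psi"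
        by (simp add: inner_diff_left inner_diff_right inner_shift_left)
      also have "\<bar>...\<bar> <= C * \<bar>- t\<bar> * norm (abs_L2 Psi)"
        by (rule order_trans[OF Cauchy_Schwarz_ineq2 mult_right_mono[OF bd]]) simp
      finally have f: "\<bar>u *. ?s t Psi\<bar> <= C * \<bar>- t\<bar> * norm (abs_L2 Psi)" .
      have "\<bar>u *. ((1 / t) *R ?s t Psi)\<bar>
          = \<bar>u *. ?s t Psi\<bar> / \<bar>t\<bar>" by simp
      also have "... <= (C * \<bar>- t\<bar> * norm (abs_L2 Psi)) / \<bar>t\<bar>" by (rule divide_right_mono[OF f]) simp
      also have "... = C * norm (abs_L2 Psi)" using t by simp
      finally show "\<bar>u *. ((1 / t) *R ?s t Psi)\<bar> <= C * norm (abs_L2 Psi)" .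
    qed
  qed simp
  \<comment> \<open>The functional is defined on classes by choosing a test function in each;
    uniqueness of weak derivatives makes the choice irrelevant.\<close>
  define l where "l v = - (u *. abs_L2 (vpd k (SOME Psi. Psi : vtest & v = abs_L2 Psi)))" for v :: "('d, 'i) L2"
  have l: "l (abs_L2 Psi) = - (u *. abs_L2 (vpd k Psi))" if Psi: "Psi : vtest" for Psi :: "real^'d => complex^'i"
  proof -
    define Phi where "Phi = (SOME Phi. Phi : vtest & abs_L2 Psi = abs_L2 Phi)"
    have Phi: "Phi : vtest & abs_L2 Psi = abs_L2 Phi" unfolding Phi_def by (rule someI[of _ Psi]) (use Psi in auto)
    hence "abs_L2 (vpd k Psi) = abs_L2 (vpd k Phi)" using wder_vtest[OF Psi, of k] wder_vtest[of Phi k] wder_unique by metis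
    thus ?thesis unfolding l_def Phi_def[symmetric] by simp
  qed
  obtain g where g: "!!x. x : abs_L2 ` vtest ==> l x = g *. x" "norm g <= C"
  proof (rule riesz_on_subspace[OF subspace_vtest, of l C])
    show "\<bar>l x\<bar> <= C * norm x" if x: "x : abs_L2 ` vtest" for x
    proof -
      obtain Psi where p: "Psi : vtest" "x = abs_L2 Psi" using x by blast
      show ?thesis using le[OF p(1)] l[OF p(1)] p(2) by simp
    qed
    show "l (x + y) = l x + l y" if xy: "x : abs_L2 ` vtest" "y : abs_L2 ` vtest" for x y
    proof -
      obtain Psi Phi where p: "Psi : vtest" "Phi : vtest" "x = abs_L2 Psi" "y = abs_L2 Phi" using xy by blast
      have e: "x + y = abs_L2 (%z. Psi z + Phi z)" using p by (simp add: plus_abs_L2_lborel vtest_sqint)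
      have "wder k (x + y) (abs_L2 (vpd k Psi) + abs_L2 (vpd k Phi))" using p by (auto intro: wder_add wder_vtest)
      hence "abs_L2 (vpd k (%z. Psi z + Phi z)) = abs_L2 (vpd k Psi) + abs_L2 (vpd k Phi)"
        using wder_vtest[OF vtest_add[OF p(1,2)], of k] wder_unique unfolding e by blast
      thus ?thesis using l[OF vtest_add[OF p(1,2)]] l[OF p(1)] l[OF p(2)] p(3,4) e
        by (simp add: inner_add_right)
    qed
    show "l (c *R x) = c * l x" if x: "x : abs_L2 ` vtest" for c x
    proof -
      obtain Psi where p: "Psi : vtest" "x = abs_L2 Psi" using x by blast
      have e: "c *R x = abs_L2 (%z. c *R Psi z)" using p by (simp add: scaleR_abs_L2_lborel vtest_sqint)
      have "wder k (c *R x) (c *R abs_L2 (vpd k Psi))" using p by (auto intro: wder_scaleR wder_vtest)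
      hence "abs_L2 (vpd k (%z. c *R Psi z)) = c *R abs_L2 (vpd k Psi)"
        using wder_vtest[OF vtest_scaleR[OF p(1)], of k c] wder_unique unfolding e by blast
      thus ?thesis using l[OF vtest_scaleR[OF p(1)], of c] l[OF p(1)] p(2) e by simp
    qed
  qed (use C in auto)
  have "wder k u g" unfolding wder_def
  proof
    fix Psi :: "real^'d => complex^'i" assume Psi: "Psi : vtest"
    thus "u *. abs_L2 (vpd k Psi) = - (g *. abs_L2 Psi)"
      using g(1)[OF imageI[OF Psi]] l[OF Psi] by simp
  qed
  thus thesis using that g(2) by blast
qed

section \<open>The product rule\<close>

definition mpd :: "'d => (real^'d => complex^'j^'i) => real^'d => complex^'j^'i" where
  "mpd k q x = (\<chi> i j. pd k (%x. q x $ i $ j) x)"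

definition smooth_mat :: "(real^'d => complex^'j^'i) => bool" where
  "smooth_mat q \<longleftrightarrow> (ALL i j. smooth_fun (%x. q x $ i $ j))"

lemma smooth_mat_adj: "smooth_mat q ==> smooth_mat (%x::real^'d. adj (q x))"
  unfolding smooth_mat_def adj_def by (auto intro: smooth_fun_cnj)

lemma mpd_adj:
  fixes q :: "real^'d => complex^'j^'i"
  assumes "smooth_mat q"
  shows "mpd k (%x. adj (q x)) = (%x. adj (mpd k q x))"
proof -
  have "pd k (%x. cnj (q x $ i $ j)) = (%x. cnj (pd k (%x. q x $ i $ j) x))" for i j
    by (rule pderiv_cl_cnj) (use assms in \<open>auto simp: smooth_mat_def intro: smooth_fun_diffble\<close>)
  thus ?thesis by (simp add: mpd_def adj_def fun_eq_iff vec_eq_iff)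
qed

lemma pderiv_cl_sum:
  fixes f :: "'k => real^'d => complex"
  assumes "!!k. k : S ==> smooth_fun (f k)"
  shows "pd j (%x. SUM k:S. f k x) = (%x. SUM k:S. pd j (f k) x)"
  using assms
proof (induction S rule: infinite_finite_induct)
  case (insert k S)
  hence "pd j (%x. f k x + (SUM k:S. f k x)) = (%x. pd j (f k) x + pd j (%x. SUM k:S. f k x) x)"
    by (intro pderiv_cl_add smooth_fun_diffble smooth_fun_sum) auto
  thus ?case using insert by simp
qed (simp_all add: pderiv_cl_const)

lemma vpd_mv:
  fixes q :: "real^'d => complex^'j^'i"
  assumes q: "smooth_mat q" and Psi: "smooth_vec Psi"
  shows "vpd k (%x. q x *v Psi x) = (%x. mpd k q x *v Psi x + q x *v vpd k Psi x)"
proof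
  fix x
  have s: "smooth_fun (%x. q x $ i $ j)" "smooth_fun (%x. Psi x $ j)" for i j
    using q Psi by (auto simp: smooth_mat_def smooth_vec_def)
  have "pd k (%x. SUM j:UNIV. q x $ i $ j * Psi x $ j) x
      = (SUM j:UNIV. q x $ i $ j * pd k (%x. Psi x $ j) x + pd k (%x. q x $ i $ j) x * Psi x $ j)" for i
    by (subst pderiv_cl_sum) (auto intro!: sum.cong smooth_fun_mult s simp: pderiv_cl_mult smooth_fun_diffble s)
  thus "vpd k (%x. q x *v Psi x) x = mpd k q x *v Psi x + q x *v vpd k Psi x"
    by (simp add: vec_eq_iff vpd_def mpd_def matrix_vector_mult_def sum.distrib)
qed

text \<open>The factor moves to the test function: \<open>adj (q x) *v Psi x\<close> is again a test
  function because \<open>q\<close> is smooth, and its derivative supplies both terms.\<close>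

lemma wder_mult:
  fixes q :: "real^'d => complex^'j^'i"
  assumes q: "smooth_mat q" "bmat q" "bmat (mpd k q)" and u: "wder k u g"
  shows "wder k (mult q u) (mult (mpd k q) u + mult q g)"
  unfolding wder_def
proof
  fix Psi :: "real^'d => complex^'i" assume Psi: "Psi : vtest"
  define Phi where "Phi x = adj (q x) *v Psi x" for x
  have Phi: "Phi : vtest" unfolding Phi_def
    using smooth_mat_adj[OF q(1)] Psi by (intro vtest_matrix) (auto simp: smooth_mat_def)
  have d: "vpd k Phi = (%x. adj (mpd k q x) *v Psi x + adj (q x) *v vpd k Psi x)"
    unfolding Phi_def using vpd_mv[OF smooth_mat_adj[OF q(1)] vtest_smooth[OF Psi]] mpd_adj[OF q(1)] by simp
  have sq: "Psi : sqint lborel" "vpd k Psi : sqint lborel"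
    by (intro vtest_sqint vtest_vpd Psi)+
  have "abs_L2 (vpd k Phi) = mult (%x. adj (mpd k q x)) (abs_L2 Psi) + mult (%x. adj (q x)) (abs_L2 (vpd k Psi))"
    unfolding d using sq q
    by (simp add: mult_abs_L2 bmat_adj plus_abs_L2_lborel sqint_mv)
  moreover have "abs_L2 Phi = mult (%x. adj (q x)) (abs_L2 Psi)"
    unfolding Phi_def using sq q by (simp add: mult_abs_L2 bmat_adj)
  ultimately have "u *. (mult (%x. adj (mpd k q x)) (abs_L2 Psi) + mult (%x. adj (q x)) (abs_L2 (vpd k Psi)))
      = - (g *. mult (%x. adj (q x)) (abs_L2 Psi))"
    using wderD[OF u Phi] by simp
  thus "mult q u *. abs_L2 (vpd k Psi) = - ((mult (mpd k q) u + mult q g) *. abs_L2 Psi)"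
    using q by (simp add: inner_mult inner_add_left inner_add_right)
qed

lemma wder_mult_const:
  fixes A :: "complex^'j^'i"
    and u g :: "('d::finite, 'j) L2"
  assumes "wder k u g" shows "wder k (mult (%_. A) u) (mult (%_. A) g)"
proof -
  have m: "mpd k (%_::real^'d. A) = (%_. 0)" by (simp add: mpd_def pderiv_cl_const vec_eq_iff fun_eq_iff)
  have "smooth_mat (%_::real^'d. A)" by (simp add: smooth_mat_def smooth_fun_const)
  from wder_mult[OF this _ _ assms] have "wder k (mult (%_. A) u) (mult (%_. 0) u + mult (%_. A) g)"
    by (simp add: m)
  moreover have "mult (%_. 0) u = (0 :: ('d, 'i) L2)" by (simp add: mult_def zero_abs_L2)
  ultimately show ?thesis by simp
qed

section \<open>The elliptic operators and their resolvents\<close>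

section \<open>The gradient\<close>

text \<open>Extracts column \<open>j\<close> of a matrix in \<open>complex^('n \<times> 'd)\<close>,
  so that applied to a gradient it gives the \<open>j\<close>-th partial derivative. Its adjoint
  inserts a vector as column \<open>j\<close>.\<close>

definition Pj :: "'d => complex^('n::finite \<times> 'd::finite)^'n" where
  "Pj j = (\<chi> i p. if p = (i, j) then 1 else 0)"

lemma Pj_apply [simp]: "(Pj j *v X) $ i = X $ (i, j)"
  by (simp add: Pj_def matrix_vector_mult_def if_distrib[of "%z. z * _"] cong: if_cong)

lemma adj_Pj_apply: "(adj (Pj j) *v v) $ (i, k) = (if k = j then v $ i else 0)"
proof -
  have "(adj (Pj j) *v v) $ (i, k) = (SUM i':UNIV. cnj (if (i, k) = (i', j) then 1 else 0) * v $ i')"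
    by (simp add: matrix_vector_mult_def adj_def Pj_def)
  also have "... = (SUM i':UNIV. if i' = i then (if k = j then v $ i else 0) else 0)"
    by (rule sum.cong) auto
  finally show ?thesis by simp
qed

lemma sum_adj_Pj: "(SUM j:UNIV. adj (Pj j) *v (Pj j *v X)) = (X :: complex^('n::finite \<times> 'd::finite))"
  by (simp add: vec_eq_iff adj_Pj_apply)

text \<open>The graph of \<open>op_grad\<close> in a form free of chosen representatives; see
  \<open>op_grad_iff\<close>.\<close>

definition grad_rel :: "('d::finite, 'n::finite) L2 => ('d, 'n \<times> 'd) L2 => bool" where
  "grad_rel u G \<longleftrightarrow> (ALL j. wder j u (mult (%_. Pj j) G))"

lemma sqint_cnj:
  "f : sqint M ==> (%x. cnj (f x)) : sqint M"
  using measurable_compose[OF _ borel_measurable_continuous_onI[OF continuous_on_cnj[OF continuous_on_id]], of f M]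
  by (simp add: square_integrable_def)

lemma abs_L2_inner_components:
  fixes F Psi :: "real^'d => complex^'i"
  assumes "F : sqint lebesgue" "Psi : sqint lebesgue"
  shows "abs_L2 F *. abs_L2 Psi = (SUM i:UNIV. Re (LINT x|lebesgue. F x $ i * cnj (Psi x $ i)))"
proof -
  have i: "integrable lebesgue (%x. F x $ i * cnj (Psi x $ i))" for i
  proof (rule sqint_mult)
    show "(%x. F x $ i) : sqint lebesgue" using assms sqint_vec by blast
    show "(%x. cnj (Psi x $ i)) : sqint lebesgue"
      by (rule sqint_cnj) (use assms sqint_vec in blast)
  qed
  have "abs_L2 F *. abs_L2 Psi = (LINT x|lebesgue. (SUM i:UNIV. Re (F x $ i * cnj (Psi x $ i))))"
    by (simp add: inner_abs_L2[OF assms] inner_vec_def inner_complex_Re)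
  also have "... = (SUM i:UNIV. (LINT x|lebesgue. Re (F x $ i * cnj (Psi x $ i))))"
    by (intro Bochner_Integration.integral_sum integrable_Re i)
  also have "... = (SUM i:UNIV. Re (LINT x|lebesgue. F x $ i * cnj (Psi x $ i)))"
    by (intro sum.cong refl integral_Re i)
  finally show ?thesis .
qed

lemma vtest_lebesgue: "Psi : vtest ==> Psi : sqint lebesgue"
  for Psi :: "real^'d => complex^'i"
  by (intro sqint_lb_leb vtest_sqint)

lemma vtest_axis:
  fixes psi :: "real^'d => complex"
  assumes "psi : test_fun UNIV"
  shows "(%x. axis i (psi x) :: complex^'i) : vtest"
  unfolding vtest_def
proof (intro CollectI allI)
  fix k show "(%x. axis i (psi x) $ k) : test_fun UNIV"
    using assms by (cases "k = i") (auto simp: axis_def test_fun_0)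
qed

lemma vpd_axis: "vpd j (%x. axis i (psi x)) = (%x. axis i (pd j psi x))"
proof (intro ext, subst vec_eq_iff, intro allI)
  fix x k show "vpd j (%x. axis i (psi x)) x $ k = axis i (pd j psi x) $ k"
    by (cases "k = i") (auto simp: vpd_def axis_def pderiv_cl_const)
qed

lemma pderiv_cl_cmult:
  fixes f :: "real^'d => complex"
  assumes "smooth_fun f" shows "pd j (%x. c * f x) = (%x. c * pd j f x)"
  using assms by (subst pderiv_cl_mult) (auto simp: pderiv_cl_const intro: smooth_fun_diffble)

lemma pderiv_cl_cnj_cmult:
  fixes f :: "real^'d => complex"
  assumes "smooth_fun f" shows "pd j (%x. cnj (c * f x)) = (%x. cnj (c * pd j f x))"
proof -
  have "(%x. c * f x) differentiable (at x)" for x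
    by (rule smooth_fun_diffble[OF smooth_fun_mult[OF smooth_fun_const assms]])
  from pderiv_cl_cnj[OF this] show ?thesis unfolding pderiv_cl_cmult[OF assms] .
qed

text \<open>The real inner product conjugates the test function and keeps a real part. Test
  functions are closed under conjugation and complex multiples, so nothing is lost in either
  direction.\<close>

lemma has_weak_pderiv_iff_wder:
  fixes f g :: "real^'d => complex^'i"
  assumes f: "f : sqint lebesgue" and g: "g : sqint lebesgue"
  shows "(ALL i. has_weak_pderiv UNIV j (%x. f x $ i) (%x. g x $ i)) \<longleftrightarrow> wder j (abs_L2 f) (abs_L2 g)"
proof
  assume w: "ALL i. has_weak_pderiv UNIV j (%x. f x $ i) (%x. g x $ i)"
  show "wder j (abs_L2 f) (abs_L2 g)"
    unfolding wder_def
  proof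
    fix Psi :: "real^'d => complex^'i" assume Psi: "Psi : vtest"
    have "(LINT x|lebesgue. f x $ i * cnj (vpd j Psi x $ i)) = - (LINT x|lebesgue. g x $ i * cnj (Psi x $ i))" for i
    proof -
      have t: "(%x. Psi x $ i) : test_fun UNIV" using Psi by (simp add: vtest_def)
      have "pd j (%x. cnj (Psi x $ i)) = (%x. cnj (vpd j Psi x $ i))"
        using pderiv_cl_cnj[of "%x. Psi x $ i"] smooth_fun_diffble[OF test_fun_smooth[OF t]] by (simp add: vpd_def)
      moreover have "(LINT x|lebesgue. f x $ i * pd j (%x. cnj (Psi x $ i)) x) = - (LINT x|lebesgue. g x $ i * cnj (Psi x $ i))"
        using w test_fun_cnj[OF t] unfolding has_weak_pderiv_def lebesgue_on_UNIV_eq by blast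
      ultimately show ?thesis by simp
    qed
    thus "abs_L2 f *. abs_L2 (vpd j Psi) = - (abs_L2 g *. abs_L2 Psi)"
      by (simp add: abs_L2_inner_components f g vtest_lebesgue Psi vtest_vpd sum_negf)
  qed
next
  assume w: "wder j (abs_L2 f) (abs_L2 g)"
  show "ALL i. has_weak_pderiv UNIV j (%x. f x $ i) (%x. g x $ i)"
    unfolding has_weak_pderiv_def lebesgue_on_UNIV_eq
  proof (intro allI ballI)
    fix i and psi :: "real^'d => complex" assume psi: "psi : test_fun UNIV"
    have "Re (c * (LINT x|lebesgue. f x $ i * pd j psi x)) = - Re (c * (LINT x|lebesgue. g x $ i * psi x))" for c
    proof -
      define phi where "phi x = cnj (c * psi x)" for x
      have phi: "phi : test_fun UNIV" unfolding phi_def by (intro test_fun_cnj test_fun_mult smooth_fun_const psi)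
      have p: "pd j phi = (%x. cnj (c * pd j psi x))"
        unfolding phi_def by (rule pderiv_cl_cnj_cmult[OF test_fun_smooth[OF psi]])
      have e: "abs_L2 F *. abs_L2 (%x. axis i (th x)) = Re (LINT x|lebesgue. F x $ i * cnj (th x))"
        if "F : sqint lebesgue" "th : test_fun UNIV" for F :: "real^'d => complex^'i" and th
      proof -
        have "abs_L2 F *. abs_L2 (%x. axis i (th x)) = (SUM k:UNIV. if k = i then Re (LINT x|lebesgue. F x $ i * cnj (th x)) else 0)"
          unfolding abs_L2_inner_components[OF that(1) vtest_lebesgue[OF vtest_axis[OF that(2)]]]
          by (rule sum.cong) (auto simp: axis_def)
        thus ?thesis by simp
      qed
      have "Re (LINT x|lebesgue. f x $ i * cnj (pd j phi x)) = - Re (LINT x|lebesgue. g x $ i * cnj (phi x))"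
        using wderD[OF w vtest_axis[OF phi, of i]] by (simp add: vpd_axis e f g phi test_fun_pderiv)
      thus ?thesis by (simp add: p phi_def mult.left_commute)
    qed
    from this[of 1] this[of "\<i>"]
    show "(LINT x|lebesgue. f x $ i * pd j psi x) = - (LINT x|lebesgue. g x $ i * psi x)"
      by (simp add: complex_eq_iff)
  qed
qed

lemma mult_abs_L2_leb:
  fixes b :: "real^'d => complex^'j^'i"
  assumes b: "bmat b" and f: "f : sqint lebesgue"
  shows "(%x. b x *v f x) : sqint lebesgue" "mult b (abs_L2 f) = abs_L2 (%x. b x *v f x)"
proof -
  have ae: "AE x in lebesgue. b x *v brep (abs_L2 f) x = b x *v f x"
    using abs_L2_eq_iff[OF sqint_lb_leb[OF brep(1)] f, of "abs_L2 f"] by (auto simp: brep)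
  have [measurable]: "f : borel_measurable lebesgue" "b : borel_measurable lebesgue"
    using f b by (auto simp: square_integrable_def bmat_def measurable_completion)
  have m: "(%x. b x *v brep (abs_L2 f) x) : sqint lebesgue"
    by (intro sqint_lb_leb sqint_mv b brep)
  show s: "(%x. b x *v f x) : sqint lebesgue"
    by (rule sqint_cong_AE[OF m _ ae]) measurable
  show "mult b (abs_L2 f) = abs_L2 (%x. b x *v f x)"
    unfolding mult_def using ae by (simp add: abs_L2_eq_iff m s)
qed

lemma op_grad_iff:
  fixes u :: "('d::finite, 'n::finite) L2"
  shows "(u, G) : op_grad \<longleftrightarrow> grad_rel u G"
proof
  assume "(u, G) : op_grad"
  hence H1: "rep_L2 u : H1_vec UNIV" and G: "G = abs_L2 (nabla UNIV (rep_L2 u))" by (auto simp: op_grad_def)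
  have w: "weak_pderiv UNIV j (%x. rep_L2 u x $ i) : sqint lebesgue"
    "has_weak_pderiv UNIV j (%x. rep_L2 u x $ i) (weak_pderiv UNIV j (%x. rep_L2 u x $ i))" for i j
    using weak_pderiv_works[of "%x. rep_L2 u x $ i" UNIV j] H1 by (auto simp: H1_vec_def lebesgue_on_UNIV_eq)
  have n: "nabla UNIV (rep_L2 u) : sqint lebesgue"
    unfolding sqint_vec using w(1) by (auto simp: nabla_def)
  show "grad_rel u G"
    unfolding grad_rel_def
  proof
    fix j
    define g where "g x = Pj j *v nabla UNIV (rep_L2 u) x" for x
    have gi: "g x $ i = weak_pderiv UNIV j (%x. rep_L2 u x $ i) x" for x i
      by (simp add: g_def nabla_def)
    have "g : sqint lebesgue" "mult (%_. Pj j) G = abs_L2 g"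
      unfolding G g_def using mult_abs_L2_leb[OF bmat_const n] by blast+
    moreover have "ALL i. has_weak_pderiv UNIV j (%x. rep_L2 u x $ i) (%x. g x $ i)" using w(2) by (simp add: gi)
    ultimately show "wder j u (mult (%_. Pj j) G)"
      using has_weak_pderiv_iff_wder[OF rep_L2_sqint, of g j u] by simp
  qed
next
  assume gr: "grad_rel u G"
  define g where "g j = rep_L2 (mult (%_. Pj j) G)" for j
  have gs: "g j : sqint lebesgue" for j by (simp add: g_def rep_L2_sqint)
  have w: "has_weak_pderiv UNIV j (%x. rep_L2 u x $ i) (%x. g j x $ i)" for i j
    using has_weak_pderiv_iff_wder[OF rep_L2_sqint gs, of j u j] gr by (auto simp: grad_rel_def g_def)
  have gis: "(%x. g j x $ i) : sqint lebesgue" for i j using gs sqint_vec by blast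
  have us: "(%x. rep_L2 u x $ i) : sqint lebesgue" for i
    using rep_L2_sqint sqint_vec by blast
  have H1: "rep_L2 u : H1_vec UNIV"
    unfolding H1_vec_def H1_def lebesgue_on_UNIV_eq using us w gis by blast
  have wp: "weak_pderiv UNIV j (%x. rep_L2 u x $ i) : sqint lebesgue"
    "AE x in lebesgue. weak_pderiv UNIV j (%x. rep_L2 u x $ i) x = g j x $ i" for i j
    using weak_pderiv_eq[of UNIV "%x. g j x $ i" j "%x. rep_L2 u x $ i", unfolded lebesgue_on_UNIV_eq] gis w by auto
  have n: "nabla UNIV (rep_L2 u) : sqint lebesgue"
    unfolding sqint_vec using wp(1) by (auto simp: nabla_def)
  have gG: "AE x in lebesgue. g j x = Pj j *v rep_L2 G x" for j
    using rep_abs_L2[OF mult_abs_L2_leb(1)[OF bmat_const rep_L2_sqint], of "Pj j" G]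
      mult_abs_L2_leb(2)[OF bmat_const rep_L2_sqint, of "Pj j" G] by (simp add: g_def)
  have "AE x in lebesgue. nabla UNIV (rep_L2 u) x $ (i, j) = rep_L2 G x $ (i, j)" for i j
    using wp(2)[of j i] gG[of j] by eventually_elim (simp add: nabla_def)
  hence "AE x in lebesgue. ALL p. nabla UNIV (rep_L2 u) x $ p = rep_L2 G x $ p"
    by (intro AE_finite_allI[of UNIV, simplified]) auto
  hence "abs_L2 (nabla UNIV (rep_L2 u)) = abs_L2 (rep_L2 G)"
    by (subst abs_L2_eq_iff[OF n rep_L2_sqint]) (simp add: vec_eq_iff)
  thus "(u, G) : op_grad" unfolding op_grad_def using H1 by auto
qed

lemma op_mult_iff: "bmat b ==> (f, g) : op_mult b \<longleftrightarrow> g = mult b f"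
proof -
  assume b: "bmat b"
  have "mult b f = abs_L2 (%x. b x *v rep_L2 f x)" "(%x. b x *v rep_L2 f x) : sqint lebesgue"
    using mult_abs_L2_leb[OF b rep_L2_sqint, of f] by auto
  thus ?thesis
    using abs_L2_eq_iff[OF rep_L2_sqint, of "%x. b x *v rep_L2 f x" g] by (simp add: op_mult_def)
qed

lemma L2_cinner_abs_L2:
  assumes "f : sqint lebesgue" "g : sqint lebesgue"
  shows "L2_cinner (abs_L2 f) (abs_L2 g) = (LINT x|lebesgue. cinner (f x) (g x))"
  using assms by (intro L2_cinner.abs_eq) (auto simp: L2_eq_def)

lemma integrable_cinner:
  fixes f g :: "'a => complex^'i"
  assumes "f : sqint M" "g : sqint M"
  shows "integrable M (%x. cinner (f x) (g x))"
  unfolding cinner_def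
proof (intro Bochner_Integration.integrable_sum sqint_mult)
  fix i show "(%x. f x $ i) : sqint M" using assms sqint_vec by blast
  show "(%x. cnj (g x $ i)) : sqint M"
    by (rule sqint_cnj) (use assms sqint_vec in blast)
qed

lemma mat_vector: "mat c *v x = c *s (x :: complex^'i)"
  by (simp add: vec_eq_iff mat_def matrix_vector_mult_def if_distrib[of "%z. z * _"] cong: if_cong)

lemma cinner_scale_left: "cinner (c *s x) y = c * cinner x y"
  by (simp add: cinner_def sum_distrib_left mult.assoc)

text \<open>The imaginary part of \<open>z\<close> is \<open>- Re (\<i> * z)\<close>, so the complex
  inner product is determined by the real one on \<open>f\<close> and on \<open>\<i>\<close> times
  \<open>f\<close>.\<close>

lemma L2_cinner_eq: "L2_cinner f g = Complex (f *. g) (- (mult (%_. mat \<i>) f *. g))"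
proof -
  note r = rep_L2_sqint
  have i: "integrable lebesgue (%x. cinner (rep_L2 f x) (rep_L2 g x))" by (rule integrable_cinner[OF r r])
  have c: "L2_cinner f g = (LINT x|lebesgue. cinner (rep_L2 f x) (rep_L2 g x))"
    using L2_cinner_abs_L2[OF r r, of f g] by simp
  have "Re (L2_cinner f g) = f *. g"
    using inner_abs_L2[OF r r, of f g] by (simp add: c integral_Re[OF i, symmetric] Re_cinner)
  moreover have "Re (\<i> * L2_cinner f g) = mult (%_. mat \<i>) f *. g"
  proof -
    have m: "mult (%_. mat \<i>) f = abs_L2 (%x. mat \<i> *v rep_L2 f x)" "(%x. mat \<i> *v rep_L2 f x) : sqint lebesgue"
      using mult_abs_L2_leb[OF bmat_const r, of "mat \<i>" f] by auto
    have "Re (\<i> * L2_cinner f g) = Re (LINT x|lebesgue. \<i> * cinner (rep_L2 f x) (rep_L2 g x))"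
      using i by (simp add: c)
    also have "... = (LINT x|lebesgue. Re (cinner (mat \<i> *v rep_L2 f x) (rep_L2 g x)))"
      using i by (subst integral_Re[symmetric]) (auto simp: mat_vector cinner_scale_left)
    also have "... = mult (%_. mat \<i>) f *. g"
      using inner_abs_L2[OF m(2) r, of g] by (simp add: m Re_cinner)
    finally show ?thesis .
  qed
  ultimately show ?thesis by (simp add: complex_eq_iff)
qed

lemma grad_rel_mult_i:
  fixes u :: "('d::finite, 'n::finite) L2"
  shows "grad_rel u G ==> grad_rel (mult (%_. mat \<i>) u) (mult (%_. mat \<i>) G)"
  unfolding grad_rel_def
proof
  fix j assume "ALL j. wder j u (mult (%_. Pj j) G)"
  hence "wder j (mult (%_. mat \<i>) u) (mult (%_. mat \<i>) (mult (%_. Pj j) G))" by (intro wder_mult_const) auto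
  moreover have "mat \<i> ** Pj j = (Pj j ** mat \<i> :: complex^('n \<times> 'd)^'n)"
    by (simp add: matrix_eq matrix_vector_mul_assoc[symmetric] mat_vector vec_eq_iff)
  ultimately show "wder j (mult (%_. mat \<i>) u) (mult (%_. Pj j) (mult (%_. mat \<i>) G))"
    by (simp add: mult_mult)
qed

text \<open>The real identity suffices: the graph of the gradient is invariant under multiplication
  by \<open>\<i>\<close>, which supplies the imaginary part of the complex one.\<close>

lemma op_div_iff:
  fixes q :: "('d::finite, 'n::finite \<times> 'd) L2"
  shows "(q, r) : op_div \<longleftrightarrow> (ALL u F. grad_rel u F --> q *. F = - (r *. u))"
proof -
  have "(q, r) : op_div \<longleftrightarrow> (q, - r) : op_adjoint op_grad"
    by (force simp: op_div_def op_neg_def)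
  also have "... \<longleftrightarrow> (ALL u F. grad_rel u F --> L2_cinner F q = L2_cinner u (- r))"
    by (auto simp: op_adjoint_def op_grad_iff)
  also have "... \<longleftrightarrow> (ALL u F. grad_rel u F --> q *. F = - (r *. u))"
  proof
    assume l: "ALL u F. grad_rel u F --> L2_cinner F q = L2_cinner u (- r)"
    thus "ALL u F. grad_rel u F --> q *. F = - (r *. u)"
      by (simp add: L2_cinner_eq inner_commute)
  next
    assume l: "ALL u F. grad_rel u F --> q *. F = - (r *. u)"
    show "ALL u F. grad_rel u F --> L2_cinner F q = L2_cinner u (- r)"
    proof (intro allI impI)
      fix u :: "('d, 'n) L2" and F assume g: "grad_rel u F"
      show "L2_cinner F q = L2_cinner u (- r)"
        using l[rule_format, OF g] l[rule_format, OF grad_rel_mult_i[OF g]]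
        by (simp add: L2_cinner_eq inner_commute)
    qed
  qed
  finally show ?thesis .
qed

text \<open>The domain condition, that \<open>mult a G\<close> lies in the domain of
  \<open>op_div\<close>, is contained in the weak equation: the latter exhibits
  \<open>mult s u - f\<close> as the divergence.\<close>

lemma op_elliptic_iff:
  fixes a :: "real^'d => complex^('n::finite \<times> 'd::finite)^('n \<times> 'd)"
  assumes a: "bmat a" and s: "bmat s"
  shows "(u, f) : op_elliptic a s \<longleftrightarrow>
    (EX G. grad_rel u G & (ALL v H. grad_rel v H --> mult a G *. H + mult s u *. v = f *. v))"
proof
  assume "(u, f) : op_elliptic a s"
  then obtain G r where G: "grad_rel u G" and r: "(mult a G, r) : op_div" and f: "f = - r + mult s u"
    unfolding op_elliptic_def op_add_def op_neg_def using op_mult_iff[OF a] op_mult_iff[OF s]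
    by (auto simp: op_grad_iff relcomp_unfold)
  show "EX G. grad_rel u G & (ALL v H. grad_rel v H --> mult a G *. H + mult s u *. v = f *. v)"
    using G r unfolding op_div_iff f by (auto simp: inner_diff_left inner_add_left)
next
  assume "EX G. grad_rel u G & (ALL v H. grad_rel v H --> mult a G *. H + mult s u *. v = f *. v)"
  then obtain G where G: "grad_rel u G" "!!v H. grad_rel v H ==> mult a G *. H + mult s u *. v = f *. v" by blast
  have "mult a G *. H = - ((mult s u - f) *. v)" if "grad_rel v H" for v H
    using G(2)[OF that] by (simp add: inner_diff_left)
  hence "(mult a G, mult s u - f) : op_div" by (simp add: op_div_iff)
  hence "(u, mult s u - f) : op_grad O op_mult a O op_div"
    using G(1) op_mult_iff[OF a] op_grad_iff by blast
  hence "(u, - (mult s u - f)) : op_neg (op_grad O op_mult a O op_div)" unfolding op_neg_def by blast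
  moreover have "(u, mult s u) : op_mult s" using op_mult_iff[OF s] by blast
  ultimately have "(u, - (mult s u - f) + mult s u) : op_elliptic a s"
    unfolding op_elliptic_def op_add_def by blast
  thus "(u, f) : op_elliptic a s" by simp
qed

section \<open>The resolvent equation\<close>

text \<open>The bound \<open>Re b >= c\<close> as a quadratic form, at every point;
  \<open>pos_semidef_re_part\<close> links it to the matrix inequality.\<close>

definition coercive :: "real => (real^'d => complex^'i^'i) => bool" where
  "coercive c b \<longleftrightarrow> (ALL x \<xi>. c * (norm \<xi>)^2 <= (b x *v \<xi>) *. \<xi>)"

lemma mult_coercive:
  fixes b :: "real^'d => complex^'i^'i"
  assumes b: "bmat b" and c: "coercive c b"
  shows "c * (norm u)^2 <= mult b u *. u"
proof -
  have "c * (norm u)^2 = (LINT x|lborel. c * (norm (brep u x))^2)"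
    using inner_abs_L2_lborel[OF brep(1) brep(1), of u u] by (simp add: brep power2_norm_eq_inner)
  also have "... <= (LINT x|lborel. (b x *v brep u x) *. brep u x)"
    using brep(1)[of u] c
    by (intro integral_mono square_integrable_inner sqint_mv b)
      (auto simp: square_integrable_def coercive_def)
  also have "... = mult b u *. u"
    using inner_abs_L2_lborel[OF sqint_mv[OF b brep(1)] brep(1), of u u] by (simp add: brep mult_def)
  finally show ?thesis .
qed

lemma grad_rel_0: "grad_rel 0 0"
  by (simp add: grad_rel_def mult_linear wder_0)

lemma grad_rel_add: "grad_rel u G ==> grad_rel v H ==> grad_rel (u + v) (G + H)"
  by (simp add: grad_rel_def mult_add_right wder_add)

lemma grad_rel_scaleR: "grad_rel u G ==> grad_rel (c *R u) (c *R G)"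
  by (simp add: grad_rel_def mult_scaleR_right wder_scaleR)

lemma grad_rel_diff: "grad_rel u G ==> grad_rel v H ==> grad_rel (u - v) (G - H)"
  by (simp add: grad_rel_def mult_linear wder_diff)

lemma grad_rel_shift: "grad_rel u G ==> grad_rel (shift h u) (shift h G)"
  unfolding grad_rel_def using wder_shift shift_mult[OF bmat_const, of h "Pj j" G for j] by metis

lemma subspace_grad: "subspace {(u, G). grad_rel u G}"
  by (rule subspaceI) (auto simp: zero_prod_def grad_rel_0 grad_rel_add grad_rel_scaleR)

lemma closed_grad: "closed {(u, G). grad_rel u G}"
  unfolding closed_sequential_limits
proof (intro allI impI)
  fix x l assume "(ALL n. x n : {(u, G). grad_rel u G}) & x ----> l"
  hence g: "!!n. grad_rel (fst (x n)) (snd (x n))" and l: "(%n. fst (x n)) ----> fst l" "(%n. snd (x n)) ----> snd l"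
    by (auto simp: case_prod_beta intro: tendsto_fst tendsto_snd)
  have "wder j (fst l) (mult (%_. Pj j) (snd l))" for j
  proof (rule wder_limit)
    show "wder j (fst (x n)) (mult (%_. Pj j) (snd (x n)))" for n using g by (simp add: grad_rel_def)
  qed (use l in \<open>auto intro: bounded_linear.tendsto[OF bounded_linear_mult]\<close>)
  thus "l : {(u, G). grad_rel u G}" by (simp add: grad_rel_def case_prod_beta)
qed

lemma elliptic_solution_bound:
  assumes a: "bmat a" "coercive c a" and s: "bmat s" "coercive c s" and c: "0 < c"
    and G: "grad_rel u G" and eq: "mult a G *. G + mult s u *. u = r"
  shows "c * ((norm u)^2 + (norm G)^2) <= r"
  using mult_coercive[OF a, of G] mult_coercive[OF s, of u] eq by (simp add: algebra_simps)

text \<open>On the graph of the gradient, a closed subspace of a product, the form is the block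
  diagonal operator with entries \<open>s\<close> and \<open>a\<close>. It is coercive with the
  common constant \<open>c\<close>, since \<open>s\<close> controls \<open>u\<close> and
  \<open>a\<close> controls \<open>G\<close>.\<close>

lemma elliptic_ex1:
  fixes a :: "real^'d => complex^('n::finite \<times> 'd::finite)^('n \<times> 'd)"
  assumes a: "bmat a" "coercive c a" and s: "bmat s" "coercive c s" and c: "0 < c"
  shows "EX! uG. grad_rel (fst uG) (snd uG) &
    (ALL v H. grad_rel v H --> mult a (snd uG) *. H + mult s (fst uG) *. v = f *. v)"
proof -
  let ?V = "{(u, G). grad_rel u G} :: (('d, 'n) L2 \<times> ('d, 'n \<times> 'd) L2) set"
  let ?T = "%z :: ('d, 'n) L2 \<times> ('d, 'n \<times> 'd) L2. (mult s (fst z), mult a (snd z))"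
  have "EX! x. x : ?V & (ALL y:?V. ?T x *. y = (f, 0) *. y)"
  proof (rule lax_milgram[OF subspace_grad closed_grad _ c])
    show "bounded_linear ?T"
      by (intro bounded_linear_Pair bounded_linear_compose[OF bounded_linear_mult] bounded_linear_fst bounded_linear_snd a s)
    show "c * (norm x)^2 <= ?T x *. x" for x
      using mult_coercive[OF a, of "snd x"] mult_coercive[OF s, of "fst x"]
      by (simp add: norm_prod_def inner_prod_def algebra_simps)
  qed
  moreover have "x : ?V & (ALL y:?V. ?T x *. y = (f, 0) *. y) \<longleftrightarrow> grad_rel (fst x) (snd x) &
    (ALL v H. grad_rel v H --> mult a (snd x) *. H + mult s (fst x) *. v = f *. v)" for x
    by (auto simp: inner_prod_def case_prod_beta add.commute)
  ultimately show ?thesis by simp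
qed

lemma elliptic_resolvent:
  fixes a :: "real^'d => complex^('n::finite \<times> 'd::finite)^('n \<times> 'd)"
  assumes a: "bmat a" "coercive c a" and s: "bmat s" "coercive c s" and c: "0 < c"
  obtains R Gr where "bounded_linear R" "!!u f. (u, f) : op_elliptic a s \<longleftrightarrow> u = R f"
    "!!f. op_inv (op_elliptic a s) f = R f" "!!f. grad_rel (R f) (Gr f)"
    "!!f v H. grad_rel v H ==> mult a (Gr f) *. H + mult s (R f) *. v = f *. v"
    "!!f. norm (R f) <= norm f / c" "!!f. norm (Gr f) <= norm f / c"
proof -
  let ?P = "%f uG. grad_rel (fst uG) (snd uG) &
    (ALL v H. grad_rel v H --> mult a (snd uG) *. H + mult s (fst uG) *. v = f *. v)"
  note ex = elliptic_ex1[OF a s c]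
  define Z where "Z f = (THE uG. ?P f uG)" for f
  have Z: "?P f (Z f)" for f unfolding Z_def by (rule theI'[OF ex])
  have Zu: "?P f uG ==> uG = Z f" for f uG using ex[of f] Z[of f] by blast
  define R where "R f = fst (Z f)" for f
  define Gr where "Gr f = snd (Z f)" for f
  have R1: "grad_rel (R f) (Gr f)" for f using Z[of f] by (simp add: R_def Gr_def)
  have R2: "grad_rel v H ==> mult a (Gr f) *. H + mult s (R f) *. v = f *. v" for f v H
    using Z[of f] by (simp add: R_def Gr_def)
  have en: "c * ((norm (R f))^2 + (norm (Gr f))^2) <= norm f * norm (R f)" for f
    using elliptic_solution_bound[OF a s c R1 R2[OF R1]] norm_cauchy_schwarz[of f "R f"] by (rule order_trans)
  have b1: "norm (R f) <= norm f / c" for f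
  proof (cases "R f = 0")
    case False
    have "c * (norm (R f))^2 <= norm f * norm (R f)" using en[of f] c by (simp add: distrib_left) (smt (verit) mult_nonneg_nonneg zero_le_power2)
    hence "c * norm (R f) <= norm f" using False by (simp add: power2_eq_square)
    thus ?thesis using c by (simp add: field_simps)
  qed (use c in simp)
  have b2: "norm (Gr f) <= norm f / c" for f
  proof (rule power2_le_imp_le)
    have "c * (norm (Gr f))^2 <= norm f * norm (R f)" using en[of f] c by (simp add: distrib_left) (smt (verit) mult_nonneg_nonneg zero_le_power2)
    also have "... <= norm f * (norm f / c)" by (intro mult_left_mono b1) simp
    finally show "(norm (Gr f))^2 <= (norm f / c)^2" using c by (simp add: field_simps power2_eq_square)
  qed (use c in simp)
  have op: "(u, f) : op_elliptic a s \<longleftrightarrow> u = R f" for u f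
  proof
    assume "(u, f) : op_elliptic a s"
    then obtain G where "?P f (u, G)" unfolding op_elliptic_iff[OF a(1) s(1)] by auto
    hence "(u, G) = Z f" by (rule Zu)
    thus "u = R f" unfolding R_def by (metis fst_conv)
  next
    assume "u = R f"
    thus "(u, f) : op_elliptic a s" unfolding op_elliptic_iff[OF a(1) s(1)] using R1 R2 by blast
  qed
  have "bounded_linear R"
  proof (rule bounded_linear_intro)
    fix f g
    have "(R f + R g, Gr f + Gr g) = Z (f + g)"
      using R2[of _ _ f] R2[of _ _ g]
      by (intro Zu) (simp add: grad_rel_add R1 mult_add_right a s inner_add_left algebra_simps)
    thus "R (f + g) = R f + R g" unfolding R_def by (metis fst_conv)
  next
    fix r f
    have "(r *R R f, r *R Gr f) = Z (r *R f)"
      using R2[of _ _ f]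
      by (intro Zu) (simp add: grad_rel_scaleR R1 mult_scaleR_right a s distrib_left[symmetric])
    thus "R (r *R f) = r *R R f" unfolding R_def by (metis fst_conv)
  next
    fix f show "norm (R f) <= norm f * (1 / c)" using b1 by simp
  qed
  moreover have "op_inv (op_elliptic a s) f = R f" for f
    unfolding op_inv_def op by blast
  ultimately show thesis using that[of R Gr] op R1 R2 b1 b2 by blast
qed

section \<open>Second order regularity for constant coefficients\<close>

lemma norm_mult_Pj_le:
  fixes G :: "('d::finite, 'n::finite \<times> 'd) L2"
  shows "norm (mult (%_. Pj j) G) <= norm G"
proof -
  have "norm (mult (%_. Pj j) G) ^ 2 <= norm G ^ 2"
  proof -
    have n: "(norm (Pj j *v X))^2 <= (norm X)^2" for X :: "complex^('n \<times> 'd)"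
    proof -
      have "(norm (Pj j *v X))^2 = (SUM i:UNIV. (norm (X $ (i, j)))^2)"
        by (simp add: norm_vec_def L2_set_def sum_nonneg)
      also have "... = (SUM p:(%i. (i, j)) ` UNIV. (norm (X $ p))^2)"
        by (subst sum.reindex) (auto simp: inj_on_def)
      also have "... <= (SUM p:UNIV. (norm (X $ p))^2)" by (intro sum_mono2) auto
      also have "... = (norm X)^2" by (simp add: norm_vec_def L2_set_def sum_nonneg)
      finally show ?thesis .
    qed
    have "ennreal ((norm (mult (%_. Pj j) G))^2) = (nn_integral lborel (%x. ennreal ((norm (Pj j *v brep G x))^2)))"
      unfolding mult_def by (rule norm_abs_L2_nn_lb[OF sqint_mv[OF bmat_const brep(1)]])
    also have "... <= (nn_integral lborel (%x. ennreal ((norm (brep G x))^2)))"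
      by (intro nn_integral_mono ennreal_leI n)
    also have "... = ennreal ((norm G)^2)" using norm_abs_L2_nn_lb[OF brep(1), of G] by (simp add: brep)
    finally show ?thesis by simp
  qed
  thus ?thesis by (rule power2_le_imp_le) simp
qed

lemma norm_shift_diff_grad_le:
  assumes "grad_rel u G"
  shows "norm (shift h u - u) <= (SUM j:UNIV. \<bar>h $ j\<bar>) * norm G"
proof -
  have "norm (shift h u - u) <= (SUM j:UNIV. \<bar>h $ j\<bar> * norm (mult (%_. Pj j) G))"
    using assms by (intro norm_shift_diff_le) (auto simp: grad_rel_def)
  also have "... <= (SUM j:UNIV. \<bar>h $ j\<bar> * norm G)" by (intro sum_mono mult_left_mono norm_mult_Pj_le) auto
  finally show ?thesis by (simp add: sum_distrib_right)
qed

text \<open>Constant coefficients commute with shifts, so \<open>shift h u - u\<close> solves the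
  equation with right side \<open>shift h f - f\<close>. Tested with itself, the difference moves
  from \<open>f\<close> to the solution, where it costs one gradient; hence the shifted difference
  of \<open>G\<close> is of order \<open>\<bar>t\<bar>\<close>.\<close>

lemma constant_coefficient_regularity:
  fixes A :: "complex^('n::finite \<times> 'd::finite)^('n \<times> 'd)" and S :: "complex^'n^'n"
  assumes A: "coercive c (%_::real^'d. A)" and S: "coercive c (%_::real^'d. S)" and c: "0 < c"
    and G: "grad_rel (u :: ('d, 'n) L2) G"
    and eq: "!!v H. grad_rel v H ==> mult (%_. A) G *. H + mult (%_. S) u *. v = f *. v"
  obtains D where "!!k. wder k G (D k)" "!!k. norm (D k) <= norm f / c"
proof -
  have b: "bmat (%_::real^'d. A)" "bmat (%_::real^'d. S)" by simp_all
  have "norm (shift (t *R axis k 1) G - G) <= norm f / c * \<bar>t\<bar>" for k t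
  proof -
    define h :: "real^'d" where "h = t *R axis k 1"
    define v where "v = shift h u - u"
    define H where "H = shift h G - G"
    have vH: "grad_rel v H" unfolding v_def H_def by (intro grad_rel_diff grad_rel_shift G)
    have sh: "mult (%_. A) (shift h G) *. K + mult (%_. S) (shift h u) *. w = shift h f *. w" if "grad_rel w K" for w K
      using eq[OF grad_rel_shift[OF that, of "- h"]] shift_mult[OF b(1), of h G] shift_mult[OF b(2), of h u]
      by (simp add: inner_shift_left[symmetric])
    have "mult (%_. A) H *. H + mult (%_. S) v *. v = (shift h f - f) *. v"
      using sh[OF vH] eq[OF vH]
      unfolding H_def[symmetric] by (simp add: H_def v_def mult_linear b inner_diff_left)
    from elliptic_solution_bound[OF b(1) A b(2) S c vH this]
    have "c * ((norm v)^2 + (norm H)^2) <= f *. (shift (- h) v - v)"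
      by (simp add: inner_diff_left inner_diff_right inner_shift_left)
    also have "... <= norm f * norm (shift (- h) v - v)" by (rule norm_cauchy_schwarz)
    also have "... <= norm f * (\<bar>t\<bar> * norm H)"
    proof (rule mult_left_mono)
      have "(SUM j:UNIV. \<bar>(- h) $ j\<bar>) = (SUM j:UNIV. if j = k then \<bar>t\<bar> else 0)"
        by (rule sum.cong) (auto simp: h_def axis_def)
      thus "norm (shift (- h) v - v) <= \<bar>t\<bar> * norm H" using norm_shift_diff_grad_le[OF vH, of "- h"] by simp
    qed simp
    finally have *: "c * ((norm v)^2 + (norm H)^2) <= norm f * (\<bar>t\<bar> * norm H)" .
    have "c * (norm H)^2 <= c * ((norm v)^2 + (norm H)^2)" using c by (intro mult_left_mono) auto
    with * have "c * (norm H)^2 <= norm f * (\<bar>t\<bar> * norm H)" by linarith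
    hence "norm H <= norm f / c * \<bar>t\<bar>"
      using c by (cases "H = 0") (auto simp: power2_eq_square field_simps)
    thus ?thesis by (simp add: H_def h_def)
  qed
  hence "EX D. wder k G D & norm D <= norm f / c" for k
    using wder_ex_if_bounded[of "norm f / c" k G] c by (metis divide_nonneg_pos norm_ge_zero)
  thus thesis using that by metis
qed

section \<open>Periodic fields and oscillating multipliers\<close>

section \<open>Periodic functions\<close>

text \<open>Half open, so that its lattice translates tile the space exactly; it differs from
  \<open>Ycell\<close> and from the closed cube by null sets (\<open>AE_unit_cells\<close>).\<close>

definition hcell :: "(real^'d) set" where
  "hcell = {x. ALL i. 0 <= x $ i & x $ i < 1}"

abbreviation "ihc \<equiv> indicator hcell"

definition fl :: "real^'d => real^'d" where
  "fl x = (\<chi> i. of_int \<lfloor>x $ i\<rfloor>)"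

definition periodic :: "(real^'d => 'a) => bool" where
  "periodic f \<longleftrightarrow> (ALL k:int_lattice. ALL x. f (x + k) = f x)"

lemma periodicD: "periodic f ==> k : int_lattice ==> f (x + k) = f x"
  by (simp add: periodic_def)

lemma int_lattice_closed: "k : int_lattice ==> l : int_lattice ==> k + l : int_lattice"
  "k : int_lattice ==> - k : int_lattice" "k : int_lattice ==> l : int_lattice ==> k - l : int_lattice"
  by (auto simp: int_lattice_def)

lemma fl_lattice [simp]: "fl x : int_lattice"
  by (simp add: fl_def int_lattice_def)

lemma hcell_iff_fl: "k : int_lattice ==> x - k : hcell \<longleftrightarrow> k = fl x"
proof
  assume k: "k : int_lattice" and x: "x - k : hcell"
  show "k = fl x"
  proof (subst vec_eq_iff, intro allI)
    fix i
    obtain m :: int where m: "k $ i = of_int m" using k by (auto simp: int_lattice_def elim!: Ints_cases)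
    have "0 <= (x - k) $ i" "(x - k) $ i < 1" using x unfolding hcell_def by blast+
    hence "0 <= x $ i - of_int m" "x $ i - of_int m < 1" by (simp_all add: m)
    hence "\<lfloor>x $ i\<rfloor> = m" by linarith
    thus "k $ i = fl x $ i" by (simp add: fl_def m)
  qed
next
  assume "k = fl x"
  thus "x - k : hcell" by (simp add: hcell_def fl_def) linarith
qed

lemma minus_fl_hcell: "x - fl x : hcell"
  using hcell_iff_fl[OF fl_lattice, of x x] by simp

lemma periodic_fl: "periodic f ==> f (x - fl x) = f x"
  using periodicD[OF _ int_lattice_closed(2)[OF fl_lattice], of f x x] by simp

lemma bm_fl [measurable]: "(fl :: real^'d => _) : borelf"
proof -
  have "(%x::real^'d. SUM i:UNIV. axis i (of_int \<lfloor>x $ i\<rfloor>) :: real^'d) : borelf"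
  proof (rule borel_measurable_sum)
    fix i :: 'd
    have "(%x::real^'d. x $ i) : borelf"
      by (intro borel_measurable_continuous_onI continuous_intros)
    from measurable_compose[OF this borel_measurable_real_floor]
    have "(%x::real^'d. real_of_int \<lfloor>x $ i\<rfloor>) : borelf" .
    moreover have "(axis i :: real => real^'d) : borelf"
      by (intro borel_measurable_continuous_onI linear_continuous_on bounded_linear_axis)
    ultimately show "(%x::real^'d. axis i (real_of_int \<lfloor>x $ i\<rfloor>) :: real^'d) : borelf"
      by (rule measurable_compose)
  qed
  moreover have "(SUM i:UNIV. axis i (of_int \<lfloor>x $ i\<rfloor>)) = fl x" for x :: "real^'d"
    using sum_axis[of "fl x"] by (simp add: fl_def)
  ultimately show ?thesis by simp
qed

lemma hcell_sets [measurable]: "(hcell :: (real^'d) set) : sets borel"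
proof -
  have "hcell = {x::real^'d. fl x = 0}"
    using hcell_iff_fl[of 0] by (auto simp: int_lattice_def)
  moreover have "{x : space borel. fl x = (0::real^'d)} : sets borel" by measurable
  ultimately show ?thesis by simp
qed

text \<open>Evaluates the coordinates of \<open>One\<close>, which is the sum over
  \<open>Basis\<close>.\<close>

lemma sum_Basis_cart [simp]: "(SUM x:Basis. (x :: real^'d) $ i) = 1"
proof -
  have "(SUM x:Basis. (x :: real^'d) $ i) = (SUM x:Basis. if x = (axis i 1 :: real^'d) then 1 else 0)"
  proof (rule sum.cong)
    fix x :: "real^'d" assume "x : Basis"
    moreover have "(axis i 1 :: real^'d) : Basis" by (simp add: axis_in_Basis_iff)
    moreover have "x $ i = x *. axis i 1" by (simp add: inner_axis)
    ultimately show "x $ i = (if x = axis i 1 then 1 else 0)" by (simp add: inner_Basis)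
  qed simp
  also have "... = 1" by (simp add: axis_in_Basis_iff)
  finally show ?thesis .
qed

lemma AE_unit_cells:
  "AE x in lborel. (x : hcell) = (x : cbox 0 (One :: real^'d)) & (x : hcell) = (x : Ycell)"
proof -
  have "cbox 0 (One :: real^'d) - box 0 One : null_sets lebesgue"
    using negligible_frontier_interval negligible_iff_null_sets by blast
  hence "AE x in lebesgue. x ~: cbox 0 (One :: real^'d) - box 0 One" by (rule AE_not_in)
  hence "AE x in lborel. x ~: cbox 0 (One :: real^'d) - box 0 One" by (simp add: AE_completion_iff)
  thus ?thesis
  proof eventually_elim
    case (elim x)
    have "Ycell \<subseteq> hcell" "hcell \<subseteq> cbox 0 (One :: real^'d)" "Ycell = box 0 (One :: real^'d)"
      by (auto simp: Ycell_def hcell_def mem_box_cart less_imp_le)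
    thus ?case using elim by blast
  qed
qed

lemma nn_integral_hcell_lattice_1:
  "(nn_integral (count_space int_lattice) (%k. ihc (x - k))) = 1"
proof -
  have "(nn_integral (count_space int_lattice) (%k. ihc (x - k))) = (nn_integral (count_space int_lattice) (%k. indicator {fl x} k))"
    by (rule nn_integral_cong) (simp add: indicator_def hcell_iff_fl)
  also have "... = emeasure (count_space int_lattice) {fl x}" by (rule nn_integral_indicator) simp
  finally show ?thesis by (simp add: emeasure_count_space_finite)
qed

lemma finite_lattice_ball: "finite {k : int_lattice. norm (x + k :: real^'d) <= r}"
proof -
  define S where "S i = (of_int ` {- \<lceil>r + \<bar>x $ i\<bar>\<rceil>..\<lceil>r + \<bar>x $ i\<bar>\<rceil>} :: real set)" for i
  have "finite (PiE UNIV S)" by (intro finite_PiE) (auto simp: S_def)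
  hence "finite ((%f. \<chi> i. f i) ` PiE UNIV S :: (real^'d) set)" by (rule finite_imageI)
  moreover have "{k : int_lattice. norm (x + k) <= r} \<subseteq> (%f. \<chi> i. f i) ` PiE UNIV S"
  proof
    fix k assume k: "k : {k : int_lattice. norm (x + k) <= r}"
    have "k $ i : S i" for i
    proof -
      obtain m :: int where m: "k $ i = of_int m" using k by (auto simp: int_lattice_def elim!: Ints_cases)
      have "\<bar>x $ i + k $ i\<bar> <= r" using component_le_norm_cart[of "x + k" i] k by simp
      hence "\<bar>real_of_int m\<bar> <= r + \<bar>x $ i\<bar>" unfolding m by linarith
      hence "- \<lceil>r + \<bar>x $ i\<bar>\<rceil> <= m" "m <= \<lceil>r + \<bar>x $ i\<bar>\<rceil>" by linarith+
      thus ?thesis unfolding S_def m by (intro imageI) simp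
    qed
    thus "k : (%f. \<chi> i. f i) ` PiE UNIV S" by (intro image_eqI[of _ _ "%i. k $ i"]) (auto simp: vec_eq_iff)
  qed
  ultimately show ?thesis by (rule finite_subset[rotated])
qed

lemma countable_int_lattice: "countable (int_lattice :: (real^'d) set)"
proof -
  have "int_lattice = (\<Union>n::nat. {k : int_lattice. norm (0 + k :: real^'d) <= real n})"
    by (auto intro: real_arch_simple)
  moreover have "countable (\<Union>n::nat. {k : int_lattice. norm (0 + k :: real^'d) <= real n})"
  proof (rule countable_UN)
    show "countable {k : int_lattice. norm (0 + k :: real^'d) <= real n}" for n
      by (rule countable_finite[OF finite_lattice_ball])
  qed simp
  ultimately show ?thesis by simp
qed

text \<open>Two tilings are compared. The translated cell is cut by the lattice cells
  \<open>k + hcell\<close>, each piece is moved back by \<open>k\<close>, and the pieces fill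
  \<open>hcell\<close> because the translates of the other cell tile as well.\<close>

lemma nn_periodic_shift:
  fixes h :: "real^'d => ennreal"
  assumes [measurable]: "h : borelf" and p: "periodic h"
  shows "(nn_integral lborel (%w. ihc w * h (z + w))) = (nn_integral lborel (%w. ihc w * h w))"
proof -
  have [measurable]: "(%x. ihc (f x) :: ennreal) : borelf"
    if [measurable]: "f : borelf" for f :: "real^'d => real^'d" by measurable
  have "(nn_integral lborel (%w. ihc w * h (z + w))) = (nn_integral lborel (%w. ihc ((w + z) - z) * h (w + z)))"
    by (simp add: add.commute)
  also have "... = (nn_integral lborel (%x. ihc (x - z) * h x))"
    by (rule nn_lborel_shift[of "%x. ihc (x - z) * h x"]) measurable
  also have "... = (nn_integral lborel (%x. (nn_integral (count_space int_lattice) (%k. ihc (x - z) * h x * ihc (x - k)))))"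
    by (simp add: nn_integral_cmult nn_integral_hcell_lattice_1)
  also have "... = (nn_integral (count_space int_lattice) (%k. (nn_integral lborel (%x. ihc (x - z) * h x * ihc (x - k)))))"
    by (rule nn_integral_count_space_nn_integral[OF countable_int_lattice]) measurable
  also have "... = (nn_integral (count_space int_lattice) (%k. (nn_integral lborel (%x. ihc x * h x * ihc (x - z + k)))))"
  proof (rule nn_integral_cong)
    fix k :: "real^'d" assume "k : space (count_space int_lattice)"
    hence k: "k : int_lattice" by simp
    have "(nn_integral lborel (%x. ihc (x - z) * h x * ihc (x - k)))
        = (nn_integral lborel (%x. ihc (x + k - z) * h (x + k) * ihc (x + k - k)))"
      by (rule nn_lborel_shift[symmetric, of "%x. ihc (x - z) * h x * ihc (x - k)"]) measurable
    thus "(nn_integral lborel (%x. ihc (x - z) * h x * ihc (x - k)))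
      = (nn_integral lborel (%x. ihc x * h x * ihc (x - z + k)))"
      by (simp add: periodicD[OF p k] add_diff_eq diff_add_eq mult_ac)
  qed
  also have "... = (nn_integral lborel (%x. (nn_integral (count_space int_lattice) (%k. ihc x * h x * ihc (x - z + k)))))"
    by (rule nn_integral_count_space_nn_integral[symmetric, OF countable_int_lattice]) measurable
  also have "... = (nn_integral lborel (%x. ihc x * h x))"
  proof (rule nn_integral_cong)
    fix x :: "real^'d"
    have "(nn_integral (count_space int_lattice) (%k. ihc (x - z + k))) = (nn_integral (count_space int_lattice) (%k. indicator {- fl (x - z)} k))"
    proof (rule nn_integral_cong)
      fix k :: "real^'d" assume "k : space (count_space int_lattice)"
      hence "x - z + k : hcell \<longleftrightarrow> - k = fl (x - z)"
        using hcell_iff_fl[OF int_lattice_closed(2), of k "x - z"] by simp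
      hence "x - z + k : hcell \<longleftrightarrow> k = - fl (x - z)" by (metis minus_minus)
      thus "(ihc (x - z + k) :: ennreal) = indicator {- fl (x - z)} k"
        by (auto simp: indicator_def)
    qed
    also have "... = emeasure (count_space int_lattice) {- fl (x - z)}"
      by (rule nn_integral_indicator) (simp add: int_lattice_closed)
    also have "... = 1" by (simp add: emeasure_count_space_finite int_lattice_closed)
    finally show "(nn_integral (count_space int_lattice) (%k. ihc x * h x * ihc (x - z + k))) = ihc x * h x"
      by (simp add: nn_integral_cmult)
  qed
  finally show ?thesis .
qed

lemma emeasure_hcell: "emeasure lborel (hcell :: (real^'d) set) = 1"
proof -
  have "emeasure lborel (hcell :: (real^'d) set) = emeasure lborel (cbox 0 (One :: real^'d))"
    using AE_unit_cells by (intro emeasure_eq_AE) auto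
  also have "... = 1" by (simp add: emeasure_lborel_cbox_eq)
  finally show ?thesis .
qed

lemma integrable_hcell_shift:
  fixes h :: "real^'d => 'b::{banach,second_countable_topology}"
  assumes [measurable]: "h : borelf" and p: "periodic h"
    and i: "integrable lborel (%w. ihc w *R h w)"
  shows "integrable lborel (%w. ihc w *R h (z + w))"
proof -
  have e: "(nn_integral lborel (%w. ennreal (norm (ihc w *R h (z + w))))) = (nn_integral lborel (%w. ihc w * ennreal (norm (h (z + w)))))" for z
    by (intro nn_integral_cong) (simp add: indicator_def)
  note e[of z]
  also have "(nn_integral lborel (%w. ihc w * ennreal (norm (h (z + w))))) = (nn_integral lborel (%w. ihc w * ennreal (norm (h w))))"
    using p by (intro nn_periodic_shift[of "%x. ennreal (norm (h x))"]) (auto simp: periodic_def)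
  also have "... = (nn_integral lborel (%w. ennreal (norm (ihc w *R h (0 + w)))))" unfolding e by simp
  finally have "(nn_integral lborel (%w. ennreal (norm (ihc w *R h (z + w))))) = (nn_integral lborel (%w. ennreal (norm (ihc w *R h (0 + w)))))" .
  thus ?thesis using i by (auto simp: integrable_iff_bounded)
qed

lemma integral_periodic_shift:
  fixes h :: "real^'d => 'b::euclidean_space"
  assumes [measurable]: "h : borelf" and p: "periodic h"
    and i: "integrable lborel (%w. ihc w *R h w)"
  shows "(LINT w|lborel. ihc w *R h (z + w)) = (LINT w|lborel. ihc w *R h w)"
proof (rule euclidean_eqI)
  fix b :: 'b assume b: "b : Basis"
  define r where "r x = h x *. b" for x
  have [measurable]: "r : borelf" unfolding r_def by measurable
  have rp: "periodic r" using p by (simp add: periodic_def r_def)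
  have ir: "integrable lborel (%w. ihc w *R r w)"
    using integrable_bounded_linear[OF bounded_linear_inner_left i, of b] by (simp add: r_def)
  have e: "(LINT w|lborel. ihc w *R h (z + w)) *. b = (LINT w|lborel. ihc w *R r (z + w))" for z
    using integral_bounded_linear[OF bounded_linear_inner_left integrable_hcell_shift[OF assms, of z], of b] by (simp add: r_def)
  have "(LINT w|lborel. ihc w *R r (z + w)) = (LINT w|lborel. ihc w *R r w)"
  proof -
    have pos: "(nn_integral lborel (%w. ennreal (ihc w *R (c * r (z + w))))) = (nn_integral lborel (%w. ennreal (ihc w *R (c * r w))))" for c
    proof -
      have e1: "(nn_integral lborel (%w. ennreal (ihc w *R (c * r (z + w))))) = (nn_integral lborel (%w. ihc w * ennreal (c * r (z + w))))" for z
        by (intro nn_integral_cong) (simp add: indicator_def)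
      note e1[of z]
      also have "(nn_integral lborel (%w. ihc w * ennreal (c * r (z + w)))) = (nn_integral lborel (%w. ihc w * ennreal (c * r w)))"
        using rp by (intro nn_periodic_shift[of "%x. ennreal (c * r x)"]) (auto simp: periodic_def)
      finally show ?thesis using e1[of 0] by simp
    qed
    show ?thesis
      using pos[of 1] pos[of "-1"] real_lebesgue_integral_def[OF ir] real_lebesgue_integral_def[OF integrable_hcell_shift[OF _ rp ir, of z]]
      by simp
  qed
  thus "(LINT w|lborel. ihc w *R h (z + w)) *. b = (LINT w|lborel. ihc w *R h w) *. b"
    using e[of z] e[of 0] by simp
qed

section \<open>Square integrable periodic fields\<close>

definition cellnn :: "(real^'d => 'b::real_normed_vector) => ennreal" where
  "cellnn G = (nn_integral lborel (%w. ihc w * ennreal ((norm (G w))^2)))"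

definition perL2 :: "(real^'d => 'b::real_normed_vector) => bool" where
  "perL2 G \<longleftrightarrow> G : borelf & periodic G & cellnn G < \<infinity>"

definition cellnorm :: "(real^'d => 'b::real_normed_vector) => real" where
  "cellnorm G = sqrt (enn2real (cellnn G))"

definition cellmean :: "(real^'d => 'b::{banach,second_countable_topology}) => 'b" where
  "cellmean G = (LINT w|lborel. ihc w *R G w)"

lemma cellnorm_nonneg [simp]: "0 <= cellnorm G"
  by (simp add: cellnorm_def)

lemma cellnn_eq: "perL2 G ==> cellnn G = ennreal ((cellnorm G)^2)"
  by (simp add: perL2_def cellnorm_def less_top)

lemma perL2_measurable [measurable_dest]: "perL2 G ==> G : borelf"
  by (simp add: perL2_def)

lemma perL2_iff_sqint:
  fixes G :: "real^'d => 'b::euclidean_space"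
  shows "perL2 G \<longleftrightarrow> G : borelf & periodic G & (%w. ihc w *R G w) : sqint lborel"
proof -
  have "cellnn G = (nn_integral lborel (%w. ennreal ((norm (ihc w *R G w))^2)))"
    unfolding cellnn_def by (intro nn_integral_cong) (simp add: indicator_def)
  thus ?thesis unfolding perL2_def sqint_iff_nn by auto
qed

lemma perL2_add:
  fixes G H :: "real^'d => 'b::euclidean_space"
  assumes "perL2 G" "perL2 H" shows "perL2 (%x. G x + H x)"
  using assms square_integrable_add[of "%w. ihc w *R G w" lborel "%w. ihc w *R H w"]
  by (auto simp: perL2_iff_sqint periodic_def scaleR_add_right)

lemma perL2_diff:
  fixes G H :: "real^'d => 'b::euclidean_space"
  assumes "perL2 G" "perL2 H" shows "perL2 (%x. G x - H x)"
  using assms square_integrable_diff[of "%w. ihc w *R G w" lborel "%w. ihc w *R H w"]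
  by (auto simp: perL2_iff_sqint periodic_def scaleR_diff_right)

lemma perL2_bounded_by:
  fixes G :: "real^'d => 'b::euclidean_space" and H :: "real^'d => 'c::euclidean_space"
  assumes G: "perL2 G" and [measurable]: "H : borelf" and p: "periodic H"
    and le: "!!x. norm (H x) <= C * norm (G x)"
  shows "perL2 H"
proof -
  have [measurable]: "G : borelf" using G by (simp add: perL2_def)
  have "cellnn H <= (nn_integral lborel (%w. ennreal (C^2) * (ihc w * ennreal ((norm (G w))^2))))"
    unfolding cellnn_def
  proof (rule nn_integral_mono)
    fix w
    have "(norm (H w))^2 <= (C * norm (G w))^2" by (intro power_mono le) simp
    hence "ennreal ((norm (H w))^2) <= ennreal (C^2) * ennreal ((norm (G w))^2)"
      by (simp add: power_mult_distrib ennreal_mult[symmetric])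
    thus "ihc w * ennreal ((norm (H w))^2) <= ennreal (C^2) * (ihc w * ennreal ((norm (G w))^2))"
      by (simp add: indicator_def)
  qed
  also have "... = ennreal (C^2) * cellnn G" unfolding cellnn_def by (rule nn_integral_cmult) measurable
  also have "... < \<infinity>" using G by (simp add: perL2_def ennreal_mult_less_top)
  finally show ?thesis using p by (simp add: perL2_def)
qed

lemma perL2_bounded:
  fixes G :: "real^'d => 'b::euclidean_space"
  assumes [measurable]: "G : borelf" and p: "periodic G" and le: "!!x. norm (G x) <= C"
  shows "perL2 G"
proof -
  have "cellnn G <= (nn_integral (lborel :: (real^'d) measure) (%w. ennreal (C^2) * ihc w))"
    unfolding cellnn_def
    by (rule nn_integral_mono) (auto simp: indicator_def intro!: ennreal_leI power_mono le)
  also have "... < \<infinity>" by (simp add: nn_integral_cmult emeasure_hcell ennreal_mult_less_top)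
  finally show ?thesis using p by (simp add: perL2_def)
qed

lemma perL2_const: "perL2 (%_::real^'d. c :: 'b::euclidean_space)"
  by (rule perL2_bounded[of _ "norm c"]) (auto simp: periodic_def)

lemma perL2_integrable:
  fixes G :: "real^'d => 'b::euclidean_space"
  assumes "perL2 G"
  shows "integrable lborel (%w. ihc w *R G w)"
proof -
  have [measurable]: "G : borelf" using assms by (simp add: perL2_def)
  have "integrable lborel (%w. (norm (ihc w *R G w))^2 + indicator (hcell :: (real^'d) set) w)"
    using assms
    by (intro Bochner_Integration.integrable_add integrable_real_indicator)
      (auto simp: perL2_iff_sqint square_integrable_def emeasure_hcell)
  thus ?thesis
  proof (rule integrable_dominated)
    have "norm (G w) <= (norm (G w))^2 + 1" for w
    proof -
      have "2 * norm (G w) <= (norm (G w))^2 + 1" using sum_squares_bound[of "norm (G w)" 1] by simp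
      thus ?thesis using norm_ge_zero[of "G w"] by linarith
    qed
    thus "AE w in lborel. norm (ihc w *R G w) <= norm ((norm (ihc w *R G w))^2 + indicator (hcell :: (real^'d) set) w)"
      by (auto simp: indicator_def)
  qed measurable
qed

lemma norm_cellmean_le:
  fixes G :: "real^'d => 'b::euclidean_space"
  assumes G: "perL2 G"
  shows "norm (cellmean G) <= cellnorm G"
proof -
  have [measurable]: "G : borelf" using G by (simp add: perL2_def)
  note i = perL2_integrable[OF G]
  define m where "m = (LINT w|lborel. ihc w * norm (G w))"
  have i1: "integrable lborel (%w. ihc w * norm (G w))"
    using integrable_norm[OF i] by simp
  have i2: "integrable lborel (%w. ihc w * (norm (G w))^2)"
  proof -
    have "(%w. (norm (ihc w *R G w))^2) = (%w. ihc w * (norm (G w))^2)"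
      by (auto simp: indicator_def)
    thus ?thesis using G by (simp add: perL2_iff_sqint square_integrable_def)
  qed
  have i3: "integrable lborel (indicator (hcell :: (real^'d) set) :: _ => real)"
    by (intro integrable_real_indicator) (auto simp: emeasure_hcell)
  have m1: "measure lborel (hcell :: (real^'d) set) = 1" by (simp add: measure_def emeasure_hcell)
  \<comment> \<open>Nonnegativity of the variance of \<open>norm (G w)\<close> on the probability
    space \<open>hcell\<close>.\<close>
  have "0 <= (LINT w|lborel. ihc w * (norm (G w) - m)^2)"
    by (intro Bochner_Integration.integral_nonneg) (auto simp: indicator_def)
  also have "... = (LINT w|lborel. ihc w * (norm (G w))^2 - 2 * m * (ihc w * norm (G w)) + m^2 * ihc w)"
    by (intro LINT_cong) (auto simp: indicator_def power2_diff)
  also have "... = (LINT w|lborel. ihc w * (norm (G w))^2) - 2 * m * m + m^2"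
    using i1 i2 i3 by (simp add: m_def[symmetric] m1)
  finally have "m^2 <= (LINT w|lborel. ihc w * (norm (G w))^2)" by (simp add: power2_eq_square)
  also have "... = (cellnorm G)^2"
  proof -
    have "ennreal ((cellnorm G)^2) = (nn_integral lborel (%w. ennreal (ihc w * (norm (G w))^2)))"
      unfolding cellnn_eq[OF G, symmetric] cellnn_def by (intro nn_integral_cong) (simp add: indicator_def)
    also have "... = ennreal (LINT w|lborel. ihc w * (norm (G w))^2)"
      by (rule nn_integral_eq_integral[OF i2]) simp
    finally show ?thesis by (simp add: Bochner_Integration.integral_nonneg)
  qed
  finally have "m <= cellnorm G" by (rule power2_le_imp_le) simp
  moreover have "norm (cellmean G) <= m"
    unfolding cellmean_def m_def using integral_norm_bound[of lborel "%w. ihc w *R G w"] by simp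
  ultimately show ?thesis by linarith
qed

text \<open>Large values are set to 0. At each point the truncation agrees with \<open>G\<close>
  from some \<open>n\<close> on, which makes all limits in \<open>n\<close> immediate.\<close>

definition trunc :: "nat => (real^'d => 'b::real_normed_vector) => real^'d => 'b" where
  "trunc n G x = (if norm (G x) <= real n then G x else 0)"

lemma trunc_bounded: "norm (trunc n G x) <= real n"
  by (simp add: trunc_def)

lemma trunc_measurable:
  fixes G :: "real^'d => 'b::euclidean_space"
  assumes [measurable]: "G : borelf"
  shows "trunc n G : borelf"
  unfolding trunc_def by measurable

lemma trunc_perL2:
  fixes G :: "real^'d => 'b::euclidean_space"
  assumes G: "perL2 G"
  shows "perL2 (trunc n G)" "cellnorm (trunc n G) <= cellnorm G" "(%n. cellnorm (%x. G x - trunc n G x)) ----> 0"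
proof -
  have Gm [measurable]: "G : borelf" using G by (simp add: perL2_def)
  note [measurable] = trunc_measurable[OF Gm]
  have pt: "periodic (trunc n G)" for n using G by (simp add: perL2_def periodic_def trunc_def)
  have tp: "perL2 (trunc n G)" for n
    by (rule perL2_bounded_by[OF G, of _ 1]) (auto simp: pt trunc_def)
  thus "perL2 (trunc n G)" .
  have "cellnn (trunc n G) <= cellnn G"
    unfolding cellnn_def by (intro nn_integral_mono mult_left_mono ennreal_leI power_mono) (auto simp: trunc_def)
  hence "(cellnorm (trunc n G))^2 <= (cellnorm G)^2"
    using cellnn_eq[OF G] cellnn_eq[OF tp, of n] by simp
  thus "cellnorm (trunc n G) <= cellnorm G" by (rule power2_le_imp_le) simp
  have dp: "perL2 (%x. G x - trunc n G x)" for n by (rule perL2_diff[OF G tp])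
  have "(%n. cellnn (%x. G x - trunc n G x)) ----> (nn_integral (lborel :: (real^'d) measure) (%w. 0))"
    unfolding cellnn_def
  proof (rule nn_integral_dominated_convergence[where w="%w. ihc w * ennreal ((norm (G w))^2)"])
    show "(nn_integral lborel (%w. ihc w * ennreal ((norm (G w))^2))) < \<infinity>"
      using G by (simp add: perL2_def cellnn_def)
    show "AE w in lborel. ihc w * ennreal ((norm (G w - trunc n G w))^2) <= ihc w * ennreal ((norm (G w))^2)" for n
      by (intro AE_I2 mult_left_mono ennreal_leI power_mono) (auto simp: trunc_def)
    show "AE w in lborel. (%n. ihc w * ennreal ((norm (G w - trunc n G w))^2)) ----> 0"
    proof (rule AE_I2)
      fix w
      obtain N where "norm (G w) <= real N" using real_arch_simple by blast
      hence "\<forall>\<^sub>F n in sequentially. 0 = ihc w * ennreal ((norm (G w - trunc n G w))^2)"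
        by (intro eventually_sequentiallyI[of N]) (simp add: trunc_def)
      thus "(%n. ihc w * ennreal ((norm (G w - trunc n G w))^2)) ----> 0"
        by (rule Lim_transform_eventually[OF tendsto_const])
    qed
  qed measurable
  hence "(%n. ennreal ((cellnorm (%x. G x - trunc n G x))^2)) ----> ennreal 0"
    by (simp add: cellnn_eq[OF dp])
  hence "(%n. (cellnorm (%x. G x - trunc n G x))^2) ----> 0"
    by (subst (asm) tendsto_ennreal_iff) auto
  from tendsto_real_sqrt[OF this] show "(%n. cellnorm (%x. G x - trunc n G x)) ----> 0" by simp
qed

section \<open>Oscillating multipliers composed with cell averages\<close>

lemma cube_integral:
  fixes phi :: "real^'d => real"
  assumes c: "continuous_on UNIV phi"
  shows "integrable lborel (%w. ihc w * phi w)"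
    and "integral (cbox 0 One) phi = (LINT w|lborel. ihc w * phi w)"
proof -
  have [measurable]: "phi : borelf" using c by (rule borel_measurable_continuous_onI)
  have i: "integrable lborel (%w. indicator (cbox 0 One) w *R phi w)"
    by (rule borel_integrable_compact) (auto intro: continuous_on_subset[OF c])
  have ae: "AE w in lborel. indicator (cbox 0 One) w *R phi w = ihc w * phi w"
    using AE_unit_cells by eventually_elim (auto simp: indicator_def)
  show "integrable lborel (%w. ihc w * phi w)"
    using i by (subst integrable_cong_AE[OF _ _ ae, symmetric]) auto
  have "integral (cbox 0 One) phi = (LINT w:cbox 0 One|lborel. phi w)"
    using i by (intro set_borel_integral_eq_integral(2)[symmetric]) (simp add: set_integrable_def)
  also have "... = (LINT w|lborel. ihc w * phi w)"
    unfolding set_lebesgue_integral_def by (rule integral_cong_AE[OF _ _ ae]) auto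
  finally show "integral (cbox 0 One) phi = (LINT w|lborel. ihc w * phi w)" .
qed

lemma continuous_on_shift_joint:
  assumes h: "continuous_on S h" and v: "continuous_on S v"
  shows "continuous_on S (%w. shift (h w) (v w))"
  unfolding continuous_on_def
proof
  fix a assume a: "a : S"
  have "(v \<longlongrightarrow> v a) (at a within S)" using v a by (simp add: continuous_on_def)
  hence 1: "((%w. norm (shift (h w) (v w - v a))) \<longlongrightarrow> 0) (at a within S)"
    by (simp add: tendsto_norm_zero_iff LIM_zero_iff)
  have "continuous_on S (%w. shift (h w) (v a))"
    by (intro continuous_on_compose2[OF continuous_on_shift[of UNIV] h]) auto
  hence 2: "((%w. shift (h w) (v a)) \<longlongrightarrow> shift (h a) (v a)) (at a within S)" using a by (simp add: continuous_on_def)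
  from tendsto_add[OF tendsto_norm_zero_cancel[OF 1] 2]
  show "((%w. shift (h w) (v w)) \<longlongrightarrow> shift (h a) (v a)) (at a within S)" by (simp add: shift_linear)
qed

lemma brep_diff: "AE x in lborel. brep (u - v) x = brep u x - brep v x"
  using brep_abs_L2[OF square_integrable_diff[OF brep(1) brep(1)], of u v] minus_abs_L2_lborel[OF brep(1) brep(1), of u v]
  by (simp add: brep)

lemma periodic_perL2_bmat: "perL2 G ==> (!!x. norm (G x) <= C) ==> bmat G"
  by (auto simp: perL2_def bmat_def)

lemma cellmean_diff:
  fixes G H :: "real^'d => 'b::euclidean_space"
  assumes "perL2 G" "perL2 H" shows "cellmean (%x. G x - H x) = cellmean G - cellmean H"
  unfolding cellmean_def scaleR_diff_right
  by (rule Bochner_Integration.integral_diff[OF perL2_integrable[OF assms(1)] perL2_integrable[OF assms(2)]])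

text \<open>The sign is chosen for \<open>shift_Fw\<close>: shifting the integrand of the averaged
  multiplier back by \<open>eps *R w\<close> frees the function from \<open>w\<close> and moves the
  period variable of \<open>G\<close> instead.\<close>

definition cellavg :: "real => ('d::finite, 'i::finite) L2 => ('d, 'i) L2" where
  "cellavg eps u = avg (%w::real^'d. (- eps) *R w) u"

text \<open>The average is what makes this bounded on \<open>L2\<close> for a periodic \<open>G\<close> that is only square integrable on the cell.\<close>

definition Mop :: "real => (real^'d => complex^'p^'m) => ('d, 'p) L2 => ('d, 'm) L2" where
  "Mop eps G u = abs_L2 (%x. G (x /\<^sub>R eps) *v brep (cellavg eps u) x)"

context
  fixes eps :: real
  assumes eps: "0 < eps"
begin

lemma bmat_scaled: "bmat b ==> bmat (%x::real^'d. b (x /\<^sub>R eps))"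
  by (rule bmat_compose) measurable

lemma Mop_bounded: "Mop eps G u = mult (%x. G (x /\<^sub>R eps)) (cellavg eps u)"
  by (simp add: Mop_def mult_def)

lemma bounded_linear_scale_arg: "bounded_linear (%w::real^'d. (- eps) *R w)"
  by (rule bounded_linear_scaleR_right)

context
  fixes G :: "real^'d => complex^'p^'m" and z :: "('d, 'p) L2"
  assumes G: "perL2 G" and bd: "bmat G"
begin

definition Fw :: "real^'d => ('d, 'm) L2" where
  "Fw w = mult (%x. G (x /\<^sub>R eps)) (shift ((- eps) *R w) z)"

lemma Fw_continuous: "continuous_on S Fw"
  unfolding Fw_def
  by (intro bounded_linear.continuous_on[OF bounded_linear_mult] bmat_scaled bd
      continuous_on_compose2[OF continuous_on_shift[of UNIV]] continuous_intros) auto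

lemma inner_mult_cellavg: "f *. mult (%x. G (x /\<^sub>R eps)) (cellavg eps z) = integral (cbox 0 One) (%w. f *. Fw w)"
proof -
  have b: "bmat (%x. G (x /\<^sub>R eps))" by (rule bmat_scaled[OF bd])
  have "f *. mult (%x. G (x /\<^sub>R eps)) (cellavg eps z) = cellavg eps z *. mult (%x. adj (G (x /\<^sub>R eps))) f"
    by (simp add: inner_mult[OF b, symmetric] inner_commute)
  also have "... = integral (cbox 0 One) (%w. shift ((- eps) *R w) z *. mult (%x. adj (G (x /\<^sub>R eps))) f)"
    unfolding cellavg_def by (rule inner_avg[OF bounded_linear_scale_arg])
  finally show ?thesis by (simp add: Fw_def inner_mult[OF b, symmetric] inner_commute)
qed

lemma shift_Fw: "shift (eps *R w) (Fw w) = mult (%x. G (x /\<^sub>R eps + w)) z"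
proof -
  have b: "bmat (%x. G (x /\<^sub>R eps))" by (rule bmat_scaled[OF bd])
  have "(x + eps *R w) /\<^sub>R eps = x /\<^sub>R eps + w" for x using eps by (simp add: scaleR_add_right)
  thus ?thesis unfolding Fw_def by (simp add: shift_mult[OF b] shift_shift)
qed

text \<open>After the shift the integrand is \<open>G (x /\<^sub>R eps + w) *v brep z x\<close>. By
  Tonelli the integral over \<open>w\<close> comes first, and for each \<open>x\<close> it runs over
  a full period of the square of \<open>norm G\<close>, giving \<open>cellnn G\<close>.\<close>

lemma Fw_integral_bound: "integral (cbox 0 One) (%w. (norm (Fw w))^2) <= (cellnorm G * norm z)^2"
proof -
  let ?G = "%w x. ennreal ((norm (G (x /\<^sub>R eps + w)))^2)" and ?z = "%x. ennreal ((norm (brep z x))^2)"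
  have Gm [measurable]: "G : borelf" using G by (simp add: perL2_def)
  have c: "continuous_on UNIV (%w. (norm (Fw w))^2)" by (intro continuous_intros Fw_continuous)
  have N: "ennreal ((norm (Fw w))^2) <= (nn_integral lborel (%x. ?G w x * ?z x))" for w
  proof -
    have b: "bmat (%x. G (x /\<^sub>R eps + w))" by (rule bmat_compose[OF bd]) measurable
    have "norm (Fw w) = norm (shift (eps *R w) (Fw w))" by simp
    hence "ennreal ((norm (Fw w))^2) = ennreal ((norm (mult (%x. G (x /\<^sub>R eps + w)) z))^2)" unfolding shift_Fw by simp
    also have "... = (nn_integral lborel (%x. ennreal ((norm (G (x /\<^sub>R eps + w) *v brep z x))^2)))"
      unfolding mult_def by (rule norm_abs_L2_nn_lb[OF sqint_mv[OF b brep(1)]])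
    also have "... <= (nn_integral lborel (%x. ?G w x * ?z x))"
    proof (rule nn_integral_mono)
      fix x
      have "(norm (G (x /\<^sub>R eps + w) *v brep z x))^2 <= (norm (G (x /\<^sub>R eps + w)) * norm (brep z x))^2"
        by (intro power_mono norm_mv_le) simp
      thus "ennreal ((norm (G (x /\<^sub>R eps + w) *v brep z x))^2) <= ?G w x * ?z x"
        by (simp add: ennreal_mult[symmetric] power_mult_distrib)
    qed
    finally show ?thesis .
  qed
  have "ennreal (integral (cbox 0 One) (%w. (norm (Fw w))^2)) = (nn_integral lborel (%w. ennreal (ihc w * (norm (Fw w))^2)))"
    unfolding cube_integral(2)[OF c]
    by (rule nn_integral_eq_integral[symmetric, OF cube_integral(1)[OF c]]) simp
  also have "... <= (nn_integral lborel (%w. (nn_integral lborel (%x. ihc w * ?G w x * ?z x))))"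
  proof (rule nn_integral_mono)
    fix w :: "real^'d"
    show "ennreal (ihc w * (norm (Fw w))^2) <= (nn_integral lborel (%x. ihc w * ?G w x * ?z x))"
      using N[of w] by (cases "w : hcell") auto
  qed
  also have "... = (nn_integral lborel (%x. (nn_integral lborel (%w. ihc w * ?G w x * ?z x))))"
    by (rule lborel_pair.Fubini') measurable
  also have "... = (nn_integral lborel (%x. cellnn G * ?z x))"
  proof (rule nn_integral_cong)
    fix x :: "real^'d"
    have p: "periodic (%x. ennreal ((norm (G x))^2))" using G by (simp add: perL2_def periodic_def)
    have "(nn_integral lborel (%w. ihc w * ?G w x)) = cellnn G"
      unfolding cellnn_def by (rule nn_periodic_shift[OF _ p]) measurable
    thus "(nn_integral lborel (%w. ihc w * ?G w x * ?z x)) = cellnn G * ?z x"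
      by (simp add: nn_integral_multc)
  qed
  also have "... = cellnn G * ennreal ((norm z)^2)"
    using norm_abs_L2_nn_lb[OF brep(1), of z] by (simp add: nn_integral_cmult brep)
  also have "... = ennreal ((cellnorm G * norm z)^2)"
    by (simp add: cellnn_eq[OF G] ennreal_mult[symmetric] power_mult_distrib)
  finally show ?thesis by simp
qed

lemma cube_integral_inner_bound:
  assumes h: "continuous_on UNIV h" and A: "0 <= A" "!!w. w : cbox 0 One ==> norm (h w) <= A"
  shows "integral (cbox 0 One) (%w. h w *. Fw w) <= A * (cellnorm G * norm z)"
proof (rule Cauchy_Schwarz_from_scaling[OF A(1)])
  show "0 <= cellnorm G * norm z" by simp
  fix t :: real assume t: "0 < t"
  have i: "(%w. h w *. Fw w) integrable_on cbox 0 One" "(%w. (norm (Fw w))^2) integrable_on cbox 0 One"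
    by (intro integrable_continuous continuous_intros continuous_on_inner Fw_continuous continuous_on_subset[OF h]; simp)+
  have "integral (cbox 0 One) (%w. 2 * (h w *. Fw w)) <= integral (cbox 0 One) (%w::real^'d. t * A^2 + (1 / t) * (norm (Fw w))^2)"
  proof (rule integral_le)
    show "(%w. 2 * (h w *. Fw w)) integrable_on cbox 0 One" using i(1) by (rule integrable_on_mult_right)
    show "(%w::real^'d. t * A^2 + (1 / t) * (norm (Fw w))^2) integrable_on cbox 0 One"
      using i(2) by (intro Henstock_Kurzweil_Integration.integrable_add integrable_const integrable_on_mult_right)
    fix w :: "real^'d" assume w: "w : cbox 0 One"
    have "2 * (h w *. Fw w) <= 2 * (norm (h w) * norm (Fw w))" using norm_cauchy_schwarz[of "h w" "Fw w"] by simp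
    also have "... <= 2 * (A * norm (Fw w))" using A(2)[OF w] by (simp add: mult_right_mono)
    also have "... = 2 * (sqrt t * A) * (norm (Fw w) / sqrt t)" using t by simp
    also have "... <= (sqrt t * A)^2 + (norm (Fw w) / sqrt t)^2" by (rule sum_squares_bound)
    also have "... = t * A^2 + (1 / t) * (norm (Fw w))^2" using t by (simp add: power_mult_distrib power_divide)
    finally show "2 * (h w *. Fw w) <= t * A^2 + (1 / t) * (norm (Fw w))^2" .
  qed
  also have "... = t * A^2 + (1 / t) * integral (cbox 0 One) (%w. (norm (Fw w))^2)"
    using i(2) by (subst Henstock_Kurzweil_Integration.integral_add[OF integrable_const integrable_on_mult_right]) auto
  also have "... <= t * A^2 + (1 / t) * (cellnorm G * norm z)^2"
    using t Fw_integral_bound by (intro add_left_mono mult_left_mono) auto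
  finally show "2 * integral (cbox 0 One) (%w. h w *. Fw w) <= t * A^2 + (cellnorm G * norm z)^2 / t"
    using i(1) by simp
qed

lemma norm_mult_cellavg_le: "norm (mult (%x. G (x /\<^sub>R eps)) (cellavg eps z)) <= cellnorm G * norm z"
proof -
  let ?f = "mult (%x. G (x /\<^sub>R eps)) (cellavg eps z)"
  have "?f *. ?f <= norm ?f * (cellnorm G * norm z)"
    unfolding inner_mult_cellavg[of ?f] by (rule cube_integral_inner_bound) auto
  thus ?thesis
    by (cases "?f = 0") (auto simp: power2_norm_eq_inner[symmetric] power2_eq_square)
qed

text \<open>Same mechanism as in the norm bound, now linear in \<open>G\<close>: the full period
  average of \<open>G\<close> at a fixed \<open>x\<close> is \<open>cellmean G\<close>. Boundedness
  of \<open>G\<close> justifies Fubini.\<close>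

lemma integral_inner_shift_Fw: "integral (cbox 0 One) (%w. f *. shift (eps *R w) (Fw w)) = f *. mult (%_. cellmean G) z"
proof -
  have Gm [measurable]: "G : borelf" using G by (simp add: perL2_def)
  have c: "continuous_on UNIV (%w. f *. shift (eps *R w) (Fw w))"
    by (intro continuous_on_inner continuous_on_shift_joint Fw_continuous continuous_intros)
  obtain C where C: "!!x. norm (G x) <= C" using bd by (auto simp: bmat_def)
  let ?E = "%x. C * ((norm (brep f x))^2 + (norm (brep z x))^2)"
  define K where "K w x = ihc w * (brep f x *. (G (x /\<^sub>R eps + w) *v brep z x))" for w x
  have Km: "(%(w, x). K w x) : borel_measurable (lborel \<Otimes>\<^sub>M lborel)" unfolding K_def by measurable
  have Ki: "integrable (lborel \<Otimes>\<^sub>M lborel) (%(w, x). K w x)"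
  proof (rule integrableI_bounded[OF Km])
    have "(nn_integral (lborel \<Otimes>\<^sub>M lborel) (%p. ennreal (norm (case p of (w, x) => K w x))))
      = (nn_integral lborel (%w. (nn_integral lborel (%x. ennreal (norm (K w x))))))"
      using Km by (subst lborel.nn_integral_fst[symmetric]) auto
    also have "... <= (nn_integral lborel (%w. indicator (hcell :: (real^'d) set) w * (nn_integral lborel (%x. ennreal (?E x)))))"
    proof (rule nn_integral_mono)
      fix w :: "real^'d"
      have "norm (K w x) <= ihc w * (?E x)" for x
      proof (cases "w : hcell")
        case True
        have "norm (K w x) <= norm (brep f x) * norm (G (x /\<^sub>R eps + w) *v brep z x)"
          using True Cauchy_Schwarz_ineq2 by (simp add: K_def)
        also have "... <= norm (brep f x) * (C * norm (brep z x))"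
          by (intro mult_left_mono order_trans[OF norm_mv_le] mult_right_mono C) auto
        also have "... = C * (norm (brep f x) * norm (brep z x))" by simp
        also have "... <= ?E x"
        proof (rule mult_left_mono)
          show "norm (brep f x) * norm (brep z x) <= (norm (brep f x))^2 + (norm (brep z x))^2"
            using sum_squares_bound[of "norm (brep f x)" "norm (brep z x)"]
              mult_nonneg_nonneg[OF norm_ge_zero[of "brep f x"] norm_ge_zero[of "brep z x"]] by linarith
          show "0 <= C" using C[of 0] norm_ge_zero order_trans by blast
        qed
        finally show ?thesis using True by simp
      qed (simp add: K_def)
      hence "(nn_integral lborel (%x. ennreal (norm (K w x)))) <= (nn_integral lborel (%x. ihc w * ennreal (?E x)))"
        by (intro nn_integral_mono) (auto simp: indicator_def intro!: ennreal_leI split: if_splits)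
      also have "... = ihc w * (nn_integral lborel (%x. ennreal (?E x)))"
        by (rule nn_integral_cmult) measurable
      finally show "(nn_integral lborel (%x. ennreal (norm (K w x)))) <= ihc w * (nn_integral lborel (%x. ennreal (?E x)))" .
    qed
    also have "... = (nn_integral lborel (%x. ennreal (?E x)))"
      by (simp add: nn_integral_multc emeasure_hcell)
    also have "... < \<infinity>"
    proof -
      have "integrable lborel (%x. ?E x)"
        using brep(1)[of f] brep(1)[of z] by (simp add: square_integrable_def)
      hence "(nn_integral lborel (%x. ennreal (norm (?E x)))) < \<infinity>"
        unfolding integrable_iff_bounded by blast
      moreover have "0 <= C" using C[of 0] norm_ge_zero order_trans by blast
      hence "norm (?E x) = ?E x" for x
        by (simp del: ennreal_plus)
      ultimately show ?thesis by (simp only:)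
    qed
    finally show "(nn_integral (lborel \<Otimes>\<^sub>M lborel) (%p. ennreal (norm (case p of (w, x) => K w x)))) < \<infinity>" .
  qed
  have "integral (cbox 0 One) (%w. f *. shift (eps *R w) (Fw w)) = (LINT w|lborel. LINT x|lborel. K w x)"
    unfolding cube_integral(2)[OF c]
  proof (rule LINT_cong)
    fix w :: "real^'d"
    have b: "bmat (%x. G (x /\<^sub>R eps + w))" by (rule bmat_compose[OF bd]) measurable
    have "f *. shift (eps *R w) (Fw w) = (LINT x|lborel. brep f x *. (G (x /\<^sub>R eps + w) *v brep z x))"
      unfolding shift_Fw mult_def
      using inner_abs_L2_lborel[OF brep(1) sqint_mv[OF b brep(1)], of f z] by (simp add: brep)
    thus "ihc w * (f *. shift (eps *R w) (Fw w)) = (LINT x|lborel. K w x)"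
      by (simp add: K_def)
  qed simp
  also have "... = (LINT x|lborel. LINT w|lborel. K w x)"
    using lborel_pair.Fubini_integral[OF Ki] by simp
  also have "... = (LINT x|lborel. brep f x *. (cellmean G *v brep z x))"
  proof (rule LINT_cong)
    fix x :: "real^'d"
    have bl: "bounded_linear (%A. brep f x *. (A *v brep z x))"
      by (intro bounded_linear_compose[OF bounded_linear_inner_right] bounded_bilinear.bounded_linear_left[OF bilinear_mv])
    have Gp: "periodic G" using G by (simp add: perL2_def)
    have "(LINT w|lborel. K w x) = (LINT w|lborel. brep f x *. ((ihc w *R G (x /\<^sub>R eps + w)) *v brep z x))"
      by (simp add: K_def scaleR_cmv)
    also have "... = brep f x *. ((LINT w|lborel. ihc w *R G (x /\<^sub>R eps + w)) *v brep z x)"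
      by (rule integral_bounded_linear[OF bl integrable_hcell_shift[OF Gm Gp perL2_integrable[OF G]]])
    also have "(LINT w|lborel. ihc w *R G (x /\<^sub>R eps + w)) = cellmean G"
      unfolding cellmean_def by (rule integral_periodic_shift[OF Gm Gp perL2_integrable[OF G]])
    finally show "(LINT w|lborel. K w x) = brep f x *. (cellmean G *v brep z x)" .
  qed simp
  also have "... = f *. mult (%_. cellmean G) z"
    using inner_abs_L2_lborel[OF brep(1) sqint_mv[OF bmat_const brep(1)], of f "cellmean G" z]
    by (simp add: brep mult_def)
  finally show ?thesis .
qed

text \<open>Both terms are integrals of \<open>Fw\<close> over the cube, against \<open>f\<close>
  and against \<open>shift ((- eps) *R w) f\<close>. Replacing an oscillating field by its mean thus
  costs only the translation differences of \<open>f\<close>; \<open>z\<close> needs no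
  regularity.\<close>

lemma oscillating_mean_bounded:
  assumes B: "0 <= B" "!!w. w : cbox 0 One ==> norm (shift (eps *R w) f - f) <= B"
  shows "f *. mult (%x. G (x /\<^sub>R eps)) (cellavg eps z) - f *. mult (%_. cellmean G) z <= B * (cellnorm G * norm z)"
proof -
  let ?h = "%w. f - shift ((- eps) *R w) f"
  have h: "continuous_on S ?h" for S
    by (intro continuous_intros continuous_on_compose2[OF continuous_on_shift[of UNIV]]) auto
  have e: "f *. shift (eps *R w) (Fw w) = shift ((- eps) *R w) f *. Fw w" for w
    by (simp add: inner_shift_left)
  have "f *. mult (%x. G (x /\<^sub>R eps)) (cellavg eps z) - f *. mult (%_. cellmean G) z
    = integral (cbox 0 One) (%w. f *. Fw w) - integral (cbox 0 One) (%w. shift ((- eps) *R w) f *. Fw w)"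
    unfolding inner_mult_cellavg integral_inner_shift_Fw[symmetric] e ..
  also have "... = integral (cbox 0 One) (%w. ?h w *. Fw w)"
    unfolding inner_diff_left
    by (rule Henstock_Kurzweil_Integration.integral_diff[symmetric]; intro integrable_continuous continuous_on_inner Fw_continuous
        continuous_intros continuous_on_compose2[OF continuous_on_shift[of UNIV]]) auto
  also have "... <= B * (cellnorm G * norm z)"
  proof (rule cube_integral_inner_bound[OF h B(1)])
    fix w :: "real^'d" assume w: "w : cbox 0 One"
    have "shift (eps *R w) (?h w) = shift (eps *R w) f - f" by (simp add: shift_linear shift_shift)
    hence "norm (?h w) = norm (shift (eps *R w) f - f)" by (metis norm_shift)
    thus "norm (?h w) <= B" using B(2)[OF w] by simp
  qed
  finally show ?thesis .
qed

end

text \<open>Truncations of \<open>G\<close> satisfy the bound uniformly; Fatou's lemma passes it to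
  \<open>G\<close> and at the same time shows that the product is square integrable.\<close>

lemma Mop_aux:
  fixes G :: "real^'d => complex^'p^'m"
  assumes G: "perL2 G"
  shows "(%x. G (x /\<^sub>R eps) *v brep (cellavg eps u) x) : sqint lborel" (is "?f : _")
    and "norm (Mop eps G u) <= cellnorm G * norm u"
proof -
  have Gm [measurable]: "G : borelf" using G by (simp add: perL2_def)
  note [measurable] = trunc_measurable[OF Gm]
  let ?fn = "%n x. trunc n G (x /\<^sub>R eps) *v brep (cellavg eps u) x"
  have b: "bmat (trunc n G)" for n
    by (rule periodic_perL2_bmat[OF trunc_perL2(1)[OF G] trunc_bounded])
  have le: "(nn_integral lborel (%x. ennreal ((norm (?fn n x))^2))) <= ennreal ((cellnorm G * norm u)^2)" for n
  proof -
    have "(nn_integral lborel (%x. ennreal ((norm (?fn n x))^2))) = ennreal ((norm (mult (%x. trunc n G (x /\<^sub>R eps)) (cellavg eps u)))^2)"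
      unfolding mult_def by (rule norm_abs_L2_nn_lb[symmetric, OF sqint_mv[OF bmat_scaled[OF b] brep(1)]])
    also have "... <= ennreal ((cellnorm G * norm u)^2)"
      using order_trans[OF norm_mult_cellavg_le[OF trunc_perL2(1)[OF G] b, of n u]
          mult_right_mono[OF trunc_perL2(2)[OF G, of n] norm_ge_zero]]
      by (intro ennreal_leI power_mono) auto
    finally show ?thesis .
  qed
  have "(nn_integral lborel (%x. ennreal ((norm (?f x))^2))) = (nn_integral lborel (%x. liminf (%n. ennreal ((norm (?fn n x))^2))))"
  proof (rule nn_integral_cong)
    fix x :: "real^'d"
    obtain N where "norm (G (x /\<^sub>R eps)) <= real N" using real_arch_simple by blast
    hence "\<forall>\<^sub>F n in sequentially. ennreal ((norm (?f x))^2) = ennreal ((norm (?fn n x))^2)"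
      by (intro eventually_sequentiallyI[of N]) (simp add: trunc_def)
    hence "(%n. ennreal ((norm (?fn n x))^2)) ----> ennreal ((norm (?f x))^2)"
      by (rule Lim_transform_eventually[OF tendsto_const])
    thus "ennreal ((norm (?f x))^2) = liminf (%n. ennreal ((norm (?fn n x))^2))"
      by (rule lim_imp_Liminf[OF trivial_limit_sequentially, symmetric])
  qed
  also have "... <= liminf (%n. nn_integral lborel (%x. ennreal ((norm (?fn n x))^2)))"
    by (rule nn_integral_liminf) measurable
  also have "... <= liminf (%n::nat. ennreal ((cellnorm G * norm u)^2))"
    using le by (intro Liminf_mono always_eventually) auto
  also have "... = ennreal ((cellnorm G * norm u)^2)" by (simp add: Liminf_const)
  finally have main: "(nn_integral lborel (%x. ennreal ((norm (?f x))^2))) <= ennreal ((cellnorm G * norm u)^2)" .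
  thus sq: "?f : sqint lborel"
    unfolding sqint_iff_nn by (auto intro: le_less_trans)
  have "ennreal ((norm (Mop eps G u))^2) <= ennreal ((cellnorm G * norm u)^2)"
    unfolding Mop_def norm_abs_L2_nn_lb[OF sq] by (rule main)
  hence "(norm (Mop eps G u))^2 <= (cellnorm G * norm u)^2" by simp
  thus "norm (Mop eps G u) <= cellnorm G * norm u" by (rule power2_le_imp_le) simp
qed

lemmas Mop_sqint = Mop_aux(1)
lemmas norm_Mop_le = Mop_aux(2)

lemma cellavg_diff: "cellavg eps (u - v) = cellavg eps u - cellavg eps v"
  unfolding cellavg_def by (rule avg_linear(1)[OF bounded_linear_scale_arg])

lemma Mop_diff_right:
  assumes G: "perL2 G"
  shows "Mop eps G (u - v) = Mop eps G u - Mop eps G v"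
proof -
  have "Mop eps G u - Mop eps G v = abs_L2 (%x. G (x /\<^sub>R eps) *v brep (cellavg eps u) x - G (x /\<^sub>R eps) *v brep (cellavg eps v) x)"
    unfolding Mop_def by (rule minus_abs_L2_lborel[OF Mop_sqint[OF G] Mop_sqint[OF G]])
  also have "... = Mop eps G (u - v)"
    unfolding Mop_def
  proof (subst abs_L2_eq_iff_lb)
    show "AE x in lborel. G (x /\<^sub>R eps) *v brep (cellavg eps u) x - G (x /\<^sub>R eps) *v brep (cellavg eps v) x = G (x /\<^sub>R eps) *v brep (cellavg eps (u - v)) x"
      using brep_diff[of "cellavg eps u" "cellavg eps v"] unfolding cellavg_diff
      by eventually_elim (simp add: matrix_vector_mult_diff_distrib)
  qed (intro square_integrable_diff Mop_sqint G)+
  finally show ?thesis by simp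
qed

lemma Mop_diff_left:
  assumes G: "perL2 G" and H: "perL2 H"
  shows "Mop eps (%x. G x - H x) u = Mop eps G u - Mop eps H u"
  unfolding Mop_def minus_abs_L2_lborel[OF Mop_sqint[OF G] Mop_sqint[OF H]]
  by (simp add: matrix_vector_mult_diff_rdistrib)

lemma Mop_add_left:
  assumes G: "perL2 G" and H: "perL2 H"
  shows "Mop eps (%x. G x + H x) u = Mop eps G u + Mop eps H u"
  unfolding Mop_def plus_abs_L2_lborel[OF Mop_sqint[OF G] Mop_sqint[OF H]]
  by (simp add: matrix_vector_mult_add_rdistrib)

lemma mult_Mop:
  assumes b: "bmat b" and G: "perL2 G"
  shows "mult (%x. b (x /\<^sub>R eps)) (Mop eps G u) = Mop eps (%x. b x ** G x) u"
  unfolding Mop_def mult_abs_L2[OF bmat_scaled[OF b] Mop_sqint[OF G]]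
  by (simp add: matrix_vector_mul_assoc)

lemma Mop_tendsto_left:
  fixes G :: "real^'d => complex^'p^'m"
  assumes G: "perL2 G" and Gn: "!!n. perL2 (Gn n)" and lim: "(%n. cellnorm (%x. G x - Gn n x)) ----> 0"
  shows "(%n. Mop eps (Gn n) u) ----> Mop eps G u"
proof -
  have "(%n. norm (Mop eps G u - Mop eps (Gn n) u)) ----> 0"
  proof (rule tendsto_sandwich[of "%_. 0" _ _ "%n. cellnorm (%x. G x - Gn n x) * norm u"])
    show "\<forall>\<^sub>F n in sequentially. norm (Mop eps G u - Mop eps (Gn n) u) <= cellnorm (%x. G x - Gn n x) * norm u"
      using norm_Mop_le[OF perL2_diff[OF G Gn], of _ u] by (simp add: Mop_diff_left[OF G Gn])
    show "(%n. cellnorm (%x. G x - Gn n x) * norm u) ----> 0" using tendsto_mult_left_zero[OF lim] by simp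
  qed auto
  from tendsto_norm_zero_cancel[OF this] have "(%n. Mop eps G u - (Mop eps G u - Mop eps (Gn n) u)) ----> Mop eps G u - 0"
    by (intro tendsto_diff tendsto_const)
  thus ?thesis by simp
qed

lemma oscillating_mean_le:
  fixes G :: "real^'d => complex^'p^'m"
  assumes G: "perL2 G" and B: "0 <= B" "!!w. w : cbox 0 One ==> norm (shift (eps *R w) f - f) <= B"
  shows "f *. Mop eps G z - f *. mult (%_. cellmean G) z <= B * (cellnorm G * norm z)"
proof (rule LIMSEQ_le_const2)
  note t = trunc_perL2[OF G]
  have b: "bmat (trunc n G)" for n by (rule periodic_perL2_bmat[OF t(1) trunc_bounded])
  have "(%n. cellmean (trunc n G)) ----> cellmean G"
  proof -
    have "(%n. norm (cellmean G - cellmean (trunc n G))) ----> 0"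
    proof (rule tendsto_sandwich[OF _ _ tendsto_const t(3)])
      show "\<forall>\<^sub>F n in sequentially. norm (cellmean G - cellmean (trunc n G)) <= cellnorm (%x. G x - trunc n G x)"
        using norm_cellmean_le[OF perL2_diff[OF G t(1)]] by (simp add: cellmean_diff[OF G t(1)])
    qed simp
    from tendsto_norm_zero_cancel[OF this] have "(%n. cellmean G - (cellmean G - cellmean (trunc n G))) ----> cellmean G - 0"
      by (intro tendsto_diff tendsto_const)
    thus ?thesis by simp
  qed
  hence "(%n. norm (cellmean (trunc n G) - cellmean G) * norm z) ----> 0"
    by (intro tendsto_mult_left_zero tendsto_norm_zero) (simp add: LIM_zero_iff)
  hence "(%n. mult (%_. cellmean (trunc n G)) z - mult (%_. cellmean G) z) ----> 0"
    by (rule Lim_null_comparison[rotated])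
      (auto simp: mult_diff_left intro!: always_eventually norm_mult_le)
  hence m: "(%n. mult (%_. cellmean (trunc n G)) z) ----> mult (%_. cellmean G) z" by (simp add: LIM_zero_iff)
  show "(%n. f *. Mop eps (trunc n G) z - f *. mult (%_. cellmean (trunc n G)) z)
      ----> f *. Mop eps G z - f *. mult (%_. cellmean G) z"
    by (intro tendsto_intros m Mop_tendsto_left G t)
  have "f *. Mop eps (trunc n G) z - f *. mult (%_. cellmean (trunc n G)) z <= B * (cellnorm G * norm z)" for n
    using oscillating_mean_bounded[OF t(1) b B, of n z] t(2)[of n] B(1)
    unfolding Mop_bounded by (meson mult_left_mono mult_right_mono norm_ge_zero order_trans)
  thus "EX N. ALL n>=N. f *. Mop eps (trunc n G) z - f *. mult (%_. cellmean (trunc n G)) z <= B * (cellnorm G * norm z)" by blast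
qed

lemma oscillating_mean:
  fixes G :: "real^'d => complex^'p^'m"
  assumes G: "perL2 G" and B: "0 <= B" "!!w. w : cbox 0 One ==> norm (shift (eps *R w) f - f) <= B"
  shows "\<bar>f *. Mop eps G z - f *. mult (%_. cellmean G) z\<bar> <= B * (cellnorm G * norm z)"
proof -
  have "norm (shift (eps *R w) (- f) - - f) <= B" if "w : cbox 0 One" for w
  proof -
    have "shift (eps *R w) (- f) - - f = - (shift (eps *R w) f - f)" by (simp add: shift_linear)
    thus ?thesis using B(2)[OF that] by (simp only: norm_minus_cancel)
  qed
  from oscillating_mean_le[OF G B(1) this] oscillating_mean_le[OF G B] show ?thesis
    by (simp add: abs_le_iff)
qed

end

section \<open>Periodic Sobolev fields\<close>

text \<open>Defined as a limit of smooth periodic fields, so that the product rule, known for smooth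
  factors, passes to the limit. The columns of \<open>N\<close> are the correctors of the unit
  matrices.\<close>

definition H1field :: "(real^'d => complex^'p^'m) => ('d => real^'d => complex^'p^'m) => bool" where
  "H1field N D \<longleftrightarrow> perL2 N & (ALL j. perL2 (D j)) &
     (EX p. (ALL m. smooth_mat (p m) & periodic (p m)) &
       (%m::nat. cellnorm (%x. N x - p m x)) ----> 0 &
       (ALL j. (%m. cellnorm (%x. D j x - mpd j (p m) x)) ----> 0))"

lemma smooth_mat_continuous:
  fixes q :: "real^'d => complex^'p^'m"
  assumes "smooth_mat q" shows "continuous_on S q"
proof -
  have "continuous_on S (%x. \<chi> i j. q x $ i $ j)"
    by (intro continuous_on_vec_lambda smooth_fun_cont) (use assms in \<open>auto simp: smooth_mat_def\<close>)
  thus ?thesis by simp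
qed

lemma smooth_mat_mpd: "smooth_mat q ==> smooth_mat (mpd k q)"
  by (simp add: smooth_mat_def mpd_def smooth_fun_pderiv)

lemma periodic_cont_bounded:
  fixes q :: "real^'d => 'b::euclidean_space"
  assumes p: "periodic q" and c: "continuous_on UNIV q"
  obtains C where "!!x. norm (q x) <= C"
proof -
  have "compact (q ` cbox 0 One)" by (intro compact_continuous_image continuous_on_subset[OF c]) auto
  then obtain C where C: "!!y. y : q ` cbox 0 One ==> norm y <= C" using compact_imp_bounded bounded_iff by metis
  have "norm (q x) <= C" for x
  proof -
    have "x - fl x : cbox 0 One" using minus_fl_hcell[of x] by (auto simp: hcell_def mem_box_cart less_imp_le)
    hence "norm (q (x - fl x)) <= C" by (intro C imageI)
    thus ?thesis by (simp add: periodic_fl[OF p])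
  qed
  thus thesis using that by blast
qed

lemma pderiv_cl_periodic:
  fixes f :: "real^'d => complex"
  assumes "periodic f" "smooth_fun f" shows "periodic (pd j f)"
  unfolding periodic_def
proof (intro ballI allI)
  fix k x :: "real^'d" assume k: "k : int_lattice"
  have "(%x. f (1 *R x + k)) = f" using periodicD[OF assms(1) k] by auto
  thus "pd j f (x + k) = pd j f x"
    using pderiv_cl_affine[of f j 1 k] smooth_fun_diffble[OF assms(2)] by (auto dest: fun_cong[of _ _ x])
qed

lemma mpd_periodic:
  fixes q :: "real^'d => complex^'p^'m"
  assumes "periodic q" "smooth_mat q" shows "periodic (mpd j q)"
proof -
  have "periodic (pd j (%x. q x $ i $ k))" for i k
    using assms by (intro pderiv_cl_periodic) (auto simp: periodic_def smooth_mat_def)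
  thus ?thesis by (simp add: periodic_def mpd_def)
qed

lemma smooth_periodic_perL2_bmat:
  fixes q :: "real^'d => complex^'p^'m"
  assumes "periodic q" "smooth_mat q"
  shows "perL2 q" "bmat q" "perL2 (mpd j q)" "bmat (mpd j q)"
proof -
  have *: "perL2 q & bmat q" if q: "periodic q" "smooth_mat q" for q :: "real^'d => complex^'p^'m"
  proof -
    obtain C where C: "!!x. norm (q x) <= C"
      by (rule periodic_cont_bounded[OF q(1) smooth_mat_continuous[OF q(2)]]) blast
    have qm: "q : borelf" by (intro borel_measurable_continuous_onI smooth_mat_continuous q)
    show ?thesis using perL2_bounded[OF qm q(1) C] qm C unfolding bmat_def by blast
  qed
  show "perL2 q" "bmat q" "perL2 (mpd j q)" "bmat (mpd j q)"
    using *[OF assms] *[OF mpd_periodic[OF assms] smooth_mat_mpd[OF assms(2)]] by auto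
qed

context
  fixes eps :: real
  assumes eps: "0 < eps"
begin

lemma wder_cellavg: "wder j u g ==> wder j (cellavg eps u) (cellavg eps g)"
  unfolding cellavg_def by (rule wder_avg[OF bounded_linear_scale_arg[OF eps]])

text \<open>The factor \<open>1 / eps\<close> comes from differentiating
  \<open>N (x /\<^sub>R eps)\<close>; the factor \<open>eps\<close> of the ansatz cancels
  it.\<close>

lemma wder_Mop:
  fixes N :: "real^'d => complex^'p^'m"
  assumes N: "H1field N D" and Z: "wder j Z Z'"
  shows "wder j (Mop eps N Z) ((1 / eps) *R Mop eps (D j) Z + Mop eps N Z')"
proof -
  obtain p where p: "!!m. smooth_mat (p m)" "!!m. periodic (p m)"
    and l1: "(%m::nat. cellnorm (%x. N x - p m x)) ----> 0" and l2: "!!j. (%m. cellnorm (%x. D j x - mpd j (p m) x)) ----> 0"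
    using N by (auto simp: H1field_def)
  have pN: "perL2 N" "perL2 (D j)" using N by (auto simp: H1field_def)
  note b = smooth_periodic_perL2_bmat[OF p(2) p(1)]
  have "wder j (Mop eps (p m) Z) ((1 / eps) *R Mop eps (mpd j (p m)) Z + Mop eps (p m) Z')" for m
  proof -
    define q where "q x = p m (x /\<^sub>R eps)" for x
    have qs: "smooth_mat q"
      using smooth_fun_affine[of "%x. p m x $ i $ k" "inverse eps" 0 for i k] p(1)[of m] by (auto simp: smooth_mat_def q_def)
    have qd: "mpd j q = (%x. (1 / eps) *R mpd j (p m) (x /\<^sub>R eps))"
    proof -
      have "pd j (%x. p m (x /\<^sub>R eps) $ i $ k) = (%x. of_real (inverse eps) * pd j (%x. p m x $ i $ k) (x /\<^sub>R eps))" for i k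
        using pderiv_cl_affine[of "%x. p m x $ i $ k" j "inverse eps" 0] p(1)[of m]
        by (simp add: smooth_mat_def smooth_fun_diffble)
      thus ?thesis
        by (simp add: mpd_def q_def fun_eq_iff vec_eq_iff scaleR_conv_of_real[where 'a=complex] inverse_eq_divide)
    qed
    have bq: "bmat q" unfolding q_def by (rule bmat_scaled[OF eps b(2)])
    have bd: "bmat (%x. mpd j (p m) (x /\<^sub>R eps))" by (rule bmat_scaled[OF eps b(4)])
    have "bmat (mpd j q)"
    proof -
      obtain C where C: "!!x. norm (mpd j (p m) x) <= C" using b(4)[of j m] by (auto simp: bmat_def)
      have "norm (mpd j q x) <= \<bar>1 / eps\<bar> * C" for x unfolding qd using C by (simp add: mult_left_mono divide_right_mono)
      moreover have "mpd j q : borelf"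
        by (intro borel_measurable_continuous_onI smooth_mat_continuous smooth_mat_mpd qs)
      ultimately show ?thesis by (auto simp: bmat_def)
    qed
    from wder_mult[OF qs bq this wder_cellavg[OF Z]]
    have w: "wder j (mult q (cellavg eps Z)) (mult (mpd j q) (cellavg eps Z) + mult q (cellavg eps Z'))" .
    have "mult (mpd j q) (cellavg eps Z) = (1 / eps) *R Mop eps (mpd j (p m)) Z"
      unfolding qd Mop_def mult_def
      by (simp add: scaleR_cmv scaleR_abs_L2_lborel Mop_sqint[OF eps b(3)])
    thus ?thesis using w unfolding Mop_bounded[OF eps] q_def by simp
  qed
  thus ?thesis
  proof (rule wder_limit)
    show "(%m. Mop eps (p m) Z) ----> Mop eps N Z" by (rule Mop_tendsto_left[OF eps pN(1) b(1) l1])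
    show "(%m. (1 / eps) *R Mop eps (mpd j (p m)) Z + Mop eps (p m) Z') ----> (1 / eps) *R Mop eps (D j) Z + Mop eps N Z'"
      by (intro tendsto_intros Mop_tendsto_left[OF eps pN(1) b(1) l1] Mop_tendsto_left[OF eps pN(2) b(3) l2])
  qed
qed

end

section \<open>Divergence-free fields and the error estimate\<close>

section \<open>Divergence-free periodic fields\<close>

lemma integral_lborel_scale:
  fixes f :: "'a::euclidean_space => 'b::{banach,second_countable_topology}"
  assumes c: "0 < c" and [measurable]: "f : borelf"
  shows "(LINT x|lborel. f x) = c ^ DIM('a) *R (LINT x|lborel. f (c *R x))"
proof -
  have "(LINT x|lborel. f x) = (LINT x|density (distr lborel borel (%x::'a. 0 + c *R x)) (%_. ennreal (\<bar>c\<bar> ^ DIM('a))). f x)"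
    using c by (subst lborel_affine[of c 0]) auto
  also have "... = (LINT x|distr lborel borel (%x::'a. 0 + c *R x). (\<bar>c\<bar> ^ DIM('a)) *R f x)"
    by (rule integral_density) auto
  also have "... = (LINT x|lborel. (\<bar>c\<bar> ^ DIM('a)) *R f (0 + c *R x))"
    by (rule integral_distr) auto
  finally show ?thesis using c by simp
qed

lemma integrable_lborel_scale:
  fixes f :: "'a::euclidean_space => 'b::{banach,second_countable_topology}"
  assumes c: "0 < c" and [measurable]: "f : borelf" and i: "integrable lborel (%x. f (c *R x))"
  shows "integrable lborel f"
proof -
  have "integrable lborel (%x. (\<bar>c\<bar> ^ DIM('a)) *R f (0 + c *R x))" using i by simp
  hence "integrable (distr lborel borel (%x::'a. 0 + c *R x)) (%x. (\<bar>c\<bar> ^ DIM('a)) *R f x)"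
    by (subst integrable_distr_eq) auto
  hence "integrable (density (distr lborel borel (%x::'a. 0 + c *R x)) (%_. ennreal (\<bar>c\<bar> ^ DIM('a)))) f"
    by (subst integrable_density) auto
  thus ?thesis using c by (subst lborel_affine[of c 0]) auto
qed

text \<open>The sum over all lattice translates, cut to a finite sum. The cut is harmless when
  \<open>phi\<close> vanishes outside the ball of radius \<open>R\<close>.\<close>

definition periodize :: "real => (real^'d => complex) => real^'d => complex" where
  "periodize R phi x = (SUM k:{k : int_lattice. norm (x + k) <= R}. phi (x + k))"

lemma periodize_superset:
  fixes phi :: "real^'d => complex"
  assumes phi: "!!x. R < norm x ==> phi x = 0" and K: "finite K" "K \<subseteq> int_lattice" "{k : int_lattice. norm (x + k) <= R} \<subseteq> K"
  shows "periodize R phi x = (SUM k:K. phi (x + k))"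
  unfolding periodize_def
proof (rule sum.mono_neutral_left[OF K(1,3)], intro ballI)
  fix k assume "k : K - {k : int_lattice. norm (x + k) <= R}"
  hence "R < norm (x + k)" using K(2) by (auto simp: not_le)
  thus "phi (x + k) = 0" by (rule phi)
qed

lemma periodize_has_derivative:
  fixes phi :: "real^'d => complex"
  assumes s: "smooth_fun phi" and phi: "!!x. R < norm x ==> phi x = 0"
  shows "(periodize R phi has_derivative (%h. SUM j:UNIV. h $ j *R periodize R (pd j phi) x)) (at x)"
proof -
  \<comment> \<open>With radius \<open>R + 1\<close> one finite index set serves all points within
    distance 1 of \<open>x\<close>, so the sum can be differentiated term by term.\<close>
  define K where "K = {k : int_lattice. norm (x + k) <= R + 1}"
  have K: "finite K" "K \<subseteq> int_lattice" unfolding K_def by (auto intro: finite_lattice_ball)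
  have sub: "{k : int_lattice. norm (y + k) <= R} \<subseteq> K" if "dist y x < 1" for y
  proof -
    have "norm (x + k) <= norm (y + k) + norm (x - y)" for k
    proof -
      have "x + k = (y + k) + (x - y)" by simp
      thus ?thesis using norm_triangle_ineq by metis
    qed
    thus ?thesis using that unfolding K_def dist_norm norm_minus_commute[of y x] by (smt (verit) Collect_mono)
  qed
  have phi': "pd j phi y = 0" if "R < norm y" for j y
    by (rule pderiv_cl_0_outside[of "cball 0 R"]) (use phi that in \<open>auto simp: not_le\<close>)
  have "((%y. SUM k:K. phi (y + k)) has_derivative (%h. SUM k:K. SUM j:UNIV. h $ j *R pd j phi (x + k))) (at x)"
  proof (intro has_derivative_sum)
    fix k
    show "((%y. phi (y + k)) has_derivative (%h. SUM j:UNIV. h $ j *R pd j phi (x + k))) (at x)"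
      by (rule has_derivative_compose[OF _ has_derivative_pderiv_cl[OF smooth_fun_diffble[OF s]]])
        (auto intro!: derivative_eq_intros)
  qed
  hence "(periodize R phi has_derivative (%h. SUM k:K. SUM j:UNIV. h $ j *R pd j phi (x + k))) (at x)"
    by (rule has_derivative_transform_within[where d=1])
      (auto simp: periodize_superset[OF phi K sub])
  moreover have "(SUM k:K. SUM j:UNIV. h $ j *R pd j phi (x + k)) = (SUM j:UNIV. h $ j *R periodize R (pd j phi) x)" for h
  proof -
    have "periodize R (pd j phi) x = (SUM k:K. pd j phi (x + k))" for j
      by (rule periodize_superset[OF phi' K]) (use sub[of x] in auto)
    thus ?thesis by (subst sum.swap) (simp add: scaleR_sum_right)
  qed
  ultimately show ?thesis by simp
qed

lemma pderiv_cl_periodize: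
  fixes phi :: "real^'d => complex"
  assumes s: "smooth_fun phi" and phi: "!!x. R < norm x ==> phi x = 0"
  shows "pd j (periodize R phi) = periodize R (pd j phi)"
proof
  fix x
  have "pd j (periodize R phi) x = (SUM k:UNIV. (axis j 1 :: real^'d) $ k *R periodize R (pd k phi) x)"
    by (rule pderiv_clI[OF periodize_has_derivative[OF assms]])
  also have "... = (SUM k:UNIV. if k = j then periodize R (pd j phi) x else 0)"
    by (rule sum.cong) (auto simp: axis_def)
  finally show "pd j (periodize R phi) x = periodize R (pd j phi) x" by simp
qed

lemma periodize_smooth_periodic:
  fixes phi :: "real^'d => complex"
  assumes s: "smooth_fun phi" and phi: "!!x. R < norm x ==> phi x = 0"
  shows "periodize R phi : smooth_periodic"
proof -
  let ?F = "periodize R ` {phi. smooth_fun phi & (ALL x. R < norm x --> phi x = 0)}"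
  have "smooth_fun (periodize R phi)"
  proof (rule smooth_fun_coinduct[of _ ?F])
    show "periodize R phi : ?F" using assms by blast
  next
    fix f x assume "f : ?F"
    thus "f differentiable (at x)" using periodize_has_derivative differentiableI by blast
  next
    fix f j assume "f : ?F"
    then obtain th where th: "smooth_fun th" "!!x. R < norm x ==> th x = 0" "f = periodize R th" by blast
    have "pd j th y = 0" if "R < norm y" for y
      by (rule pderiv_cl_0_outside[of "cball 0 R"]) (use th that in \<open>auto simp: not_le\<close>)
    thus "pd j f : ?F"
      using pderiv_cl_periodize[OF th(1,2), where j=j] smooth_fun_pderiv[OF th(1), where j=j] th(3) by blast
  qed
  moreover have "periodize R phi (x + l) = periodize R phi x" if l: "l : int_lattice" for l x
  proof -
    have "bij_betw (%k. k + l) {k : int_lattice. norm (x + l + k) <= R} {k : int_lattice. norm (x + k) <= R}"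
      by (rule bij_betwI[where g="%k. k - l"]) (auto simp: int_lattice_closed l algebra_simps)
    from sum.reindex_bij_betw[OF this, of "%k. phi (x + k)"] show ?thesis
      by (simp add: periodize_def algebra_simps)
  qed
  ultimately show ?thesis by (simp add: smooth_periodic_def)
qed

lemma norm_hcell_le: "x : hcell ==> norm (x :: real^'d) <= real CARD('d)"
proof -
  assume x: "x : hcell"
  have "0 <= x $ i & x $ i < 1" for i using x by (simp add: hcell_def)
  hence 1: "\<bar>x $ i\<bar> <= 1" for i by (smt (verit))
  have "norm x <= (SUM i:UNIV. \<bar>x $ i\<bar>)" by (rule norm_le_l1_cart)
  also have "... <= (SUM i:(UNIV::'d set). 1)" by (intro sum_mono 1)
  finally show ?thesis by simp
qed

text \<open>Unfolding: cutting the space into lattice cells and moving each back to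
  \<open>hcell\<close> collects the translates of \<open>phi\<close> while \<open>g\<close> stays
  the same. This passes between compactly supported and periodic test functions.\<close>

lemma integral_periodize:
  fixes g phi :: "real^'d => complex"
  assumes gm [measurable]: "g : borelf" and g: "periodic g" "integrable lborel (%y. ihc y *R g y)"
    and phim [measurable]: "phi : borelf" and phi: "!!x. R < norm x ==> phi x = 0" "!!x. norm (phi x) <= C"
  shows "integrable lborel (%x. g x * phi x)"
    and "(LINT x|lborel. g x * phi x) = (LINT y|lborel. ihc y *R (g y * periodize R phi y))"
proof -
  \<comment> \<open>Points of \<open>hcell\<close> have norm at most \<open>CARD('d)\<close>, so
    these finitely many cells cover the support of \<open>phi\<close>.\<close>
  define K where "K = {k : int_lattice. norm (0 + k :: real^'d) <= R + real CARD('d)}"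
  have K: "finite K" "K \<subseteq> int_lattice" unfolding K_def by (auto intro!: finite_lattice_ball simp del: add_0)
  have sub: "{k : int_lattice. norm (y + k) <= R} \<subseteq> K" if y: "y : hcell" for y
  proof
    fix k assume k: "k : {k : int_lattice. norm (y + k) <= R}"
    have "norm k <= norm (y + k) + norm y" using norm_triangle_ineq4[of "y + k" y] by simp
    thus "k : K" using k norm_hcell_le[OF y] by (simp add: K_def)
  qed
  define F where "F k y = ihc y *R (g y * phi (y + k))" for k y
  have Fi: "integrable lborel (F k)" for k
  proof (rule integrable_dominated)
    show "integrable lborel (%y. C *R (ihc y *R g y))" by (intro integrable_scaleR_right g)
    show "AE y in lborel. norm (F k y) <= norm (C *R (ihc y *R g y))"
    proof (rule AE_I2)
      fix y
      have "norm (g y * phi (y + k)) <= norm (g y) * C" unfolding norm_mult by (intro mult_left_mono phi) simp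
      moreover have "0 <= C" using phi(2)[of 0] norm_ge_zero order_trans by blast
      ultimately show "norm (F k y) <= norm (C *R (ihc y *R g y))"
        by (simp add: F_def indicator_def mult.commute)
    qed
  qed (unfold F_def, measurable)
  have sh: "integrable lborel (%x. F k (x - k))" "(LINT x|lborel. F k (x - k)) = (LINT y|lborel. F k y)" for k
  proof -
    have [measurable]: "F k : borelf" unfolding F_def by measurable
    show "(LINT x|lborel. F k (x - k)) = (LINT y|lborel. F k y)" using integral_lborel_shift[of "F k" "- k"] by simp
    have "(nn_integral lborel (%x. ennreal (norm (F k (x - k))))) = (nn_integral lborel (%x. ennreal (norm (F k x))))"
      using nn_lborel_shift[of "%x. ennreal (norm (F k x))" "- k"] by simp
    thus "integrable lborel (%x. F k (x - k))" using Fi[of k] by (simp add: integrable_iff_bounded)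
  qed
  have dec: "g x * phi x = (SUM k:K. F k (x - k))" for x
  proof (cases "norm x <= R")
    case True
    have flK: "fl x : K"
    proof -
      have "norm (fl x) <= norm x + norm (x - fl x)" using norm_triangle_ineq4[of x "x - fl x"] by simp
      thus ?thesis using True norm_hcell_le[OF minus_fl_hcell[of x]] by (simp add: K_def)
    qed
    \<comment> \<open>Each \<open>x\<close> lies in exactly one cell, the one with
      \<open>k = fl x\<close>.\<close>
    have "F k (x - k) = (if k = fl x then g x * phi x else 0)" if "k : K" for k
      using that K(2) hcell_iff_fl[of k x] periodic_fl[OF g(1), of x] by (auto simp: F_def indicator_def)
    hence "(SUM k:K. F k (x - k)) = (SUM k:K. if k = fl x then g x * phi x else 0)" by (intro sum.cong) auto
    thus ?thesis using flK K(1) by simp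
  next
    case False
    thus ?thesis using phi(1)[of x] by (simp add: F_def not_le)
  qed
  show "integrable lborel (%x. g x * phi x)"
    unfolding dec by (intro Bochner_Integration.integrable_sum sh)
  have "(LINT x|lborel. g x * phi x) = (SUM k:K. LINT y|lborel. F k y)"
    unfolding dec by (subst Bochner_Integration.integral_sum) (auto simp: sh)
  also have "... = (LINT y|lborel. (SUM k:K. F k y))"
    by (rule Bochner_Integration.integral_sum[symmetric]) (rule Fi)
  also have "... = (LINT y|lborel. ihc y *R (g y * periodize R phi y))"
  proof (rule LINT_cong)
    fix y
    show "(SUM k:K. F k y) = ihc y *R (g y * periodize R phi y)"
    proof (cases "y : hcell")
      case True
      thus ?thesis using periodize_superset[OF phi(1) K sub[OF True]] by (simp add: F_def sum_distrib_left)
    qed (simp add: F_def)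
  qed simp
  finally show "(LINT x|lborel. g x * phi x) = (LINT y|lborel. ihc y *R (g y * periodize R phi y))" .
qed

text \<open>In the row index \<open>(i, j)\<close> the second entry is the direction of
  differentiation; for each \<open>i\<close> and each column \<open>q\<close> the divergence over
  \<open>j\<close> vanishes weakly on the torus.\<close>

definition divfree :: "(real^'d => complex^'q^('n::finite \<times> 'd)) => bool" where
  "divfree g \<longleftrightarrow> (ALL i q. ALL psi:smooth_periodic.
     (SUM j:UNIV. LINT y|lborel. ihc y *R (g y $ (i, j) $ q * pd j psi y)) = 0)"

lemma perL2_component:
  fixes g :: "real^'d => complex^'q^'m"
  assumes "perL2 g" shows "perL2 (%x. g x $ p $ q)"
proof (rule perL2_bounded_by[OF assms, of _ 1])
  have "continuous_on UNIV (%A::complex^'q^'m. A $ p $ q)" by (intro continuous_intros)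
  from measurable_compose[OF perL2_measurable[OF assms] borel_measurable_continuous_onI[OF this]]
  show "(%x. g x $ p $ q) : borelf" .
  show "periodic (%x. g x $ p $ q)" using assms by (simp add: perL2_def periodic_def)
  show "norm (g x $ p $ q) <= 1 * norm (g x)" for x
    using Finite_Cartesian_Product.norm_nth_le[of "g x $ p" q] Finite_Cartesian_Product.norm_nth_le[of "g x" p] by simp
qed

text \<open>After rescaling by \<open>eps\<close>, the test function is periodized; the integral
  over the space becomes one over the cell, where the assumption on \<open>g\<close>
  applies.\<close>

lemma divfree_test_fun:
  fixes g :: "real^'d => complex^'q^('n::finite \<times> 'd)"
  assumes eps: "0 < eps" and g: "perL2 g" "divfree g" and psi: "psi : test_fun UNIV"
  shows "integrable lborel (%x. g (x /\<^sub>R eps) $ p $ q * pd j psi x)"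
    and "(SUM j:UNIV. LINT x|lborel. g (x /\<^sub>R eps) $ (i, j) $ q * pd j psi x) = 0"
proof -
  define th where "th y = psi (eps *R y)" for y
  have th: "th : test_fun UNIV" unfolding th_def using test_fun_affine[OF psi, of eps 0] eps by simp
  have dth: "pd j th y = of_real eps * pd j psi (eps *R y)" for j y
    using pderiv_cl_affine[of psi j eps 0] smooth_fun_diffble[OF test_fun_smooth[OF psi]]
    unfolding th_def by (simp add: fun_eq_iff)
  obtain L where L: "compact L" "!!x. x ~: L ==> th x = 0" using th by (auto simp: test_fun_iff)
  obtain R where R: "!!x. x : L ==> norm x <= R" using compact_imp_bounded[OF L(1)] bounded_iff by metis
  have th0: "th x = 0" if "R < norm x" for x using L(2) R that by (meson not_le)
  have dth0: "pd j th y = 0" if "R < norm y" for j y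
    by (rule pderiv_cl_0_outside[of "cball 0 R"]) (use th0 that in \<open>auto simp: not_le\<close>)
  have dthm: "pd j th : borelf" for j
    by (rule smooth_fun_measurable[OF test_fun_smooth[OF test_fun_pderiv[OF th]]])
  have psim [measurable]: "pd j psi : borelf" for j
    by (rule smooth_fun_measurable[OF test_fun_smooth[OF test_fun_pderiv[OF psi]]])
  have main: "integrable lborel (%y. g y $ p $ q * pd j th y)"
    "(LINT y|lborel. g y $ p $ q * pd j th y) = (LINT y|lborel. ihc y *R (g y $ p $ q * pd j (periodize R th) y))" for p j
  proof -
    have c: "perL2 (%y. g y $ p $ q)" by (rule perL2_component[OF g(1)])
    obtain C where C: "!!x. norm (pd j th x) <= C" using test_fun_bounded[OF test_fun_pderiv[OF th, of j]] by blast
    have pr: "periodic (%y. g y $ p $ q)" using c by (simp add: perL2_def)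
    note m = integral_periodize[OF perL2_measurable[OF c] pr perL2_integrable[OF c] dthm dth0 C]
    show "integrable lborel (%y. g y $ p $ q * pd j th y)" by (rule m(1))
    show "(LINT y|lborel. g y $ p $ q * pd j th y) = (LINT y|lborel. ihc y *R (g y $ p $ q * pd j (periodize R th) y))"
      using m(2) pderiv_cl_periodize[OF test_fun_smooth[OF th] th0, where j=j] by simp
  qed
  have fm: "(%x. g (x /\<^sub>R eps) $ p $ q * pd j psi x) : borelf" for p j
  proof -
    have "(%x. g x $ p $ q) : borelf" by (rule perL2_measurable[OF perL2_component[OF g(1)]])
    from measurable_compose[OF _ this, of "%x. x /\<^sub>R eps" borel] have "(%x. g (x /\<^sub>R eps) $ p $ q) : borelf" by simp
    thus ?thesis by measurable
  qed
  have e: "g ((eps *R y) /\<^sub>R eps) $ p $ q * pd j psi (eps *R y) = of_real (1 / eps) * (g y $ p $ q * pd j th y)" for y p j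
    using eps by (simp add: dth)
  show "integrable lborel (%x. g (x /\<^sub>R eps) $ p $ q * pd j psi x)"
    by (rule integrable_lborel_scale[OF eps fm], unfold e) (intro integrable_mult_right main)
  have "(LINT x|lborel. g (x /\<^sub>R eps) $ (i, j) $ q * pd j psi x)
      = eps ^ CARD('d) *R (of_real (1 / eps) * (LINT y|lborel. ihc y *R (g y $ (i, j) $ q * pd j (periodize R th) y)))" for j
    unfolding main(2)[symmetric] integral_lborel_scale[OF eps fm] e by simp
  hence "(SUM j:UNIV. LINT x|lborel. g (x /\<^sub>R eps) $ (i, j) $ q * pd j psi x)
      = eps ^ CARD('d) *R (of_real (1 / eps) * (SUM j:UNIV. LINT y|lborel. ihc y *R (g y $ (i, j) $ q * pd j (periodize R th) y)))"
    by (simp add: sum_distrib_left scaleR_sum_right)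
  also have "... = 0"
    using g(2) periodize_smooth_periodic[OF test_fun_smooth[OF th] th0] by (simp add: divfree_def)
  finally show "(SUM j:UNIV. LINT x|lborel. g (x /\<^sub>R eps) $ (i, j) $ q * pd j psi x) = 0" .
qed

lemma perL2_matrix_mult:
  fixes g :: "real^'d => complex^'q^'m" and b :: "real^'d => complex^'m^'k"
  assumes g: "perL2 g" and b: "bmat b" "periodic b"
  shows "perL2 (%x. b x ** g x)"
proof -
  have nm: "norm (A ** B) <= norm A * norm B" for A :: "complex^'m^'k" and B :: "complex^'q^'m"
  proof -
    have col: "(A ** B) $ i $ q = (A *v (\<chi> k. B $ k $ q)) $ i" for i q
      by (simp add: matrix_matrix_mult_def matrix_vector_mult_def)
    have "(norm (A ** B))^2 = (SUM i:UNIV. SUM q:UNIV. (norm ((A ** B) $ i $ q))^2)"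
      by (simp add: norm_vec_def L2_set_def sum_nonneg)
    also have "... = (SUM q:UNIV. (norm (A *v (\<chi> k. B $ k $ q)))^2)"
      unfolding col by (subst sum.swap) (simp add: norm_vec_def L2_set_def sum_nonneg)
    also have "... <= (SUM q:UNIV. (norm A * norm (\<chi> k. B $ k $ q))^2)"
      by (intro sum_mono power_mono norm_mv_le) simp
    also have "... = (norm A)^2 * (SUM q:UNIV. SUM k:UNIV. (norm (B $ k $ q))^2)"
      by (simp add: power_mult_distrib sum_distrib_left norm_vec_def[of "\<chi> k. B $ k $ q" for q] L2_set_def sum_nonneg)
    also have "... = (norm A)^2 * (norm B)^2"
      by (subst sum.swap) (simp add: norm_vec_def[of B] norm_vec_def[of "B $ k" for k] L2_set_def sum_nonneg)
    finally show ?thesis by (intro power2_le_imp_le[of "norm (A ** B)"]) (auto simp: power_mult_distrib)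
  qed
  obtain C where C: "!!x. norm (b x) <= C" using b by (auto simp: bmat_def)
  have "continuous_on UNIV (%p. fst p ** snd p :: complex^'q^'k)" for dummy :: "(complex^'m^'k) \<times> (complex^'q^'m)"
    unfolding matrix_matrix_mult_def by (intro continuous_on_vec_lambda continuous_intros)
  hence "continuous_on UNIV (%p :: (complex^'m^'k) \<times> (complex^'q^'m). fst p ** snd p)" .
  from borel_measurable_continuous_Pair[OF _ _ this, of b borel g]
  have m: "(%x. b x ** g x) : borelf" using b g by (simp add: bmat_def perL2_def)
  show ?thesis
  proof (rule perL2_bounded_by[OF g m])
    show "periodic (%x. b x ** g x)" using b g by (simp add: perL2_def periodic_def)
    show "norm (b x ** g x) <= C * norm (g x)" for x
      using order_trans[OF nm mult_right_mono[OF C norm_ge_zero]] .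
  qed
qed

lemma perL2_Pj: "perL2 g ==> perL2 (%x. Pj j ** g x)"
  for g :: "real^'d => complex^'q^('n::finite \<times> 'd)"
  by (rule perL2_matrix_mult) (auto simp: periodic_def)

lemma mult_sum_left: "finite S ==> (SUM k:S. mult (%_. A k) u) = mult (%_. SUM k:S. A k) u"
proof (induction S rule: finite_induct)
  case empty
  show ?case by (simp add: mult_def zero_abs_L2)
next
  case (insert k S)
  thus ?case by (simp add: mult_add_left)
qed

lemma sum_adj_Pj_mat: "(SUM j:UNIV. adj (Pj j) ** Pj j) = (mat 1 :: complex^('n::finite \<times> 'd::finite)^('n \<times> 'd))"
proof -
  have "(SUM j:UNIV. adj (Pj j) ** Pj j) *v X = X" for X :: "complex^('n \<times> 'd)"
  proof -
    have "(SUM j:S. B j) *v X = (SUM j:S. B j *v X)" if "finite S" for S and B :: "'d => complex^('n \<times> 'd)^('n \<times> 'd)"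
      using that by (induction S rule: finite_induct) (auto simp: matrix_vector_mult_add_rdistrib)
    thus ?thesis by (simp add: matrix_vector_mul_assoc[symmetric] sum_adj_Pj)
  qed
  thus ?thesis by (simp add: matrix_eq)
qed

lemma L2_decompose_Pj: "V = (SUM j:UNIV. mult (%_. adj (Pj j)) (mult (%_. Pj j) V))"
  for V :: "('d::finite, 'n::finite \<times> 'd) L2"
  by (simp add: mult_mult mult_sum_left sum_adj_Pj_mat)

lemma inner_Pj_sum: "U *. V = (SUM j:UNIV. mult (%_. Pj j) U *. mult (%_. Pj j) V)"
  for V :: "('d::finite, 'n::finite \<times> 'd) L2"
  by (subst L2_decompose_Pj) (simp add: inner_sum_right inner_mult)

text \<open>The entries of \<open>g\<close> are tested with \<open>Phi $ q * cnj (v $ i)\<close>,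
  where \<open>Phi\<close> is the average of \<open>Z\<close>. The product rule splits the
  derivative into the two terms of the claim.\<close>

lemma divfree_vtest:
  fixes g :: "real^'d => complex^'q^('n::finite \<times> 'd)"
  assumes eps: "0 < eps" and g: "perL2 g" "divfree g" and Z: "Z : vtest" and v: "v : vtest"
  shows "(SUM j:UNIV. Mop eps (%x. Pj j ** g x) (abs_L2 Z) *. abs_L2 (vpd j v)
      + Mop eps (%x. Pj j ** g x) (abs_L2 (vpd j Z)) *. abs_L2 v) = 0"
proof -
  have T: "bounded_linear (%w::real^'d. (- eps) *R w)" by (rule bounded_linear_scaleR_right)
  obtain Phi where Phi: "Phi : vtest" "cellavg eps (abs_L2 Z) = abs_L2 Phi"
    unfolding cellavg_def using avg_vtest[OF T Z] by blast
  have Phij: "cellavg eps (abs_L2 (vpd j Z)) = abs_L2 (vpd j Phi)" for j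
    using wder_cellavg[OF eps wder_vtest[OF Z, of j]] wder_vtest[OF Phi(1), of j] Phi(2) wder_unique by metis
  define G where "G j x = Pj j ** g x" for j x
  have G: "perL2 (G j)" for j unfolding G_def by (rule perL2_Pj[OF g(1)])
  have M: "(%x. G j (x /\<^sub>R eps) *v \<Theta> x) : sqint lborel" "Mop eps (G j) U = abs_L2 (%x. G j (x /\<^sub>R eps) *v \<Theta> x)"
    if "cellavg eps U = abs_L2 \<Theta>" "\<Theta> : vtest" for j U \<Theta>
  proof -
    have [measurable]: "G j : borelf" using G by (simp add: perL2_def)
    have [measurable]: "\<Theta> : borelf" by (rule smooth_vec_measurable[OF vtest_smooth[OF that(2)]])
    have ae: "AE x in lborel. G j (x /\<^sub>R eps) *v brep (cellavg eps U) x = G j (x /\<^sub>R eps) *v \<Theta> x"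
      unfolding that(1) using brep_abs_L2[OF vtest_sqint[OF that(2)]] by eventually_elim simp
    show s: "(%x. G j (x /\<^sub>R eps) *v \<Theta> x) : sqint lborel"
      by (rule sqint_cong_AE[OF Mop_sqint[OF eps G] _ ae]) measurable
    show "Mop eps (G j) U = abs_L2 (%x. G j (x /\<^sub>R eps) *v \<Theta> x)"
      unfolding Mop_def using ae by (simp add: abs_L2_eq_iff_lb Mop_sqint[OF eps G] s)
  qed
  define psi where "psi i q x = Phi x $ q * cnj (v x $ i)" for i q x
  let ?g = "%i j q x. g (x /\<^sub>R eps) $ (i, j) $ q * pd j (psi i q) x"
  have t: "(%x. Phi x $ q) : test_fun UNIV" "(%x. v x $ i) : test_fun UNIV" for q i
    using Phi(1) v by (auto simp: vtest_def)
  have psi: "psi i q : test_fun UNIV" for i q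
    unfolding psi_def by (rule test_fun_mult[OF test_fun_cnj[OF t(2)] test_fun_smooth[OF t(1)]])
  have dpsi: "pd j (psi i q) x = Phi x $ q * cnj (vpd j v x $ i) + vpd j Phi x $ q * cnj (v x $ i)" for i q j x
  proof -
    have "smooth_fun (%x. Phi x $ q)" "smooth_fun (%x. v x $ i)" "smooth_fun (%x. cnj (v x $ i))"
      using test_fun_smooth[OF t(1)] test_fun_smooth[OF t(2)] smooth_fun_cnj by auto
    thus ?thesis unfolding psi_def
      by (simp add: pderiv_cl_mult pderiv_cl_cnj smooth_fun_diffble vpd_def)
  qed
  have Gc: "(G j y *v z) $ i = (SUM q:UNIV. g y $ (i, j) $ q * z $ q)" for j y z i
  proof -
    have "(G j y *v z) $ i = (Pj j *v (g y *v z)) $ i" by (simp add: G_def matrix_vector_mul_assoc)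
    also have "... = (g y *v z) $ (i, j)" by (rule Pj_apply)
    finally show ?thesis by (simp add: matrix_vector_mult_def)
  qed
  have step: "Mop eps (G j) (abs_L2 Z) *. abs_L2 (vpd j v) + Mop eps (G j) (abs_L2 (vpd j Z)) *. abs_L2 v
      = (SUM i:UNIV. SUM q:UNIV. Re (LINT x|lborel. ?g i j q x))" for j
  proof -
    note m1 = M[OF Phi(2) Phi(1), of j] and m2 = M[OF Phij[of j] vtest_vpd[OF Phi(1)], of j]
    have vs: "vpd j v : sqint lborel" "v : sqint lborel"
      by (intro vtest_sqint vtest_vpd v)+
    have "Mop eps (G j) (abs_L2 Z) *. abs_L2 (vpd j v) + Mop eps (G j) (abs_L2 (vpd j Z)) *. abs_L2 v
      = (LINT x|lborel. (G j (x /\<^sub>R eps) *v Phi x) *. vpd j v x) + (LINT x|lborel. (G j (x /\<^sub>R eps) *v vpd j Phi x) *. v x)"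
      unfolding m1(2) m2(2) using inner_abs_L2_lborel[OF m1(1) vs(1)] inner_abs_L2_lborel[OF m2(1) vs(2)] by simp
    also have "... = (LINT x|lborel. (G j (x /\<^sub>R eps) *v Phi x) *. vpd j v x + (G j (x /\<^sub>R eps) *v vpd j Phi x) *. v x)"
      by (intro Bochner_Integration.integral_add[symmetric] square_integrable_inner m1(1) m2(1) vs)
    also have "... = (LINT x|lborel. (SUM i:UNIV. SUM q:UNIV. Re (?g i j q x)))"
    proof (rule LINT_cong)
      fix x
      show "(G j (x /\<^sub>R eps) *v Phi x) *. vpd j v x + (G j (x /\<^sub>R eps) *v vpd j Phi x) *. v x
        = (SUM i:UNIV. SUM q:UNIV. Re (?g i j q x))"
      proof -
        have "(SUM i:UNIV. (SUM q:UNIV. g (x /\<^sub>R eps) $ (i, j) $ q * Phi x $ q) * cnj (vpd j v x $ i))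
            + (SUM i:UNIV. (SUM q:UNIV. g (x /\<^sub>R eps) $ (i, j) $ q * vpd j Phi x $ q) * cnj (v x $ i))
            = (SUM i:UNIV. SUM q:UNIV. ?g i j q x)"
          unfolding dpsi by (simp only: sum_distrib_right sum.distrib[symmetric] distrib_left mult.assoc)
        from arg_cong[OF this, of Re] show ?thesis unfolding inner_cvec Gc by simp
      qed
    qed simp
    also have "... = (SUM i:UNIV. SUM q:UNIV. (LINT x|lborel. Re (?g i j q x)))"
      by (subst Bochner_Integration.integral_sum, intro Bochner_Integration.integrable_sum integrable_Re divfree_test_fun[OF eps g psi])
        (intro sum.cong refl Bochner_Integration.integral_sum integrable_Re divfree_test_fun[OF eps g psi])
    also have "... = (SUM i:UNIV. SUM q:UNIV. Re (LINT x|lborel. ?g i j q x))"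
      by (intro sum.cong refl integral_Re divfree_test_fun[OF eps g psi])
    finally show ?thesis .
  qed
  have "(SUM j:UNIV. SUM i:UNIV. SUM q:UNIV. Re (LINT x|lborel. ?g i j q x))
      = (SUM i:UNIV. SUM q:UNIV. SUM j:UNIV. Re (LINT x|lborel. ?g i j q x))"
    by (subst sum.swap, intro sum.cong refl, subst sum.swap, rule refl)
  also have "... = (SUM i:UNIV. SUM q:UNIV. Re (SUM j:UNIV. LINT x|lborel. ?g i j q x))"
    by simp
  also have "... = 0" by (simp only: divfree_test_fun(2)[OF eps g psi]) simp
  finally have 0: "(SUM j:UNIV. SUM i:UNIV. SUM q:UNIV. Re (LINT x|lborel. ?g i j q x)) = 0" .
  have "(%x. Pj j ** g x) = G j" for j by (simp add: G_def fun_eq_iff)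
  thus ?thesis by (simp only: step 0)
qed

lemma Mop_tendsto_right:
  assumes "0 < eps" "perL2 G" "(%n. u n) ----> u'"
  shows "(%n. Mop eps G (u n)) ----> Mop eps G u'"
proof -
  have "(%n. cellnorm G * norm (u n - u')) ----> 0"
    using assms(3) by (intro tendsto_mult_right_zero tendsto_norm_zero) (simp add: LIM_zero_iff)
  hence "(%n. Mop eps G (u n) - Mop eps G u') ----> 0"
    by (rule Lim_null_comparison[rotated])
      (simp add: Mop_diff_right[OF assms(1,2), symmetric] norm_Mop_le[OF assms(1,2)])
  thus ?thesis by (simp add: LIM_zero_iff)
qed

lemma H1_vtest_sequence:
  fixes u :: "('d::finite, 'i::finite) L2"
  assumes g: "!!j. wder j u (g j)"
  obtains Psi where "!!m::nat. Psi m : vtest" "(%m. abs_L2 (Psi m)) ----> u" "!!j. (%m. abs_L2 (vpd j (Psi m))) ----> g j"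
proof -
  have "EX Psi. Psi : vtest & norm (u - abs_L2 Psi) < 1 / real (Suc m) & (ALL j. norm (g j - abs_L2 (vpd j Psi)) < 1 / real (Suc m))" for m
    using vtest_dense_H1[OF g, of "1 / real (Suc m)"] by (metis of_nat_0_less_iff zero_less_Suc zero_less_divide_1_iff)
  then obtain Psi where Psi: "!!m. Psi m : vtest" "!!m. norm (u - abs_L2 (Psi m)) < 1 / real (Suc m)"
    "!!m j. norm (g j - abs_L2 (vpd j (Psi m))) < 1 / real (Suc m)" by metis
  have l: "X ----> x" if "!!m. norm (x - X m) < 1 / real (Suc m)" for X and x :: "('d, 'i) L2"
  proof -
    have "(%m. 1 / real (Suc m)) ----> 0" using LIMSEQ_inverse_real_of_nat by (simp add: inverse_eq_divide)
    hence "(%m. X m - x) ----> 0"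
      by (rule Lim_null_comparison[rotated]) (use that in \<open>auto simp: norm_minus_commute intro!: always_eventually less_imp_le\<close>)
    thus ?thesis by (simp add: LIM_zero_iff)
  qed
  show thesis by (rule that[OF Psi(1) l[OF Psi(2)] l[OF Psi(3)]])
qed

text \<open>A divergence-free factor passes the derivative to the other factors; no potential of \<open>g\<close> is needed.\<close>

lemma divfree_integration_by_parts:
  fixes g :: "real^'d => complex^'q^('n::finite \<times> 'd)"
  assumes eps: "0 < eps" and g: "perL2 g" "divfree g" and Z: "!!j. wder j Z (D j)" and v: "grad_rel v V"
  shows "Mop eps g Z *. V = - (SUM j:UNIV. Mop eps (%x. Pj j ** g x) (D j) *. v)"
proof -
  obtain Psi where Psi: "!!m::nat. Psi m : vtest" "(%m. abs_L2 (Psi m)) ----> Z" "!!j. (%m. abs_L2 (vpd j (Psi m))) ----> D j"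
    using H1_vtest_sequence[OF Z] by blast
  obtain Phi where Phi: "!!m::nat. Phi m : vtest" "(%m. abs_L2 (Phi m)) ----> v" "!!j. (%m. abs_L2 (vpd j (Phi m))) ----> mult (%_. Pj j) V"
    using H1_vtest_sequence[of v "%j. mult (%_. Pj j) V"] v by (auto simp: grad_rel_def)
  have "(%m. SUM j:UNIV. Mop eps (%x. Pj j ** g x) (abs_L2 (Psi m)) *. abs_L2 (vpd j (Phi m))
      + Mop eps (%x. Pj j ** g x) (abs_L2 (vpd j (Psi m))) *. abs_L2 (Phi m))
    ----> (SUM j:UNIV. Mop eps (%x. Pj j ** g x) Z *. mult (%_. Pj j) V + Mop eps (%x. Pj j ** g x) (D j) *. v)"
    by (intro tendsto_intros Mop_tendsto_right[OF eps perL2_Pj[OF g(1)]] Psi Phi)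
  hence "(SUM j:UNIV. Mop eps (%x. Pj j ** g x) Z *. mult (%_. Pj j) V + Mop eps (%x. Pj j ** g x) (D j) *. v) = 0"
    unfolding divfree_vtest[OF eps g Psi(1) Phi(1)] by (simp add: LIMSEQ_const_iff)
  moreover have "Mop eps g Z *. V = (SUM j:UNIV. Mop eps (%x. Pj j ** g x) Z *. mult (%_. Pj j) V)"
    using mult_Mop[OF eps bmat_const g(1), of "Pj j" Z for j] by (simp add: inner_Pj_sum)
  ultimately show ?thesis by (simp add: sum.distrib)
qed

section \<open>The error estimate\<close>

lemma grad_rel_from_wder:
  fixes h :: "'d::finite => ('d, 'n::finite) L2"
  assumes "!!j. wder j w (h j)"
  shows "grad_rel w (SUM k:UNIV. mult (%_. adj (Pj k)) (h k))"
proof -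
  have P: "Pj j ** adj (Pj k) = (if k = j then mat 1 else (0 :: complex^'n^'n))" for j k :: 'd
  proof -
    have "(Pj j ** adj (Pj k)) *v x = (if k = j then mat 1 else (0 :: complex^'n^'n)) *v x" for x
      by (simp add: matrix_vector_mul_assoc[symmetric] vec_eq_iff adj_Pj_apply)
    thus ?thesis by (simp add: matrix_eq)
  qed
  have "mult (%_. Pj j) (SUM k:UNIV. mult (%_. adj (Pj k)) (h k)) = h j" for j
  proof -
    have "mult (%_. Pj j) (SUM k:UNIV. mult (%_. adj (Pj k)) (h k)) = (SUM k:UNIV. mult (%_. Pj j ** adj (Pj k)) (h k))"
      by (simp add: mult_linear mult_mult)
    also have "... = (SUM k:UNIV. if k = j then h j else 0)"
    proof (rule sum.cong)
      fix k
      have z: "mult (%_. 0) (h k) = (0 :: ('d, 'n) L2)" by (simp add: mult_def zero_abs_L2)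
      show "mult (%_. Pj j ** adj (Pj k)) (h k) = (if k = j then h j else 0)" by (simp add: P z)
    qed simp
    finally show ?thesis by simp
  qed
  thus ?thesis using assms by (simp add: grad_rel_def)
qed

text \<open>If \<open>D j\<close> is the \<open>j\<close>-th derivative of a matrix field, column
  \<open>q\<close> of \<open>grad_field D\<close> is the gradient of its column
  \<open>q\<close>.\<close>

definition grad_field :: "('d::finite => real^'d => complex^'q^'n) => real^'d => complex^'q^('n \<times> 'd)" where
  "grad_field D y = (SUM j:UNIV. adj (Pj j) ** D j y)"

lemma perL2_sum:
  fixes G :: "'k => real^'d => 'b::euclidean_space"
  assumes "finite S" "!!k. k : S ==> perL2 (G k)"
  shows "perL2 (%x. SUM k:S. G k x)"
  using assms
proof (induction S rule: finite_induct)
  case empty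
  show ?case using perL2_const[of "0 :: 'b"] by simp
next
  case (insert k S)
  thus ?case by (simp add: perL2_add)
qed

lemma perL2_adj_Pj: "perL2 D ==> perL2 (%y. adj (Pj j) ** D y)"
  by (rule perL2_matrix_mult) (auto simp: periodic_def)

lemma perL2_grad_field: "(!!j. perL2 (D j)) ==> perL2 (grad_field D)"
  unfolding grad_field_def[abs_def] by (intro perL2_sum perL2_adj_Pj) auto

lemma Mop_sum_left:
  fixes G :: "'k => real^'d => complex^'p^'m"
  assumes "0 < eps" "finite S" "!!k. k : S ==> perL2 (G k)"
  shows "Mop eps (%x. SUM k:S. G k x) u = (SUM k:S. Mop eps (G k) u)"
  using assms(2,3)
proof (induction S rule: finite_induct)
  case empty
  show ?case by (simp add: Mop_def zero_abs_L2)
next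
  case (insert k S)
  hence "Mop eps (%x. G k x + (SUM k:S. G k x)) u = Mop eps (G k) u + Mop eps (%x. SUM k:S. G k x) u"
    by (intro Mop_add_left[OF assms(1)] perL2_sum) auto
  thus ?case using insert by simp
qed

lemma Mop_grad_field:
  assumes "0 < eps" "!!j. perL2 (D j)"
  shows "Mop eps (grad_field D) u = (SUM j:UNIV. mult (%_. adj (Pj j)) (Mop eps (D j) u))"
proof -
  have "Mop eps (%y. adj (Pj j) ** D j y) u = mult (%_. adj (Pj j)) (Mop eps (D j) u)" for j
    by (rule mult_Mop[OF assms(1) bmat_const assms(2), symmetric])
  thus ?thesis unfolding grad_field_def[abs_def]
    by (subst Mop_sum_left[OF assms(1)]) (auto intro: perL2_adj_Pj assms)
qed

lemma cellmean_matrix_mult: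
  fixes g :: "real^'d => complex^'q^'m" and A :: "complex^'m^'k"
  assumes "perL2 g"
  shows "cellmean (%x. A ** g x) = A ** cellmean g"
proof -
  have "linear (%X :: complex^'q^'m. A ** X)"
    by (rule linearI) (simp_all add: matrix_matrix_mult_def vec_eq_iff sum.distrib algebra_simps scaleR_sum_right)
  hence bl: "bounded_linear (%X :: complex^'q^'m. A ** X)" by (simp add: linear_conv_bounded_linear)
  have "cellmean (%x. A ** g x) = (LINT w|lborel. A ** (ihc w *R g w))"
    unfolding cellmean_def linear_scale[OF bounded_linear.linear[OF bl]] ..
  also have "... = A ** cellmean g"
    unfolding cellmean_def by (rule integral_bounded_linear[OF bl perL2_integrable[OF assms]])
  finally show ?thesis .
qed

lemma norm_diff_cellavg_le:
  fixes u :: "('d::finite, 'i::finite) L2"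
  assumes eps: "0 < eps" and g: "!!j. wder j u (g j)" and F: "!!j. norm (g j) <= F"
  shows "norm (u - cellavg eps u) <= eps * (real CARD('d) * F)"
proof -
  have "norm (cellavg eps u - u) <= eps * (real CARD('d) * F)"
    unfolding cellavg_def
  proof (rule norm_avg_diff_le[OF bounded_linear_scaleR_right])
    fix w :: "real^'d" assume w: "w : cbox 0 One"
    have "norm (shift ((- eps) *R w) u - u) <= (SUM j:UNIV. \<bar>((- eps) *R w) $ j\<bar> * norm (g j))"
      by (rule norm_shift_diff_le[OF g])
    also have "... <= (SUM j:(UNIV::'d set). eps * F)"
    proof (rule sum_mono)
      fix j
      have "0 <= w $ j" "w $ j <= 1" using w by (auto simp: mem_box_cart)
      hence "\<bar>((- eps) *R w) $ j\<bar> <= eps" using eps by (simp add: abs_mult mult_left_le)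
      thus "\<bar>((- eps) *R w) $ j\<bar> * norm (g j) <= eps * F" using F[of j] eps by (intro mult_mono) auto
    qed
    finally show "norm (shift ((- eps) *R w) u - u) <= eps * (real CARD('d) * F)" by (simp add: mult_ac)
  qed
  thus ?thesis by (simp add: norm_minus_commute)
qed

lemma norm_shift_cube_le:
  fixes v :: "('d::finite, 'n::finite) L2"
  assumes eps: "0 < eps" and v: "grad_rel v V" and w: "w : cbox 0 One"
  shows "norm (shift (eps *R w) v - v) <= eps * (real CARD('d) * norm V)"
proof -
  have "(SUM j:UNIV. \<bar>(eps *R w) $ j\<bar>) <= (SUM j:(UNIV::'d set). eps)"
  proof (rule sum_mono)
    fix j
    have "0 <= w $ j" "w $ j <= 1" using w by (auto simp: mem_box_cart)
    thus "\<bar>(eps *R w) $ j\<bar> <= eps" using eps by (simp add: abs_mult mult_left_le)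
  qed
  hence "(SUM j:UNIV. \<bar>(eps *R w) $ j\<bar>) * norm V <= (real CARD('d) * eps) * norm V" by (intro mult_right_mono) auto
  thus ?thesis using norm_shift_diff_grad_le[OF v, of "eps *R w"] by (simp add: mult_ac)
qed

lemma inner_abs_le: "norm x <= B ==> \<bar>x *. y\<bar> <= B * norm y"
  by (rule order_trans[OF Cauchy_Schwarz_ineq2 mult_right_mono]) auto

lemma coercive_scaled: "coercive c b ==> coercive c (%x. b (x /\<^sub>R eps))"
  by (simp add: coercive_def)

lemma bmat_periodic_perL2:
  fixes b :: "real^'d => complex^'j^'i"
  assumes b: "bmat b" "periodic b"
  shows "perL2 b"
proof -
  obtain C where C: "!!x. norm (b x) <= C" using b(1) by (auto simp: bmat_def)
  show ?thesis by (rule perL2_bounded[OF bmat_measurable[OF b(1)] b(2) C])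
qed

theorem homogenization_estimate:
  fixes a :: "real^'d => complex^('n::finite \<times> 'd)^('n \<times> 'd)"
    and s :: "real^'d => complex^'n^'n"
    and N :: "real^'d => complex^('n \<times> 'd)^'n"
    and A :: "complex^('n \<times> 'd)^('n \<times> 'd)"
  assumes a: "bmat a" "periodic a" "coercive c a" and s: "bmat s" "periodic s" "coercive c s" and c: "0 < c"
    and A: "coercive c (%_::real^'d. A)" and m: "coercive c (%_::real^'d. cellmean s)"
    and N: "H1field N D"
    and g: "divfree (%y. a y ** (grad_field D y + mat 1) - A)" "cellmean (%y. a y ** (grad_field D y + mat 1) - A) = 0"
  obtains \<kappa> where "0 < \<kappa>" "!!eps f. 0 < eps ==>
    norm (op_inv (op_elliptic (%x. a (x /\<^sub>R eps)) (%x. s (x /\<^sub>R eps))) f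
      - op_inv (op_elliptic (%x::real^'d. A) (%x. cellmean s)) f) <= \<kappa> * eps * norm f"
proof -
  define g where "g y = a y ** (grad_field D y + mat 1) - A" for y
  have pN: "perL2 N" using N by (simp add: H1field_def)
  have pD: "perL2 (D j)" for j using N by (simp add: H1field_def)
  have pa: "perL2 a" by (rule bmat_periodic_perL2[OF a(1,2)])
  have ps: "perL2 s" by (rule bmat_periodic_perL2[OF s(1,2)])
  have pDN: "perL2 (grad_field D)" by (rule perL2_grad_field[OF pD])
  have paDN: "perL2 (%y. a y ** grad_field D y)" by (rule perL2_matrix_mult[OF pDN a(1,2)])
  have g_eq: "g = (%y. (a y ** grad_field D y + a y) - A)"
    by (simp add: g_def[abs_def] matrix_add_ldistrib)
  have pg: "perL2 g" unfolding g_eq by (intro perL2_diff perL2_add paDN pa perL2_const)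
  have dg: "divfree g" and mg: "cellmean g = 0" using g by (simp_all add: g_def[abs_def])
  have mgj: "cellmean (%y. Pj j ** g y) = 0" for j
    using cellmean_matrix_mult[OF pg, of "Pj j"] by (simp add: mg matrix_matrix_mult_def vec_eq_iff)
  obtain Ca where Ca: "!!x. norm (a x) <= Ca" using a(1) by (auto simp: bmat_def)
  obtain Cs where Cs: "!!x. norm (s x) <= Cs" using s(1) by (auto simp: bmat_def)
  have C0: "0 <= Ca" "0 <= Cs" using Ca[of 0] Cs[of 0] norm_ge_zero order_trans by blast+
  define d where "d = real CARD('d)"
  define SP where "SP = (SUM j:(UNIV::'d set). norm (adj (Pj j) :: complex^'n^('n \<times> 'd)))"
  \<comment> \<open>\<open>K1\<close> collects the errors that pair with the gradient
    \<open>V\<close>, \<open>K2\<close> those that pair with \<open>v\<close>; the terms are bounded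
    one by one in \<open>t1\<close> to \<open>t7\<close> below.\<close>
  define K1 where "K1 = Ca * d + norm A * d + (SUM j:(UNIV::'d set). d * cellnorm (%y. Pj j ** g y)) + Ca * (SP * cellnorm N) + d * cellnorm s"
  define K2 where "K2 = Cs * d + Cs * cellnorm N"
  have K0: "0 <= K1" "0 <= K2" "0 <= d" "0 <= SP" using C0
    by (auto simp: K1_def K2_def d_def SP_def intro!: add_nonneg_nonneg mult_nonneg_nonneg sum_nonneg)
  define K where "K = max K1 K2"
  \<comment> \<open>The first summand bounds the distance to the ansatz, \<open>cellnorm N\<close>
    the correction inside the ansatz; the division by \<open>c\<close> stems from
    \<open>F = norm f / c\<close>, and 1 is added for positivity.\<close>
  define \<kappa> where "\<kappa> = (2 * K / c + cellnorm N) / c + 1"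
  have Kn: "0 <= K" using K0 by (simp add: K_def)
  have \<kappa>: "0 < \<kappa>" using Kn c by (auto simp: \<kappa>_def intro!: add_nonneg_pos divide_nonneg_pos add_nonneg_nonneg)
  obtain R0 Gr0 where "bounded_linear R0" "!!u f. (u, f) : op_elliptic (%x::real^'d. A) (%x. cellmean s) \<longleftrightarrow> u = R0 f"
    and R0: "!!f. op_inv (op_elliptic (%x::real^'d. A) (%x. cellmean s)) f = R0 f" "!!f. grad_rel (R0 f) (Gr0 f)"
    "!!f v H. grad_rel v H ==> mult (%_. A) (Gr0 f) *. H + mult (%_. cellmean s) (R0 f) *. v = f *. v"
    "!!f. norm (R0 f) <= norm f / c" "!!f. norm (Gr0 f) <= norm f / c"
    by (rule elliptic_resolvent[OF bmat_const A bmat_const m c]) (rule that)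
  have "norm (op_inv (op_elliptic (%x. a (x /\<^sub>R eps)) (%x. s (x /\<^sub>R eps))) f
      - op_inv (op_elliptic (%x::real^'d. A) (%x. cellmean s)) f) <= \<kappa> * eps * norm f" if eps: "0 < eps" for eps f
  proof -
    let ?a = "%x. a (x /\<^sub>R eps)" and ?s = "%x. s (x /\<^sub>R eps)"
    note ba = bmat_scaled[OF eps a(1)] and bs = bmat_scaled[OF eps s(1)]
    note ca = coercive_scaled[OF a(3), of eps] and cs = coercive_scaled[OF s(3), of eps]
    obtain R Gr where "bounded_linear R" "!!u f. (u, f) : op_elliptic ?a ?s \<longleftrightarrow> u = R f"
      and R: "!!f. op_inv (op_elliptic ?a ?s) f = R f" "!!f. grad_rel (R f) (Gr f)"
      "!!f v H. grad_rel v H ==> mult ?a (Gr f) *. H + mult ?s (R f) *. v = f *. v"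
      "!!f. norm (R f) <= norm f / c" "!!f. norm (Gr f) <= norm f / c"
      by (rule elliptic_resolvent[OF ba ca bs cs c]) (rule that)
    define F where "F = norm f / c"
    have F0: "0 <= F" using c by (simp add: F_def)
    define u where "u = R0 f"
    define G where "G = Gr0 f"
    have uG: "grad_rel u G" "norm u <= F" "norm G <= F"
      and ueq: "!!v H. grad_rel v H ==> mult (%_. A) G *. H + mult (%_. cellmean s) u *. v = f *. v"
      using R0 by (auto simp: u_def G_def F_def)
    obtain D2 where D2w: "!!k. wder k G (D2 k)" and D2n: "!!k. norm (D2 k) <= norm f / c"
      by (rule constant_coefficient_regularity[OF A m c uG(1) ueq]) (assumption, rule that)
    have D2: "wder k G (D2 k)" "norm (D2 k) <= F" for k
      unfolding F_def by (rule D2w, rule D2n)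
    have wu: "wder j u (mult (%_. Pj j) G)" for j using uG(1) by (simp add: grad_rel_def)
    define w where "w = u + eps *R Mop eps N G"
    define X where "X = (SUM j:UNIV. mult (%_. adj (Pj j)) (Mop eps N (D2 j)))"
    \<comment> \<open>The gradient of the ansatz: the corrector contributes at order one after
      \<open>eps\<close> cancels \<open>1 / eps\<close>, and \<open>X\<close> collects the terms in
      which the derivative falls on \<open>G\<close>.\<close>
    define W where "W = G + Mop eps (grad_field D) G + eps *R X"
    have wW: "grad_rel w W"
    proof -
      have "wder j w (mult (%_. Pj j) G + eps *R ((1 / eps) *R Mop eps (D j) G + Mop eps N (D2 j)))" for j
        unfolding w_def by (intro wder_add wder_scaleR wu wder_Mop[OF eps N] D2)
      from grad_rel_from_wder[OF this]
      have "grad_rel w (SUM k:UNIV. mult (%_. adj (Pj k)) (mult (%_. Pj k) G + eps *R ((1 / eps) *R Mop eps (D k) G + Mop eps N (D2 k))))" .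
      also have "(SUM k:UNIV. mult (%_. adj (Pj k)) (mult (%_. Pj k) G + eps *R ((1 / eps) *R Mop eps (D k) G + Mop eps N (D2 k)))) = W"
        unfolding W_def X_def Mop_grad_field[OF eps pD]
        using eps L2_decompose_Pj[of G]
        by (simp add: mult_add_right mult_scaleR_right scaleR_add_right sum.distrib scaleR_sum_right)
      finally show ?thesis .
    qed
    have X: "norm X <= SP * cellnorm N * F"
    proof -
      have "norm X <= (SUM j:UNIV. norm (adj (Pj j) :: complex^'n^('n \<times> 'd)) * (cellnorm N * F))"
        unfolding X_def
      proof (rule order_trans[OF norm_sum sum_mono])
        fix j
        have "norm (mult (%_. adj (Pj j)) (Mop eps N (D2 j))) <= norm (adj (Pj j) :: complex^'n^('n \<times> 'd)) * norm (Mop eps N (D2 j))"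
          by (rule norm_mult_le) auto
        also have "... <= norm (adj (Pj j) :: complex^'n^('n \<times> 'd)) * (cellnorm N * F)"
          by (intro mult_left_mono order_trans[OF norm_Mop_le[OF eps pN]] D2) auto
        finally show "norm (mult (%_. adj (Pj j)) (Mop eps N (D2 j))) <= norm (adj (Pj j) :: complex^'n^('n \<times> 'd)) * (cellnorm N * F)" .
      qed
      thus ?thesis by (simp add: SP_def sum_distrib_right mult.assoc)
    qed
    have dG: "norm (G - cellavg eps G) <= eps * (d * F)"
      unfolding d_def by (rule norm_diff_cellavg_le[OF eps D2])
    have du: "norm (u - cellavg eps u) <= eps * (d * F)"
      unfolding d_def by (rule norm_diff_cellavg_le[OF eps wu]) (rule order_trans[OF norm_mult_Pj_le uG(3)])
    \<comment> \<open>The residual of the ansatz in the oscillating equation, as a functional on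
      H^1.\<close>
    have E: "mult ?a W *. V + mult ?s w *. v - f *. v <= eps * F * (K1 * norm V + K2 * norm v)" if vV: "grad_rel v V" for v V
    proof -
      have gG: "Mop eps g G = mult ?a (Mop eps (grad_field D) G) + mult ?a (cellavg eps G) - mult (%_. A) (cellavg eps G)"
        unfolding g_eq Mop_diff_left[OF eps perL2_add[OF paDN pa] perL2_const] Mop_add_left[OF eps paDN pa]
          mult_Mop[OF eps a(1) pDN] by (simp add: Mop_bounded[OF eps])
      \<comment> \<open>\<open>G\<close> is exchanged for its average in \<open>?a\<close> and in
        \<open>A\<close>; what then remains at order one is exactly
        \<open>Mop eps g G\<close>.\<close>
      have e1: "mult ?a W - mult (%_. A) G = mult ?a (G - cellavg eps G) - mult (%_. A) (G - cellavg eps G) + Mop eps g G + eps *R mult ?a X"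
        unfolding gG W_def by (simp add: mult_add_right mult_scaleR_right mult_linear ba)
      have e2: "mult ?s w - mult (%_. cellmean s) u = mult ?s (u - cellavg eps u) + (Mop eps s u - mult (%_. cellmean s) u) + eps *R mult ?s (Mop eps N G)"
        unfolding w_def Mop_bounded[OF eps, of s] by (simp add: mult_add_right mult_scaleR_right mult_linear bs)
      have B: "norm (shift (eps *R z) v - v) <= eps * (d * norm V)" if "z : cbox 0 One" for z
        unfolding d_def by (rule norm_shift_cube_le[OF eps vV that])
      have B0: "0 <= eps * (d * norm V)" using eps K0 by simp
      let ?c = "%j. eps * (d * norm V) * (cellnorm (%y. Pj j ** g y) * F)"
      have t1: "mult ?a (G - cellavg eps G) *. V <= Ca * (eps * (d * F)) * norm V"
        by (rule order_trans[OF abs_ge_self inner_abs_le[OF order_trans[OF norm_mult_le[OF ba Ca] mult_left_mono[OF dG C0(1)]]]])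
      have t2: "- (mult (%_. A) (G - cellavg eps G) *. V) <= norm A * (eps * (d * F)) * norm V"
        by (rule order_trans[OF abs_ge_minus_self inner_abs_le[OF order_trans[OF norm_mult_le[OF bmat_const] mult_left_mono[OF dG]]]]) auto
      have t3: "Mop eps g G *. V <= (SUM j:(UNIV::'d set). ?c j)"
      proof -
        have "Mop eps g G *. V = (SUM j:UNIV. - (Mop eps (%x. Pj j ** g x) (D2 j) *. v))"
          using divfree_integration_by_parts[OF eps pg dg D2(1) vV] by (simp add: sum_negf)
        also have "... <= (SUM j:(UNIV::'d set). ?c j)"
        proof (rule sum_mono)
          fix j :: 'd
          have z: "mult (%_. 0) (D2 j) = (0 :: ('d, 'n) L2)" by (simp add: mult_def zero_abs_L2)
          have "\<bar>v *. Mop eps (%x. Pj j ** g x) (D2 j)\<bar> <= eps * (d * norm V) * (cellnorm (%y. Pj j ** g y) * norm (D2 j))"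
            using oscillating_mean[OF eps perL2_Pj[OF pg, of j] B0 B, of "D2 j"] by (simp add: mgj z)
          also have "... <= ?c j"
            by (intro mult_left_mono D2 B0) auto
          finally show "- (Mop eps (%x. Pj j ** g x) (D2 j) *. v) <= ?c j"
            by (simp add: inner_commute)
        qed
        finally show ?thesis .
      qed
      have t4: "eps * (mult ?a X *. V) <= eps * (Ca * (SP * cellnorm N * F) * norm V)"
        using eps by (intro mult_left_mono order_trans[OF abs_ge_self inner_abs_le[OF order_trans[OF norm_mult_le[OF ba Ca] mult_left_mono[OF X C0(1)]]]]) auto
      have t5: "mult ?s (u - cellavg eps u) *. v <= Cs * (eps * (d * F)) * norm v"
        by (rule order_trans[OF abs_ge_self inner_abs_le[OF order_trans[OF norm_mult_le[OF bs Cs] mult_left_mono[OF du C0(2)]]]])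
      \<comment> \<open>The field \<open>s\<close> minus its mean averages to zero, and the gain of
        \<open>eps\<close> comes from translating \<open>v\<close>; hence the bound involves
        \<open>norm V\<close>.\<close>
      have t6: "(Mop eps s u - mult (%_. cellmean s) u) *. v <= eps * (d * norm V) * (cellnorm s * F)"
      proof -
        have "(Mop eps s u - mult (%_. cellmean s) u) *. v <= eps * (d * norm V) * (cellnorm s * norm u)"
          using oscillating_mean[OF eps ps B0 B, of u] by (simp add: inner_diff_left inner_diff_right inner_commute abs_le_iff)
        also have "... <= eps * (d * norm V) * (cellnorm s * F)" by (intro mult_left_mono uG B0) auto
        finally show ?thesis .
      qed
      have t7: "eps * (mult ?s (Mop eps N G) *. v) <= eps * (Cs * (cellnorm N * F) * norm v)"
      proof (intro mult_left_mono order_trans[OF abs_ge_self inner_abs_le])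
        have "norm (Mop eps N G) <= cellnorm N * F"
          by (rule order_trans[OF norm_Mop_le[OF eps pN] mult_left_mono[OF uG(3)]]) simp
        thus "norm (mult ?s (Mop eps N G)) <= Cs * (cellnorm N * F)"
          using norm_mult_le[OF bs Cs, of "Mop eps N G"] C0(2) by (meson mult_left_mono order_trans)
      qed (use eps in simp)
      have "mult ?a W *. V + mult ?s w *. v - f *. v = (mult ?a W - mult (%_. A) G) *. V + (mult ?s w - mult (%_. cellmean s) u) *. v"
        using ueq[OF vV] by (simp add: inner_diff_left)
      also have "... = mult ?a (G - cellavg eps G) *. V + - (mult (%_. A) (G - cellavg eps G) *. V) + Mop eps g G *. V + eps * (mult ?a X *. V)
          + mult ?s (u - cellavg eps u) *. v + (Mop eps s u - mult (%_. cellmean s) u) *. v + eps * (mult ?s (Mop eps N G) *. v)"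
        unfolding e1 e2 by (simp add: inner_add_left inner_diff_left)
      also have "... <= Ca * (eps * (d * F)) * norm V + norm A * (eps * (d * F)) * norm V
          + (SUM j:(UNIV::'d set). ?c j) + eps * (Ca * (SP * cellnorm N * F) * norm V)
          + Cs * (eps * (d * F)) * norm v + eps * (d * norm V) * (cellnorm s * F) + eps * (Cs * (cellnorm N * F) * norm v)"
        by (intro add_mono t1 t2 t3 t4 t5 t6 t7)
      also have "(SUM j:(UNIV::'d set). ?c j) = eps * F * norm V * (SUM j:(UNIV::'d set). d * cellnorm (%y. Pj j ** g y))"
        by (simp add: sum_distrib_left mult_ac)
      also have "Ca * (eps * (d * F)) * norm V + norm A * (eps * (d * F)) * norm V
          + eps * F * norm V * (SUM j:(UNIV::'d set). d * cellnorm (%y. Pj j ** g y)) + eps * (Ca * (SP * cellnorm N * F) * norm V)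
          + Cs * (eps * (d * F)) * norm v + eps * (d * norm V) * (cellnorm s * F) + eps * (Cs * (cellnorm N * F) * norm v)
          = eps * F * (K1 * norm V + K2 * norm v)"
        unfolding K1_def K2_def by (simp add: algebra_simps)
      finally show ?thesis .
    qed
    define v where "v = w - R f"
    define V where "V = W - Gr f"
    have vV: "grad_rel v V" unfolding v_def V_def by (rule grad_rel_diff[OF wW R(2)])
    \<comment> \<open>The error itself is an admissible test function, and the exact solution turns
      its part of the equation into \<open>f *. v\<close>.\<close>
    have "mult ?a V *. V + mult ?s v *. v = mult ?a W *. V + mult ?s w *. v - f *. v"
      using R(3)[OF vV, of f] by (simp add: v_def V_def mult_linear ba bs inner_diff_left)
    from elliptic_solution_bound[OF ba ca bs cs c vV this]
    have "c * ((norm v)^2 + (norm V)^2) <= eps * F * (K1 * norm V + K2 * norm v)" using E[OF vV] by linarith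
    also have "... <= eps * F * (K * norm V + K * norm v)"
      using eps F0 by (intro mult_left_mono add_mono mult_right_mono) (auto simp: K_def)
    finally have en: "c * ((norm v)^2 + (norm V)^2) <= eps * F * K * (norm v + norm V)" by (simp add: algebra_simps)
    have vb: "norm v <= 2 * K / c * (eps * F)"
    proof (cases "norm v + norm V = 0")
      case True
      hence "norm v = 0" using norm_ge_zero[of v] norm_ge_zero[of V] by linarith
      thus ?thesis using Kn c eps F0 by simp
    next
      case False
      hence pos: "0 < norm v + norm V" using norm_ge_zero[of v] norm_ge_zero[of V] by linarith
      \<comment> \<open>The residual is linear in \<open>norm v + norm V\<close>, so the energy is
        compared with the square of this sum in order to cancel one factor.\<close>
      have "c * (norm v + norm V)^2 <= c * (2 * ((norm v)^2 + (norm V)^2))"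
        using c sum_squares_bound[of "norm v" "norm V"] by (intro mult_left_mono) (auto simp: power2_sum)
      also have "... = 2 * (c * ((norm v)^2 + (norm V)^2))" by simp
      also have "... <= 2 * (eps * F * K * (norm v + norm V))" by (rule mult_left_mono[OF en]) simp
      finally have "(c * (norm v + norm V)) * (norm v + norm V) <= (2 * eps * F * K) * (norm v + norm V)"
        by (simp add: power2_eq_square mult_ac)
      hence "c * (norm v + norm V) <= 2 * eps * F * K" using pos by (rule mult_right_le_imp_le)
      moreover have "c * norm v <= c * (norm v + norm V)" using c by simp
      ultimately have "c * norm v <= 2 * eps * F * K" by linarith
      thus ?thesis using c by (simp add: field_simps)
    qed
    have "R f - u = eps *R Mop eps N G - v" by (simp add: v_def w_def)
    hence "norm (R f - u) <= eps * norm (Mop eps N G) + norm v"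
      using norm_triangle_ineq4[of "eps *R Mop eps N G" v] eps by simp
    also have "... <= eps * (cellnorm N * F) + 2 * K / c * (eps * F)"
    proof (intro add_mono vb mult_left_mono)
      show "norm (Mop eps N G) <= cellnorm N * F"
        by (rule order_trans[OF norm_Mop_le[OF eps pN] mult_left_mono[OF uG(3)]]) simp
    qed (use eps in simp)
    also have "... = (2 * K / c + cellnorm N) / c * eps * norm f"
      by (simp add: F_def algebra_simps add_divide_distrib)
    also have "... <= \<kappa> * eps * norm f"
      using eps by (intro mult_right_mono) (auto simp: \<kappa>_def)
    finally show ?thesis by (simp add: R(1) R0(1) u_def)
  qed
  thus thesis using that \<kappa> by blast
qed

section \<open>The periodic Sobolev space on the cell\<close>

section \<open>Functions on the cell\<close>

text \<open>Functions on the cell are extended by zero, so that the Hilbert space \<open>L2\<close> can be reused.\<close>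

definition cel :: "(real^'d => complex^'i) => ('d, 'i) L2" where
  "cel f = abs_L2 (%x. indicator Ycell x *R f x)"

lemma sqint_Y_iff:
  fixes f :: "real^'d => 'b::euclidean_space"
  shows "f : sqint LY \<longleftrightarrow> (%x. indicator Ycell x *R f x) : sqint lebesgue"
proof -
  have "(%x. (norm (indicator Ycell x *R f x))^2) = (%x. indicator Ycell x *R (norm (f x))^2)"
    by (auto simp: indicator_def)
  thus ?thesis
    by (simp add: square_integrable_def borel_measurable_restrict_space_iff integrable_restrict_space Ycell_sets)
qed

context
  fixes f g :: "real^'d => complex^'i"
  assumes f: "f : sqint LY" and g: "g : sqint LY"
begin

lemma cel_eq_iff: "cel f = cel g \<longleftrightarrow> (AE x in LY. f x = g x)"
proof -
  have "cel f = cel g \<longleftrightarrow> (AE x in lebesgue. indicator Ycell x *R f x = indicator Ycell x *R g x)"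
    unfolding cel_def using f g by (intro abs_L2_eq_iff) (auto simp: sqint_Y_iff)
  also have "... \<longleftrightarrow> (AE x in lebesgue. x : Ycell --> f x = g x)"
    by (intro eventually_cong) (auto simp: indicator_def)
  finally show ?thesis by (simp add: AE_restrict_space_iff Ycell_sets)
qed

lemma cel_add: "cel (%x. f x + g x) = cel f + cel g"
  unfolding cel_def using f g by (subst plus_abs_L2) (auto simp: sqint_Y_iff scaleR_add_right)

lemma cel_diff: "cel (%x. f x - g x) = cel f - cel g"
  unfolding cel_def using f g by (subst minus_abs_L2) (auto simp: sqint_Y_iff scaleR_diff_right)

lemma inner_cel: "cel f *. cel g = (LINT x|LY. f x *. g x)"
proof -
  have "cel f *. cel g = (LINT x|lebesgue. (indicator Ycell x *R f x) *. (indicator Ycell x *R g x))"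
    unfolding cel_def using f g by (intro inner_abs_L2) (auto simp: sqint_Y_iff)
  also have "... = (LINT x|lebesgue. indicator Ycell x *R (f x *. g x))"
    by (intro LINT_cong) (auto simp: indicator_def)
  finally show ?thesis by (simp add: integral_restrict_space Ycell_sets)
qed

end

lemma cel_scaleR:
  assumes f: "f : sqint LY"
  shows "cel (%x. c *R f x) = c *R cel f"
  unfolding cel_def using scaleR_abs_L2[of "%x. indicator Ycell x *R f x" "%x. indicator Ycell x *R f x" c] f
  by (simp add: sqint_Y_iff mult.commute)

lemma norm_cel: "f : sqint LY ==> (norm (cel f))^2 = (LINT x|LY. (norm (f x))^2)"
  by (simp add: power2_norm_eq_inner inner_cel)

lemma sqint_Y_mult:
  fixes b :: "real^'d => complex^'j^'i"
  assumes b: "bmat b" and f: "f : sqint LY"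
  shows "(%x. b x *v f x) : sqint LY" "mult b (cel f) = cel (%x. b x *v f x)"
  using mult_abs_L2_leb[OF b, of "%x. indicator Ycell x *R f x"] f
  by (simp_all add: sqint_Y_iff scaleR_cmv cel_def)

lemma sqint_Y_bounded:
  fixes f :: "real^'d => 'b::euclidean_space"
  assumes "f : borelf" "!!x. norm (f x) <= C"
  shows "f : sqint LY"
proof -
  have [measurable]: "f : borelf" by fact
  have fin: "emeasure lborel (Ycell :: (real^'d) set) < \<infinity>"
    unfolding Ycell_eq_box using emeasure_lborel_box_finite by (simp add: less_top)
  have "integrable lborel (%x. C^2 * indicator (Ycell :: (real^'d) set) x)"
    by (intro integrable_mult_right integrable_real_indicator fin) measurable
  hence "integrable lborel (%x. (norm (indicator Ycell x *R f x))^2)"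
  proof (rule integrable_dominated)
    show "AE x in lborel. norm ((norm (indicator Ycell x *R f x))^2) <= norm (C^2 * indicator (Ycell :: (real^'d) set) x)"
      by (intro AE_I2) (auto simp: indicator_def intro!: power_mono assms)
  qed measurable
  hence "(%x. indicator Ycell x *R f x) : sqint lborel"
    by (simp add: square_integrable_def)
  thus ?thesis unfolding sqint_Y_iff by (rule sqint_lb_leb)
qed

lemma sqint_Y_const: "(%x::real^'d. c :: 'b::euclidean_space) : sqint LY"
  by (rule sqint_Y_bounded[of _ "norm c"]) auto

lemma bmat_Ycell: "bmat (%x::real^'d. if x : Ycell then mat 1 else (0 :: complex^'i^'i))"
  unfolding bmat_def
proof
  have [measurable]: "(Ycell :: (real^'d) set) : sets borel" unfolding Ycell_eq_box by measurable
  show "(%x::real^'d. if x : Ycell then mat 1 else (0 :: complex^'i^'i)) : borelf" by measurable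
  show "EX C. ALL x::real^'d. norm (if x : Ycell then mat 1 else (0 :: complex^'i^'i)) <= C"
    by (rule exI[of _ "norm (mat 1 :: complex^'i^'i)"]) simp
qed

text \<open>Restriction to the cell is a multiplication operator. The condition
  \<open>cel (rep_L2 U) = U\<close>, used below, says that \<open>U\<close> vanishes outside the
  cell.\<close>

lemma rep_L2_Ycell: "rep_L2 U : sqint LY"
  "cel (rep_L2 U) = mult (%x. if x : Ycell then mat 1 else 0) U"
proof -
  have e: "(if x : Ycell then mat 1 else 0) *v v = indicator Ycell x *R v" for x and v :: "complex^'b"
    by (simp add: indicator_def)
  show "rep_L2 U : sqint LY" "cel (rep_L2 U) = mult (%x. if x : Ycell then mat 1 else 0) U"
    using mult_abs_L2_leb[OF bmat_Ycell rep_L2_sqint, of U]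
    by (simp_all only: sqint_Y_iff e cel_def abs_rep_L2)
qed

lemma measure_Ycell: "measure lebesgue (Ycell :: (real^'d) set) = 1"
proof -
  have "emeasure lborel (Ycell :: (real^'d) set) = emeasure lborel (hcell :: (real^'d) set)"
    using AE_unit_cells by (intro emeasure_eq_AE) auto
  hence "emeasure lebesgue (Ycell :: (real^'d) set) = 1" by (simp add: emeasure_hcell emeasure_completion)
  thus ?thesis by (simp add: measure_def)
qed

lemma integral_Ycell_const: "(LINT x|lebesgue_on (Ycell :: (real^'d) set). (c :: real)) = c"
  by (simp add: measure_restrict_space Ycell_sets measure_Ycell)

section \<open>Smooth periodic functions and their closure\<close>

definition smooth_pv :: "(real^'d => complex^'i) set" where
  "smooth_pv = {p. smooth_vec p & periodic p}"

definition gradv :: "(real^'d => complex^'n) => real^'d => complex^('n \<times> 'd)" where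
  "gradv p x = (\<chi> q. vpd (snd q) p x $ fst q)"

lemma gradv_component [simp]: "gradv p x $ (i, j) = pd j (%x. p x $ i) x"
  by (simp add: gradv_def vpd_def)

lemma smooth_vec_gradv: "smooth_vec p ==> smooth_vec (gradv p)"
  unfolding smooth_vec_def
proof
  fix q assume "ALL i. smooth_fun (%x. p x $ i)"
  thus "smooth_fun (%x. gradv p x $ q)" by (cases q) (simp add: smooth_fun_pderiv)
qed

lemma smooth_pv_gradv: "p : smooth_pv ==> gradv p : smooth_pv"
proof -
  assume p: "p : smooth_pv"
  have "gradv p (x + k) $ q = gradv p x $ q" if k: "k : int_lattice" for x k q
  proof (cases q)
    case (Pair i j)
    have "periodic (pd j (%x. p x $ i))"
      using p by (intro pderiv_cl_periodic) (auto simp: smooth_pv_def periodic_def smooth_vec_def)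
    thus ?thesis using periodicD[OF _ k] by (simp add: Pair)
  qed
  hence "periodic (gradv p)" unfolding periodic_def vec_eq_iff by blast
  thus ?thesis using p by (simp add: smooth_pv_def smooth_vec_gradv)
qed

lemma smooth_pv_bounded:
  assumes "p : smooth_pv" obtains C where "!!x. norm (p x) <= C"
  using periodic_cont_bounded[of p] smooth_vec_continuous assms by (auto simp: smooth_pv_def)

lemma smooth_pv_measurable: "p : smooth_pv ==> p : borelf"
  by (auto simp: smooth_pv_def intro: smooth_vec_measurable)

lemma smooth_pv_Ycell: "p : smooth_pv ==> p : sqint LY"
  by (rule smooth_pv_bounded, assumption) (rule sqint_Y_bounded[OF smooth_pv_measurable])

lemma smooth_vec_add: "smooth_vec p ==> smooth_vec q ==> smooth_vec (%x. p x + q x :: complex^'i)"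
  for p :: "real^'d => complex^'i"
  by (simp add: smooth_vec_def smooth_fun_add)

lemma smooth_pv_add: "p : smooth_pv ==> q : smooth_pv ==> (%x. p x + q x) : smooth_pv"
  by (simp add: smooth_pv_def smooth_vec_add periodic_def)

lemma smooth_pv_const: "(%x. c) : smooth_pv"
  by (simp add: smooth_pv_def smooth_vec_def smooth_fun_const periodic_def)

lemma smooth_pv_matrix:
  fixes A :: "complex^'i^'k"
  assumes "p : smooth_pv" shows "(%x. A *v p x) : smooth_pv"
proof -
  have "smooth_fun (%x. SUM j:UNIV. A $ i $ j * p x $ j)" for i
    using assms by (intro smooth_fun_sum smooth_fun_mult smooth_fun_const) (auto simp: smooth_pv_def smooth_vec_def)
  thus ?thesis using assms by (simp add: smooth_pv_def smooth_vec_def matrix_vector_mult_def periodic_def)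
qed

lemma gradv_add:
  assumes "smooth_vec p" "smooth_vec q"
  shows "gradv (%x. p x + q x) = (%x. gradv p x + gradv q x)"
proof (rule ext, subst vec_eq_iff, rule allI)
  fix x r
  show "gradv (%x. p x + q x) x $ r = (gradv p x + gradv q x) $ r"
    using assms by (cases r) (simp add: pderiv_cl_add smooth_vec_def smooth_fun_diffble)
qed

lemma gradv_const: "gradv (%x. c) = (%x. 0)"
  by (rule ext, subst vec_eq_iff) (auto simp: gradv_def vpd_def pderiv_cl_const)

lemma gradv_mat:
  assumes "smooth_vec p"
  shows "gradv (%x. mat c *v p x) = (%x. mat c *v gradv p x)"
proof (rule ext, subst vec_eq_iff, rule allI)
  fix x r
  show "gradv (%x. mat c *v p x) x $ r = (mat c *v gradv p x) $ r"
    using assms by (cases r) (simp add: mat_vector pderiv_cl_cmult smooth_vec_def)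
qed

lemma mat_of_real: "mat (complex_of_real c) = c *R (mat 1 :: complex^'i^'i)"
  by (simp add: mat_def vec_eq_iff scaleR_conv_of_real[where 'a=complex])

definition PG :: "(('d::finite, 'n::finite) L2 \<times> ('d, 'n \<times> 'd) L2) set" where
  "PG = {(cel p, cel (gradv p)) | p. p : smooth_pv}"

lemma PG_add: "x : PG ==> y : PG ==> x + y : PG"
proof -
  assume "x : PG" "y : PG"
  then obtain p q where p: "p : smooth_pv" "x = (cel p, cel (gradv p))" and q: "q : smooth_pv" "y = (cel q, cel (gradv q))"
    by (auto simp: PG_def)
  have "x + y = (cel (%x. p x + q x), cel (gradv (%x. p x + q x)))"
    using p q by (subst gradv_add) (auto simp: cel_add smooth_pv_Ycell smooth_pv_gradv, auto simp: smooth_pv_def)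
  thus ?thesis using smooth_pv_add[OF p(1) q(1)] by (auto simp: PG_def)
qed

lemma PG_mat: "(U, G) : PG ==> (mult (%_. mat c) U, mult (%_. mat c) G) : PG"
proof -
  assume "(U, G) : PG"
  then obtain p where p: "p : smooth_pv" "U = cel p" "G = cel (gradv p)" by (auto simp: PG_def)
  hence "(mult (%_. mat c) U, mult (%_. mat c) G) = (cel (%x. mat c *v p x), cel (gradv (%x. mat c *v p x)))"
    by (subst gradv_mat) (auto simp: sqint_Y_mult smooth_pv_Ycell smooth_pv_gradv, auto simp: smooth_pv_def)
  thus ?thesis using smooth_pv_matrix[OF p(1)] by (auto simp: PG_def)
qed

lemma PG_scaleR: "x : PG ==> c *R x : PG"
proof -
  assume x: "x : PG"
  have e: "mult (%_. mat (complex_of_real c)) u = c *R u" for u :: "('e::finite, 'f::finite) L2"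
  proof -
    have "mult (%_. c *R mat 1) u = abs_L2 (%x. c *R brep u x)" by (simp add: mult_def scaleR_cmv)
    thus ?thesis by (simp add: mat_of_real scaleR_abs_L2_lborel[symmetric] brep)
  qed
  show ?thesis using PG_mat[of "fst x" "snd x" "of_real c"] x by (simp add: e scaleR_prod_def)
qed

text \<open>The graph of the weak gradient on the periodic Sobolev space \<open>[H\<^sup>1\<^sub>#(Y)]\<^sup>n\<close>.\<close>

definition CS :: "(('d::finite, 'n::finite) L2 \<times> ('d, 'n \<times> 'd) L2) set" where
  "CS = closure PG"

lemma subspace_CS: "subspace CS"
proof -
  have "(0::('a, 'b) L2 \<times> ('a, 'b \<times> 'a) L2) : PG"
  proof -
    obtain x :: "('a, 'b) L2 \<times> ('a, 'b \<times> 'a) L2" where "x : PG" using smooth_pv_const by (auto simp: PG_def)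
    from PG_scaleR[OF this, of 0] show ?thesis by simp
  qed
  hence "subspace (PG :: (('a, 'b) L2 \<times> ('a, 'b \<times> 'a) L2) set)"
    by (intro subspaceI PG_add PG_scaleR)
  thus ?thesis unfolding CS_def
  proof (intro subspaceI)
    assume s: "subspace (PG :: (('a, 'b) L2 \<times> ('a, 'b \<times> 'a) L2) set)"
    show "0 : closure (PG :: (('a, 'b) L2 \<times> ('a, 'b \<times> 'a) L2) set)" using subspace_0[OF s] closure_subset by blast
    fix x y :: "('a, 'b) L2 \<times> ('a, 'b \<times> 'a) L2" and c
    assume x: "x : closure PG"
    then obtain X where X: "!!n. X n : PG" "X ----> x" by (auto simp: closure_sequential)
    show "c *R x : closure PG"
      unfolding closure_sequential
      by (rule exI[of _ "%n. c *R X n"]) (intro conjI allI PG_scaleR X tendsto_intros)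
    assume "y : closure PG"
    then obtain Y where Y: "!!n. Y n : PG" "Y ----> y" by (auto simp: closure_sequential)
    show "x + y : closure PG"
      unfolding closure_sequential
      by (rule exI[of _ "%n. X n + Y n"]) (intro conjI allI PG_add X Y tendsto_intros)
  qed
qed

lemma CS_sequence:
  assumes "(U, G) : CS"
  obtains p where "!!n::nat. p n : smooth_pv" "(%n. cel (p n)) ----> U" "(%n. cel (gradv (p n))) ----> G"
proof -
  obtain X where X: "!!n. X n : PG" "X ----> (U, G)" using assms by (auto simp: CS_def closure_sequential)
  hence "ALL n. EX p. p : smooth_pv & X n = (cel p, cel (gradv p))" by (auto simp: PG_def)
  then obtain p where p: "!!n. p n : smooth_pv" "!!n. X n = (cel (p n), cel (gradv (p n)))" by metis
  show thesis using that[OF p(1)] tendsto_fst[OF X(2)] tendsto_snd[OF X(2)] by (simp add: p(2))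
qed

lemma CS_I:
  assumes "!!n::nat. (U n, G n) : CS" "U ----> U'" "G ----> G'"
  shows "(U', G') : CS"
proof -
  have "(%n. (U n, G n)) ----> (U', G')" by (intro tendsto_Pair assms)
  thus ?thesis
    unfolding CS_def by (rule closed_sequentially[OF closed_closure assms(1)[unfolded CS_def]])
qed

lemma PG_CS: "p : smooth_pv ==> (cel p, cel (gradv p)) : CS"
  unfolding CS_def by (rule subsetD[OF closure_subset]) (auto simp: PG_def)

lemma CS_mat: "(U, G) : CS ==> (mult (%_. mat c) U, mult (%_. mat c) G) : CS"
proof -
  assume "(U, G) : CS"
  then obtain p where p: "!!n::nat. p n : smooth_pv" "(%n. cel (p n)) ----> U" "(%n. cel (gradv (p n))) ----> G"
    by (rule CS_sequence) blast
  show ?thesis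
  proof (rule CS_I)
    show "(mult (%_. mat c) (cel (p n)), mult (%_. mat c) (cel (gradv (p n)))) : CS" for n
      unfolding CS_def by (rule subsetD[OF closure_subset PG_mat]) (use p(1) in \<open>auto simp: PG_def\<close>)
  qed (rule bounded_linear.tendsto[OF bounded_linear_mult[OF bmat_const] p(2)],
      rule bounded_linear.tendsto[OF bounded_linear_mult[OF bmat_const] p(3)])
qed

lemma CS_supported: "(U, G) : CS ==> cel (rep_L2 U) = U & cel (rep_L2 G) = G"
proof -
  assume "(U, G) : CS"
  then obtain p where p: "!!n::nat. p n : smooth_pv" "(%n. cel (p n)) ----> U" "(%n. cel (gradv (p n))) ----> G"
    by (rule CS_sequence) blast
  have *: "cel (rep_L2 V) = V" if V: "(%n. cel (q n)) ----> V" "!!n. q n : sqint LY" for q and V :: "('c::finite, 'd::finite) L2"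
  proof -
    have "mult (%x. if x : Ycell then mat 1 else 0) (cel (q n)) = cel (q n)" for n
      unfolding sqint_Y_mult(2)[OF bmat_Ycell V(2)] unfolding cel_def
      by (intro arg_cong[of _ _ abs_L2]) (auto simp: indicator_def)
    hence "(%n. cel (q n)) ----> cel (rep_L2 V)"
      using bounded_linear.tendsto[OF bounded_linear_mult[OF bmat_Ycell] V(1)] unfolding rep_L2_Ycell(2) by simp
    from LIMSEQ_unique[OF this V(1)] show ?thesis .
  qed
  show ?thesis
    by (rule conjI; rule *[OF p(2)] *[OF p(3)]; intro smooth_pv_Ycell smooth_pv_gradv p(1))
qed

text \<open>A single test vector isolates component \<open>i\<close>; with \<open>c = 1\<close> and
  \<open>c = \<i>\<close> the complex integral against \<open>psi\<close> is recovered from real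
  inner products.\<close>

lemma inner_cel_axis:
  fixes f :: "real^'d => complex^'i" and psi :: "real^'d => complex"
  assumes f: "f : sqint LY" and psi: "psi : sqint LY"
  shows "(%x. axis i (cnj (c * psi x)) :: complex^'i) : sqint LY"
    and "cel f *. cel (%x. axis i (cnj (c * psi x))) = Re (c * (LINT x|LY. f x $ i * psi x))"
proof -
  have cpsi: "(%x. cnj (c * psi x)) : sqint LY"
  proof (rule sqint_cnj)
    show "(%x. c * psi x) : sqint LY"
      using psi by (auto simp: square_integrable_def norm_mult power_mult_distrib)
  qed
  show v: "(%x. axis i (cnj (c * psi x)) :: complex^'i) : sqint LY"
    unfolding sqint_vec
  proof
    fix k show "(%x. axis i (cnj (c * psi x)) $ k) : sqint LY"
      using cpsi by (cases "k = i") (auto simp: axis_def square_integrable_0)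
  qed
  have i: "integrable LY (%x. f x $ i * psi x)"
    using f psi sqint_vec by (intro sqint_mult) blast+
  have "cel f *. cel (%x. axis i (cnj (c * psi x))) = (LINT x|LY. Re (c * (f x $ i * psi x)))"
    unfolding inner_cel[OF f v] by (simp add: inner_axis inner_complex_Re mult_ac)
  also have "... = Re (LINT x|LY. c * (f x $ i * psi x))"
    using i by (intro integral_Re integrable_mult_right)
  finally show "cel f *. cel (%x. axis i (cnj (c * psi x))) = Re (c * (LINT x|LY. f x $ i * psi x))"
    by simp
qed

lemma test_fun_mono: "psi : test_fun \<Omega> ==> psi : test_fun UNIV"
  by (auto simp: test_fun_iff)

lemma test_fun_Ycell: "psi : test_fun \<Omega> ==> psi : sqint LY"
  for psi :: "real^'d => complex"
  by (rule test_fun_bounded, assumption)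
    (rule sqint_Y_bounded[OF smooth_fun_measurable[OF test_fun_smooth]])

section \<open>The Poincare inequality on the cell\<close>

lemma indicator_Ycell_hcell: "AE x in lborel. (indicator Ycell (x::real^'d) :: real) = ihc x"
  using AE_unit_cells by eventually_elim (auto simp: indicator_def)

lemma integral_Ycell:
  fixes f :: "real^'d => 'b::euclidean_space"
  assumes [measurable]: "f : borelf"
  shows "(LINT x|LY. f x) = cellmean f"
proof -
  have [measurable]: "(Ycell :: (real^'d) set) : sets borel" unfolding Ycell_eq_box by measurable
  have "(LINT x|LY. f x) = (LINT x|lebesgue. indicator Ycell x *R f x)"
    by (simp add: integral_restrict_space Ycell_sets)
  also have "... = (LINT x|lborel. indicator Ycell x *R f x)" by (rule integral_completion) measurable
  also have "... = cellmean f"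
    unfolding cellmean_def
  proof (rule integral_cong_AE)
    show "AE x in lborel. indicator Ycell x *R f x = ihc x *R f x"
      using indicator_Ycell_hcell by eventually_elim simp
  qed measurable
  finally show ?thesis .
qed

lemma perL2_cel:
  fixes f :: "real^'d => complex^'i"
  assumes f: "perL2 f"
  shows "cel f = abs_L2 (%x. ihc x *R f x)" "f : sqint LY"
    "norm (cel f) = cellnorm f"
proof -
  have [measurable]: "f : borelf" using f by (simp add: perL2_def)
  have [measurable]: "(Ycell :: (real^'d) set) : sets borel" unfolding Ycell_eq_box by measurable
  have h: "(%x. ihc x *R f x) : sqint lborel" using f by (simp add: perL2_iff_sqint)
  have ae: "AE x in lborel. ihc x *R f x = indicator Ycell x *R f x"
    using indicator_Ycell_hcell by eventually_elim simp
  have y: "(%x. indicator Ycell x *R f x) : sqint lborel"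
    by (rule sqint_cong_AE[OF h _ ae]) (intro borel_measurable_scaleR borel_measurable_indicator; simp)
  show e: "cel f = abs_L2 (%x. ihc x *R f x)"
    unfolding cel_def abs_L2_eq_iff_lb[OF y h] using ae by eventually_elim (rule sym)
  show "f : sqint LY"
    unfolding sqint_Y_iff by (rule sqint_lb_leb[OF y])
  have "ennreal ((norm (cel f))^2) = cellnn f"
    unfolding e cellnn_def norm_abs_L2_nn_lb[OF h] by (intro nn_integral_cong) (simp add: indicator_def)
  thus "norm (cel f) = cellnorm f"
    by (simp add: cellnn_eq[OF f])
qed

lemma perL2_smooth: "p : smooth_pv ==> perL2 p"
  by (rule smooth_pv_bounded, assumption)
    (rule perL2_bounded[OF smooth_pv_measurable], auto simp: smooth_pv_def)

lemma cellnn_shift: "perL2 q ==> cellnn (%x. q (x + h)) = cellnn q"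
  for q :: "real^'d => 'b::euclidean_space"
proof -
  assume q: "perL2 q"
  hence [measurable]: "q : borelf" by (simp add: perL2_def)
  show ?thesis unfolding cellnn_def
    using nn_periodic_shift[of "%x. ennreal ((norm (q x))^2)" h] q
    by (simp add: perL2_def periodic_def add.commute[of h])
qed

lemma perL2_shift: "perL2 q ==> perL2 (%x. q (x + h))"
  for q :: "real^'d => 'b::euclidean_space"
proof -
  assume q: "perL2 q"
  hence [measurable]: "q : borelf" by (simp add: perL2_def)
  have "q (x + k + h) = q (x + h)" if "k : int_lattice" for x k
    using periodicD[of q k "x + h"] q that by (simp add: perL2_def algebra_simps)
  hence "periodic (%x. q (x + h))" by (simp add: periodic_def)
  thus ?thesis using q by (simp add: perL2_def cellnn_shift[OF q, unfolded perL2_def])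
qed

lemma cellnorm_shift: "perL2 q ==> cellnorm (%x. q (x + h)) = cellnorm q"
  for q :: "real^'d => 'b::euclidean_space"
  by (simp add: cellnorm_def cellnn_shift)

lemma vpd_gradv: "vpd j p x = Pj j *v gradv p x"
  by (simp add: vec_eq_iff vpd_def)

lemma norm_dirderiv_le: "norm (dirderiv h p x) <= (SUM j:UNIV. norm (Pj j :: complex^('i \<times> 'd)^'i)) * norm h * norm (gradv p x)"
  for p :: "real^'d => complex^'i"
proof -
  have "norm (dirderiv h p x) <= (SUM j:UNIV. norm (h $ j *R vpd j p x))"
    unfolding dirderiv_def by (rule norm_sum)
  also have "... <= (SUM j:UNIV. norm h * (norm (Pj j :: complex^('i \<times> 'd)^'i) * norm (gradv p x)))"
    unfolding norm_scaleR vpd_gradv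
    by (intro sum_mono mult_mono norm_mv_le) (auto simp: component_le_norm_cart)
  finally show ?thesis by (simp add: sum_distrib_left sum_distrib_right mult_ac)
qed

lemma smooth_pv_Lipschitz:
  fixes p :: "real^'d => complex^'i"
  assumes p: "p : smooth_pv"
  obtains B where "0 <= B" "!!x y. norm (p x - p y) <= B * norm (x - y)"
proof -
  obtain C where C: "!!x. norm (gradv p x) <= C" by (rule smooth_pv_bounded[OF smooth_pv_gradv[OF p]]) blast
  define B where "B = (SUM j:UNIV. norm (Pj j :: complex^('i \<times> 'd)^'i)) * C"
  have C0: "0 <= C" using C[of 0] norm_ge_zero order_trans by blast
  hence B0: "0 <= B" by (auto simp: B_def intro!: mult_nonneg_nonneg sum_nonneg)
  have "norm (p x - p y) <= B * norm (x - y)" for x y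
  proof (rule differentiable_bound[of UNIV p "%x h. dirderiv h p x"])
    fix z :: "real^'d"
    show "(p has_derivative (%h. dirderiv h p z)) (at z within UNIV)"
      using p by (intro smooth_vec_has_derivative) (simp add: smooth_pv_def)
    show "onorm (%h. dirderiv h p z) <= B"
    proof (rule onorm_le)
      fix h
      have "norm (dirderiv h p z) <= (SUM j:UNIV. norm (Pj j :: complex^('i \<times> 'd)^'i)) * norm h * C"
        by (rule order_trans[OF norm_dirderiv_le mult_left_mono[OF C]]) (auto intro!: mult_nonneg_nonneg sum_nonneg)
      thus "norm (dirderiv h p z) <= B * norm h" by (simp add: B_def mult_ac)
    qed
  qed auto
  thus thesis using B0 that by blast
qed

lemma dirderiv_gradv_bound:
  fixes p :: "real^'d => complex^'i"
  shows "norm (dirderiv h p x - dirderiv h p y) <= (SUM j:UNIV. norm (Pj j :: complex^('i \<times> 'd)^'i)) * norm h * norm (gradv p x - gradv p y)"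
proof -
  have "dirderiv h p x - dirderiv h p y = (SUM j:UNIV. h $ j *R (Pj j *v (gradv p x - gradv p y)))"
    unfolding dirderiv_def vpd_gradv
    by (simp add: sum_subtractf[symmetric] scaleR_diff_right[symmetric] matrix_vector_mult_diff_distrib)
  also have "norm ... <= (SUM j:UNIV. norm (h $ j *R (Pj j *v (gradv p x - gradv p y))))" by (rule norm_sum)
  also have "... <= (SUM j:UNIV. norm h * (norm (Pj j :: complex^('i \<times> 'd)^'i) * norm (gradv p x - gradv p y)))"
    unfolding norm_scaleR
    by (intro sum_mono mult_mono norm_mv_le) (auto simp: component_le_norm_cart)
  finally show ?thesis by (simp add: sum_distrib_left sum_distrib_right mult_ac)
qed

text \<open>Mean value inequality for \<open>p (x + t *R h) - t *R dirderiv h p x\<close>, whose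
  derivative in \<open>t\<close> is small because \<open>gradv p\<close> is Lipschitz on the whole
  space by periodicity.\<close>

lemma smooth_pv_Taylor:
  fixes p :: "real^'d => complex^'i"
  assumes p: "p : smooth_pv"
  obtains C where "0 <= C" "!!x h. norm (p (x + h) - p x - dirderiv h p x) <= C * (norm h)^2"
proof -
  obtain B where B: "0 <= B" "!!x y. norm (gradv p x - gradv p y) <= B * norm (x - y)"
    by (rule smooth_pv_Lipschitz[OF smooth_pv_gradv[OF p]]) blast
  define S where "S = (SUM j:UNIV. norm (Pj j :: complex^('i \<times> 'd)^'i))"
  have S0: "0 <= S" by (auto simp: S_def intro!: sum_nonneg)
  have "norm (p (x + h) - p x - dirderiv h p x) <= (S * B) * (norm h)^2" for x h
  proof -
    let ?F = "%t. p (x + t *R h) - t *R dirderiv h p x"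
    have "norm (?F 1 - ?F 0) <= (S * B * (norm h)^2) * norm ((1::real) - 0)"
    proof (rule differentiable_bound[of "{0..1}" ?F "%t s. dirderiv (s *R h) p (x + t *R h) - s *R dirderiv h p x"])
      fix t :: real assume t: "t : {0..1}"
      have "((%t. p (x + t *R h)) has_derivative (%s. dirderiv (s *R h) p (x + t *R h))) (at t within {0..1})"
        using p
        by (intro has_derivative_compose[OF _ smooth_vec_has_derivative, of "%t. x + t *R h" "%s. s *R h"])
          (auto simp: smooth_pv_def intro!: derivative_eq_intros)
      thus "(?F has_derivative (%s. dirderiv (s *R h) p (x + t *R h) - s *R dirderiv h p x)) (at t within {0..1})"
        by (intro has_derivative_diff) (auto intro!: derivative_eq_intros)
      show "onorm (%s. dirderiv (s *R h) p (x + t *R h) - s *R dirderiv h p x) <= S * B * (norm h)^2"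
      proof (rule onorm_le)
        fix s :: real
        have e: "dirderiv (s *R h) p (x + t *R h) - s *R dirderiv h p x = s *R (dirderiv h p (x + t *R h) - dirderiv h p x)"
          by (simp add: dirderiv_def scaleR_sum_right scaleR_diff_right)
        have "norm (dirderiv h p (x + t *R h) - dirderiv h p x) <= S * norm h * (B * norm h)"
        proof -
          have "norm (gradv p (x + t *R h) - gradv p x) <= B * norm (t *R h)" using B(2)[of "x + t *R h" x] by simp
          also have "... <= B * norm h" using t B(1) by (intro mult_left_mono) (auto simp: mult_left_le_one_le)
          finally show ?thesis
            by (intro order_trans[OF dirderiv_gradv_bound[of h p "x + t *R h" x]]) (auto simp: S_def[symmetric] S0 intro!: mult_left_mono)
        qed
        from mult_left_mono[OF this, of "\<bar>s\<bar>"]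
        show "norm (dirderiv (s *R h) p (x + t *R h) - s *R dirderiv h p x) <= S * B * (norm h)^2 * norm s"
          unfolding e by (simp add: power2_eq_square mult_ac)
      qed
    qed auto
    thus ?thesis by (simp add: diff_diff_eq add.commute)
  qed
  thus thesis using that[of "S * B"] S0 B(1) by simp
qed

lemma cel_norm_bounded:
  fixes f :: "real^'a => complex^'i"
  assumes "f : sqint LY" "!!x. norm (f x) <= C"
  shows "norm (cel f) <= C"
proof (rule power2_le_imp_le)
  show C: "0 <= C" using assms(2)[of 0] norm_ge_zero order_trans by blast
  have "(LINT x|LY. (norm (f x))^2) <= (LINT x|lebesgue_on (Ycell :: (real^'a) set). C^2)"
  proof (rule Bochner_Integration.integral_mono)
    show "integrable LY (%x. (norm (f x))^2)" using assms(1) by (simp add: square_integrable_def)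
    show "integrable (lebesgue_on (Ycell :: (real^'a) set)) (%x. C^2)"
      using sqint_Y_const[of C] by (simp add: square_integrable_def)
  qed (auto intro!: power_mono assms)
  thus "(norm (cel f))^2 <= C^2" by (simp only: norm_cel[OF assms(1)] integral_Ycell_const)
qed

lemma norm_dirderiv_cel:
  fixes p :: "real^'d => complex^'i"
  assumes p: "p : smooth_pv"
  shows "dirderiv h p : sqint LY"
    and "cel (dirderiv h p) = (SUM j:UNIV. h $ j *R mult (%_. Pj j) (cel (gradv p)))"
proof -
  have g: "gradv p : sqint LY" by (intro smooth_pv_Ycell smooth_pv_gradv p)
  note m = sqint_Y_mult[OF bmat_const g]
  have "(%x. SUM j:S. h $ j *R (Pj j *v gradv p x)) : sqint LY &
    cel (%x. SUM j:S. h $ j *R (Pj j *v gradv p x)) = (SUM j:S. h $ j *R mult (%_. Pj j) (cel (gradv p)))" if "finite S" for S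
    using that
  proof induction
    case empty
    show ?case using cel_scaleR[OF sqint_Y_const[of "0::complex^'i"], where c=0] sqint_Y_const[of "0::complex^'i"] by simp
  next
    case (insert j S)
    have "(%x. h $ j *R (Pj j *v gradv p x)) : sqint LY"
      by (rule square_integrable_scaleR[OF m(1)])
    thus ?case using insert square_integrable_add[of "%x. h $ j *R (Pj j *v gradv p x)" "LY"]
      by (simp add: cel_add cel_scaleR m)
  qed
  from this[of UNIV] show "dirderiv h p : sqint LY"
    "cel (dirderiv h p) = (SUM j:UNIV. h $ j *R mult (%_. Pj j) (cel (gradv p)))"
    unfolding dirderiv_def[abs_def] vpd_gradv by simp_all
qed

lemma cel_const_shift_inner:
  assumes p: "perL2 p"
  shows "cel (%x. p (x + h)) *. cel (%_. b) = cel p *. cel (%_. b)"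
proof -
  have [measurable]: "p : borelf" using p by (simp add: perL2_def)
  have [measurable]: "(%x. p (x + h) *. b) : borelf" by measurable
  note i = integrable_inner_left[OF perL2_integrable[OF p], of b]
  have "cel (%x. p (x + h)) *. cel (%_. b) = cellmean (%x. p (x + h) *. b)"
    unfolding inner_cel[OF perL2_cel(2)[OF perL2_shift[OF p]] sqint_Y_const] by (rule integral_Ycell) measurable
  also have "... = cellmean (%x. p x *. b)"
    unfolding cellmean_def
    using integral_periodic_shift[of "%x. p x *. b" h] p i by (simp add: perL2_def periodic_def add.commute[of h])
  also have "... = cel p *. cel (%_. b)"
    unfolding inner_cel[OF perL2_cel(2)[OF p] sqint_Y_const] by (rule integral_Ycell[symmetric]) measurable
  finally show ?thesis .
qed

lemma cel_Taylor:
  fixes p :: "real^'d => complex^'i"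
  assumes p: "p : smooth_pv"
  obtains C where "0 <= C" "!!h. norm (cel (%x. p (x + h)) - cel p - cel (dirderiv h p)) <= C * (norm h)^2"
proof -
  obtain C where C: "0 <= C" "!!x h. norm (p (x + h) - p x - dirderiv h p x) <= C * (norm h)^2"
    by (rule smooth_pv_Taylor[OF p]) blast
  note s = perL2_cel(2)[OF perL2_shift[OF perL2_smooth[OF p]]] smooth_pv_Ycell[OF p] norm_dirderiv_cel(1)[OF p]
  have "cel (%x. p (x + h)) - cel p - cel (dirderiv h p) = cel (%x. p (x + h) - p x - dirderiv h p x)" for h
    by (simp add: cel_diff s square_integrable_diff)
  hence "norm (cel (%x. p (x + h)) - cel p - cel (dirderiv h p)) <= C * (norm h)^2" for h
    using cel_norm_bounded[OF square_integrable_diff[OF square_integrable_diff[OF s(1,2)] s(3)] C(2)] by simp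
  thus thesis using that[OF C(1)] by blast
qed

text \<open>The cell mean is invariant under translations, so difference quotients have mean zero;
  by Taylor they differ from the derivative by \<open>O(t)\<close>.\<close>

lemma vpd_mean_0:
  fixes p :: "real^'d => complex^'i"
  assumes p: "p : smooth_pv"
  shows "mult (%_. Pj j) (cel (gradv p)) *. cel (%_. b) = 0"
proof -
  obtain C where C: "0 <= C" "!!h. norm (cel (%x. p (x + h)) - cel p - cel (dirderiv h p)) <= C * (norm h)^2"
    by (rule cel_Taylor[OF p]) blast
  let ?z = "mult (%_. Pj j) (cel (gradv p)) *. cel (%_::real^'d. b)"
  let ?K = "C * norm (cel (%_::real^'d. b))"
  have "\<bar>?z\<bar> <= t * ?K" if t: "0 < t" for t
  proof -
    let ?h = "t *R axis j 1 :: real^'d"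
    have "cel (dirderiv ?h p) = t *R mult (%_. Pj j) (cel (gradv p))"
      unfolding norm_dirderiv_cel(2)[OF p] by (simp add: axis_def if_distrib[of "%z. _ * z"] if_distrib[of "%z. z *R _"] cong: if_cong)
    hence "t * ?z = - ((cel (%x. p (x + ?h)) - cel p - cel (dirderiv ?h p)) *. cel (%_. b))"
      using cel_const_shift_inner[OF perL2_smooth[OF p], of ?h b] by (simp add: inner_diff_left)
    hence "\<bar>t * ?z\<bar> <= norm (cel (%x. p (x + ?h)) - cel p - cel (dirderiv ?h p)) * norm (cel (%_::real^'d. b))"
      using Cauchy_Schwarz_ineq2 by (metis abs_minus_cancel)
    also have "... <= (C * (norm ?h)^2) * norm (cel (%_::real^'d. b))" by (intro mult_right_mono C) auto
    also have "... = t * (t * ?K)" using t by (simp add: power2_eq_square)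
    finally show ?thesis using t by (simp add: abs_mult)
  qed
  hence "\<bar>?z\<bar> <= 0"
    by (intro tendsto_le[OF trivial_limit_at_right_real[of 0] _ tendsto_const, of "%t. t * ?K"])
      (auto intro!: tendsto_eq_intros eventually_at_right_less simp: eventually_at_filter)
  thus ?thesis by simp
qed

text \<open>Taylor alone leaves a quadratic error. Splitting the shift into \<open>n + 1\<close>
  equal steps, all of the same norm by periodicity, divides this error by
  \<open>n + 1\<close>.\<close>

lemma norm_cel_shift_diff_le:
  fixes p :: "real^'d => complex^'i"
  assumes p: "p : smooth_pv"
  shows "norm (cel (%x. p (x + h)) - cel p) <= (SUM j:UNIV. norm (Pj j :: complex^('i \<times> 'd)^'i)) * norm h * norm (cel (gradv p))"
proof -
  define S where "S = (SUM j:UNIV. norm (Pj j :: complex^('i \<times> 'd)^'i))"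
  obtain C where C: "0 <= C" "!!h. norm (cel (%x. p (x + h)) - cel p - cel (dirderiv h p)) <= C * (norm h)^2"
    by (rule cel_Taylor[OF p]) blast
  have pp: "perL2 p" by (rule perL2_smooth[OF p])
  have dd: "norm (cel (dirderiv h p)) <= S * norm h * norm (cel (gradv p))" for h
  proof -
    have "norm (cel (dirderiv h p)) <= (SUM j:UNIV. norm h * (norm (Pj j :: complex^('i \<times> 'd)^'i) * norm (cel (gradv p))))"
      unfolding norm_dirderiv_cel(2)[OF p]
      by (intro order_trans[OF norm_sum sum_mono], unfold norm_scaleR)
        (intro mult_mono norm_mult_le bmat_const; simp add: component_le_norm_cart)
    thus ?thesis by (simp add: S_def sum_distrib_left sum_distrib_right mult_ac)
  qed
  have 1: "norm (cel (%x. p (x + h)) - cel p) <= S * norm h * norm (cel (gradv p)) + C * (norm h)^2" for h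
    using norm_triangle_sub[of "cel (%x. p (x + h)) - cel p" "cel (dirderiv h p)"] dd[of h] C(2)[of h] by linarith
  have si: "(%x. p (x + h)) : sqint LY" for h by (rule perL2_cel(2)[OF perL2_shift[OF pp]])
  have 2: "norm (cel (%x. p (x + h)) - cel p) <= S * norm h * norm (cel (gradv p)) + (C * (norm h)^2) * (1 / real (Suc n))" for n
  proof -
    define k where "k = (1 / real (Suc n)) *R h"
    have step: "norm (cel (%x. p (x + real (Suc i) *R k)) - cel (%x. p (x + real i *R k))) = norm (cel (%x. p (x + k)) - cel p)" for i
    proof -
      have q: "perL2 (%x. p (x + k) - p x)" by (intro perL2_diff perL2_shift pp)
      have q': "perL2 (%x. p ((x + real i *R k) + k) - p (x + real i *R k))" using perL2_shift[OF q, of "real i *R k"] .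
      have "cel (%x. p (x + real (Suc i) *R k)) - cel (%x. p (x + real i *R k)) = cel (%x. p (x + real (Suc i) *R k) - p (x + real i *R k))"
        by (rule cel_diff[OF si si, symmetric])
      also have "... = cel (%x. p ((x + real i *R k) + k) - p (x + real i *R k))"
        by (simp add: algebra_simps)
      also have "norm ... = cellnorm (%x. p (x + k) - p x)"
        unfolding perL2_cel(3)[OF q'] using cellnorm_shift[OF q, of "real i *R k"] .
      also have "... = norm (cel (%x. p (x + k) - p x))" by (rule perL2_cel(3)[OF q, symmetric])
      also have "cel (%x. p (x + k) - p x) = cel (%x. p (x + k)) - cel p" by (rule cel_diff[OF si smooth_pv_Ycell[OF p]])
      finally show ?thesis .
    qed
    have "cel (%x. p (x + h)) - cel p = (\<Sum>i<Suc n. cel (%x. p (x + real (Suc i) *R k)) - cel (%x. p (x + real i *R k)))"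
      unfolding sum_lessThan_telescope[of "%i. cel (%x. p (x + real i *R k))"] by (simp add: k_def)
    also have "norm ... <= (\<Sum>i<Suc n. norm (cel (%x. p (x + k)) - cel p))"
      using step by (intro sum_norm_le) (simp del: of_nat_Suc)
    also have "... = real (Suc n) * norm (cel (%x. p (x + k)) - cel p)" by simp
    also have "... <= real (Suc n) * (S * norm k * norm (cel (gradv p)) + C * (norm k)^2)"
      by (intro mult_left_mono 1) simp
    also have "... = S * norm h * norm (cel (gradv p)) + (C * (norm h)^2) * (1 / real (Suc n))"
      by (simp add: k_def field_simps power2_eq_square del: of_nat_Suc)
    finally show ?thesis .
  qed
  have "(%n. S * norm h * norm (cel (gradv p)) + (C * (norm h)^2) * (1 / real (Suc n))) ----> S * norm h * norm (cel (gradv p)) + (C * (norm h)^2) * 0"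
    using LIMSEQ_inverse_real_of_nat by (intro tendsto_intros) (simp add: inverse_eq_divide)
  from LIMSEQ_le_const[OF this] 2 show ?thesis unfolding S_def[symmetric] by simp
qed

text \<open>The deviation from the mean is, up to sign, the average of
  \<open>p (x + h) - p x\<close> over a period in \<open>h\<close>. Jensen's inequality and Tonelli
  reduce it to the translation estimate for \<open>h\<close> in the cell, where
  \<open>norm h <= CARD('d)\<close>.\<close>

lemma Poincare_smooth:
  fixes p :: "real^'d => complex^'i"
  assumes p: "p : smooth_pv"
  shows "norm (cel p - cel (%_. cellmean p))
    <= (SUM j:UNIV. norm (Pj j :: complex^('i \<times> 'd)^'i)) * real CARD('d) * norm (cel (gradv p))"
proof -
  let ?E = "%x h. ihc x * (ihc h * ennreal ((norm (p (x + h) - p x))^2))"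
  define K where "K = (SUM j:UNIV. norm (Pj j :: complex^('i \<times> 'd)^'i)) * real CARD('d) * norm (cel (gradv p))"
  have K0: "0 <= K" by (auto simp: K_def intro!: mult_nonneg_nonneg sum_nonneg)
  have pp: "perL2 p" by (rule perL2_smooth[OF p])
  have [measurable]: "p : borelf" using pp by (simp add: perL2_def)
  have d: "perL2 (%x. p (x + h) - p x)" for h by (intro perL2_diff perL2_shift pp)
  have d': "perL2 (%h. p (x + h) - p x)" for x
    using perL2_diff[OF perL2_shift[OF pp, of x] perL2_const[of "p x"]] by (simp add: add.commute)
  have sh: "cellnn (%x. p (x + h) - p x) <= ennreal (K^2)" if h: "h : hcell" for h
  proof -
    have "cellnorm (%x. p (x + h) - p x) = norm (cel (%x. p (x + h)) - cel p)"
      unfolding perL2_cel(3)[OF d, symmetric] using cel_diff[OF perL2_cel(2)[OF perL2_shift[OF pp]] perL2_cel(2)[OF pp], of h] by simp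
    also have "... <= K"
      unfolding K_def by (rule order_trans[OF norm_cel_shift_diff_le[OF p] mult_right_mono[OF mult_left_mono[OF norm_hcell_le[OF h]]]])
        (auto intro!: sum_nonneg)
    finally show ?thesis unfolding cellnn_eq[OF d] by (intro ennreal_leI power_mono) auto
  qed
  have m: "cellmean (%h. p (x + h) - p x) = cellmean p - p x" for x
  proof -
    have "cellmean (%h. p (x + h) - p x) = cellmean (%h. p (x + h)) - cellmean (%_::real^'d. p x)"
      by (rule cellmean_diff[OF _ perL2_const]) (use perL2_shift[OF pp, of x] in \<open>simp add: add.commute\<close>)
    also have "cellmean (%h. p (x + h)) = cellmean p"
      unfolding cellmean_def using pp perL2_integrable[OF pp] by (intro integral_periodic_shift) (auto simp: perL2_def)
    also have "cellmean (%_::real^'d. p x) = p x"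
      by (simp add: cellmean_def measure_def emeasure_hcell)
    finally show ?thesis .
  qed
  have pm: "perL2 (%x. p x - cellmean p)" by (intro perL2_diff pp perL2_const)
  have "cellnn (%x. p x - cellmean p) <= (nn_integral lborel (%x. nn_integral lborel (%h. ?E x h)))"
    unfolding cellnn_def
  proof (rule nn_integral_mono)
    fix x
    have "norm (p x - cellmean p) <= cellnorm (%h. p (x + h) - p x)"
      using norm_cellmean_le[OF d', of x] unfolding m by (simp add: norm_minus_commute)
    hence "ennreal ((norm (p x - cellmean p))^2) <= cellnn (%h. p (x + h) - p x)"
      unfolding cellnn_eq[OF d'] by (intro ennreal_leI power_mono) auto
    hence "ihc x * ennreal ((norm (p x - cellmean p))^2) <= ihc x * cellnn (%h. p (x + h) - p x)"
      by (rule mult_left_mono) simp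
    also have "... = (nn_integral lborel (%h. ?E x h))"
      unfolding cellnn_def by (rule nn_integral_cmult[symmetric]) measurable
    finally show "ihc x * ennreal ((norm (p x - cellmean p))^2)
      <= (nn_integral lborel (%h. ?E x h))" .
  qed
  also have "... = (nn_integral lborel (%h. nn_integral lborel (%x. ?E x h)))"
    by (rule lborel_pair.Fubini') measurable
  also have "... <= (nn_integral lborel (%h. ennreal (K^2) * ihc (h :: real^'d)))"
  proof (rule nn_integral_mono)
    fix h
    have "(nn_integral lborel (%x. ?E x h)) = ihc h * cellnn (%x. p (x + h) - p x)"
      unfolding cellnn_def by (subst nn_integral_cmult[symmetric]) (auto intro!: nn_integral_cong simp: mult_ac)
    also have "... <= ennreal (K^2) * ihc h" using sh[of h] by (auto simp: indicator_def)
    finally show "(nn_integral lborel (%x. ?E x h)) <= ennreal (K^2) * ihc h" .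
  qed
  also have "... = ennreal (K^2)" by (simp add: nn_integral_cmult emeasure_hcell)
  finally have "(cellnorm (%x. p x - cellmean p))^2 <= K^2" unfolding cellnn_eq[OF pm] by (simp add: K0)
  hence "cellnorm (%x. p x - cellmean p) <= K" using K0 by (rule power2_le_imp_le)
  thus ?thesis
    unfolding K_def[symmetric] perL2_cel(3)[OF pm, symmetric]
    using cel_diff[OF perL2_cel(2)[OF pp] sqint_Y_const, of "cellmean p"] by simp
qed

section \<open>Means and weak derivatives on the cell\<close>

abbreviation celc :: "complex^'i => ('d::finite, 'i) L2" where
  "celc X \<equiv> cel (%_. X)"

definition cmean :: "('d::finite, 'i::finite) L2 => complex^'i" where
  "cmean U = (LINT y|LY. rep_L2 U y)"

lemma integrable_Ycell:
  fixes f :: "real^'d => 'b::euclidean_space"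
  assumes f: "f : sqint LY"
  shows "integrable LY f"
proof (rule integrable_dominated)
  show "integrable LY (%x. (norm (f x))^2 + (1::real)^2)"
    using f sqint_Y_const[of "1::real", where 'd='d] by (intro Bochner_Integration.integrable_add) (simp_all add: square_integrable_def)
  have "norm (f x) <= (norm (f x))^2 + 1^2" for x
    using sum_squares_bound[of "norm (f x)" 1] norm_ge_zero[of "f x"] by (simp del: norm_ge_zero)
  thus "AE x in LY. norm (f x) <= norm ((norm (f x))^2 + (1::real)^2)" by (intro AE_I2) simp
  show "f : borel_measurable LY" using f by (simp add: square_integrable_def)
qed

lemma cmean_inner_cel:
  fixes f :: "real^'d => complex^'i"
  assumes f: "f : sqint LY"
  shows "(LINT y|LY. f y) *. b = cel f *. celc b"
  unfolding inner_cel[OF f sqint_Y_const] by (simp add: integrable_Ycell[OF f])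

lemma cmean_cel:
  assumes f: "f : sqint LY"
  shows "cmean (cel f) = (LINT y|LY. f y)"
  unfolding cmean_def
proof (rule integral_cong_AE)
  note r = rep_L2_Ycell(1)[of "cel f"]
  have "cel (rep_L2 (cel f)) = cel f"
    unfolding rep_L2_Ycell(2) sqint_Y_mult(2)[OF bmat_Ycell f] unfolding cel_def
    by (intro arg_cong[of _ _ abs_L2]) (auto simp: indicator_def)
  thus "AE x in LY. rep_L2 (cel f) x = f x" by (simp add: cel_eq_iff[OF r f])
  show "rep_L2 (cel f) : borel_measurable LY" using r by (simp add: square_integrable_def)
  show "f : borel_measurable LY" using f by (simp add: square_integrable_def)
qed

lemma cmean_inner: "cel (rep_L2 U) = U ==> cmean U *. b = U *. celc b"
  unfolding cmean_def using cmean_inner_cel[OF rep_L2_Ycell(1), of U b] by simp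

lemma celc_add: "celc (X + Y) = celc X + celc Y"
  by (rule cel_add[OF sqint_Y_const sqint_Y_const])

lemma mult_celc: "mult (%_. A) (celc X) = celc (A *v X)"
  by (rule sqint_Y_mult(2)[OF bmat_const sqint_Y_const])

lemma inner_celc: "(celc X :: ('d::finite, 'i::finite) L2) *. celc Y = X *. Y"
  unfolding inner_cel[OF sqint_Y_const sqint_Y_const] by (rule integral_Ycell_const)

lemma gradv_mean_0:
  fixes p :: "real^'d => complex^'n"
  assumes "p : smooth_pv"
  shows "cel (gradv p) *. celc B = 0"
  unfolding inner_Pj_sum[of "cel (gradv p)"] mult_celc by (simp add: vpd_mean_0[OF assms])

text \<open>A scalar test function \<open>psi\<close> enters as the vector field
  \<open>axis i (cnj (c * psi))\<close>, whose gradient has the single nonzero row \<open>i\<close>;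
  the factor \<open>c\<close> again serves to recover complex values.\<close>

lemma divfree_if_orthogonal:
  fixes g :: "real^'d => complex^'q^('n::finite \<times> 'd)"
  assumes g: "!!q. perL2 (%y. column q (g y))" and o: "!!q p. p : smooth_pv ==> cel (%y. column q (g y)) *. cel (gradv p) = 0"
  shows "divfree g"
  unfolding divfree_def
proof (intro allI ballI)
  fix i q and psi :: "real^'d => complex" assume psi: "psi : smooth_periodic"
  let ?f = "%y. column q (g y)"
  have psis: "smooth_fun psi" "periodic psi" using psi by (auto simp: smooth_periodic_def periodic_def)
  note d = smooth_fun_pderiv[OF psis(1)] pderiv_cl_periodic[OF psis(2,1)]
  note fs = perL2_cel(2)[OF g]
  have f: "(%y. Pj j *v ?f y) : sqint LY" "mult (%_. Pj j) (cel ?f) = cel (%y. Pj j *v ?f y)" for j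
    by (rule sqint_Y_mult[OF bmat_const fs])+
  have ds: "pd j psi : sqint LY" for j
  proof -
    obtain C where "!!x. norm (pd j psi x) <= C"
      by (rule periodic_cont_bounded[OF d(2) smooth_fun_cont[OF d(1)]]) blast
    thus ?thesis by (rule sqint_Y_bounded[OF smooth_fun_measurable[OF d(1)]])
  qed
  have e: "(LINT y|lborel. ihc y *R (g y $ (i, j) $ q * pd j psi y)) = (LINT y|LY. (Pj j *v ?f y) $ i * pd j psi y)" for j
  proof -
    have [measurable]: "?f : borelf" using g[of q] by (simp add: perL2_def)
    have [measurable]: "pd j psi : borelf" by (rule smooth_fun_measurable[OF d(1)])
    have "(%y. (Pj j *v ?f y) $ i) : borelf"
      by (rule measurable_compose[of "%y. Pj j *v ?f y" borel borel "%v. v $ i"]) (auto intro!: borel_measurable_continuous_onI continuous_intros)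
    hence "(%y. (Pj j *v ?f y) $ i * pd j psi y) : borelf" by (intro borel_measurable_times) auto
    thus ?thesis by (simp add: integral_Ycell cellmean_def column_def)
  qed
  have "Re (c * (SUM j:UNIV. LINT y|lborel. ihc y *R (g y $ (i, j) $ q * pd j psi y))) = 0" for c
  proof -
    define p :: "real^'d => complex^'n" where "p x = axis i (cnj (c * psi x))" for x
    have "smooth_fun (%x. p x $ k)" for k
      unfolding p_def using psis(1) by (cases "k = i") (auto simp: axis_def smooth_fun_const intro!: smooth_fun_cnj smooth_fun_mult)
    hence p: "p : smooth_pv" using psis(2) by (simp add: smooth_pv_def smooth_vec_def periodic_def p_def)
    have v: "vpd j p = (%x. axis i (cnj (c * pd j psi x)))" for j
      unfolding p_def[abs_def] vpd_axis pderiv_cl_cnj_cmult[OF psis(1)] ..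
    have mg: "mult (%_. Pj j) (cel (gradv p)) = cel (vpd j p)" for j
      unfolding sqint_Y_mult(2)[OF bmat_const smooth_pv_Ycell[OF smooth_pv_gradv[OF p]]] vpd_gradv[symmetric] ..
    have "0 = cel ?f *. cel (gradv p)" using o[OF p] by simp
    also have "... = (SUM j:UNIV. cel (%y. Pj j *v ?f y) *. cel (%x. axis i (cnj (c * pd j psi x))))"
      unfolding inner_Pj_sum[of "cel ?f"] mg v f(2) ..
    also have "... = (SUM j:UNIV. Re (c * (LINT y|LY. (Pj j *v ?f y) $ i * pd j psi y)))"
      by (intro sum.cong refl inner_cel_axis(2) f ds)
    finally show ?thesis unfolding e by (simp only: sum_distrib_left Re_sum)
  qed
  from this[of 1] this[of "\<i>"]
  show "(SUM j:UNIV. LINT y|lborel. ihc y *R (g y $ (i, j) $ q * pd j psi y)) = 0"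
    by (simp add: complex_eq_iff)
qed

lemma divfree_const: "divfree (%_::real^'d. A :: complex^'q^('n::finite \<times> 'd))"
proof (rule divfree_if_orthogonal)
  show "perL2 (%_::real^'d. column q A)" for q by (rule perL2_const)
  show "celc (column q A) *. cel (gradv p) = 0" if "p : smooth_pv" for q and p :: "real^'d => complex^'n"
    using gradv_mean_0[OF that, of "column q A"] by (simp add: inner_commute)
qed

text \<open>Derivatives of smooth periodic functions have mean zero, so constant fields are
  divergence free. Periodization carries this to the whole space; the matrix \<open>?A\<close>
  selects the one direction \<open>j\<close>.\<close>

lemma integral_pderiv_test_fun:
  fixes th :: "real^'d => complex"
  assumes th: "th : test_fun UNIV"
  shows "(LINT x|lborel. pd j th x) = 0"
proof -
  let ?A = "\<chi> p q. if snd p = j then 1 else 0 :: complex^1^(1 \<times> 'd)"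
  have "(LINT x|lborel. ?A $ (1, k) $ 1 * pd k th x) = (if k = j then LINT x|lborel. pd j th x else 0)" for k
    by simp
  thus ?thesis
    using divfree_test_fun(2)[OF zero_less_one perL2_const divfree_const th, of ?A 1 1] by simp
qed

text \<open>The product with a test function of the cell is itself a test function, so the integral
  of its derivative vanishes.\<close>

lemma has_weak_pderiv_smooth:
  fixes f :: "real^'d => complex"
  assumes f: "smooth_fun f" and fs: "f : sqint LY" "pd j f : sqint LY"
  shows "has_weak_pderiv Ycell j f (pd j f)"
  unfolding has_weak_pderiv_def
proof
  fix psi :: "real^'d => complex" assume psi: "psi : test_fun Ycell"
  define th where "th x = f x * psi x" for x
  have th: "th : test_fun Ycell" unfolding th_def by (rule test_fun_mult[OF psi f])
  have d: "pd j th = (%x. f x * pd j psi x + pd j f x * psi x)"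
    unfolding th_def by (intro pderiv_cl_mult smooth_fun_diffble f test_fun_smooth[OF psi])
  have dth: "pd j th : test_fun Ycell" by (rule test_fun_pderiv[OF th])
  then obtain K where K: "K \<subseteq> Ycell" "!!x. x ~: K ==> pd j th x = 0" by (auto simp: test_fun_iff)
  have [measurable]: "pd j th : borelf" by (rule smooth_fun_measurable[OF test_fun_smooth[OF dth]])
  have "(LINT x|LY. pd j th x) = (LINT x|lebesgue. indicator Ycell x *R pd j th x)"
    by (simp add: integral_restrict_space Ycell_sets)
  also have "... = (LINT x|lebesgue. pd j th x)"
    using K by (intro LINT_cong) (auto simp: indicator_def)
  also have "... = 0" using integral_pderiv_test_fun[OF test_fun_mono[OF th], of j] by (subst integral_completion) auto
  finally have "(LINT x|LY. f x * pd j psi x + pd j f x * psi x) = 0" unfolding d .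
  thus "(LINT x|LY. f x * pd j psi x) = - (LINT x|LY. pd j f x * psi x)"
    using sqint_mult[OF fs(1) test_fun_Ycell[OF test_fun_pderiv[OF psi, of j]]]
      sqint_mult[OF fs(2) test_fun_Ycell[OF psi]]
    by (simp add: eq_neg_iff_add_eq_0)
qed

lemma smooth_pv_component:
  assumes "p : smooth_pv"
  shows "smooth_fun (%x. p x $ i)" "(%x. p x $ i) : sqint LY"
    "pd j (%x. p x $ i) : sqint LY" "(%x. p x $ i) : smooth_periodic"
proof -
  show "smooth_fun (%x. p x $ i)" using assms by (simp add: smooth_pv_def smooth_vec_def)
  thus "(%x. p x $ i) : smooth_periodic" using assms by (simp add: smooth_periodic_def smooth_pv_def periodic_def)
  show "(%x. p x $ i) : sqint LY"
    using smooth_pv_Ycell[OF assms] sqint_vec by blast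
  have "(%x. gradv p x $ (i, j)) : sqint LY"
    using smooth_pv_Ycell[OF smooth_pv_gradv[OF assms]] sqint_vec by blast
  thus "pd j (%x. p x $ i) : sqint LY" by simp
qed

lemma CS_weak_pderiv:
  fixes u :: "real^'d => complex^'n"
  assumes u: "u : sqint LY" and g: "g : sqint LY"
    and CS: "(cel u, cel g) : CS"
  shows "has_weak_pderiv Ycell j (%x. u x $ i) (%x. g x $ (i, j))"
  unfolding has_weak_pderiv_def
proof
  fix psi :: "real^'d => complex" assume psi: "psi : test_fun Ycell"
  note t = test_fun_Ycell[OF psi] test_fun_Ycell[OF test_fun_pderiv[OF psi, of j]]
  obtain p where p: "!!n::nat. p n : smooth_pv" "(%n. cel (p n)) ----> cel u" "(%n. cel (gradv (p n))) ----> cel g"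
    by (rule CS_sequence[OF CS]) blast
  have "Re (c * (LINT x|LY. u x $ i * pd j psi x)) = - Re (c * (LINT x|LY. g x $ (i, j) * psi x))" for c
  proof (rule LIMSEQ_unique)
    show "(%n. cel (p n) *. cel (%x. axis i (cnj (c * pd j psi x)))) ----> Re (c * (LINT x|LY. u x $ i * pd j psi x))"
      unfolding inner_cel_axis(2)[OF u t(2), symmetric] by (intro tendsto_intros p)
    have "cel (p n) *. cel (%x. axis i (cnj (c * pd j psi x))) = - (cel (gradv (p n)) *. cel (%x. axis (i, j) (cnj (c * psi x))))" for n
    proof -
      have "(LINT x|LY. p n x $ i * pd j psi x) = - (LINT x|LY. gradv (p n) x $ (i, j) * psi x)"
        using has_weak_pderiv_smooth[OF smooth_pv_component(1)[OF p(1)[of n]] smooth_pv_component(2,3)[OF p(1)[of n]], of j i] psi by (simp add: has_weak_pderiv_def)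
      thus ?thesis
        by (simp only: inner_cel_axis(2)[OF smooth_pv_Ycell[OF p(1)] t(2)] inner_cel_axis(2)[OF smooth_pv_Ycell[OF smooth_pv_gradv[OF p(1)]] t(1)]) simp
    qed
    thus "(%n. cel (p n) *. cel (%x. axis i (cnj (c * pd j psi x)))) ----> - Re (c * (LINT x|LY. g x $ (i, j) * psi x))"
      unfolding inner_cel_axis(2)[OF g t(1), symmetric] by (simp only:) (intro tendsto_intros p)
  qed
  from this[of 1] this[of "\<i>"]
  show "(LINT x|LY. u x $ i * pd j psi x) = - (LINT x|LY. g x $ (i, j) * psi x)"
    by (simp add: complex_eq_iff)
qed

lemma norm_cel_components:
  fixes f :: "real^'d => complex^'i"
  assumes f: "f : sqint LY"
  shows "(norm (cel f))^2 = (SUM i:UNIV. LINT x|LY. (cmod (f x $ i))^2)"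
proof -
  have "integrable LY (%x. (cmod (f x $ i))^2)" for i
    using f unfolding sqint_vec by (simp add: square_integrable_def)
  thus ?thesis unfolding norm_cel[OF f]
    by (simp add: norm_vec_def L2_set_def sum_nonneg)
qed

lemma CS_imp_H1:
  fixes u :: "real^'d => complex^'n"
  assumes u: "u : sqint LY" and g: "g : sqint LY"
    and CS: "(cel u, cel g) : CS"
  shows "(%x. u x $ i) : H1 Ycell"
    and "AE x in LY. weak_pderiv Ycell j (%x. u x $ i) x = g x $ (i, j)"
    and "H1_norm Ycell (%x. u x $ i) <= sqrt ((norm (cel u))^2 + (norm (cel g))^2)"
proof -
  have gi: "(%x. g x $ (i, j)) : sqint LY" for i j using g sqint_vec by blast
  have ui: "(%x. u x $ i) : sqint LY" for i using u sqint_vec by blast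
  note w = CS_weak_pderiv[OF assms]
  let ?w = "%i j. weak_pderiv Ycell j (%x. u x $ i)"
  show "(%x. u x $ i) : H1 Ycell" unfolding H1_def using ui gi w by blast
  have W: "?w i j : sqint LY"
    "AE x in LY. ?w i j x = g x $ (i, j)" for i j
    using weak_pderiv_eq[OF _ gi w] by blast+
  thus "AE x in LY. ?w i j x = g x $ (i, j)" by blast
  have "(LINT x|LY. (cmod (u x $ i))^2) <= (norm (cel u))^2"
    unfolding norm_cel_components[OF u]
    by (rule member_le_sum[of i UNIV "%i. LINT x|LY. (cmod (u x $ i))^2"]) auto
  moreover have "(SUM j:UNIV. LINT x|LY. (cmod (?w i j x))^2) <= (norm (cel g))^2"
  proof -
    have "(LINT x|LY. (cmod (?w i j x))^2) = (LINT x|LY. (cmod (g x $ (i, j)))^2)" for j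
    proof (rule integral_cong_AE)
      show "AE x in LY. (cmod (?w i j x))^2 = (cmod (g x $ (i, j)))^2"
        using W(2)[of j i] by eventually_elim simp
      show "(%x. (cmod (?w i j x))^2) : borel_measurable LY"
        using W(1)[of j i] by (simp add: square_integrable_def borel_measurable_integrable)
      show "(%x. (cmod (g x $ (i, j)))^2) : borel_measurable LY"
        using gi[of i j] by (simp add: square_integrable_def borel_measurable_integrable)
    qed
    hence "(SUM j:UNIV. LINT x|LY. (cmod (?w i j x))^2)
        = (SUM q:Pair i ` UNIV. LINT x|LY. (cmod (g x $ q))^2)"
      by (subst sum.reindex) (auto simp: inj_on_def)
    also have "... <= (norm (cel g))^2"
      unfolding norm_cel_components[OF g] by (intro sum_mono2) auto
    finally show ?thesis .
  qed
  ultimately show "H1_norm Ycell (%x. u x $ i) <= sqrt ((norm (cel u))^2 + (norm (cel g))^2)"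
    unfolding H1_norm_def by (intro real_sqrt_le_mono add_mono)
qed

text \<open>One half of the identification of \<open>CS\<close> with the vector-valued
  \<open>H1_per\<close>; it also shows that the chosen derivatives in \<open>nabla\<close> agree
  with the limit gradient.\<close>

lemma CS_imp_H1_per:
  fixes u :: "real^'d => complex^'n"
  assumes u: "u : sqint LY" and g: "g : sqint LY"
    and CS: "(cel u, cel g) : CS"
  shows "(%x. u x $ i) : H1_per"
    and "nabla Ycell u : sqint LY" "cel (nabla Ycell u) = cel g"
    and "AE x in LY. nabla Ycell u x = g x"
proof -
  have "EX phi:smooth_periodic. H1_norm Ycell (%x. u x $ i - phi x) < e" if e: "0 < e" for e
  proof -
    obtain p where p: "!!n::nat. p n : smooth_pv" "(%n. cel (p n)) ----> cel u" "(%n. cel (gradv (p n))) ----> cel g"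
      by (rule CS_sequence[OF CS]) blast
    have "(%n. sqrt ((norm (cel u - cel (p n)))^2 + (norm (cel g - cel (gradv (p n))))^2)) ----> sqrt ((norm (cel u - cel u))^2 + (norm (cel g - cel g))^2)"
      by (intro tendsto_intros p)
    hence "\<forall>\<^sub>F n in sequentially. sqrt ((norm (cel u - cel (p n)))^2 + (norm (cel g - cel (gradv (p n))))^2) < e"
      using e by (intro order_tendstoD(2)[where y="sqrt ((norm (cel u - cel u))^2 + (norm (cel g - cel g))^2)"]) auto
    then obtain n where n: "sqrt ((norm (cel u - cel (p n)))^2 + (norm (cel g - cel (gradv (p n))))^2) < e"
      by (auto simp: eventually_sequentially)
    note ps = smooth_pv_Ycell[OF p(1)] smooth_pv_Ycell[OF smooth_pv_gradv[OF p(1)]]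
    have "(cel u, cel g) - (cel (p n), cel (gradv (p n))) : CS"
      by (rule subspace_diff[OF subspace_CS CS PG_CS[OF p(1)]])
    hence "(cel (%x. u x - p n x), cel (%x. g x - gradv (p n) x)) : CS"
      by (simp add: cel_diff u g ps)
    from CS_imp_H1(3)[OF square_integrable_diff[OF u ps(1)] square_integrable_diff[OF g ps(2)] this, of i]
    have "H1_norm Ycell (%x. u x $ i - p n x $ i) < e" using n by (simp add: cel_diff u g ps)
    thus ?thesis by (rule bexI[where x="%x. p n x $ i"]) (rule smooth_pv_component(4)[OF p(1)])
  qed
  thus "(%x. u x $ i) : H1_per" unfolding H1_per_def using CS_imp_H1(1)[OF assms] by blast
  have w: "AE x in LY. nabla Ycell u x $ q = g x $ q" for q
    using CS_imp_H1(2)[OF assms, of "snd q" "fst q"] by (cases q) (simp add: nabla_def)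
  have "AE x in LY. ALL q. nabla Ycell u x $ q = g x $ q"
    by (intro AE_finite_allI[of UNIV, simplified] w) auto
  thus ae: "AE x in LY. nabla Ycell u x = g x" by (simp add: vec_eq_iff)
  have "(%x. nabla Ycell u x $ q) : sqint LY" for q
    using weak_pderiv_works(1)[OF CS_imp_H1(1)[OF assms]] by (cases q) (simp add: nabla_def)
  thus n: "nabla Ycell u : sqint LY" unfolding sqint_vec by blast
  show "cel (nabla Ycell u) = cel g" using cel_eq_iff[OF n g] ae by simp
qed

text \<open>The other half. The definition of \<open>H1_per\<close> approximates each component
  separately; the scalar approximants are assembled into one smooth periodic vector field.\<close>

lemma H1_per_imp_CS:
  fixes u :: "real^'d => complex^'n"
  assumes u: "!!i. (%x. u x $ i) : H1_per"
  shows "u : sqint LY" "nabla Ycell u : sqint LY"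
    and "(cel u, cel (nabla Ycell u)) : CS"
proof -
  have H1: "(%x. u x $ i) : H1 Ycell" for i using u by (simp add: H1_per_def)
  show us: "u : sqint LY" unfolding sqint_vec using H1 by (simp add: H1_def)
  note w = weak_pderiv_works[OF H1]
  have "(%x. nabla Ycell u x $ q) : sqint LY" for q
    using w(1) by (cases q) (simp add: nabla_def)
  thus ns: "nabla Ycell u : sqint LY" unfolding sqint_vec by blast
  let ?n = "%p. norm (cel u - cel p)" and ?N = "%p. norm (cel (nabla Ycell u) - cel (gradv p))" and ?c = "real CARD('n)"
  have ex: "EX p:smooth_pv. ?n p <= ?c * e & ?N p <= ?c * e" if e: "0 < e" for e
  proof -
    have "ALL i. EX phi:smooth_periodic. H1_norm Ycell (%x. u x $ i - phi x) < e" using u e by (simp add: H1_per_def)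
    then obtain phi where phi: "!!i. phi i : smooth_periodic" "!!i. H1_norm Ycell (%x. u x $ i - phi i x) < e" by metis
    define p where "p x = (\<chi> i. phi i x)" for x
    have p: "p : smooth_pv" using phi(1) by (simp add: p_def smooth_pv_def smooth_vec_def smooth_periodic_def periodic_def vec_eq_iff)
    note ps = smooth_pv_Ycell[OF p] smooth_pv_Ycell[OF smooth_pv_gradv[OF p]]
    note pc = smooth_pv_component[OF p, unfolded p_def, simplified]
    let ?w = "%i j. weak_pderiv Ycell j (%x. u x $ i - phi i x)"
    have wd: "AE x in LY. ?w i j x = nabla Ycell u x $ (i, j) - gradv p x $ (i, j)"
      and ws: "?w i j : sqint LY" for i j
    proof -
      have "has_weak_pderiv Ycell j (%x. u x $ i - phi i x) (%x. weak_pderiv Ycell j (%x. u x $ i) x - pd j (phi i) x)"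
        unfolding has_weak_pderiv_def
      proof
        fix psi :: "real^'d => complex" assume psi: "psi : test_fun Ycell"
        note t = test_fun_Ycell[OF psi] test_fun_Ycell[OF test_fun_pderiv[OF psi, of j]]
        have ui: "(%x. u x $ i) : sqint LY" using H1 by (simp add: H1_def)
        show "(LINT x|LY. (u x $ i - phi i x) * pd j psi x)
          = - (LINT x|LY. (weak_pderiv Ycell j (%x. u x $ i) x - pd j (phi i) x) * psi x)"
          using sqint_mult[OF ui t(2)] sqint_mult[OF pc(2)[where i=i] t(2)]
            sqint_mult[OF w(1)[of j i] t(1)] sqint_mult[OF pc(3)[where i=i and j=j] t(1)]
            w(2)[of j i] has_weak_pderiv_smooth[OF pc(1)[where i=i] pc(2)[where i=i] pc(3)[where i=i and j=j]] psi
          by (simp add: left_diff_distrib has_weak_pderiv_def)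
      qed
      from weak_pderiv_eq[OF disjI2[OF refl] square_integrable_diff[OF w(1)[of j i] pc(3)[where i=i and j=j]] this]
      show "AE x in LY. ?w i j x = nabla Ycell u x $ (i, j) - gradv p x $ (i, j)"
        "?w i j : sqint LY"
        by (simp_all add: nabla_def p_def)
    qed
    define A where "A i = (LINT x|LY. (cmod (u x $ i - phi i x))^2)" for i
    define B where "B i = (SUM j:UNIV. LINT x|LY. (cmod (?w i j x))^2)" for i
    have AB: "0 <= A i" "0 <= B i" for i by (auto simp: A_def B_def intro!: sum_nonneg Bochner_Integration.integral_nonneg)
    have ABe: "A i + B i <= e^2" for i
    proof -
      have "sqrt (A i + B i) < e" using phi(2)[of i] by (simp add: H1_norm_def A_def B_def)
      hence "(sqrt (A i + B i))^2 <= e^2" using AB by (intro power_mono) (auto simp: add_nonneg_nonneg)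
      thus ?thesis using AB by (simp add: add_nonneg_nonneg)
    qed
    have AB': "A i <= e^2" "B i <= e^2" for i using ABe[of i] AB[of i] by linarith+
    have n1: "1 <= ?c" by (simp add: Suc_leI)
    \<comment> \<open>The exact factor would be the square root of \<open>CARD('n)\<close>; it is
      rounded up to \<open>CARD('n)\<close>.\<close>
    have fin: "x <= ?c * e" if "x^2 <= (SUM i:(UNIV::'n set). e^2)" for x
    proof (rule power2_le_imp_le)
      have "x^2 <= ?c * e^2" using that by simp
      also have "... <= (?c)^2 * e^2" using n1 by (intro mult_right_mono) (auto simp: power2_eq_square)
      finally show "x^2 <= (?c * e)^2" by (simp add: power_mult_distrib)
    qed (use e in simp)
    have "(?n p)^2 = (SUM i:UNIV. A i)"
      unfolding cel_diff[OF us ps(1), symmetric] norm_cel_components[OF square_integrable_diff[OF us ps(1)]] A_def by (simp add: p_def)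
    also have "... <= (SUM i:(UNIV::'n set). e^2)" by (intro sum_mono AB')
    finally have 1: "?n p <= ?c * e" by (rule fin)
    have "(?N p)^2 = (SUM q:UNIV. LINT x|LY. (cmod (nabla Ycell u x $ q - gradv p x $ q))^2)"
      unfolding cel_diff[OF ns ps(2), symmetric] norm_cel_components[OF square_integrable_diff[OF ns ps(2)]] by simp
    also have "... = (SUM i:UNIV. SUM j:UNIV. LINT x|LY. (cmod (nabla Ycell u x $ (i, j) - gradv p x $ (i, j)))^2)"
      by (simp add: sum.cartesian_product UNIV_Times_UNIV[symmetric] case_prod_beta del: UNIV_Times_UNIV gradv_component)
    also have "... = (SUM i:UNIV. B i)"
      unfolding B_def
    proof (intro sum.cong refl integral_cong_AE)
      fix i j
      show "AE x in LY. (cmod (nabla Ycell u x $ (i, j) - gradv p x $ (i, j)))^2 = (cmod (?w i j x))^2"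
        using wd[of j i] by eventually_elim simp
      show "(%x. (cmod (?w i j x))^2) : borel_measurable LY"
        using ws[of j i] by (simp add: square_integrable_def borel_measurable_integrable)
      have "(%x. nabla Ycell u x $ (i, j) - gradv p x $ (i, j)) : sqint LY"
        using square_integrable_diff[OF ns ps(2)] unfolding sqint_vec by (simp del: gradv_component)
      thus "(%x. (cmod (nabla Ycell u x $ (i, j) - gradv p x $ (i, j)))^2) : borel_measurable LY"
        by (simp add: square_integrable_def borel_measurable_integrable del: gradv_component)
    qed
    also have "... <= (SUM i:(UNIV::'n set). e^2)" by (intro sum_mono AB')
    finally have 2: "?N p <= ?c * e" by (rule fin)
    show ?thesis using p 1 2 by blast
  qed
  have "ALL m. EX p:smooth_pv. ?n p <= ?c * (1 / real (Suc m)) & ?N p <= ?c * (1 / real (Suc m))"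
    by (intro allI ex) simp
  then obtain p where p: "!!m. p m : smooth_pv" "!!m. ?n (p m) <= ?c * (1 / real (Suc m))"
    "!!m. ?N (p m) <= ?c * (1 / real (Suc m))" by metis
  have l: "X ----> x" if "!!m. norm (x - X m) <= ?c * (1 / real (Suc m))" for X and x :: "'z::real_normed_vector"
  proof -
    have "(%m. ?c * (1 / real (Suc m))) ----> 0"
      using tendsto_mult_right_zero[OF LIMSEQ_inverse_real_of_nat] by (simp add: inverse_eq_divide)
    hence "(%m. X m - x) ----> 0"
      by (rule Lim_null_comparison[rotated]) (use that in \<open>simp add: norm_minus_commute\<close>)
    thus ?thesis by (simp add: LIM_zero_iff)
  qed
  show "(cel u, cel (nabla Ycell u)) : CS"
    by (rule CS_I[OF PG_CS[OF p(1)] l[OF p(2)] l[OF p(3)]])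
qed

section \<open>Periodic functions of mean zero\<close>

lemma CS_mean_0:
  fixes U :: "('d::finite, 'n::finite) L2"
  assumes "(U, G) : CS" shows "G *. celc B = 0"
proof -
  obtain p where p: "!!n::nat. p n : smooth_pv" "(%n. cel (gradv (p n))) ----> G"
    by (rule CS_sequence[OF assms]) blast
  have "(%n. cel (gradv (p n)) *. celc B) ----> G *. celc B" by (intro tendsto_intros p)
  thus ?thesis by (simp add: gradv_mean_0[OF p(1)] LIMSEQ_const_iff)
qed

definition CS0 :: "(('d::finite, 'n::finite) L2 \<times> ('d, 'n \<times> 'd) L2) set" where
  "CS0 = {z : CS. ALL b. fst z *. celc b = 0}"

lemma CS0_I:
  fixes U :: "('d::finite, 'n::finite) L2"
  assumes z: "(U, G) : CS"
  shows "(U - celc (cmean U), G) : CS0"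
proof -
  have "cel (gradv (%_::real^'d. cmean U)) = (0 :: ('d, 'n \<times> 'd) L2)"
    unfolding gradv_const using cel_scaleR[OF sqint_Y_const, of 0 "0 :: complex^('n \<times> 'd)"] by simp
  moreover have "(celc (cmean U), cel (gradv (%_::real^'d. cmean U))) : CS" by (intro PG_CS smooth_pv_const)
  ultimately have "(celc (cmean U), 0 :: ('d, 'n \<times> 'd) L2) : CS" by simp
  from subspace_diff[OF subspace_CS z this] have 1: "(U - celc (cmean U), G) : CS" by simp
  have "(U - celc (cmean U)) *. celc b = 0" for b
    unfolding inner_diff_left inner_celc using CS_supported[OF z] by (simp add: cmean_inner)
  thus ?thesis using 1 by (simp add: CS0_def)
qed

lemma subspace_CS0: "subspace CS0"
  by (rule subspaceI)
    (simp_all add: CS0_def subspace_0[OF subspace_CS] subspace_add[OF subspace_CS] subspace_scale[OF subspace_CS] inner_add_left)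

lemma closed_CS0: "closed CS0"
proof -
  have e: "CS0 = CS \<inter> (\<Inter>b. {z. fst z *. celc b = 0})" by (auto simp: CS0_def)
  show ?thesis
    unfolding e CS_def by (intro closed_Int closed_INT ballI closed_closure closed_Collect_eq continuous_intros)
qed

text \<open>Since \<open>U\<close> is orthogonal to constants, the means of the approximating smooth
  functions may be subtracted inside \<open>U *. cel (p n)\<close> before the smooth inequality is
  applied.\<close>

lemma Poincare:
  obtains K where "0 <= K" "!!(U :: ('d::finite, 'n::finite) L2) G. (U, G) : CS0 ==> norm U <= K * norm G"
proof -
  define K where "K = (SUM j:UNIV. norm (Pj j :: complex^('n \<times> 'd)^'n)) * real CARD('d)"
  have K0: "0 <= K" by (auto simp: K_def intro!: mult_nonneg_nonneg sum_nonneg)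
  have "norm U <= K * norm G" if z: "(U, G) : CS0" for U :: "('d, 'n) L2" and G
  proof -
    have CS: "(U, G) : CS" and U0: "!!b. U *. celc b = 0" using z by (auto simp: CS0_def)
    obtain p where p: "!!n::nat. p n : smooth_pv" "(%n. cel (p n)) ----> U" "(%n. cel (gradv (p n))) ----> G"
      by (rule CS_sequence[OF CS]) blast
    have "U *. U <= norm U * (K * norm G)"
    proof (rule LIMSEQ_le)
      show "(%n. U *. cel (p n)) ----> U *. U" "(%n. norm U * (K * norm (cel (gradv (p n))))) ----> norm U * (K * norm G)"
        by (intro tendsto_intros p)+
      have "U *. cel (p n) <= norm U * (K * norm (cel (gradv (p n))))" for n
      proof -
        have "U *. cel (p n) = U *. (cel (p n) - celc (cellmean (p n)))" by (simp add: inner_diff_right U0)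
        also have "... <= norm U * norm (cel (p n) - celc (cellmean (p n)))" by (rule norm_cauchy_schwarz)
        also have "... <= norm U * (K * norm (cel (gradv (p n))))"
          unfolding K_def by (intro mult_left_mono Poincare_smooth p) auto
        finally show ?thesis .
      qed
      thus "EX N. ALL n>=N. U *. cel (p n) <= norm U * (K * norm (cel (gradv (p n))))" by blast
    qed
    hence "norm U * norm U <= norm U * (K * norm G)" by (simp add: power2_norm_eq_inner[symmetric] power2_eq_square)
    thus ?thesis using K0 by (cases "U = 0") auto
  qed
  thus thesis using that[OF K0] by blast
qed

section \<open>The cell problem and the homogenized coefficients\<close>

section \<open>The cell problem\<close>

text \<open>The unknown is the pair of a corrector and its gradient. Testing with all of
  \<open>CS\<close> amounts to testing with mean zero functions, because subtracting the mean does
  not change the gradient.\<close>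

definition cell_solution :: "(real^'d => complex^('n::finite \<times> 'd)^('n \<times> 'd)) => complex^('n \<times> 'd)
    => ('d, 'n) L2 \<times> ('d, 'n \<times> 'd) L2 => bool" where
  "cell_solution a X z \<longleftrightarrow> z : CS0 & (ALL (V, H):CS. mult a (snd z + celc X) *. H = 0)"

text \<open>The form contains only the gradient; on \<open>CS0\<close> the Poincare inequality makes
  it coercive for the full graph norm.\<close>

lemma cell_solution_ex1:
  fixes a :: "real^'d => complex^('n::finite \<times> 'd)^('n \<times> 'd)"
  assumes a: "bmat a" "coercive c a" "0 < c"
  shows "EX! z. cell_solution a X z"
proof -
  obtain K where K: "0 <= K" "!!(U :: ('d, 'n) L2) G. (U, G) : CS0 ==> norm U <= K * norm G"
    by (rule Poincare) blast
  let ?T = "%z :: ('d, 'n) L2 \<times> ('d, 'n \<times> 'd) L2. (0 :: ('d, 'n) L2, mult a (snd z))"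
  have T: "bounded_linear ?T"
    by (intro bounded_linear_Pair bounded_linear_zero bounded_linear_compose[OF bounded_linear_mult[OF a(1)] bounded_linear_snd])
  have "EX! z. z : CS0 & (ALL y:CS0. ?T z *. y = (0 :: ('d, 'n) L2, - mult a (celc X)) *. y)"
  proof (rule lax_milgram[OF subspace_CS0 closed_CS0 T])
    \<comment> \<open>On \<open>CS0\<close> the squared graph norm is at most \<open>K^2 + 1\<close>
      times the squared norm of the gradient.\<close>
    show "0 < c / (K^2 + 1)" using a(3) by (auto intro!: divide_pos_pos add_nonneg_pos)
    fix z :: "('d, 'n) L2 \<times> ('d, 'n \<times> 'd) L2" assume z: "z : CS0"
    have "(norm (fst z))^2 <= (K * norm (snd z))^2" using K z by (intro power_mono) auto
    hence "(norm z)^2 <= (K^2 + 1) * (norm (snd z))^2" by (simp add: norm_prod_def power_mult_distrib algebra_simps)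
    hence "c / (K^2 + 1) * (norm z)^2 <= c / (K^2 + 1) * ((K^2 + 1) * (norm (snd z))^2)"
      using a(3) by (intro mult_left_mono) (auto intro!: divide_nonneg_nonneg)
    also have "... = c * (norm (snd z))^2" by (simp add: add_nonneg_eq_0_iff)
    also have "... <= mult a (snd z) *. snd z" by (rule mult_coercive[OF a(1,2)])
    finally show "c / (K^2 + 1) * (norm z)^2 <= ?T z *. z" by (simp add: inner_prod_def)
  qed
  moreover have "(ALL y:CS0. ?T z *. y = (0 :: ('d, 'n) L2, - mult a (celc X)) *. y) \<longleftrightarrow> (ALL (V, H):CS. mult a (snd z + celc X) *. H = 0)" for z :: "('d, 'n) L2 \<times> ('d, 'n \<times> 'd) L2"
  proof -
    have e: "mult a (snd z + celc X) *. H = ?T z *. (V, H) - (0 :: ('d, 'n) L2, - mult a (celc X)) *. (V, H)" for V :: "('d, 'n) L2" and H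
      by (simp add: mult_add_right[OF a(1)] inner_add_left)
    have "(ALL (V, H):CS. mult a (snd z + celc X) *. H = 0) \<longleftrightarrow> (ALL (V, H):CS0. mult a (snd z + celc X) *. H = 0)"
    proof
      assume l: "ALL (V, H):CS. mult a (snd z + celc X) *. H = 0"
      show "ALL (V, H):CS0. mult a (snd z + celc X) *. H = 0"
      proof (clarify)
        fix V :: "('d, 'n) L2" and H assume "(V, H) : CS0"
        hence "(V, H) : CS" by (simp add: CS0_def)
        thus "mult a (snd z + celc X) *. H = 0" using l by blast
      qed
    next
      assume r: "ALL (V, H):CS0. mult a (snd z + celc X) *. H = 0"
      show "ALL (V, H):CS. mult a (snd z + celc X) *. H = 0"
      proof (clarify)
        fix V :: "('d, 'n) L2" and H assume "(V, H) : CS"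
        from CS0_I[OF this] show "mult a (snd z + celc X) *. H = 0" using r by blast
      qed
    qed
    also have "... \<longleftrightarrow> (ALL y:CS0. ?T z *. y = (0 :: ('d, 'n) L2, - mult a (celc X)) *. y)"
    proof (rule ball_cong[OF refl])
      fix y :: "('d, 'n) L2 \<times> ('d, 'n \<times> 'd) L2"
      show "(case y of (V, H) => mult a (snd z + celc X) *. H = 0) \<longleftrightarrow> ?T z *. y = (0 :: ('d, 'n) L2, - mult a (celc X)) *. y"
        using e[of "snd y" "fst y"] by (simp add: case_prod_beta)
    qed
    finally show ?thesis by (rule sym)
  qed
  ultimately show ?thesis by (simp add: cell_solution_def)
qed

lemma cell_solution_add:
  assumes a: "bmat a" and "cell_solution a X z" "cell_solution a Y w"
  shows "cell_solution a (X + Y) (z + w)"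
  unfolding cell_solution_def
proof (intro conjI ballI)
  show "z + w : CS0" by (rule subspace_add[OF subspace_CS0]) (use assms in \<open>simp_all add: cell_solution_def\<close>)
  fix y :: "('a, 'b) L2 \<times> ('a, 'b \<times> 'a) L2" assume y: "y : CS"
  have "mult a (snd z + celc X) *. snd y = 0" "mult a (snd w + celc Y) *. snd y = 0"
    using assms y by (auto simp: cell_solution_def case_prod_beta)
  moreover have "snd (z + w) + celc (X + Y) = (snd z + celc X) + (snd w + celc Y)" by (simp add: celc_add)
  ultimately have "mult a (snd (z + w) + celc (X + Y)) *. snd y = 0"
    by (simp only: mult_add_right[OF a, of "snd z + celc X"] inner_add_left)
  thus "case y of (V, H) => mult a (snd (z + w) + celc (X + Y)) *. H = 0" by (simp add: case_prod_beta)
qed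

lemma adj_mat: "adj (mat c) = (mat (cnj c) :: complex^'i^'i)"
  by (simp add: adj_def mat_def vec_eq_iff)

lemma mult_mat_commute:
  fixes a :: "real^'d => complex^'j^'i"
  assumes a: "bmat a"
  shows "mult a (mult (%_. mat c) u) = mult (%_. mat c) (mult a u)"
proof -
  have "A ** mat c = mat c ** A" for A :: "complex^'j^'i"
    by (simp add: matrix_matrix_mult_def mat_def vec_eq_iff if_distrib[of "%z. _ * z"] if_distrib[of "%z. z * _"] mult.commute cong: if_cong)
  thus ?thesis by (simp add: mult_mult a)
qed

lemma cell_scale_eq:
  "bmat a ==> mult a (mult (%_. mat c) G + celc (c *s X)) = mult (%_. mat c) (mult a (G + celc X))"
  unfolding mult_mat_commute[symmetric]
  by (simp only: mult_add_right[OF bmat_const, of "mat c"] mult_celc mat_vector)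

lemma cell_solution_scale:
  fixes X :: "complex^('n::finite \<times> 'd::finite)"
  assumes a: "bmat a" and z: "cell_solution a X z"
  shows "cell_solution a (c *s X) (mult (%_. mat c) (fst z), mult (%_. mat c) (snd z))"
  unfolding cell_solution_def
proof (intro conjI ballI)
  have f: "fst z *. celc b = 0" for b using z by (simp add: cell_solution_def CS0_def)
  have "mult (%_. mat c) (fst z) *. celc b = 0" for b
    unfolding inner_mult[OF bmat_const] mult_celc by (rule f)
  thus "(mult (%_. mat c) (fst z), mult (%_. mat c) (snd z)) : CS0"
    using z CS_mat[of "fst z" "snd z" c] by (simp add: cell_solution_def CS0_def)
  fix y :: "('d, 'n) L2 \<times> ('d, 'n \<times> 'd) L2" assume y: "y : CS"
  \<comment> \<open>The scalar passes to the test function as its conjugate, and \<open>CS\<close>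
    is invariant under complex scalars.\<close>
  have "(mult (%_. mat (cnj c)) (fst y), mult (%_. mat (cnj c)) (snd y)) : CS" using CS_mat[of "fst y" "snd y"] y by simp
  hence "mult a (snd z + celc X) *. mult (%_. mat (cnj c)) (snd y) = 0" using z by (auto simp: cell_solution_def)
  moreover note cell_scale_eq[OF a, of c "snd z" X]
  ultimately show "case y of (V, H) => mult a (snd (mult (%_. mat c) (fst z), mult (%_. mat c) (snd z)) + celc (c *s X)) *. H = 0"
    by (simp add: case_prod_beta inner_mult[OF bmat_const] adj_mat)
qed

lemma integral_cinner_Ycell:
  fixes f g :: "real^'d => complex^'i"
  assumes f: "f : sqint LY" and g: "g : sqint LY"
  shows "(LINT y|LY. cinner (f y) (g y)) = Complex (cel f *. cel g) (- (mult (%_. mat \<i>) (cel f) *. cel g))"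
proof -
  have i: "integrable LY (%y. cinner (f y) (g y))" by (rule integrable_cinner[OF f g])
  have "Re (LINT y|LY. cinner (f y) (g y)) = cel f *. cel g"
    unfolding inner_cel[OF f g] using integral_Re[OF i] by (simp add: Re_cinner)
  moreover have "Re (\<i> * (LINT y|LY. cinner (f y) (g y))) = mult (%_. mat \<i>) (cel f) *. cel g"
  proof -
    have "mult (%_. mat \<i>) (cel f) *. cel g = (LINT y|LY. Re (\<i> * cinner (f y) (g y)))"
      unfolding sqint_Y_mult(2)[OF bmat_const f] inner_cel[OF sqint_Y_mult(1)[OF bmat_const f] g]
      by (simp add: Re_cinner[symmetric] mat_vector cinner_scale_left)
    also have "... = Re (LINT y|LY. \<i> * cinner (f y) (g y))"
      by (rule integral_Re) (rule integrable_mult_right[OF i])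
    also have "(LINT y|LY. \<i> * cinner (f y) (g y)) = \<i> * (LINT y|LY. cinner (f y) (g y))"
      by (rule integral_mult_right_zero)
    finally show ?thesis by (rule sym)
  qed
  ultimately show ?thesis by (simp add: complex_eq_iff)
qed

lemma H1_per_perp1_vec_iff:
  fixes u :: "real^'d => complex^'n"
  shows "u : H1_per_perp1_vec \<longleftrightarrow> (ALL i. (%x. u x $ i) : H1_per) & (ALL b. cel u *. celc b = 0)"
proof -
  have "(ALL i. (LINT y|LY. u y $ i) = 0) \<longleftrightarrow> (ALL b. cel u *. celc b = 0)" if u: "!!i. (%x. u x $ i) : H1_per"
  proof -
    note us = H1_per_imp_CS(1)[OF u]
    have "(LINT y|LY. u y $ i) = (LINT y|LY. u y) $ i" for i
      using integral_bounded_linear[OF bounded_linear_vec_nth integrable_Ycell[OF us], of i] .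
    hence "(ALL i. (LINT y|LY. u y $ i) = 0) \<longleftrightarrow> (LINT y|LY. u y) = 0"
      by (simp add: vec_eq_iff)
    also have "... \<longleftrightarrow> (ALL b. (LINT y|LY. u y) *. b = 0)" by (metis inner_eq_zero_iff inner_zero_left)
    finally show ?thesis unfolding cmean_inner_cel[OF us] .
  qed
  thus ?thesis unfolding H1_per_perp1_vec_def H1_per_perp1_def by blast
qed

lemma CS0_function:
  assumes "(U, G) : CS0"
  shows "rep_L2 U : H1_per_perp1_vec" "cel (rep_L2 U) = U" "cel (nabla Ycell (rep_L2 U)) = G"
proof -
  have CS: "(U, G) : CS" and z: "!!b. U *. celc b = 0" using assms by (auto simp: CS0_def)
  have s: "cel (rep_L2 U) = U" "cel (rep_L2 G) = G" using CS_supported[OF CS] by auto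
  have "(cel (rep_L2 U), cel (rep_L2 G)) : CS" using CS by (simp add: s)
  note h = CS_imp_H1_per[OF rep_L2_Ycell(1) rep_L2_Ycell(1) this]
  show "rep_L2 U : H1_per_perp1_vec" using h(1) z by (simp add: H1_per_perp1_vec_iff s)
  show "cel (rep_L2 U) = U" by (rule s)
  show "cel (nabla Ycell (rep_L2 U)) = G" using h(3) s by simp
qed

lemma perp1_CS0:
  fixes u :: "real^'d => complex^'n"
  assumes "u : H1_per_perp1_vec"
  shows "u : sqint LY" "nabla Ycell u : sqint LY"
    "(cel u, cel (nabla Ycell u)) : CS0"
  using assms H1_per_imp_CS[of u] by (auto simp: H1_per_perp1_vec_iff CS0_def)

text \<open>The imaginary part of the complex equation is the real equation for \<open>\<i>\<close>
  times the test function. Conversely, a pair in \<open>CS\<close> becomes an admissible test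
  function after its mean is subtracted.\<close>

lemma is_corrector_iff:
  fixes a :: "real^'d => complex^('n::finite \<times> 'd)^('n \<times> 'd)"
  assumes a: "bmat a"
  shows "is_corrector a X N \<longleftrightarrow> N : H1_per_perp1_vec & cell_solution a X (cel N, cel (nabla Ycell N))"
proof -
  have "(ALL phi:H1_per_perp1_vec. (LINT y|LY. cinner (a y *v (nabla Ycell N y + X)) (nabla Ycell phi y)) = 0)
      \<longleftrightarrow> (ALL (V, H):CS. mult a (cel (nabla Ycell N) + celc X) *. H = 0)" (is "?L \<longleftrightarrow> ?R") if N: "N : H1_per_perp1_vec"
  proof -
    note n = perp1_CS0[OF N]
    let ?f = "%y. a y *v (nabla Ycell N y + X)"
    have ns: "(%y. nabla Ycell N y + X) : sqint LY"
      by (intro square_integrable_add n sqint_Y_const)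
    have f: "?f : sqint LY" by (rule sqint_Y_mult(1)[OF a ns])
    have cf: "cel ?f = mult a (cel (nabla Ycell N) + celc X)"
      unfolding sqint_Y_mult(2)[OF a ns, symmetric] cel_add[OF n(2) sqint_Y_const] ..
    have c: "(LINT y|LY. cinner (?f y) (nabla Ycell phi y)) = Complex (cel ?f *. cel (nabla Ycell phi)) (- (mult (%_. mat \<i>) (cel ?f) *. cel (nabla Ycell phi)))"
      if "phi : H1_per_perp1_vec" for phi
      by (rule integral_cinner_Ycell[OF f perp1_CS0(2)[OF that]])
    show ?thesis
    proof
      assume L: ?L
      show ?R
      proof (clarify)
        fix V H assume "(V, H) : (CS :: (('d, 'n) L2 \<times> ('d, 'n \<times> 'd) L2) set)"
        note phi = CS0_function[OF CS0_I[OF this]]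
        have "(LINT y|LY. cinner (?f y) (nabla Ycell (rep_L2 (V - celc (cmean V))) y)) = 0" using L phi(1) by blast
        thus "mult a (cel (nabla Ycell N) + celc X) *. H = 0" unfolding c[OF phi(1)] phi(3) cf by (simp add: complex_eq_iff)
      qed
    next
      assume R: ?R
      have R': "cel ?f *. H = 0" if "(V, H) : CS" for V H using R that unfolding cf by blast
      show ?L
      proof
        fix phi :: "real^'d => complex^'n" assume phi: "phi : H1_per_perp1_vec"
        have v: "(cel phi, cel (nabla Ycell phi)) : CS" using perp1_CS0(3)[OF phi] by (simp add: CS0_def)
        have "mult (%_. mat \<i>) (cel ?f) *. cel (nabla Ycell phi) = 0"
          unfolding inner_mult[OF bmat_const] adj_mat by (rule R'[OF CS_mat[OF v]])
        thus "(LINT y|LY. cinner (?f y) (nabla Ycell phi y)) = 0"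
          unfolding c[OF phi] R'[OF v] by (simp add: complex_eq_iff)
      qed
    qed
  qed
  thus ?thesis unfolding is_corrector_def cell_solution_def using perp1_CS0(3) by auto
qed

lemma corrector_ex:
  fixes a :: "real^'d => complex^('n::finite \<times> 'd)^('n \<times> 'd)"
  assumes a: "bmat a" "coercive c a" "0 < c"
  shows "EX N. is_corrector a X N & (ALL N'. is_corrector a X N' --> (AE y in LY. N' y = N y))"
proof -
  obtain z where z: "cell_solution a X z" and uniq: "!!w. cell_solution a X w ==> w = z"
    using cell_solution_ex1[OF a] by (rule ex1E) blast
  obtain U G where UG: "z = (U, G)" by (cases z)
  have U: "(U, G) : CS0" using z by (simp add: UG cell_solution_def)
  note N = CS0_function[OF U]
  have "is_corrector a X (rep_L2 U)" unfolding is_corrector_iff[OF a(1)] N(2,3) using N(1) z by (simp add: UG)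
  moreover have "AE y in LY. N' y = rep_L2 U y" if "is_corrector a X N'" for N'
  proof -
    have N': "N' : H1_per_perp1_vec" "cell_solution a X (cel N', cel (nabla Ycell N'))" using that by (auto simp: is_corrector_iff[OF a(1)])
    have "cel N' = cel (rep_L2 U)" using uniq[OF N'(2)] by (simp add: UG N(2))
    thus ?thesis by (simp add: cel_eq_iff[OF perp1_CS0(1)[OF N'(1)] rep_L2_Ycell(1)])
  qed
  ultimately show ?thesis by blast
qed

text \<open>The mean flux as a map of \<open>X\<close>, available before it is known to come from a
  matrix.\<close>

definition flux :: "(real^'d => complex^('n::finite \<times> 'd)^('n \<times> 'd)) => complex^('n \<times> 'd) => complex^('n \<times> 'd)" where
  "flux a X = cmean (mult a (snd (THE z. cell_solution a X z) + celc X))"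

lemma flux_eq:
  assumes a: "bmat a" "coercive c a" "0 < c" and z: "cell_solution a X z"
  shows "flux a X = cmean (mult a (snd z + celc X))"
proof -
  have "(THE z. cell_solution a X z) = z" by (rule the1_equality[OF cell_solution_ex1[OF a] z])
  thus ?thesis by (simp add: flux_def)
qed

lemma flux_inner:
  assumes a: "bmat a" "coercive c a" "0 < c" and z: "cell_solution a X z"
  shows "flux a X *. B = mult a (snd z + celc X) *. celc B"
proof -
  have "cel (rep_L2 (snd z)) = snd z" using z CS_supported[of "fst z" "snd z"] by (simp add: cell_solution_def CS0_def)
  hence "snd z + celc X = cel (%x. rep_L2 (snd z) x + X)"
    by (simp add: cel_add rep_L2_Ycell(1) sqint_Y_const)
  hence e: "mult a (snd z + celc X) = cel (%x. a x *v (rep_L2 (snd z) x + X))"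
    and s: "(%x. a x *v (rep_L2 (snd z) x + X)) : sqint LY"
    using sqint_Y_mult[OF a(1) square_integrable_add[OF rep_L2_Ycell(1) sqint_Y_const], of "snd z" X] by auto
  show ?thesis unfolding flux_eq[OF assms] unfolding e cmean_cel[OF s] by (rule cmean_inner_cel[OF s])
qed

text \<open>Linearity over the complex numbers is required to represent the map by a matrix. It
  follows from linearity of the cell problem and uniqueness of its solution.\<close>

lemma flux_linear:
  fixes a :: "real^'d => complex^('n::finite \<times> 'd)^('n \<times> 'd)"
  assumes a: "bmat a" "coercive c a" "0 < c"
  shows "Vector_Spaces.linear (*s) (*s) (flux a)"
proof -
  have ex: "EX z. cell_solution a X z" for X using cell_solution_ex1[OF a] by (rule ex1_implies_ex)
  have "flux a (X + Y) = flux a X + flux a Y" for X Y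
  proof -
    obtain z w where z: "cell_solution a X z" and w: "cell_solution a Y w" using ex by meson
    have e: "snd (z + w) + celc (X + Y) = (snd z + celc X) + (snd w + celc Y)" by (simp add: celc_add)
    have "flux a (X + Y) *. B = (flux a X + flux a Y) *. B" for B
      unfolding inner_add_left flux_inner[OF a z] flux_inner[OF a w] flux_inner[OF a cell_solution_add[OF a(1) z w]] e mult_add_right[OF a(1), of "snd z + celc X"] ..
    thus ?thesis by (metis vector_eq_rdot)
  qed
  moreover have "flux a (k *s X) = k *s flux a X" for k X
  proof -
    obtain z where z: "cell_solution a X z" using ex by meson
    note e = cell_scale_eq[OF a(1), of k "snd z" X]
    have "flux a (k *s X) *. B = (k *s flux a X) *. B" for B
    proof -
      have "flux a (k *s X) *. B = mult a (snd z + celc X) *. celc (mat (cnj k) *v B)"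
        unfolding flux_inner[OF a cell_solution_scale[OF a(1) z]] snd_conv e inner_mult[OF bmat_const] adj_mat mult_celc ..
      also have "... = flux a X *. (adj (mat k) *v B)" unfolding flux_inner[OF a z] adj_mat ..
      also have "... = (k *s flux a X) *. B" unfolding inner_adj[symmetric] mat_vector ..
      finally show ?thesis .
    qed
    thus ?thesis by (metis vector_eq_rdot)
  qed
  ultimately show ?thesis by unfold_locales (auto simp: vector_add_ldistrib vector_sadd_rdistrib)
qed

text \<open>The matrix of \<open>flux a\<close> satisfies the description in \<open>a_hom\<close>,
  and it is the only one, since every \<open>X\<close> has a corrector on which the description can
  be evaluated.\<close>

lemma a_hom_flux:
  fixes a :: "real^'d => complex^('n::finite \<times> 'd)^('n \<times> 'd)"
  assumes a: "bmat a" "coercive c a" "0 < c"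
  shows "a_hom a *v X = flux a X"
    and "is_corrector a X N ==> (LINT y|LY. a y *v (nabla Ycell N y + X)) = flux a X"
proof -
  let ?I = "%X N. LINT y|LY. a y *v (nabla Ycell N y + X)"
  have c: "?I X N = flux a X" if N: "is_corrector a X N" for X N
  proof -
    have N': "N : H1_per_perp1_vec" "cell_solution a X (cel N, cel (nabla Ycell N))" using N by (auto simp: is_corrector_iff[OF a(1)])
    note n = perp1_CS0(2)[OF N'(1)]
    have ns: "(%y. nabla Ycell N y + X) : sqint LY"
      by (intro square_integrable_add n sqint_Y_const)
    show ?thesis
      unfolding flux_eq[OF a N'(2)] snd_conv cel_add[OF n sqint_Y_const, symmetric]
        sqint_Y_mult(2)[OF a(1) ns] cmean_cel[OF sqint_Y_mult(1)[OF a(1) ns]] ..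
  qed
  thus "is_corrector a X N ==> ?I X N = flux a X" .
  have m: "matrix (flux a) *v X = flux a X" for X by (rule matrix_works[OF flux_linear[OF a]])
  have "a_hom a = matrix (flux a)"
    unfolding a_hom_def
  proof (rule the_equality)
    show "ALL X N. is_corrector a X N --> matrix (flux a) *v X = ?I X N"
      by (simp add: c m)
    fix A assume A: "ALL X N. is_corrector a X N --> A *v X = ?I X N"
    have "A *v X = matrix (flux a) *v X" for X
    proof -
      obtain N where N: "is_corrector a X N" using corrector_ex[OF a] by blast
      hence "A *v X = ?I X N" using A by blast
      thus ?thesis unfolding c[OF N] m .
    qed
    thus "A = matrix (flux a)" by (simp add: matrix_eq)
  qed
  thus "a_hom a *v X = flux a X" by (simp add: m)
qed

text \<open>By the cell equation the form at \<open>X\<close> equals that of \<open>a\<close> at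
  \<open>snd z + celc X\<close>. Gradients have mean zero and are therefore orthogonal to
  \<open>celc X\<close>, so the constant \<open>c\<close> survives unchanged.\<close>

lemma coercive_a_hom:
  fixes a :: "real^'d => complex^('n::finite \<times> 'd)^('n \<times> 'd)"
  assumes a: "bmat a" "coercive c a" "0 < c"
  shows "coercive c (%_::real^'e. a_hom a)"
  unfolding coercive_def
proof (intro allI)
  fix X
  obtain z where z: "cell_solution a X z" using cell_solution_ex1[OF a] by blast
  have zz: "(fst z, snd z) : CS" using z by (simp add: cell_solution_def CS0_def)
  let ?W = "snd z + celc X"
  have o: "mult a ?W *. snd z = 0" using z zz unfolding cell_solution_def by blast
  have "(norm ?W)^2 = (norm (snd z))^2 + (norm X)^2"
    using CS_mean_0[OF zz, of X] by (simp add: power2_norm_eq_inner inner_add_left inner_add_right inner_celc inner_commute)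
  hence "c * (norm X)^2 <= c * (norm ?W)^2" using a(3) by simp
  also have "... <= mult a ?W *. ?W" by (rule mult_coercive[OF a(1,2)])
  also have "... = (a_hom a *v X) *. X"
    unfolding a_hom_flux(1)[OF a] flux_inner[OF a z] inner_add_right[of "mult a ?W"] o by simp
  finally show "c * (norm X)^2 <= (a_hom a *v X) *. X" .
qed

section \<open>Corrector fields\<close>

lemma fl_add_lattice: "k : int_lattice ==> fl (x + k) = fl x + k"
  using hcell_iff_fl[of "fl x + k" "x + k"] minus_fl_hcell[of x] by (simp add: int_lattice_closed)

text \<open>The periodic extension from \<open>hcell\<close>; \<open>Mop\<close> acts with
  everywhere defined periodic fields, whereas the solutions of the cell problem are classes
  supported in the cell.\<close>

definition perext :: "('d::finite, 'i::finite) L2 => real^'d => complex^'i" where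
  "perext u y = brep u (y - fl y)"

lemma perext_perL2: "perL2 (perext u)"
  and cel_perext: "cel (rep_L2 u) = u ==> cel (perext u) = u"
proof -
  have h: "ihc x *R perext u x = ihc x *R brep u x" for x
  proof (cases "x : hcell")
    case True
    have "(0 :: real^'a) = fl x" using hcell_iff_fl[of 0 x] True by (simp add: int_lattice_def)
    thus ?thesis by (simp add: perext_def)
  qed simp
  have hs: "(%x. ihc x *R brep u x) : sqint lborel"
    unfolding sqint_iff_nn
  proof
    have "(nn_integral lborel (%x. ennreal ((norm (ihc x *R brep u x))^2))) <= (nn_integral lborel (%x. ennreal ((norm (brep u x))^2)))"
      by (rule nn_integral_mono) (simp add: indicator_def)
    also have "... < \<infinity>" using brep(1)[of u] by (simp add: sqint_iff_nn)
    finally show "(nn_integral lborel (%x. ennreal ((norm (ihc x *R brep u x))^2))) < \<infinity>" .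
  qed measurable
  have m: "perext u : borelf" unfolding perext_def[abs_def] by measurable
  have p: "periodic (perext u)" by (simp add: periodic_def perext_def fl_add_lattice)
  show pp: "perL2 (perext u)" unfolding perL2_iff_sqint h by (intro conjI m p hs)
  assume u: "cel (rep_L2 u) = u"
  have ae: "AE x in lborel. ihc x *R brep u x = (if x : Ycell then mat 1 else 0) *v brep u x"
    using AE_unit_cells by eventually_elim (auto simp: indicator_def)
  have "cel (perext u) = mult (%x. if x : Ycell then mat 1 else 0) u"
    unfolding perL2_cel(1)[OF pp] h mult_def
    by (subst abs_L2_eq_iff_lb[OF hs sqint_mv[OF bmat_Ycell brep(1)]]) (rule ae)
  thus "cel (perext u) = u" using u by (simp add: rep_L2_Ycell(2))
qed

lemma norm_sq_vec: "(norm x)^2 = (SUM i:UNIV. (norm (x $ i))^2)"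
  by (simp add: norm_vec_def L2_set_def sum_nonneg)

lemma perL2_columns:
  fixes M :: "real^'d => complex^'q^'m"
  assumes c: "!!q. perL2 (%x. column q (M x))"
  shows "perL2 M" "(cellnorm M)^2 = (SUM q:UNIV. (cellnorm (%x. column q (M x)))^2)"
proof -
  define L :: "'q => complex^'m => complex^'q^'m" where "L q v = (\<chi> i r. if r = q then v $ i else 0)" for q v
  have L: "L q : borelf" for q
    unfolding L_def
  proof (intro borel_measurable_continuous_onI continuous_on_vec_lambda)
    fix i r show "continuous_on UNIV (%v. if r = q then v $ i else 0 :: complex)" by (cases "r = q") (auto intro!: continuous_intros)
  qed
  have Mc: "(%x. column q (M x)) : borelf" for q using c by (simp add: perL2_def)
  have M_eq: "M x = (SUM q:UNIV. L q (column q (M x)))" for x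
    by (simp add: L_def column_def vec_eq_iff)
  have Mm: "M : borelf"
    by (subst ext[OF M_eq]) (intro borel_measurable_sum measurable_compose[OF Mc L])
  have per: "periodic M"
    unfolding periodic_def
  proof (intro ballI allI)
    fix k x assume k: "k : (int_lattice :: (real^'d) set)"
    have "column q (M (x + k)) = column q (M x)" for q using c[of q] k by (simp add: perL2_def periodic_def)
    thus "M (x + k) = M x" by (subst (1 2) M_eq) simp
  qed
  have n: "(norm A)^2 = (SUM q:UNIV. (norm (column q A))^2)" for A :: "complex^'q^'m"
    by (simp add: norm_sq_vec column_def) (rule sum.swap)
  have "cellnn M = (nn_integral lborel (%w. (SUM q:UNIV. ihc w * ennreal ((norm (column q (M w)))^2))))"
    unfolding cellnn_def n by (intro nn_integral_cong, subst sum_ennreal[symmetric]) (auto simp: sum_distrib_left)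
  also have "... = (SUM q:UNIV. cellnn (%x. column q (M x)))"
    unfolding cellnn_def using Mc by (intro nn_integral_sum) measurable
  finally have e: "cellnn M = (SUM q:UNIV. cellnn (%x. column q (M x)))" .
  have "cellnn (%x. column q (M x)) < \<infinity>" for q using c by (simp add: perL2_def)
  thus p: "perL2 M" unfolding perL2_def e using Mm per by simp
  have "ennreal ((cellnorm M)^2) = ennreal (SUM q:UNIV. (cellnorm (%x. column q (M x)))^2)"
    unfolding cellnn_eq[OF p, symmetric] e cellnn_eq[OF c] by simp
  thus "(cellnorm M)^2 = (SUM q:UNIV. (cellnorm (%x. column q (M x)))^2)"
    by (simp add: sum_nonneg)
qed

lemma cellnorm_tendsto_columns:
  fixes M :: "nat => real^'d => complex^'q^'m"
  assumes c: "!!n q. perL2 (%x. column q (M n x))"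
    and l: "!!q. (%n. cellnorm (%x. column q (M n x))) ----> 0"
  shows "(%n. cellnorm (M n)) ----> 0"
proof -
  have "(%n. sqrt (SUM q:UNIV. (cellnorm (%x. column q (M n x)))^2)) ----> sqrt (SUM q:(UNIV :: 'q set). 0^2)"
    by (intro tendsto_intros l)
  thus ?thesis unfolding perL2_columns(2)[OF c, symmetric] by simp
qed

lemma column_mult: "column q (A ** B) = (A :: complex^'j^'i) *v column q B"
  by (simp add: column_def matrix_matrix_mult_def matrix_vector_mult_def vec_eq_iff)

lemma column_mat_1: "column q (mat 1 :: complex^'i^'i) = axis q 1"
  by (simp add: column_def mat_def axis_def vec_eq_iff)

lemma mv_axis: "(A :: complex^'j^'i) *v axis q 1 = column q A"
  by (simp add: column_def matrix_vector_mult_def axis_def vec_eq_iff if_distrib[of "%z. _ * z"] cong: if_cong)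

text \<open>Smooth approximants are chosen for each column and assembled into matrices; the squared
  \<open>cellnorm\<close> of a matrix field is the sum over its finitely many columns.\<close>

lemma H1field_corrector:
  fixes U :: "'q::finite => ('d::finite, 'n::finite) L2"
  assumes CS: "!!q. (U q, G q) : CS"
  shows "H1field (%y. \<chi> i q. perext (U q) y $ i) (%j y. \<chi> i q. perext (G q) y $ (i, j))" (is "H1field ?N ?D")
proof -
  have s: "cel (perext (U q)) = U q" "cel (perext (G q)) = G q" for q
    using CS_supported[OF CS, of q] by (auto intro!: cel_perext)
  have cN: "column q (?N x) = perext (U q) x" for q x by (simp add: column_def vec_eq_iff)
  have cD: "column q (?D j x) = Pj j *v perext (G q) x" for q j x by (simp add: column_def vec_eq_iff)
  have pj: "perL2 (%x. Pj j *v f x)" "cellnorm (%x. Pj j *v f x) = norm (mult (%_. Pj j) (cel f))"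
    if f: "perL2 f" for j and f :: "real^'d => complex^('n \<times> 'd)"
  proof -
    show p: "perL2 (%x. Pj j *v f x)"
    proof (rule perL2_bounded_by[OF f])
      show "(%x. Pj j *v f x) : borelf"
        using f by (intro bm_mv) (simp_all add: perL2_def)
      show "periodic (%x. Pj j *v f x)" using f by (simp add: perL2_def periodic_def)
    qed (rule norm_mv_le)
    show "cellnorm (%x. Pj j *v f x) = norm (mult (%_. Pj j) (cel f))"
      unfolding perL2_cel(3)[OF p, symmetric] sqint_Y_mult(2)[OF bmat_const perL2_cel(2)[OF f]] ..
  qed
  have "ALL q. EX p. (ALL n::nat. p n : smooth_pv) & (%n. cel (p n)) ----> U q & (%n. cel (gradv (p n))) ----> G q"
    by (rule allI, rule CS_sequence[OF CS]) blast
  then obtain P where P: "!!q n. P q n : smooth_pv" "!!q. (%n::nat. cel (P q n)) ----> U q"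
    "!!q. (%n. cel (gradv (P q n))) ----> G q" by metis
  define p :: "nat => real^'d => complex^'q^'n" where "p n x = (\<chi> i q. P q n x $ i)" for n x
  have sp: "smooth_mat (p n)" "periodic (p n)" for n
    using P(1) by (simp_all add: smooth_mat_def p_def smooth_pv_def smooth_vec_def periodic_def vec_eq_iff)
  have dN: "column q (?N x - p n x) = perext (U q) x - P q n x" for q n x
    by (simp add: column_def p_def vec_eq_iff)
  have dD: "column q (?D j x - mpd j (p n) x) = Pj j *v (perext (G q) x - gradv (P q n) x)" for q j n x
    by (simp add: column_def p_def mpd_def vec_eq_iff)
  have pN: "perL2 (%x. perext (U q) x - P q n x)" for q n by (intro perL2_diff perext_perL2 perL2_smooth P)
  have pG: "perL2 (%x. perext (G q) x - gradv (P q n) x)" for q n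
    by (intro perL2_diff perext_perL2 perL2_smooth smooth_pv_gradv P)
  have "(%n. cellnorm (%x. ?N x - p n x)) ----> 0"
  proof (rule cellnorm_tendsto_columns, unfold dN, rule pN)
    fix q
    have "(%n. norm (U q - cel (P q n))) ----> norm (U q - U q)" by (intro tendsto_intros P)
    thus "(%n. cellnorm (%x. perext (U q) x - P q n x)) ----> 0"
      unfolding perL2_cel(3)[OF pN, symmetric] by (simp add: cel_diff perL2_cel(2)[OF perext_perL2] smooth_pv_Ycell P s)
  qed
  moreover have "(%n. cellnorm (%x. ?D j x - mpd j (p n) x)) ----> 0" for j
  proof (rule cellnorm_tendsto_columns, unfold dD, rule pj(1)[OF pG])
    fix q
    have "(%n. norm (mult (%_. Pj j) (G q - cel (gradv (P q n))))) ----> norm (mult (%_. Pj j :: complex^('n \<times> 'd)^'n) (G q - G q))"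
      by (intro tendsto_norm bounded_linear.tendsto[OF bounded_linear_mult[OF bmat_const]] tendsto_diff tendsto_const P)
    thus "(%n. cellnorm (%x. Pj j *v (perext (G q) x - gradv (P q n) x))) ----> 0"
      unfolding pj(2)[OF pG]
      by (simp add: cel_diff perL2_cel(2)[OF perext_perL2] smooth_pv_Ycell smooth_pv_gradv P s mult_linear)
  qed
  moreover have "perL2 ?N" by (rule perL2_columns, unfold cN, rule perext_perL2)
  moreover have "perL2 (?D j)" for j by (rule perL2_columns, unfold cD, rule pj(1)[OF perext_perL2])
  ultimately show ?thesis using sp unfolding H1field_def by blast
qed

lemma bounded_linear_column: "bounded_linear (column q :: complex^'j^'i => _)"
  unfolding mv_axis[symmetric]
  by (rule bounded_bilinear.bounded_linear_left[OF bilinear_mv])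

text \<open>Column \<open>q\<close> solves the cell problem for \<open>axis q 1\<close>. The cell
  equation is then the vanishing divergence of the flux, and subtracting \<open>a_hom a\<close>
  removes exactly its mean.\<close>

lemma corrector_field:
  fixes a :: "real^'d => complex^('n::finite \<times> 'd)^('n \<times> 'd)"
  assumes a: "bmat a" "coercive c a" "0 < c" "periodic a"
  obtains N D where "H1field N D" "divfree (%y. a y ** (grad_field D y + mat 1) - a_hom a)"
    "cellmean (%y. a y ** (grad_field D y + mat 1) - a_hom a) = 0"
proof -
  have "ALL q. EX z. cell_solution a (axis q 1) z" by (intro allI ex1_implies_ex cell_solution_ex1[OF a(1-3)])
  then obtain z where z: "!!q. cell_solution a (axis q 1) (z q)" by metis
  let ?m = "%q. mult a (snd (z q) + celc (axis q 1))"
  define U where "U q = fst (z q)" for q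
  define G where "G q = snd (z q)" for q
  let ?f = "%q y. a y *v (perext (G q) y + axis q 1)"
  have CS: "(U q, G q) : CS" for q using z[of q] by (simp add: U_def G_def cell_solution_def CS0_def)
  define D :: "'d => real^'d => complex^('n \<times> 'd)^'n" where "D j y = (\<chi> i q. perext (G q) y $ (i, j))" for j y
  define N :: "real^'d => complex^('n \<times> 'd)^'n" where "N y = (\<chi> i q. perext (U q) y $ i)" for y
  have H: "H1field N D" unfolding N_def[abs_def] D_def[abs_def] by (rule H1field_corrector[OF CS])
  have cs: "column q (SUM j:UNIV. B j) = (SUM j:UNIV. column q (B j))" for q and B :: "'d => complex^('n \<times> 'd)^('n \<times> 'd)"
    by (rule linear_sum[OF bounded_linear.linear[OF bounded_linear_column]])
  have cg: "column q (grad_field D y) = perext (G q) y" for q y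
  proof (subst vec_eq_iff, rule allI)
    fix r :: "'n \<times> 'd"
    obtain i k where r: "r = (i, k)" by (cases r)
    have "column q (grad_field D y) = (SUM j:UNIV. adj (Pj j) *v column q (D j y))"
      unfolding grad_field_def cs column_mult ..
    also have "... $ r = perext (G q) y $ r"
      by (simp add: r adj_Pj_apply) (simp add: D_def column_def)
    finally show "column q (grad_field D y) $ r = perext (G q) y $ r" .
  qed
  define g where "g y = a y ** (grad_field D y + mat 1) - a_hom a" for y
  have lc: "column q (B + C) = column q B + column q C" "column q (B - C) = column q B - column q C" for q and B C :: "complex^('n \<times> 'd)^('n \<times> 'd)"
    by (simp_all add: column_def vec_eq_iff)
  have c: "column q (g y) = ?f q y - a_hom a *v axis q 1" for q y
    unfolding g_def lc column_mult cg column_mat_1 mv_axis ..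
  have pe: "perL2 (%y. perext (G q) y + axis q 1)" for q by (intro perL2_add perext_perL2 perL2_const)
  obtain C where C: "!!x. norm (a x) <= C" using a(1) by (auto simp: bmat_def)
  have pa: "perL2 (?f q)" for q
  proof (rule perL2_bounded_by[OF pe])
    show "(?f q) : borelf"
      using pe[of q] a(1) by (intro bm_mv) (auto simp: perL2_def bmat_def)
    show "periodic (?f q)" using pe[of q] a(4) by (simp add: perL2_def periodic_def)
    show "norm (?f q y) <= C * norm (perext (G q) y + axis q 1)" for y
      by (rule order_trans[OF norm_mv_le mult_right_mono[OF C]]) simp
  qed
  have pc: "perL2 (%y. column q (g y))" for q unfolding c by (intro perL2_diff pa perL2_const)
  have ce: "cel (?f q) = ?m q" for q
  proof -
    have "cel (perext (G q)) = G q" using CS_supported[OF CS, of q] by (auto intro!: cel_perext)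
    hence "cel (%y. perext (G q) y + axis q 1) = snd (z q) + celc (axis q 1)"
      using cel_add[OF perL2_cel(2)[OF perext_perL2] sqint_Y_const, of "G q" "axis q 1"] by (simp add: G_def)
    thus ?thesis using sqint_Y_mult(2)[OF a(1) perL2_cel(2)[OF pe], of q] by simp
  qed
  have cc: "cel (%y. column q (g y)) = ?m q - celc (a_hom a *v axis q 1)" for q
    unfolding c ce[symmetric] by (rule cel_diff[OF perL2_cel(2)[OF pa] sqint_Y_const])
  have "divfree g"
  proof (rule divfree_if_orthogonal[OF pc])
    fix q and p :: "real^'d => complex^'n" assume p: "p : smooth_pv"
    have "?m q *. cel (gradv p) = 0" using z[of q] PG_CS[OF p] unfolding cell_solution_def by blast
    thus "cel (%y. column q (g y)) *. cel (gradv p) = 0"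
      unfolding cc inner_diff_left using gradv_mean_0[OF p, of "a_hom a *v axis q 1"] by (simp add: inner_commute)
  qed
  moreover have "cellmean g = 0"
  proof -
    have pg: "perL2 g" by (rule perL2_columns(1)[OF pc])
    have "column q (cellmean g) = 0" for q
    proof -
      have "column q (cellmean g) = cellmean (%y. column q (g y))"
        unfolding cellmean_def integral_bounded_linear[OF bounded_linear_column perL2_integrable[OF pg], symmetric]
          linear_scale[OF bounded_linear.linear[OF bounded_linear_column]] ..
      also have "... = (LINT y|LY. column q (g y))" using pc[of q] by (intro integral_Ycell[symmetric]) (simp add: perL2_def)
      finally have 1: "column q (cellmean g) *. B = (?m q - celc (a_hom a *v axis q 1)) *. celc B" for B
        unfolding cc[symmetric] cmean_inner_cel[OF perL2_cel(2)[OF pc], symmetric] by simp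
      have "column q (cellmean g) *. B = 0" for B
        unfolding 1 inner_diff_left flux_inner[OF a(1-3) z, symmetric] a_hom_flux(1)[OF a(1-3)] inner_celc by simp
      thus ?thesis by (metis inner_eq_zero_iff)
    qed
    thus ?thesis by (simp add: column_def vec_eq_iff)
  qed
  ultimately show thesis using that[OF H, unfolded g_def[abs_def]] unfolding g_def[abs_def] by blast
qed

text \<open>The form of the mean is the form of \<open>s\<close> evaluated on a constant function on
  the cell, which has volume 1.\<close>

lemma cell_mean_regular:
  fixes s :: "real^'d => complex^'n^'n"
  assumes s: "bmat s" "coercive c s"
  shows "cell_mean s = cellmean s" "coercive c (%_::real^'e. cell_mean s)"
proof -
  show "cell_mean s = cellmean s" unfolding cell_mean_def by (rule integral_Ycell[OF bmat_measurable[OF s(1)]])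
  obtain C where C: "!!x. norm (s x) <= C" using s(1) by (auto simp: bmat_def)
  have i: "integrable LY s"
    by (rule integrable_Ycell[OF sqint_Y_bounded[OF bmat_measurable[OF s(1)] C]])
  have "c * (norm \<xi>)^2 <= (cell_mean s *v \<xi>) *. \<xi>" for \<xi>
  proof -
    note m = sqint_Y_mult[OF s(1) sqint_Y_const[of \<xi>]]
    have "c * (norm \<xi>)^2 = c * (norm (celc \<xi> :: ('d, 'n) L2))^2" by (simp add: power2_norm_eq_inner inner_celc)
    also have "... <= mult s (celc \<xi>) *. celc \<xi>" by (rule mult_coercive[OF s])
    also have "... = (LINT y|LY. s y *v \<xi>) *. \<xi>" unfolding m(2) by (rule cmean_inner_cel[OF m(1), symmetric])
    also have "(LINT y|LY. s y *v \<xi>) = cell_mean s *v \<xi>"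
      unfolding cell_mean_def
      by (rule integral_bounded_linear[OF bounded_bilinear.bounded_linear_left[OF bilinear_mv] i])
    finally show ?thesis .
  qed
  thus "coercive c (%_::real^'e. cell_mean s)" by (simp add: coercive_def)
qed

section \<open>Coefficients defined almost everywhere, and the conclusion\<close>

section \<open>Regular representatives of the coefficients\<close>

text \<open>The transposed half of \<open>re_part A\<close> contributes the conjugate of the other
  half, so the form is real and equals the real inner product.\<close>

lemma cinner_re_part:
  fixes A :: "complex^'i^'i"
  shows "cinner ((re_part A - mat (complex_of_real \<nu>)) *v \<xi>) \<xi> = complex_of_real ((A *v \<xi>) *. \<xi> - \<nu> * (norm \<xi>)^2)"
proof -
  have add: "cinner (x + y) z = cinner x z + cinner y z" "cinner (x - y) z = cinner x z - cinner y z" for x y z :: "complex^'i"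
    by (simp_all add: cinner_def sum.distrib sum_subtractf algebra_simps)
  have self: "cinner \<xi> \<xi> = complex_of_real ((norm \<xi>)^2)"
    unfolding cinner_def norm_sq_vec of_real_sum complex_norm_square ..
  have "cinner (conj_transpose A *v \<xi>) \<xi> = (SUM j:UNIV. SUM i:UNIV. cnj (A $ i $ j) * \<xi> $ i * cnj (\<xi> $ j))"
    by (simp add: cinner_def conj_transpose_def matrix_vector_mult_def sum_distrib_right)
  also have "... = (SUM i:UNIV. SUM j:UNIV. cnj (A $ i $ j) * \<xi> $ i * cnj (\<xi> $ j))" by (rule sum.swap)
  also have "... = cnj (cinner (A *v \<xi>) \<xi>)"
    by (simp add: cinner_def matrix_vector_mult_def sum_distrib_right sum_distrib_left mult_ac)
  finally have t: "cinner (conj_transpose A *v \<xi>) \<xi> = cnj (cinner (A *v \<xi>) \<xi>)" .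
  have "(re_part A - mat (complex_of_real \<nu>)) *v \<xi> = mat (1/2) *v (A *v \<xi> + conj_transpose A *v \<xi>) - mat (complex_of_real \<nu>) *v \<xi>"
    using mat_of_real[of "1/2", where 'i='i] by (simp add: re_part_def matrix_vector_mult_diff_rdistrib matrix_vector_mult_add_rdistrib scaleR_cmv)
  hence "cinner ((re_part A - mat (complex_of_real \<nu>)) *v \<xi>) \<xi>
      = (cinner (A *v \<xi>) \<xi> + cnj (cinner (A *v \<xi>) \<xi>)) / 2 - complex_of_real (\<nu> * (norm \<xi>)^2)"
    by (simp add: add mat_vector cinner_scale_left t self)
  thus ?thesis by (simp add: complex_add_cnj Re_cinner)
qed

lemma pos_semidef_re_part:
  fixes A :: "complex^'i^'i"
  shows "pos_semidef (re_part A - mat (complex_of_real \<nu>)) \<longleftrightarrow> (ALL \<xi>. \<nu> * (norm \<xi>)^2 <= (A *v \<xi>) *. \<xi>)"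
  unfolding pos_semidef_def cinner_re_part nonneg_Reals_of_real_iff by simp

lemma const_ell_coeffs:
  assumes "coercive c (%_::real^'d. A)" "0 < c"
  shows "(%_::real^'d. A) : ell_coeffs"
  unfolding ell_coeffs_def
proof (intro CollectI conjI)
  show "EX C. AE x::real^'d in lebesgue. norm A <= C" by (rule exI[of _ "norm A"]) simp
  show "EX \<nu>>0. AE x::real^'d in lebesgue. pos_semidef (re_part A - mat (complex_of_real \<nu>))"
    unfolding pos_semidef_re_part using assms by (intro exI[of _ c]) (simp add: coercive_def)
qed auto

text \<open>All three properties, bound, periodicity and coercivity, are known only off null sets;
  they are made to hold at every point by correcting the values and extending periodically from one
  cell.\<close>

lemma ell_coeffs_regular:
  fixes b :: "real^'d => complex^'i^'i"
  assumes b: "b : ell_coeffs"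
  obtains b' \<nu> where "bmat b'" "periodic b'" "coercive \<nu> b'" "0 < \<nu>" "AE x in lborel. b x = b' x"
proof -
  obtain C \<nu> where bm: "b : borel_measurable lebesgue" and C: "AE x in lborel. norm (b x) <= C" and \<nu>: "0 < \<nu>"
    and pos: "AE x in lborel. ALL \<xi>. \<nu> * (norm \<xi>)^2 <= (b x *v \<xi>) *. \<xi>"
    and per: "!!k. k : int_lattice ==> AE x in lborel. b (x + k) = b x"
    using b unfolding ell_coeffs_def pos_semidef_re_part AE_completion_iff by blast
  obtain b0 where b0: "b0 : borelf" "AE x in lebesgue. b x = b0 x"
    by (rule lebesgue_measurable_ex_borel[OF bm]) blast
  have [measurable]: "b0 : borelf" by (rule b0(1))
  \<comment> \<open>The matrices with admissible bound and coercivity form a closed set; values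
    outside it are replaced by \<open>\<nu> *R mat 1\<close>, which is coercive.\<close>
  define F where "F = cball (0 :: complex^'i^'i) C \<inter> (\<Inter>\<xi>. {A. \<nu> * (norm \<xi>)^2 <= (A *v \<xi>) *. \<xi>})"
  have "closed F" unfolding F_def by (intro closed_Int closed_INT ballI closed_cball closed_Collect_le continuous_intros)
  hence [measurable]: "F : sets borel" by (rule borel_closed)
  define h where "h A = (if A : F then A else \<nu> *R mat 1)" for A :: "complex^'i^'i"
  have [measurable]: "h : borelf" unfolding h_def by measurable
  define b' where "b' x = h (b0 (x - fl x))" for x
  show thesis
  proof (rule that[OF _ _ _ \<nu>])
    have "norm (h A) <= max C (norm (\<nu> *R mat 1 :: complex^'i^'i))" for A by (auto simp: h_def F_def)
    hence "EX C. ALL x. norm (b' x) <= C" unfolding b'_def by blast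
    moreover have "b' : borelf" unfolding b'_def[abs_def] by measurable
    ultimately show "bmat b'" by (simp add: bmat_def)
    show "periodic b'" by (simp add: periodic_def b'_def fl_add_lattice)
    have "\<nu> * (norm \<xi>)^2 <= (h A *v \<xi>) *. \<xi>" for A \<xi>
      by (auto simp: h_def F_def scaleR_cmv power2_norm_eq_inner)
    thus "coercive \<nu> b'" by (simp add: coercive_def b'_def)
    \<comment> \<open>The lattice is countable, so one null set serves all translations, including
      the variable one \<open>- fl x\<close>.\<close>
    have "AE x in lborel. ALL k:int_lattice. b (x + k) = b0 (x + k) & b (x + k) = b x"
      by (rule AE_ball_countable'[OF _ countable_int_lattice])
        (intro AE_conjI per AE_lborel_shift b0(2)[unfolded AE_completion_iff])
    thus "AE x in lborel. b x = b' x"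
      using C pos
    proof eventually_elim
      fix x assume k: "ALL k:int_lattice. b (x + k) = b0 (x + k) & b (x + k) = b x" and n: "norm (b x) <= C"
        and p: "ALL \<xi>. \<nu> * (norm \<xi>)^2 <= (b x *v \<xi>) *. \<xi>"
      have "- fl x : int_lattice" using fl_lattice[of x] by (simp add: int_lattice_def)
      hence "b0 (x - fl x) = b x" using k by force
      moreover have "b x : F" using n p by (simp add: F_def)
      ultimately show "b x = b' x" by (simp add: b'_def h_def)
    qed
  qed
qed

lemma op_mult_cong: "AE x in lborel. b x = b' x ==> op_mult b = op_mult b'"
proof -
  assume ae: "AE x in lborel. b x = b' x"
  have "(AE x in lebesgue. rep_L2 g x = b x *v rep_L2 f x) \<longleftrightarrow> (AE x in lebesgue. rep_L2 g x = b' x *v rep_L2 f x)" for f g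
    by (rule eventually_cong[of "%x. b x = b' x"]) (use ae in \<open>auto simp: AE_completion_iff\<close>)
  thus ?thesis by (simp add: op_mult_def)
qed

lemma AE_Ycell: "AE x in lborel. P x ==> AE x in LY. P x"
  by (simp add: AE_restrict_space_iff Ycell_sets AE_completion_iff) (elim eventually_mono, simp)

context
  fixes a a' :: "real^'d => complex^('n::finite \<times> 'd)^('n \<times> 'd)"
  assumes am: "a : borel_measurable lebesgue" "a' : borel_measurable lebesgue" and ae: "AE x in lborel. a x = a' x"
begin

lemma flux_measurable:
  assumes "N : H1_per_perp1_vec" "b : borel_measurable lebesgue"
  shows "(%y. b y *v (nabla Ycell N y + X)) : borel_measurable LY"
proof (intro bm_mv borel_measurable_add borel_measurable_const)
  show "b : borel_measurable LY" using assms(2) by (rule measurable_restrict_space1)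
  show "nabla Ycell N : borel_measurable LY"
    using perp1_CS0(2)[OF assms(1)] by (simp add: square_integrable_def)
qed

lemma flux_cong:
  assumes "N : H1_per_perp1_vec"
  shows "(LINT y|LY. a y *v (nabla Ycell N y + X)) = (LINT y|LY. a' y *v (nabla Ycell N y + X))"
  by (intro integral_cong_AE flux_measurable assms am) (use AE_Ycell[OF ae] in eventually_elim, simp)

lemma is_corrector_cong: "is_corrector a X N \<longleftrightarrow> is_corrector a' X N"
proof -
  have "(LINT y|LY. cinner (a y *v (nabla Ycell N y + X)) (nabla Ycell phi y))
      = (LINT y|LY. cinner (a' y *v (nabla Ycell N y + X)) (nabla Ycell phi y))"
    if N: "N : H1_per_perp1_vec" and phi: "phi : H1_per_perp1_vec" for phi
  proof (rule integral_cong_AE)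
    have c: "continuous_on UNIV (%p. cinner (fst p) (snd p :: complex^('n \<times> 'd)))"
      unfolding cinner_def by (intro continuous_intros)
    have m: "(%y. cinner (f y) (nabla Ycell phi y)) : borel_measurable LY"
      if "f : borel_measurable LY" for f
      using borel_measurable_continuous_Pair[OF that _ c, of "nabla Ycell phi"] perp1_CS0(2)[OF phi]
      by (simp add: square_integrable_def)
    show "(%y. cinner (a y *v (nabla Ycell N y + X)) (nabla Ycell phi y)) : borel_measurable LY"
      "(%y. cinner (a' y *v (nabla Ycell N y + X)) (nabla Ycell phi y)) : borel_measurable LY"
      by (intro m flux_measurable N am)+
  qed (use AE_Ycell[OF ae] in eventually_elim, simp)
  thus ?thesis unfolding is_corrector_def by auto
qed

lemma a_hom_cong: "a_hom a = a_hom a'"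
proof -
  have "(is_corrector a X N --> A *v X = (LINT y|LY. a y *v (nabla Ycell N y + X)))
    \<longleftrightarrow> (is_corrector a' X N --> A *v X = (LINT y|LY. a' y *v (nabla Ycell N y + X)))" for A X N
    using flux_cong[of N X] is_corrector_cong[of X N] unfolding is_corrector_def by auto
  thus ?thesis by (simp add: a_hom_def)
qed

end

lemma coercive_mono: "coercive c b ==> c' <= c ==> coercive c' b"
  unfolding coercive_def by (meson mult_right_mono order_trans zero_le_power2)

theorem theorem4p1:
  fixes a :: "real^'d \<Rightarrow> complex^('n::finite \<times> 'd::finite)^('n \<times> 'd)"
    and s :: "real^'d \<Rightarrow> complex^'n^'n"
  assumes a: "a \<in> M_per" and s: "s \<in> S_per"
  shows "(\<forall>X. \<exists>N. is_corrector a X N \<and>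
             (\<forall>N'. is_corrector a X N' \<longrightarrow> (AE y in lebesgue_on Ycell. N' y = N y))) \<and>
         (\<forall>X N. is_corrector a X N \<longrightarrow>
             a_hom a *v X = (LINT y|lebesgue_on Ycell. a y *v (nabla Ycell N y + X))) \<and>
         (\<lambda>_. a_hom a) \<in> (M_per :: (real^'d \<Rightarrow> complex^('n \<times> 'd)^('n \<times> 'd)) set) \<and>
         (\<lambda>_. cell_mean s) \<in> (S_per :: (real^'d \<Rightarrow> complex^'n^'n) set) \<and>
         (\<forall>\<epsilon>>0. boundedly_invertible
             (op_elliptic (\<lambda>x. a (x /\<^sub>R \<epsilon>)) (\<lambda>x. s (x /\<^sub>R \<epsilon>)))) \<and>
         boundedly_invertible
             (op_elliptic (\<lambda>x::real^'d. a_hom a) (\<lambda>x. cell_mean s)) \<and>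
         (\<exists>\<kappa>>0. \<forall>\<epsilon>>0.
             onorm (\<lambda>f. op_inv (op_elliptic (\<lambda>x. a (x /\<^sub>R \<epsilon>)) (\<lambda>x. s (x /\<^sub>R \<epsilon>))) f
                      - op_inv (op_elliptic (\<lambda>x. a_hom a) (\<lambda>x. cell_mean s)) f)
               \<le> \<kappa> * \<epsilon>)"
proof -
  obtain a' \<nu> where a': "bmat a'" "periodic a'" "coercive \<nu> a'" "0 < \<nu>" and aa: "AE x in lborel. a x = a' x"
    using a unfolding M_per_def by (rule ell_coeffs_regular)
  obtain s' \<mu> where s': "bmat s'" "periodic s'" "coercive \<mu> s'" "0 < \<mu>" and ss: "AE x in lborel. s x = s' x"
    using s unfolding S_per_def by (rule ell_coeffs_regular)
  \<comment> \<open>One constant for both coefficients, as the graph norm estimates use a common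
    \<open>c\<close>.\<close>
  define c where "c = min \<nu> \<mu>"
  let ?L = "%eps. op_elliptic (%x. a (x /\<^sub>R eps)) (%x. s (x /\<^sub>R eps))"
  have c: "0 < c" and ca: "coercive c a'" and cs: "coercive c s'"
    using a' s' by (auto simp: c_def intro: coercive_mono)
  have lm: "b : borel_measurable lebesgue" if "bmat b" for b :: "real^'d => complex^'i^'i"
    using bmat_measurable[OF that] by (simp add: measurable_completion)
  have ma: "a : borel_measurable lebesgue" using a by (simp add: M_per_def ell_coeffs_def)
  have ms: "s : borel_measurable lebesgue" using s by (simp add: S_per_def ell_coeffs_def)
  note corr = is_corrector_cong[OF ma lm[OF a'(1)] aa]
  note hom = a_hom_cong[OF ma lm[OF a'(1)] aa]
  have mean: "cell_mean s = cell_mean s'"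
    unfolding cell_mean_def
    by (intro integral_cong_AE measurable_restrict_space1 ms lm s' AE_Ycell ss)
  note A = coercive_a_hom[OF a'(1) ca c, where 'e='d]
  note m = cell_mean_regular[OF s'(1) cs]
  note mc = m(2)[where 'e='d]
  \<comment> \<open>The operators depend on the coefficients only up to null sets, and scaling by
    \<open>eps\<close> preserves null sets.\<close>
  have el: "?L eps = op_elliptic (%x. a' (x /\<^sub>R eps)) (%x. s' (x /\<^sub>R eps))" if "0 < eps" for eps
  proof -
    have sc: "AE x in lborel. P (x /\<^sub>R eps)" if "AE x in lborel. P (x :: real^'d)" for P
      using AE_lborel_affine[of "inverse eps" P 0] that \<open>0 < eps\<close> by simp
    show ?thesis unfolding op_elliptic_def op_mult_cong[OF sc[OF aa]] op_mult_cong[OF sc[OF ss]] ..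
  qed
  have inv: "boundedly_invertible (op_elliptic b t)"
    if b: "bmat b" "coercive c b" and t: "bmat t" "coercive c t" for b :: "real^'d => complex^('n \<times> 'd)^('n \<times> 'd)" and t
  proof -
    obtain R where "bounded_linear R" "!!u f. (u, f) : op_elliptic b t \<longleftrightarrow> u = R f"
      by (rule elliptic_resolvent[OF b t c]) (rule that)
    thus ?thesis unfolding boundedly_invertible_def by blast
  qed
  obtain N D where ND: "H1field N D" "divfree (%y. a' y ** (grad_field D y + mat 1) - a_hom a')"
    "cellmean (%y. a' y ** (grad_field D y + mat 1) - a_hom a') = 0"
    by (rule corrector_field[OF a'(1) ca c a'(2)])
  obtain \<kappa> where \<kappa>: "0 < \<kappa>" "!!eps f. 0 < eps ==>
    norm (op_inv (op_elliptic (%x. a' (x /\<^sub>R eps)) (%x. s' (x /\<^sub>R eps))) f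
      - op_inv (op_elliptic (%x::real^'d. a_hom a') (%x. cellmean s')) f) <= \<kappa> * eps * norm f"
    by (rule homogenization_estimate[OF a'(1,2) ca s'(1,2) cs c A mc[unfolded m(1)] ND]) (rule that)
  have flux: "a_hom a *v X = (LINT y|LY. a y *v (nabla Ycell N y + X))" if N: "is_corrector a X N" for X N
  proof -
    have "N : H1_per_perp1_vec" using N by (simp add: is_corrector_def)
    from flux_cong[OF ma lm[OF a'(1)] aa this] show ?thesis
      using a_hom_flux[OF a'(1) ca c, of X] N unfolding corr hom by simp
  qed
  have const: "(%_. a_hom a) : (M_per :: (real^'d => _) set)" "(%_. cell_mean s) : (S_per :: (real^'d => _) set)"
    unfolding M_per_def S_per_def hom mean by (rule const_ell_coeffs[OF A c] const_ell_coeffs[OF mc c])+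
  have inv_eps: "boundedly_invertible (?L eps)" if eps: "0 < eps" for eps
    unfolding el[OF eps] by (intro inv bmat_scaled[OF eps] coercive_scaled a' ca s' cs)
  have inv_hom: "boundedly_invertible (op_elliptic (%x::real^'d. a_hom a) (%x. cell_mean s))"
    unfolding hom mean by (intro inv bmat_const A mc)
  have est: "onorm (%f. op_inv (?L eps) f
      - op_inv (op_elliptic (%x. a_hom a) (%x. cell_mean s)) f) <= \<kappa> * eps" if eps: "0 < eps" for eps
    unfolding el[OF eps] hom mean m(1)
    by (rule onorm_bound) (use \<kappa>(1) eps in simp, rule \<kappa>(2)[OF eps])
  show ?thesis
    by (intro conjI allI impI exI[of _ \<kappa>] corrector_ex[OF a'(1) ca c, folded corr] flux const inv_eps inv_hom est \<kappa>(1))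
qed

end
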